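(* Let $(S,\mathfrak{m})$ be a regular local ring and let $R$ be a ring. Let $\varphi\colon S\to R$ be a ring homomorphism which induces on $R$ the structure of a finitely generated $S$-module. Set $\tilde S=S/\operatorname{ann}_S R$ and let $\tilde\varphi\colon\tilde S\to R$ be the induced injective homomorphism. Assume that for every minimal prime $p$ of $\tilde S$ the localization $\tilde\varphi_p\colon\tilde S_p\to R_p$ is an isomorphism. Let $c=\dim S-\dim_S R$ be the codimension of $R$, and suppose $c=2m+1$ for some integer $m\ge 0$. Then the following conditions are equivalent: (1) $R$ is a Gorenstein $S$-algebra of codimension $c$. (2) There exists a minimal free resolution of $R$ as an $S$-module of the form $$0\leftarrow R\xleftarrow{d_0}F_0\xleftarrow{d_1}F_1\leftarrow\cdots\xleftarrow{d_m}F_m\xleftarrow{d_{m+1}}F_m^\ast\xleftarrow{d_m^\ast}\cdots\leftarrow F_1^\ast\xleftarrow{d_1^\ast}F_0^\ast\leftarrow 0,$$ where $F_0=S\oplus F_0'$ for some free $S$-module $F_0'$, $d_0=(\varphi\mid d_0')$ (that is, $d_0$ restricted to the summand $S$ is $\varphi$, and $d_0'\colon F_0'\to R$ is its restriction to $F_0'$), and $d_{m+1}^\ast=(-1)^m d_{m+1}$.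
   Context: All rings are commutative Noetherian with identity. For an $S$-module $F$, $F^\ast=\operatorname{Hom}_S(F,S)$, and for a homomorphism $d$, $d^\ast$ denotes $\operatorname{Hom}_S(d,S)$; for finitely generated free $F$ one identifies $F^{\ast\ast}$ with $F$. For a finitely generated $S$-module $M$, $\operatorname{grade} M=\min\{i\mid \operatorname{Ext}^i_S(M,S)\ne 0\}$, and $M$ is called perfect if $\operatorname{grade} M=\operatorname{projdim}_S M$. Let $\varphi\colon S\to R$ be a ring homomorphism from a regular local ring making $R$ a finitely generated $S$-module, with codimension $c=\dim S-\dim_S R$. $R$ is called a Gorenstein $S$-algebra of codimension $c$ if $R$ is a perfect $S$-module and $R\cong\operatorname{Ext}^c_S(R,S)$ as $R$-modules. Here the $R$-module structure on $\operatorname{Ext}^c_S(R,S)$ is given by functoriality: $r\in R$ acts as $\operatorname{Ext}^c_S(\mu_r,S)$, where $\mu_r\colon R\to R$ is multiplication by $r$. *)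

theory Defs
  imports "HOL-Algebra.Algebra" "HOL-Library.Extended_Real"
begin

text \<open>The dimension of the zero ring is \<open>- \<infinity>\<close>, the supremum of the empty set.\<close>

definition krull_dim :: "('a, 'r) ring_scheme \<Rightarrow> ereal" where
  "krull_dim A = (SUP n \<in> {n. \<exists>p. (\<forall>i\<le>n. primeideal (p i) A) \<and> (\<forall>i<n. p i \<subset> p (Suc i))}.
     ereal (real n))"

definition local_ring :: "('a, 'r) ring_scheme \<Rightarrow> 'a set \<Rightarrow> bool" where
  "local_ring S \<mm> \<longleftrightarrow> cring S \<and> noetherian_ring S \<and> maximalideal \<mm> S \<and>
     (\<forall>I. maximalideal I S \<longrightarrow> I = \<mm>)"

definition min_generators :: "('a, 'r) ring_scheme \<Rightarrow> 'a set \<Rightarrow> nat" where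
  "min_generators S I =
     (LEAST n. \<exists>A. finite A \<and> card A = n \<and> A \<subseteq> carrier S \<and> Idl\<^bsub>S\<^esub> A = I)"

definition regular_local_ring :: "('a, 'r) ring_scheme \<Rightarrow> 'a set \<Rightarrow> bool" where
  "regular_local_ring S \<mm> \<longleftrightarrow>
     local_ring S \<mm> \<and> krull_dim S = ereal (real (min_generators S \<mm>))"

definition minimal_prime :: "('a, 'r) ring_scheme \<Rightarrow> 'a set \<Rightarrow> bool" where
  "minimal_prime A p \<longleftrightarrow>
     primeideal p A \<and> (\<forall>q. primeideal q A \<longrightarrow> q \<subseteq> p \<longrightarrow> q = p)"

text \<open>\<open>fraction A U a u\<close> is the fraction $a/u$, as the set of all pairs representing it.\<close>

definition fraction :: "('a, 'r) ring_scheme \<Rightarrow> 'a set \<Rightarrow> 'a \<Rightarrow> 'a \<Rightarrow> ('a \<times> 'a) set" where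
  "fraction A U a u = {(b, v). b \<in> carrier A \<and> v \<in> U \<and>
     (\<exists>w\<in>U. w \<otimes>\<^bsub>A\<^esub> (v \<otimes>\<^bsub>A\<^esub> a \<ominus>\<^bsub>A\<^esub> u \<otimes>\<^bsub>A\<^esub> b) = \<zero>\<^bsub>A\<^esub>)}"

definition localization :: "('a, 'r) ring_scheme \<Rightarrow> 'a set \<Rightarrow> ('a \<times> 'a) set ring" where
  "localization A U =
    \<lparr>carrier = {fraction A U a u | a u. a \<in> carrier A \<and> u \<in> U},
     monoid.mult = (\<lambda>P Q. \<Union>(a, u)\<in>P. \<Union>(b, v)\<in>Q. fraction A U (a \<otimes>\<^bsub>A\<^esub> b) (u \<otimes>\<^bsub>A\<^esub> v)),
     one = fraction A U \<one>\<^bsub>A\<^esub> \<one>\<^bsub>A\<^esub>,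
     ring.zero = fraction A U \<zero>\<^bsub>A\<^esub> \<one>\<^bsub>A\<^esub>,
     add = (\<lambda>P Q. \<Union>(a, u)\<in>P. \<Union>(b, v)\<in>Q.
       fraction A U (v \<otimes>\<^bsub>A\<^esub> a \<oplus>\<^bsub>A\<^esub> u \<otimes>\<^bsub>A\<^esub> b) (u \<otimes>\<^bsub>A\<^esub> v))\<rparr>"

text \<open>For a ring homomorphism $f\colon A \to B$ and a multiplicative set $U \subseteq A$, the
  module localization $U^{-1}B$ is the ring \<open>localization B (f ` U)\<close>, and the following is
  $U^{-1}f\colon U^{-1}A \to U^{-1}B$.\<close>

definition localization_map ::
  "('b, 'q) ring_scheme \<Rightarrow> 'a set \<Rightarrow> ('a \<Rightarrow> 'b) \<Rightarrow> ('a \<times> 'a) set \<Rightarrow> ('b \<times> 'b) set" where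
  "localization_map B U f P = (\<Union>(a, u)\<in>P. fraction B (f ` U) (f a) (f u))"

text \<open>The library's module records extend ring records; the components \<open>mult\<close> and \<open>one\<close> are
  not used by the locale \<open>module\<close>, and are left undefined below where there is no natural choice.\<close>

definition self_module :: "('a, 'r) ring_scheme \<Rightarrow> ('a, 'a) module" where
  "self_module S = \<lparr>carrier = carrier S, monoid.mult = monoid.mult S, one = one S,
     ring.zero = ring.zero S, add = add S, smult = monoid.mult S\<rparr>"

definition restrict_scalars :: "('a \<Rightarrow> 'b) \<Rightarrow> ('b, 'q) ring_scheme \<Rightarrow> ('a, 'b) module" where
  "restrict_scalars \<phi> R = \<lparr>carrier = carrier R, monoid.mult = monoid.mult R, one = one R,
     ring.zero = ring.zero R, add = add R, smult = (\<lambda>s x. \<phi> s \<otimes>\<^bsub>R\<^esub> x)\<rparr>"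

definition fin_gen :: "('a, 'r) ring_scheme \<Rightarrow> ('a, 'x) module \<Rightarrow> bool" where
  "fin_gen S M \<longleftrightarrow> module S M \<and> (\<exists>A. finite A \<and> A \<subseteq> carrier M \<and>
     (\<forall>x\<in>carrier M. \<exists>c \<in> A \<rightarrow> carrier S. x = (\<Oplus>\<^bsub>M\<^esub>a\<in>A. c a \<odot>\<^bsub>M\<^esub> a)))"

definition annihilator :: "('a, 'r) ring_scheme \<Rightarrow> ('a, 'x) module \<Rightarrow> 'a set" where
  "annihilator S M = {s \<in> carrier S. \<forall>x\<in>carrier M. s \<odot>\<^bsub>M\<^esub> x = \<zero>\<^bsub>M\<^esub>}"

definition module_dim :: "('a, 'r) ring_scheme \<Rightarrow> ('a, 'x) module \<Rightarrow> ereal" where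
  "module_dim S M = krull_dim (S Quot annihilator S M)"

definition codimension :: "('a, 'r) ring_scheme \<Rightarrow> ('a, 'x) module \<Rightarrow> ereal" where
  "codimension S M = krull_dim S - module_dim S M"

definition mod_hom ::
  "('a, 'r) ring_scheme \<Rightarrow> ('a, 'x) module \<Rightarrow> ('a, 'y) module \<Rightarrow> ('x \<Rightarrow> 'y) set" where
  "mod_hom S M N = {f \<in> carrier M \<rightarrow> carrier N.
     (\<forall>x\<in>carrier M. \<forall>y\<in>carrier M. f (x \<oplus>\<^bsub>M\<^esub> y) = f x \<oplus>\<^bsub>N\<^esub> f y) \<and>
     (\<forall>s\<in>carrier S. \<forall>x\<in>carrier M. f (s \<odot>\<^bsub>M\<^esub> x) = s \<odot>\<^bsub>N\<^esub> f x)}"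

definition mod_iso ::
  "('a, 'r) ring_scheme \<Rightarrow> ('a, 'x) module \<Rightarrow> ('a, 'y) module \<Rightarrow> ('x \<Rightarrow> 'y) set" where
  "mod_iso S M N = {f \<in> mod_hom S M N. bij_betw f (carrier M) (carrier N)}"

definition mod_ker :: "('a, 'x) module \<Rightarrow> ('a, 'y) module \<Rightarrow> ('x \<Rightarrow> 'y) \<Rightarrow> 'x set" where
  "mod_ker M N f = {x \<in> carrier M. f x = \<zero>\<^bsub>N\<^esub>}"

definition ideal_smult :: "'a set \<Rightarrow> ('a, 'x) module \<Rightarrow> 'x set" where
  "ideal_smult I M = {\<Oplus>\<^bsub>M\<^esub>k\<in>{..<n}. a k \<odot>\<^bsub>M\<^esub> x k | (n::nat) a x.
     a \<in> {..<n} \<rightarrow> I \<and> x \<in> {..<n} \<rightarrow> carrier M}"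

definition quot_mod :: "('a, 'x) module \<Rightarrow> 'x set \<Rightarrow> ('a, 'x set) module" where
  "quot_mod M B = \<lparr>carrier = a_rcosets\<^bsub>M\<^esub> B, monoid.mult = undefined, one = undefined,
     ring.zero = B, add = set_add M, smult = (\<lambda>s P. \<Union>x\<in>P. B +>\<^bsub>M\<^esub> (s \<odot>\<^bsub>M\<^esub> x))\<rparr>"

text \<open>The module $S^n$; its elements are padded by zeros beyond position $n$.\<close>

definition free_mod :: "('a, 'r) ring_scheme \<Rightarrow> nat \<Rightarrow> ('a, nat \<Rightarrow> 'a) module" where
  "free_mod S n = \<lparr>carrier = {x. (\<forall>i<n. x i \<in> carrier S) \<and> (\<forall>i\<ge>n. x i = \<zero>\<^bsub>S\<^esub>)},
     monoid.mult = undefined, one = undefined, ring.zero = (\<lambda>i. \<zero>\<^bsub>S\<^esub>),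
     add = (\<lambda>x y i. x i \<oplus>\<^bsub>S\<^esub> y i), smult = (\<lambda>s x i. s \<otimes>\<^bsub>S\<^esub> x i)\<rparr>"

definition fg_free :: "('a, 'r) ring_scheme \<Rightarrow> ('a, 'x) module \<Rightarrow> bool" where
  "fg_free S M \<longleftrightarrow> module S M \<and> (\<exists>n. mod_iso S (free_mod S n) M \<noteq> {})"

text \<open>Finitely generated projective modules are the direct summands of the modules $S^n$.\<close>

definition fg_projective :: "('a, 'r) ring_scheme \<Rightarrow> ('a, 'x) module \<Rightarrow> bool" where
  "fg_projective S P \<longleftrightarrow> module S P \<and>
     (\<exists>n. \<exists>\<iota> \<in> mod_hom S P (free_mod S n). \<exists>\<pi> \<in> mod_hom S (free_mod S n) P.
        \<forall>x\<in>carrier P. \<pi> (\<iota> x) = x)"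

definition hom_mod ::
  "('a, 'r) ring_scheme \<Rightarrow> ('a, 'x) module \<Rightarrow> ('a, 'y) module \<Rightarrow> ('a, 'x \<Rightarrow> 'y) module" where
  "hom_mod S M N = \<lparr>carrier = mod_hom S M N \<inter> extensional (carrier M),
     monoid.mult = undefined, one = undefined, ring.zero = (\<lambda>x\<in>carrier M. \<zero>\<^bsub>N\<^esub>),
     add = (\<lambda>f g. \<lambda>x\<in>carrier M. f x \<oplus>\<^bsub>N\<^esub> g x),
     smult = (\<lambda>s f. \<lambda>x\<in>carrier M. s \<odot>\<^bsub>N\<^esub> f x)\<rparr>"

abbreviation dual :: "('a, 'r) ring_scheme \<Rightarrow> ('a, 'x) module \<Rightarrow> ('a, 'x \<Rightarrow> 'a) module" where
  "dual S F \<equiv> hom_mod S F (self_module S)"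

text \<open>$\mathrm{Hom}(f, N)$ for a homomorphism $f$ with domain $M$ (for any $N$).\<close>

definition hom_map :: "('a, 'x) module \<Rightarrow> ('x \<Rightarrow> 'y) \<Rightarrow> ('y \<Rightarrow> 'z) \<Rightarrow> 'x \<Rightarrow> 'z" where
  "hom_map M f g = compose (carrier M) g f"

definition bidual_map ::
  "('a, 'r) ring_scheme \<Rightarrow> ('a, 'x) module \<Rightarrow> 'x \<Rightarrow> ('x \<Rightarrow> 'a) \<Rightarrow> 'a" where
  "bidual_map S F x = (\<lambda>\<beta>\<in>carrier (dual S F). \<beta> x)"

text \<open>The differential \<open>d i\<close> goes from \<open>C (Suc i)\<close> to \<open>C i\<close>, and \<open>\<epsilon>\<close> from \<open>C 0\<close> to \<open>M\<close>. A
  finite resolution is continued by zero modules.\<close>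

definition resolution :: "('a, 'r) ring_scheme \<Rightarrow> ('a, 'y) module \<Rightarrow> (nat \<Rightarrow> ('a, 'x) module) \<Rightarrow>
    (nat \<Rightarrow> 'x \<Rightarrow> 'x) \<Rightarrow> ('x \<Rightarrow> 'y) \<Rightarrow> bool" where
  "resolution S M C d \<epsilon> \<longleftrightarrow>
     (\<forall>i. module S (C i)) \<and>
     \<epsilon> \<in> mod_hom S (C 0) M \<and> (\<forall>i. d i \<in> mod_hom S (C (Suc i)) (C i)) \<and>
     \<epsilon> ` carrier (C 0) = carrier M \<and>
     d 0 ` carrier (C 1) = mod_ker (C 0) M \<epsilon> \<and>
     (\<forall>i. d (Suc i) ` carrier (C (Suc (Suc i))) = mod_ker (C (Suc i)) (C i) (d i))"

definition minimal_free_resolution :: "('a, 'r) ring_scheme \<Rightarrow> 'a set \<Rightarrow> ('a, 'y) module \<Rightarrow>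
    (nat \<Rightarrow> ('a, 'x) module) \<Rightarrow> (nat \<Rightarrow> 'x \<Rightarrow> 'x) \<Rightarrow> ('x \<Rightarrow> 'y) \<Rightarrow> bool" where
  "minimal_free_resolution S \<mm> M C d \<epsilon> \<longleftrightarrow>
     resolution S M C d \<epsilon> \<and> (\<forall>i. fg_free S (C i)) \<and>
     (\<forall>i. d i ` carrier (C (Suc i)) \<subseteq> ideal_smult \<mm> (C i))"

text \<open>Every finitely generated projective module is isomorphic to a submodule of some $S^n$, so
  it is no restriction that the modules in the resolutions below have elements of type
  \<open>nat \<Rightarrow> 'a\<close>.\<close>

definition proj_dim :: "('a, 'r) ring_scheme \<Rightarrow> ('a, 'y) module \<Rightarrow> enat" where
  "proj_dim S M = Inf {enat l | l. \<exists>(P :: nat \<Rightarrow> ('a, nat \<Rightarrow> 'a) module) d \<epsilon>.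
     resolution S M P d \<epsilon> \<and> (\<forall>i. fg_projective S (P i)) \<and>
     (\<forall>i>l. carrier (P i) = {\<zero>\<^bsub>P i\<^esub>})}"

text \<open>Ext is computed from a chosen resolution by modules $S^n$, which exists for finitely
  generated modules over Noetherian rings.\<close>

definition chosen_resolution :: "('a, 'r) ring_scheme \<Rightarrow> ('a, 'y) module \<Rightarrow>
    (nat \<Rightarrow> nat) \<times> (nat \<Rightarrow> (nat \<Rightarrow> 'a) \<Rightarrow> nat \<Rightarrow> 'a) \<times> ((nat \<Rightarrow> 'a) \<Rightarrow> 'y)" where
  "chosen_resolution S M = (SOME (b, d, \<epsilon>). resolution S M (\<lambda>i. free_mod S (b i)) d \<epsilon>)"

definition res_mod ::
  "('a, 'r) ring_scheme \<Rightarrow> ('a, 'y) module \<Rightarrow> nat \<Rightarrow> ('a, nat \<Rightarrow> 'a) module" where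
  "res_mod S M i = free_mod S (fst (chosen_resolution S M) i)"

definition res_diff ::
  "('a, 'r) ring_scheme \<Rightarrow> ('a, 'y) module \<Rightarrow> nat \<Rightarrow> (nat \<Rightarrow> 'a) \<Rightarrow> nat \<Rightarrow> 'a" where
  "res_diff S M = fst (snd (chosen_resolution S M))"

definition res_aug :: "('a, 'r) ring_scheme \<Rightarrow> ('a, 'y) module \<Rightarrow> (nat \<Rightarrow> 'a) \<Rightarrow> 'y" where
  "res_aug S M = snd (snd (chosen_resolution S M))"

definition cocycles :: "('a, 'r) ring_scheme \<Rightarrow> nat \<Rightarrow> ('a, 'y) module \<Rightarrow> ('a, 'z) module \<Rightarrow>
    ((nat \<Rightarrow> 'a) \<Rightarrow> 'z) set" where
  "cocycles S i M N = mod_ker (hom_mod S (res_mod S M i) N) (hom_mod S (res_mod S M (Suc i)) N)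
     (hom_map (res_mod S M (Suc i)) (res_diff S M i))"

definition coboundaries :: "('a, 'r) ring_scheme \<Rightarrow> nat \<Rightarrow> ('a, 'y) module \<Rightarrow> ('a, 'z) module \<Rightarrow>
    ((nat \<Rightarrow> 'a) \<Rightarrow> 'z) set" where
  "coboundaries S i M N = (case i of
       0 \<Rightarrow> {\<zero>\<^bsub>hom_mod S (res_mod S M 0) N\<^esub>}
     | Suc j \<Rightarrow> hom_map (res_mod S M i) (res_diff S M j) ` carrier (hom_mod S (res_mod S M j) N))"

definition Ext :: "('a, 'r) ring_scheme \<Rightarrow> nat \<Rightarrow> ('a, 'y) module \<Rightarrow> ('a, 'z) module \<Rightarrow>
    ('a, ((nat \<Rightarrow> 'a) \<Rightarrow> 'z) set) module" where
  "Ext S i M N = quot_mod ((hom_mod S (res_mod S M i) N)\<lparr>carrier := cocycles S i M N\<rparr>)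
     (coboundaries S i M N)"

definition chain_lift :: "('a, 'r) ring_scheme \<Rightarrow> ('a, 'x) module \<Rightarrow> ('a, 'y) module \<Rightarrow>
    ('x \<Rightarrow> 'y) \<Rightarrow> nat \<Rightarrow> (nat \<Rightarrow> 'a) \<Rightarrow> nat \<Rightarrow> 'a" where
  "chain_lift S M M' f = (SOME \<theta>.
     (\<forall>i. \<theta> i \<in> mod_hom S (res_mod S M i) (res_mod S M' i)) \<and>
     (\<forall>x\<in>carrier (res_mod S M 0). res_aug S M' (\<theta> 0 x) = f (res_aug S M x)) \<and>
     (\<forall>i. \<forall>x\<in>carrier (res_mod S M (Suc i)).
        res_diff S M' i (\<theta> (Suc i) x) = \<theta> i (res_diff S M i x)))"

text \<open>$\mathrm{Ext}^i(f, N)\colon \mathrm{Ext}^i(M', N) \to \mathrm{Ext}^i(M, N)$ for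
  $f\colon M \to M'$.\<close>

definition Ext_map :: "('a, 'r) ring_scheme \<Rightarrow> nat \<Rightarrow> ('a, 'x) module \<Rightarrow> ('a, 'y) module \<Rightarrow>
    ('a, 'z) module \<Rightarrow> ('x \<Rightarrow> 'y) \<Rightarrow> ((nat \<Rightarrow> 'a) \<Rightarrow> 'z) set \<Rightarrow> ((nat \<Rightarrow> 'a) \<Rightarrow> 'z) set" where
  "Ext_map S i M M' N f P = (\<Union>g\<in>P. coboundaries S i M N
     +>\<^bsub>hom_mod S (res_mod S M i) N\<^esub> hom_map (res_mod S M i) (chain_lift S M M' f i) g)"

definition grade :: "('a, 'r) ring_scheme \<Rightarrow> ('a, 'y) module \<Rightarrow> enat" where
  "grade S M = Inf {enat i | i.
     carrier (Ext S i M (self_module S)) \<noteq> {\<zero>\<^bsub>Ext S i M (self_module S)\<^esub>}}"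

definition perfect_module :: "('a, 'r) ring_scheme \<Rightarrow> ('a, 'y) module \<Rightarrow> bool" where
  "perfect_module S M \<longleftrightarrow> fin_gen S M \<and> grade S M = proj_dim S M"

definition Ext_over_algebra :: "('a, 'r) ring_scheme \<Rightarrow> ('b, 'q) ring_scheme \<Rightarrow> ('a \<Rightarrow> 'b) \<Rightarrow>
    nat \<Rightarrow> ('b, ((nat \<Rightarrow> 'a) \<Rightarrow> 'a) set) module" where
  "Ext_over_algebra S R \<phi> i =
    (let M = restrict_scalars \<phi> R; E = Ext S i M (self_module S) in
     \<lparr>carrier = carrier E, monoid.mult = undefined, one = undefined, ring.zero = ring.zero E, add = add E,
      smult = (\<lambda>r. Ext_map S i M M (self_module S) (\<lambda>x. r \<otimes>\<^bsub>R\<^esub> x))\<rparr>)"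

definition gorenstein_algebra ::
  "('a, 'r) ring_scheme \<Rightarrow> ('b, 'q) ring_scheme \<Rightarrow> ('a \<Rightarrow> 'b) \<Rightarrow> nat \<Rightarrow> bool" where
  "gorenstein_algebra S R \<phi> c \<longleftrightarrow>
     codimension S (restrict_scalars \<phi> R) = ereal (real c) \<and>
     perfect_module S (restrict_scalars \<phi> R) \<and>
     mod_iso R (self_module R) (Ext_over_algebra S R \<phi> c) \<noteq> {}"

text \<open>The complex
  $$F_0 \leftarrow \cdots \leftarrow F_m \leftarrow F_m^* \leftarrow \cdots \leftarrow F_0^*
    \leftarrow 0$$
  with $d_i\colon F_i \to F_{i-1}$ for $1 \le i \le m$ in the left half, $e\colon F_m^* \to F_m$
  in the middle and $d_m^*, \ldots, d_1^*$ in the right half. Since the modules $F_i$ and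
  $F_i^*$ have elements of different types, they are moved into a sum type.\<close>

definition image_mod :: "('x \<Rightarrow> 'y) \<Rightarrow> ('a, 'x) module \<Rightarrow> ('a, 'y) module" where
  "image_mod j M = (let k = inv_into (carrier M) j in
     \<lparr>carrier = j ` carrier M, monoid.mult = undefined, one = undefined, ring.zero = j \<zero>\<^bsub>M\<^esub>,
      add = (\<lambda>x y. j (k x \<oplus>\<^bsub>M\<^esub> k y)), smult = (\<lambda>s x. j (s \<odot>\<^bsub>M\<^esub> k x))\<rparr>)"

definition self_dual_mod :: "('a, 'r) ring_scheme \<Rightarrow> nat \<Rightarrow> (nat \<Rightarrow> ('a, 'x) module) \<Rightarrow>
    nat \<Rightarrow> ('a, 'x + ('x \<Rightarrow> 'a)) module" where
  "self_dual_mod S m F i =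
     (if i \<le> m then image_mod Inl (F i)
      else if i \<le> 2 * m + 1 then image_mod Inr (dual S (F (2 * m + 1 - i)))
      else (image_mod Inl (F 0))\<lparr>carrier := {Inl \<zero>\<^bsub>F 0\<^esub>}\<rparr>)"

definition self_dual_diff :: "('a, 'r) ring_scheme \<Rightarrow> nat \<Rightarrow> (nat \<Rightarrow> ('a, 'x) module) \<Rightarrow>
    (nat \<Rightarrow> 'x \<Rightarrow> 'x) \<Rightarrow> (('x \<Rightarrow> 'a) \<Rightarrow> 'x) \<Rightarrow> nat \<Rightarrow> 'x + ('x \<Rightarrow> 'a) \<Rightarrow> 'x + ('x \<Rightarrow> 'a)" where
  "self_dual_diff S m F d e i =
     (if i < m then (\<lambda>x. Inl (d (Suc i) (projl x)))
      else if i = m then (\<lambda>\<alpha>. Inl (e (projr \<alpha>)))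
      else if i \<le> 2 * m then
        (\<lambda>\<alpha>. Inr (hom_map (F (2 * m + 1 - i)) (d (2 * m + 1 - i)) (projr \<alpha>)))
      else (\<lambda>_. \<zero>\<^bsub>self_dual_mod S m F i\<^esub>))"

end

theory Submission
  imports Defs
begin

text \<open>(2) to (1): duality identifies \<open>Ext\<^sup>c(R,S)\<close> with \<open>R\<close> as an \<open>S\<close>-module. Since \<open>R\<close> has a free
resolution of length \<open>c\<close>, its associated primes are minimal over the annihilator; there \<open>S\<close> and
\<open>R\<close> agree up to denominators, so an \<open>S\<close>-linear map between torsion free \<open>R\<close>-modules is \<open>R\<close>-linear.

(1) to (2), following Buchsbaum and Eisenbud: the multiplication of \<open>R\<close> lifts to a graded
commutative product on a minimal free resolution \<open>F\<close>, with a Leibniz rule. A functional on \<open>F\<^sub>c\<close> that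
represents the generator of \<open>Ext\<^sup>c(R,S)\<close> turns it into pairings of \<open>F\<^sub>i\<close> with \<open>F\<^sub>c\<^sub>-\<^sub>i\<close>. They are perfect
by Nakayama's lemma, so \<open>F\<^sub>c\<^sub>-\<^sub>i\<close> is the dual of \<open>F\<^sub>i\<close>, and the Leibniz rule makes the middle map
symmetric up to the sign \<open>(-1)\<^sup>m\<close>.\<close>

text \<open>Localizations are never formed. A statement at a prime \<open>P\<close> is made over the
  ring itself, with a denominator from \<open>carrier R - P\<close> multiplied through, and ideals
  of the local ring are replaced by their contractions.

  Duals are handled in coordinates: \<open>dot\<close> identifies R^n with its dual, dual maps
  become transposes, and the complex in a sum type that the theorem speaks of is reached only at the
  end, through an isomorphism of complexes.

  For (2) to (1), regularity of \<open>S\<close> enters as a regular sequence of length dim S in the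
  maximal ideal: a module with a free resolution of length c then satisfies dim S/P \<ge> dim S - c
  for each of its associated primes P.

  For (1) to (2), graded commutativity must hold exactly and not only up to homotopy, also where 2
  is not invertible, so the product is prescribed on bases. The sign in the middle has one source:
  products of degrees m and m + 1 commute without sign, as m (m + 1) is even, while the Leibniz rule
  moves the differential from one factor of degree m + 1 to the other at the cost of (-1)^m.\<close>

context module
begin

text \<open>Gives \<open>algebra\<close> the identities of a module and of its ring together, so
  that vector computations with ring coefficients are single calls of it.\<close>

lemmas module_simprules
 [algebra add: module "ring.zero M" "add M" "a_inv M" "a_minus M" "smult M"
   "ring.zero R" "add R" "a_inv R" "a_minus R" "one R" "monoid.mult R"] =
 M.a_closed M.zero_closed M.a_inv_closed M.minus_closed
 M.a_assoc M.l_zero M.l_neg M.a_comm M.minus_eq M.r_zero M.r_neg M.r_neg2 M.r_neg1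
 M.minus_add M.minus_minus M.add.inv_one M.a_lcomm
 smult_closed smult_l_distr smult_r_distr smult_assoc1[symmetric] smult_one smult_l_null smult_r_null
 smult_l_minus smult_r_minus
 cring_simprules

end

text \<open>A home for the module theory below that can be imported into \<open>cring\<close> for
  every \<open>Free n\<close> and for the ring over itself.\<close>

locale lmodule = module R M
 for R :: "('a, 'r) ring_scheme" (structure) and M :: "('a, 'x) module" (structure)

context lmodule
begin

abbreviation mod_zero ("\<zero>\<^sub>M") where "\<zero>\<^sub>M \<equiv> \<zero>\<^bsub>M\<^esub>"

abbreviation mod_add (infixl "\<oplus>\<^sub>M" 65) where "x \<oplus>\<^sub>M y \<equiv> x \<oplus>\<^bsub>M\<^esub> y"

abbreviation mod_uminus ("\<ominus>\<^sub>M _" [81] 80) where "\<ominus>\<^sub>M x \<equiv> \<ominus>\<^bsub>M\<^esub> x"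

abbreviation mod_minus (infixl "\<ominus>\<^sub>M" 65) where "x \<ominus>\<^sub>M y \<equiv> x \<ominus>\<^bsub>M\<^esub> y"

abbreviation mod_smult (infixl "\<odot>\<^sub>M" 70) where "s \<odot>\<^sub>M x \<equiv> s \<odot>\<^bsub>M\<^esub> x"

end

section \<open>Linear maps and linear combinations\<close>

lemma mod_homI:
 assumes "\<And>x. x \<in> carrier M ==> f x \<in> carrier N"
  and "\<And>x y. x \<in> carrier M ==> y \<in> carrier M ==> f (x \<oplus>\<^bsub>M\<^esub> y) = f x \<oplus>\<^bsub>N\<^esub> f y"
  and "\<And>s x. s \<in> carrier S ==> x \<in> carrier M ==> f (s \<odot>\<^bsub>M\<^esub> x) = s \<odot>\<^bsub>N\<^esub> f x"
 shows "f \<in> mod_hom S M N" using assms by (auto simp: mod_hom_def)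

lemma mod_hom_closed [intro]: "f \<in> mod_hom S M N ==> x \<in> carrier M ==> f x \<in> carrier N"
 and mod_hom_add: "f \<in> mod_hom S M N ==> x \<in> carrier M ==> y \<in> carrier M ==> f (x \<oplus>\<^bsub>M\<^esub> y) = f x \<oplus>\<^bsub>N\<^esub> f y"
 and mod_hom_smult: "f \<in> mod_hom S M N ==> s \<in> carrier S ==> x \<in> carrier M ==> f (s \<odot>\<^bsub>M\<^esub> x) = s \<odot>\<^bsub>N\<^esub> f x"
 by (auto simp: mod_hom_def)

lemma mod_hom_comp:
 "f \<in> mod_hom S M N ==> g \<in> mod_hom S N P ==> (\<lambda>x. g (f x)) \<in> mod_hom S M P"
 by (rule mod_homI) (auto simp: mod_hom_add mod_hom_smult mod_hom_closed)

lemma mod_hom_id: "(\<lambda>x. x) \<in> mod_hom S M M" by (auto simp: mod_hom_def)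

lemma mod_hom_cong:
 assumes "module S M" "f \<in> mod_hom S M N" "\<And>x. x \<in> carrier M ==> g x = f x"
 shows "g \<in> mod_hom S M N"
proof -
 interpret lmodule S M by (rule lmodule.intro) fact
 show ?thesis by (rule mod_homI) (simp_all add: assms(3) mod_hom_add[OF assms(2)] mod_hom_smult[OF assms(2)] mod_hom_closed[OF assms(2)])
qed

lemma mod_hom_zero:
 assumes "module S M" "module S N" "f \<in> mod_hom S M N"
 shows "f \<zero>\<^bsub>M\<^esub> = \<zero>\<^bsub>N\<^esub>"
proof -
 interpret M: lmodule S M by (rule lmodule.intro) fact
 interpret N: lmodule S N by (rule lmodule.intro) fact
 have "f (\<zero>\<^bsub>S\<^esub> \<odot>\<^bsub>M\<^esub> \<zero>\<^bsub>M\<^esub>) = \<zero>\<^bsub>S\<^esub> \<odot>\<^bsub>N\<^esub> f \<zero>\<^bsub>M\<^esub>"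
  by (rule mod_hom_smult[OF assms(3)]) auto
 then show ?thesis using mod_hom_closed[OF assms(3) M.M.zero_closed] by simp
qed

lemma mod_hom_uminus:
 assumes "module S M" "module S N" "f \<in> mod_hom S M N" "x \<in> carrier M"
 shows "f (\<ominus>\<^bsub>M\<^esub> x) = \<ominus>\<^bsub>N\<^esub> f x"
proof -
 interpret M: lmodule S M by (rule lmodule.intro) fact
 interpret N: lmodule S N by (rule lmodule.intro) fact
 have "f (\<ominus>\<^bsub>M\<^esub> x) \<oplus>\<^bsub>N\<^esub> f x = \<zero>\<^bsub>N\<^esub>"
  using assms(4) mod_hom_add[OF assms(3), of "\<ominus>\<^bsub>M\<^esub> x" x] mod_hom_zero[OF assms(1-3)] by (simp add: M.M.l_neg)
 then show ?thesis using assms(4) mod_hom_closed[OF assms(3)] N.M.minus_equality by (metis M.M.a_inv_closed)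
qed

lemma mod_hom_minus:
 assumes "module S M" "module S N" "f \<in> mod_hom S M N" "x \<in> carrier M" "y \<in> carrier M"
 shows "f (x \<ominus>\<^bsub>M\<^esub> y) = f x \<ominus>\<^bsub>N\<^esub> f y"
proof -
 interpret M: lmodule S M by (rule lmodule.intro) fact
 show ?thesis using assms by (simp add: a_minus_def mod_hom_add mod_hom_uminus[OF assms(1-3)])
qed

context lmodule
begin

lemma mod_hom_addf:
 assumes "f \<in> mod_hom R L M" "g \<in> mod_hom R L M"
 shows "(\<lambda>x. f x \<oplus>\<^sub>M g x) \<in> mod_hom R L M"
proof (rule mod_homI)
 note [simp] = mod_hom_closed[OF assms(1)] mod_hom_closed[OF assms(2)]
 show "f x \<oplus>\<^sub>M g x \<in> carrier M" if "x \<in> carrier L" for x using that by simp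
 show "f (x \<oplus>\<^bsub>L\<^esub> y) \<oplus>\<^sub>M g (x \<oplus>\<^bsub>L\<^esub> y) = f x \<oplus>\<^sub>M g x \<oplus>\<^sub>M (f y \<oplus>\<^sub>M g y)"
  if "x \<in> carrier L" "y \<in> carrier L" for x y using that by (simp add: mod_hom_add[OF assms(1)] mod_hom_add[OF assms(2)] M.a_ac)
 show "f (s \<odot>\<^bsub>L\<^esub> x) \<oplus>\<^sub>M g (s \<odot>\<^bsub>L\<^esub> x) = s \<odot>\<^sub>M (f x \<oplus>\<^sub>M g x)"
  if "s \<in> carrier R" "x \<in> carrier L" for s x
  using that by (simp add: mod_hom_smult[OF assms(1)] mod_hom_smult[OF assms(2)] smult_r_distr)
qed

lemma mod_hom_smultf:
 assumes "f \<in> mod_hom R L M" "r \<in> carrier R"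
 shows "(\<lambda>x. r \<odot>\<^sub>M f x) \<in> mod_hom R L M"
proof (rule mod_homI)
 note [simp] = mod_hom_closed[OF assms(1)]
 show "r \<odot>\<^sub>M f x \<in> carrier M" if "x \<in> carrier L" for x using that assms by simp
 show "r \<odot>\<^sub>M f (x \<oplus>\<^bsub>L\<^esub> y) = r \<odot>\<^sub>M f x \<oplus>\<^sub>M r \<odot>\<^sub>M f y"
  if "x \<in> carrier L" "y \<in> carrier L" for x y using that assms by (simp add: mod_hom_add[OF assms(1)] smult_r_distr)
 show "r \<odot>\<^sub>M f (s \<odot>\<^bsub>L\<^esub> x) = s \<odot>\<^sub>M (r \<odot>\<^sub>M f x)"
  if "s \<in> carrier R" "x \<in> carrier L" for s x
  using that assms by (simp add: mod_hom_smult[OF assms(1)] smult_assoc1[symmetric] m_comm)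
qed

lemma mod_hom_zerof: "(\<lambda>x. \<zero>\<^sub>M) \<in> mod_hom R L M" by (rule mod_homI) simp_all

lemma mod_hom_subf:
 assumes "f \<in> mod_hom R L M" "g \<in> mod_hom R L M" "module R L"
 shows "(\<lambda>x. f x \<ominus>\<^sub>M g x) \<in> mod_hom R L M"
proof -
 have "(\<lambda>x. f x \<oplus>\<^sub>M (\<ominus> \<one>) \<odot>\<^sub>M g x) \<in> mod_hom R L M"
  by (intro mod_hom_addf mod_hom_smultf assms) auto
 then show ?thesis by (rule mod_hom_cong[OF assms(3)])
   (simp add: a_minus_def smult_l_minus mod_hom_closed[OF assms(2)])
qed

lemma eq_of_minus_zero: "x \<in> carrier M ==> y \<in> carrier M ==> x \<ominus>\<^sub>M y = \<zero>\<^sub>M ==> x = y"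
 by (metis M.add.inv_closed M.minus_eq M.minus_equality M.minus_minus)

lemma minus_self: "x \<in> carrier M ==> x \<ominus>\<^sub>M x = \<zero>\<^sub>M" by (simp add: M.minus_eq M.r_neg)

end

text \<open>Indexed by an initial segment rather than a set, so that proofs run by
  \<open>lincomb_Suc\<close> and the coefficients can be a vector of \<open>Free n\<close>.\<close>

definition lincomb :: "('a, 'x) module => nat => (nat => 'a) => (nat => 'x) => 'x" where
 "lincomb M n a g = (\<Oplus>\<^bsub>M\<^esub>k\<in>{..<n}. a k \<odot>\<^bsub>M\<^esub> g k)"

lemma (in lmodule) lincomb_0 [simp]: "lincomb M 0 a g = \<zero>\<^sub>M" by (simp add: lincomb_def)

lemma (in lmodule) lincomb_closed [simp]:
 assumes "\<And>k. k < n ==> a k \<in> carrier R" "\<And>k. k < n ==> g k \<in> carrier M"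
 shows "lincomb M n a g \<in> carrier M" unfolding lincomb_def using assms by (intro M.finsum_closed) auto

lemma (in lmodule) lincomb_Suc:
 assumes "\<And>k. k \<le> n ==> a k \<in> carrier R" "\<And>k. k \<le> n ==> g k \<in> carrier M"
 shows "lincomb M (Suc n) a g = lincomb M n a g \<oplus>\<^sub>M a n \<odot>\<^sub>M g n" unfolding lincomb_def lessThan_Suc using assms
 by (subst M.finsum_insert) (auto intro!: M.a_comm M.finsum_closed)

lemma (in lmodule) lincomb_cong:
 assumes "\<And>k. k < n ==> a k = a' k" "\<And>k. k < n ==> g k = g' k"
  and "\<And>k. k < n ==> a k \<in> carrier R" "\<And>k. k < n ==> g k \<in> carrier M"
 shows "lincomb M n a g = lincomb M n a' g'" unfolding lincomb_def using assms by (intro M.finsum_cong') (auto simp: Pi_def)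

lemma (in lmodule) lincomb_mod_hom:
 assumes "module R N" "f \<in> mod_hom R M N"
  and "\<And>k. k < n ==> a k \<in> carrier R" "\<And>k. k < n ==> g k \<in> carrier M"
 shows "f (lincomb M n a g) = lincomb N n a (\<lambda>k. f (g k))" using assms(3,4)
proof (induction n)
 case 0
 interpret N: lmodule R N by (rule lmodule.intro) fact
 show ?case by (simp add: mod_hom_zero[OF module_axioms assms(1,2)])
next
 case (Suc n)
 interpret N: lmodule R N by (rule lmodule.intro) fact
 show ?case
  using Suc by (simp add: lincomb_Suc N.lincomb_Suc mod_hom_add[OF assms(2)] mod_hom_smult[OF assms(2)] mod_hom_closed[OF assms(2)])
qed

section \<open>Scalars, free modules and coordinates\<close>

text \<open>\<open>N\<close> is only a record of operations; it inherits the axioms through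
  \<open>f\<close>. The records made by \<open>image_mod\<close> are shown to be modules in this
  way.\<close>

lemma module_transport:
 fixes M :: "('a, 'x) module" and N :: "('a, 'y) module"
 assumes "module S M" and f: "bij_betw f (carrier M) (carrier N)" and f0: "f \<zero>\<^bsub>M\<^esub> = \<zero>\<^bsub>N\<^esub>"
  and fa: "\<And>x y. x \<in> carrier M ==> y \<in> carrier M ==> f (x \<oplus>\<^bsub>M\<^esub> y) = f x \<oplus>\<^bsub>N\<^esub> f y"
  and fs: "\<And>s x. s \<in> carrier S ==> x \<in> carrier M ==> f (s \<odot>\<^bsub>M\<^esub> x) = s \<odot>\<^bsub>N\<^esub> f x"
 shows "module S N"
proof -
 interpret lmodule S M by (rule lmodule.intro) fact
 have ex: "\<exists>u\<in>carrier M. x = f u" if "x \<in> carrier N" for x using that f by (auto simp: bij_betw_def)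
 have cl [simp]: "f u \<in> carrier N" if "u \<in> carrier M" for u using that f by (auto simp: bij_betw_def)
 note [simp] = fa[symmetric] fs[symmetric] f0[symmetric]
 show ?thesis
 proof (intro moduleI abelian_groupI)
  show "\<exists>y\<in>carrier N. y \<oplus>\<^bsub>N\<^esub> x = \<zero>\<^bsub>N\<^esub>" if x: "x \<in> carrier N" for x
  proof -
   obtain u where "u \<in> carrier M" "x = f u" using ex[OF x] by blast
   then show ?thesis by (intro bexI[of _ "f (\<ominus>\<^bsub>M\<^esub> u)"]) (auto simp: M.l_neg)
  qed
  show "x \<oplus>\<^bsub>N\<^esub> y = y \<oplus>\<^bsub>N\<^esub> x" if "x \<in> carrier N" "y \<in> carrier N" for x y
   using ex[OF that(1)] ex[OF that(2)] by (auto simp: M.a_comm simp del: f0)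
  show "x \<oplus>\<^bsub>N\<^esub> y \<oplus>\<^bsub>N\<^esub> z = x \<oplus>\<^bsub>N\<^esub> (y \<oplus>\<^bsub>N\<^esub> z)"
   if "x \<in> carrier N" "y \<in> carrier N" "z \<in> carrier N" for x y z
   using ex[OF that(1)] ex[OF that(2)] ex[OF that(3)] by (auto simp: M.a_assoc)
  show "cring S" by (rule is_cring)
 qed (auto dest!: ex simp: smult_l_distr smult_r_distr smult_assoc1)
qed

lemma mod_isoI:
 "f \<in> mod_hom S M N ==> bij_betw f (carrier M) (carrier N) ==> f \<in> mod_iso S M N"
 by (simp add: mod_iso_def)

lemma self_module_simps [simp]:
 "carrier (self_module S) = carrier S" "\<zero>\<^bsub>self_module S\<^esub> = \<zero>\<^bsub>S\<^esub>"
 "add (self_module S) = add S" "smult (self_module S) = monoid.mult S" by (simp_all add: self_module_def)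

lemma restrict_scalars_simps [simp]:
 "carrier (restrict_scalars \<phi> R) = carrier R" "\<zero>\<^bsub>restrict_scalars \<phi> R\<^esub> = \<zero>\<^bsub>R\<^esub>"
 "add (restrict_scalars \<phi> R) = add R" "s \<odot>\<^bsub>restrict_scalars \<phi> R\<^esub> x = \<phi> s \<otimes>\<^bsub>R\<^esub> x"
 by (simp_all add: restrict_scalars_def)

lemma a_inv_cong: "carrier M = carrier N ==> add M = add N ==> \<zero>\<^bsub>M\<^esub> = \<zero>\<^bsub>N\<^esub> ==> a_inv M = a_inv N"
 by (simp add: a_inv_def m_inv_def fun_eq_iff)

lemma a_minus_cong: "carrier M = carrier N ==> add M = add N ==> \<zero>\<^bsub>M\<^esub> = \<zero>\<^bsub>N\<^esub> ==> a_minus M = a_minus N"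
 using a_inv_cong[of M N] by (simp add: a_minus_def fun_eq_iff)

lemma self_module_minus [simp]:
 "a_inv (self_module S) = a_inv S" "a_minus (self_module S) = a_minus S" by (rule a_inv_cong a_minus_cong; simp)+

lemma restrict_scalars_minus [simp]:
 "a_inv (restrict_scalars \<phi> R) = a_inv R" "a_minus (restrict_scalars \<phi> R) = a_minus R" by (rule a_inv_cong a_minus_cong; simp)+

lemma (in cring) module_self: "module R (self_module R)"
proof (intro moduleI abelian_groupI)
 show "\<exists>y\<in>carrier (self_module R). y \<oplus>\<^bsub>self_module R\<^esub> x = \<zero>\<^bsub>self_module R\<^esub>"
  if "x \<in> carrier (self_module R)" for x using that by (intro bexI[of _ "\<ominus> x"]) (auto simp: l_neg)
qed (auto simp: is_cring a_ac m_assoc l_distr r_distr)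

lemma module_restrict_scalars:
 assumes "cring S" "cring R" "\<phi> \<in> ring_hom S R"
 shows "module S (restrict_scalars \<phi> R)"
proof -
 interpret S: cring S by fact
 interpret R: cring R by fact
 interpret \<phi>: ring_hom_cring S R \<phi> using assms by unfold_locales
 show ?thesis
 proof (intro moduleI abelian_groupI)
  show "\<exists>y\<in>carrier (restrict_scalars \<phi> R). y \<oplus>\<^bsub>restrict_scalars \<phi> R\<^esub> x = \<zero>\<^bsub>restrict_scalars \<phi> R\<^esub>"
   if "x \<in> carrier (restrict_scalars \<phi> R)" for x
   using that by (intro bexI[of _ "\<ominus>\<^bsub>R\<^esub> x"]) (auto simp: R.l_neg)
 qed (auto simp: assms R.a_ac R.m_assoc R.l_distr R.r_distr)
qed

lemma free_mod_simps [simp]: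
 "\<zero>\<^bsub>free_mod S n\<^esub> = (\<lambda>i. \<zero>\<^bsub>S\<^esub>)"
 "x \<oplus>\<^bsub>free_mod S n\<^esub> y = (\<lambda>i. x i \<oplus>\<^bsub>S\<^esub> y i)"
 "s \<odot>\<^bsub>free_mod S n\<^esub> x = (\<lambda>i. s \<otimes>\<^bsub>S\<^esub> x i)" by (simp_all add: free_mod_def)

lemma free_mod_carrier:
 "x \<in> carrier (free_mod S n) \<longleftrightarrow> (\<forall>i<n. x i \<in> carrier S) \<and> (\<forall>i\<ge>n. x i = \<zero>\<^bsub>S\<^esub>)"
 by (simp add: free_mod_def)

context cring
begin

abbreviation Free :: "nat => ('a, nat => 'a) module" where
 "Free n \<equiv> free_mod R n"

abbreviation Frees :: "(nat => nat) => nat => ('a, nat => 'a) module" where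
 "Frees b \<equiv> \<lambda>i. Free (b i)"

abbreviation Vec :: "nat => (nat => 'a) set" where
 "Vec n \<equiv> carrier (Free n)"

abbreviation Lin :: "nat => nat => ((nat => 'a) => nat => 'a) set" where
 "Lin p q \<equiv> mod_hom R (Free p) (Free q)"

abbreviation vec_zero :: "nat => nat => 'a" ("\<zero>[_]") where
 "\<zero>[n] \<equiv> \<zero>\<^bsub>Free n\<^esub>"

abbreviation vec_add :: "(nat => 'a) => nat => (nat => 'a) => nat => 'a" ("_ \<oplus>[_] _" [65, 0, 66] 65) where
 "x \<oplus>[n] y \<equiv> x \<oplus>\<^bsub>Free n\<^esub> y"

abbreviation vec_uminus :: "nat => (nat => 'a) => nat => 'a" ("\<ominus>[_] _" [0, 81] 80) where
 "\<ominus>[n] x \<equiv> \<ominus>\<^bsub>Free n\<^esub> x"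

abbreviation vec_minus :: "(nat => 'a) => nat => (nat => 'a) => nat => 'a" ("_ \<ominus>[_] _" [65, 0, 66] 65) where
 "x \<ominus>[n] y \<equiv> x \<ominus>\<^bsub>Free n\<^esub> y"

abbreviation vec_smult :: "'a => nat => (nat => 'a) => nat => 'a" ("_ \<odot>[_] _" [70, 0, 71] 70) where
 "s \<odot>[n] x \<equiv> s \<odot>\<^bsub>Free n\<^esub> x"

lemma Vec_closed: "x \<in> Vec n ==> x i \<in> carrier R" by (cases "i < n") (auto simp: free_mod_carrier)

lemma free_mod_beyond: "x \<in> Vec n ==> n \<le> i ==> x i = \<zero>" by (simp add: free_mod_carrier)

lemma free_modI:
 "(\<And>i. x i \<in> carrier R) ==> (\<And>i. n \<le> i ==> x i = \<zero>) ==> x \<in> Vec n"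
 by (simp add: free_mod_carrier)

lemma free_module: "module R (Free n)"
proof (intro moduleI abelian_groupI)
 show "\<exists>y\<in>Vec n. y \<oplus>[n] x = \<zero>[n]"
  if "x \<in> Vec n" for x
  using that by (intro bexI[of _ "\<lambda>i. \<ominus> x i"]) (auto simp: l_neg free_mod_carrier not_less Vec_closed fun_eq_iff)
qed (auto simp: is_cring fun_eq_iff Vec_closed free_mod_beyond a_ac m_assoc l_distr r_distr intro!: free_modI)

text \<open>From here on, every fact about an arbitrary module is available for R^n under
  \<open>Free\<close> and for the ring over itself under \<open>Self\<close>; ideals are treated as
  submodules of the latter.\<close>

sublocale Free: lmodule R "Free n" for n by (rule lmodule.intro free_module)+

sublocale Self: lmodule R "self_module R" by (rule lmodule.intro module_self)+

lemma free_mod_uminus: "x \<in> Vec n ==> \<ominus>[n] x = (\<lambda>i. \<ominus> x i)" by (rule Free.M.minus_equality)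
  (auto simp: fun_eq_iff Vec_closed free_mod_beyond l_neg intro!: free_modI)

lemma free_mod_minus:
 "x \<in> Vec n ==> y \<in> Vec n ==> x \<ominus>[n] y = (\<lambda>i. x i \<ominus> y i)"
 by (simp add: Free.M.minus_eq free_mod_uminus) (simp add: minus_eq)

definition unitvec :: "nat => nat => 'a" where
 "unitvec k = (\<lambda>i. if i = k then \<one> else \<zero>)"

lemma unitvec_closed [simp]: "k < n ==> unitvec k \<in> Vec n" by (auto simp: unitvec_def free_mod_carrier)

lemma lincomb_free_apply:
 assumes "\<And>k. k < p ==> a k \<in> carrier R" "\<And>k. k < p ==> g k \<in> Vec n"
 shows "lincomb (Free n) p a g i = lincomb (self_module R) p a (\<lambda>k. g k i)" using assms
proof (induction p)
 case (Suc p)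
 have "g k i \<in> carrier R" if "k < Suc p" for k using Suc.prems(2)[OF that] by (rule Vec_closed)
 with Suc show ?case by (simp add: Free.lincomb_Suc Self.lincomb_Suc)
qed simp

lemma lincomb_unitvec:
 assumes "x \<in> Vec n"
 shows "lincomb (Free n) n x unitvec = x"
proof
 fix i
 have "lincomb (self_module R) p x (\<lambda>k. unitvec k i) = (if i < p then x i else \<zero>)" if "p \<le> n" for p using that
 proof (induction p)
  case (Suc p)
  then show ?case using Vec_closed[OF assms] by (auto simp: Self.lincomb_Suc unitvec_def not_less less_Suc_eq)
 qed simp
 then show "lincomb (Free n) n x unitvec i = x i" using assms by (subst lincomb_free_apply) (auto simp: Vec_closed free_mod_beyond)
qed

end

context lmodule
begin

lemma lincomb_add:
 assumes "\<And>k. k < n ==> a k \<in> carrier R" "\<And>k. k < n ==> b k \<in> carrier R" "\<And>k. k < n ==> g k \<in> carrier M"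
 shows "lincomb M n (\<lambda>k. a k \<oplus> b k) g = lincomb M n a g \<oplus>\<^sub>M lincomb M n b g" using assms
 by (induction n) (simp_all add: lincomb_Suc smult_l_distr M.a_ac)

lemma lincomb_smult:
 assumes "\<And>k. k < n ==> a k \<in> carrier R" "s \<in> carrier R" "\<And>k. k < n ==> g k \<in> carrier M"
 shows "lincomb M n (\<lambda>k. s \<otimes> a k) g = s \<odot>\<^sub>M lincomb M n a g" using assms
 by (induction n) (simp_all add: lincomb_Suc smult_r_distr smult_assoc1)

lemma lincomb_hom:
 assumes "\<And>k. k < n ==> g k \<in> carrier M"
 shows "(\<lambda>x. lincomb M n x g) \<in> mod_hom R (Free n) M"
 by (rule mod_homI) (simp_all add: lincomb_add lincomb_smult assms Vec_closed)

lemma free_hom_lincomb: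
 assumes "f \<in> mod_hom R (Free n) M" "x \<in> Vec n"
 shows "f x = lincomb M n x (\<lambda>k. f (unitvec k))"
proof -
 have "f (lincomb (Free n) n x unitvec) = lincomb M n x (\<lambda>k. f (unitvec k))"
  by (rule Free.lincomb_mod_hom[OF module_axioms assms(1)])
   (use assms(2) in \<open>auto intro: Vec_closed\<close>)
 then show ?thesis by (simp add: lincomb_unitvec assms)
qed

lemma lincomb_unit:
 assumes "j < n" "\<And>k. k < n ==> g k \<in> carrier M"
 shows "lincomb M n (unitvec j) g = g j"
proof -
 have "lincomb M p (unitvec j) g = (if j < p then g j else \<zero>\<^sub>M)" if "p \<le> n" for p using that
  by (induction p) (use assms in \<open>auto simp: lincomb_Suc unitvec_def not_less less_Suc_eq\<close>)
 from this[of n] show ?thesis using assms by simp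
qed

lemma free_hom_eqI:
 assumes "f \<in> mod_hom R (Free n) M" "g \<in> mod_hom R (Free n) M"
  and "\<And>k. k < n ==> f (unitvec k) = g (unitvec k)" "x \<in> Vec n"
 shows "f x = g x"
proof -
 have "lincomb M n x (\<lambda>k. f (unitvec k)) = lincomb M n x (\<lambda>k. g (unitvec k))"
  using assms by (intro lincomb_cong) (auto simp: Vec_closed intro!: mod_hom_closed[of g])
 then show ?thesis using free_hom_lincomb[OF assms(1,4)] free_hom_lincomb[OF assms(2,4)] by simp
qed

end

section \<open>Finitely generated submodules and Nakayama's lemma\<close>

text \<open>An intersection instead of a set of finite sums: spans of infinite sets, as in
  \<open>prime_mult\<close>, then cost nothing.\<close>

definition mspan :: "('a, 'r) ring_scheme => ('a, 'x) module => 'x set => 'x set" where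
 "mspan S M A = \<Inter>{K. submodule K S M \<and> A \<subseteq> K}"

definition fg_sub :: "('a, 'r) ring_scheme => ('a, 'x) module => 'x set => bool" where
 "fg_sub S M K \<longleftrightarrow> (\<exists>A. finite A \<and> A \<subseteq> carrier M \<and> K = mspan S M A)"

definition noeth_mod :: "('a, 'r) ring_scheme => ('a, 'x) module => bool" where
 "noeth_mod S M \<longleftrightarrow> (\<forall>K. submodule K S M --> fg_sub S M K)"

lemma noeth_mod_obtain:
 assumes "noeth_mod S M" "submodule K S M"
 obtains A where "finite A" "A \<subseteq> carrier M" "K = mspan S M A" using assms unfolding noeth_mod_def fg_sub_def by auto

context lmodule
begin

lemma submod_carrier: "submodule K R M ==> x \<in> K ==> x \<in> carrier M" using submoduleE(1) by blast

lemma submod_add: "submodule K R M ==> x \<in> K ==> y \<in> K ==> x \<oplus>\<^sub>M y \<in> K"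
 using submoduleE(5) by blast

lemma submod_smult: "submodule K R M ==> s \<in> carrier R ==> x \<in> K ==> s \<odot>\<^sub>M x \<in> K"
 using submoduleE(4) by blast

lemma submod_uminus: "submodule K R M ==> x \<in> K ==> \<ominus>\<^sub>M x \<in> K"
 using submoduleE(3) by blast

lemma submod_zero: "submodule K R M ==> \<zero>\<^sub>M \<in> K"
 by (metis M.r_neg all_not_in_conv submoduleE(2) submod_add submod_carrier submod_uminus)

lemma submod_minus: "submodule K R M ==> x \<in> K ==> y \<in> K ==> x \<ominus>\<^sub>M y \<in> K"
 by (simp add: M.minus_eq submod_add submod_uminus)

lemma submodI:
 assumes "H \<subseteq> carrier M" "\<zero>\<^sub>M \<in> H" "\<And>a b. a \<in> H ==> b \<in> H ==> a \<oplus>\<^sub>M b \<in> H"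
  "\<And>a x. a \<in> carrier R ==> x \<in> H ==> a \<odot>\<^sub>M x \<in> H"
 shows "submodule H R M"
proof (rule submoduleI)
 show "\<ominus>\<^sub>M a \<in> H" if "a \<in> H" for a
  using assms(4)[of "\<ominus> \<one>" a] assms(1) that by (auto simp: smult_l_minus subset_iff)
qed (use assms in auto)

lemma mspan_submod: "A \<subseteq> carrier M ==> submodule (mspan R M A) R M" unfolding mspan_def using carrier_is_submodule
 by (intro submodI) (auto intro: submod_add submod_smult submod_zero)

lemma mspan_incl: "A \<subseteq> mspan R M A" by (auto simp: mspan_def)

lemma mspan_self: "x \<in> A ==> x \<in> mspan R M A" by (auto simp: mspan_def)

lemma mspan_min: "submodule K R M ==> A \<subseteq> K ==> mspan R M A \<subseteq> K" by (auto simp: mspan_def)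

lemma submod_sum:
 assumes "submodule K R M" "submodule L R M"
 shows "submodule {x \<oplus>\<^sub>M y | x y. x \<in> K \<and> y \<in> L} R M"
proof (rule submodI)
 note KL = submod_carrier[OF assms(1)] submod_carrier[OF assms(2)]
 show "{x \<oplus>\<^sub>M y | x y. x \<in> K \<and> y \<in> L} \<subseteq> carrier M" using KL by auto
 have "\<zero>\<^sub>M = \<zero>\<^sub>M \<oplus>\<^sub>M \<zero>\<^sub>M" by simp
 then show "\<zero>\<^sub>M \<in> {x \<oplus>\<^sub>M y | x y. x \<in> K \<and> y \<in> L}" using submod_zero assms by blast
 fix a b assume "a \<in> {x \<oplus>\<^sub>M y | x y. x \<in> K \<and> y \<in> L}" "b \<in> {x \<oplus>\<^sub>M y | x y. x \<in> K \<and> y \<in> L}"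
 then obtain x y x' y' where *: "x \<in> K" "y \<in> L" "x' \<in> K" "y' \<in> L"
  and ab: "a = x \<oplus>\<^sub>M y" "b = x' \<oplus>\<^sub>M y'" by auto
 have "a \<oplus>\<^sub>M b = (x \<oplus>\<^sub>M x') \<oplus>\<^sub>M (y \<oplus>\<^sub>M y')" using * KL by (simp add: ab M.a_ac)
 then show "a \<oplus>\<^sub>M b \<in> {x \<oplus>\<^sub>M y | x y. x \<in> K \<and> y \<in> L}" using * assms submod_add by blast
next
 fix s a assume "s \<in> carrier R" "a \<in> {x \<oplus>\<^sub>M y | x y. x \<in> K \<and> y \<in> L}"
 moreover then obtain x y where *: "x \<in> K" "y \<in> L" and a: "a = x \<oplus>\<^sub>M y" by auto
 moreover have "s \<odot>\<^sub>M a = s \<odot>\<^sub>M x \<oplus>\<^sub>M s \<odot>\<^sub>M y"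
  using calculation submod_carrier[OF assms(1)] submod_carrier[OF assms(2)] by (simp add: smult_r_distr)
 ultimately show "s \<odot>\<^sub>M a \<in> {x \<oplus>\<^sub>M y | x y. x \<in> K \<and> y \<in> L}" using assms submod_smult by blast
qed

lemma submod_vimage_smult:
 assumes "submodule K R M" "s \<in> carrier R"
 shows "submodule {x \<in> carrier M. s \<odot>\<^sub>M x \<in> K} R M"
proof (rule submodI)
 fix a x assume "a \<in> carrier R" "x \<in> {x \<in> carrier M. s \<odot>\<^sub>M x \<in> K}"
 moreover from this have "s \<odot>\<^sub>M (a \<odot>\<^sub>M x) = a \<odot>\<^sub>M (s \<odot>\<^sub>M x)"
  using assms by (simp add: smult_assoc1[symmetric] m_comm)
 ultimately show "a \<odot>\<^sub>M x \<in> {x \<in> carrier M. s \<odot>\<^sub>M x \<in> K}" using assms by (simp add: submod_smult)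
qed (use assms in \<open>auto simp: submod_zero smult_r_distr submod_add\<close>)

lemma submod_Union_chain:
 assumes "C \<noteq> {}" "subset.chain {K. submodule K R M} C"
 shows "submodule (\<Union>C) R M"
proof (rule submodI)
 have C: "submodule K R M" if "K \<in> C" for K using assms(2) that by (auto simp: subset.chain_def)
 show "\<Union>C \<subseteq> carrier M" using C submod_carrier by blast
 show "\<zero>\<^sub>M \<in> \<Union>C" using C submod_zero assms(1) by blast
 show "a \<oplus>\<^sub>M b \<in> \<Union>C" if ab: "a \<in> \<Union>C" "b \<in> \<Union>C" for a b
 proof -
  obtain K L where "K \<in> C" "L \<in> C" "a \<in> K" "b \<in> L" using ab by blast
  moreover from this have "K \<subseteq> L \<or> L \<subseteq> K" using assms(2) by (meson subset.chain_def subset_chain_def)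
  ultimately show ?thesis using C submod_add by blast
 qed
 show "s \<odot>\<^sub>M a \<in> \<Union>C" if "s \<in> carrier R" "a \<in> \<Union>C" for s a using that C submod_smult by blast
qed

text \<open>Zorn's lemma applies: the union of a chain is finitely generated, and its finitely many
  generators already lie in one member of the chain.\<close>

lemma noeth_max:
 assumes "noeth_mod R M" "F \<noteq> {}" "\<And>K. K \<in> F ==> submodule K R M"
 shows "\<exists>N\<in>F. \<forall>K\<in>F. N \<subseteq> K --> K = N"
proof (rule subset_Zorn_nonempty[OF assms(2)])
 fix C assume C: "C \<noteq> {}" "subset.chain F C"
 have "subset.chain {K. submodule K R M} C" using C(2) assms(3) by (auto simp: subset.chain_def)
 then have "submodule (\<Union>C) R M" using C by (intro submod_Union_chain)
 then obtain A where A: "finite A" "A \<subseteq> carrier M" "\<Union>C = mspan R M A" by (rule noeth_mod_obtain[OF assms(1)])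
 then have "A \<subseteq> \<Union>C" using mspan_incl by auto
 then obtain K where K: "K \<in> C" "A \<subseteq> K" using finite_subset_Union_chain[OF A(1) _ C] by blast
 have "K \<in> F" using K(1) C(2) by (auto simp: subset.chain_def)
 then have "\<Union>C \<subseteq> K" using A(3) K mspan_min assms(3) by simp
 then have "\<Union>C = K" using K(1) by auto
 then show "\<Union>C \<in> F" using \<open>K \<in> F\<close> by simp
qed

end

context lmodule
begin

lemma colon_submod:
 assumes "submodule K R M" "w \<in> carrier M"
 shows "submodule {r \<in> carrier R. r \<odot>\<^sub>M w \<in> K} R (self_module R)"
 by (rule Self.submodI) (use assms in \<open>auto simp: submod_zero smult_l_distr submod_add smult_assoc1 submod_smult\<close>)

end

context cring
begin

text \<open>Through this bridge the existence of maximal members, Nakayama's lemma and associated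
  primes, all proved for modules, apply to ideals.\<close>

lemma ideal_iff_submod: "ideal I R \<longleftrightarrow> submodule I R (self_module R)"
proof
 assume "ideal I R"
 then interpret I: ideal I R .
 show "submodule I R (self_module R)" by (rule Self.submodI) (use I.a_subset in \<open>auto simp: I.I_l_closed\<close>)
next
 assume I: "submodule I R (self_module R)"
 show "ideal I R"
 proof (rule idealI)
  show "subgroup I (add_monoid R)" using Self.submod_carrier[OF I] Self.submod_zero[OF I] Self.submod_add[OF I] Self.submod_uminus[OF I]
   by (intro add.subgroupI) (auto simp: a_inv_def[symmetric])
  show "x \<otimes> a \<in> I" "a \<otimes> x \<in> I" if "a \<in> I" "x \<in> carrier R" for a x
   using Self.submod_smult[OF I, of x a] Self.submod_carrier[OF I, of a] that m_comm[of a x] by auto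
 qed (rule ring_axioms)
qed

lemmas ideal_carrier = Self.submod_carrier[folded ideal_iff_submod, simplified]
 and ideal_zero = Self.submod_zero[folded ideal_iff_submod, simplified]
 and ideal_add = Self.submod_add[folded ideal_iff_submod, simplified]
 and ideal_mult = Self.submod_smult[folded ideal_iff_submod, simplified]
 and ideal_uminus = Self.submod_uminus[folded ideal_iff_submod, simplified]
 and ideal_minus = Self.submod_minus[folded ideal_iff_submod, simplified]
 and idealI_simple = Self.submodI[folded ideal_iff_submod, simplified]

lemma prime_ideal: "primeideal P R ==> ideal P R" by (rule primeideal.axioms)

lemma prime_one: "primeideal P R ==> \<one> \<notin> P" using primeideal.I_notcarr ideal.one_imp_carrier prime_ideal by metis

lemma prime_mult_notin:
 "primeideal P R ==> a \<in> carrier R - P ==> b \<in> carrier R - P ==> a \<otimes> b \<in> carrier R - P"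
 by (auto dest: primeideal.I_prime)

lemma prime_minus_notin:
 assumes "primeideal P R" "u \<in> carrier R - P" "p \<in> P"
 shows "u \<ominus> p \<in> carrier R - P"
proof -
 have P: "ideal P R" and p: "p \<in> carrier R" using assms prime_ideal ideal_carrier by blast+
 have u: "u \<in> carrier R" using assms by blast
 have "u = (u \<ominus> p) \<oplus> p" using u p by algebra
 then show ?thesis using assms p ideal_add[OF P, of "u \<ominus> p" p] by auto
qed

lemma noeth_self:
 assumes "noetherian_ring R"
 shows "noeth_mod R (self_module R)" unfolding noeth_mod_def fg_sub_def
proof (intro allI impI)
 fix K assume "submodule K R (self_module R)"
 then have "ideal K R" by (simp add: ideal_iff_submod)
 then obtain A where "A \<subseteq> carrier R" "finite A" "K = Idl A" using noetherian_ring.finetely_gen[OF assms] by blast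
 then show "\<exists>A. finite A \<and> A \<subseteq> carrier (self_module R) \<and> K = mspan R (self_module R) A"
  by (intro exI[of _ A]) (auto simp: mspan_def genideal_def ideal_iff_submod)
qed

lemma free_submod_restrict:
 assumes "submodule K R (Free (Suc n))"
 shows "submodule {x \<in> K. x n = \<zero>} R (Free n)"
proof (rule Free.submodI)
 show "{x \<in> K. x n = \<zero>} \<subseteq> Vec n"
 proof
  fix x assume x: "x \<in> {x \<in> K. x n = \<zero>}"
  then have "x \<in> Vec (Suc n)" using Free.submod_carrier[OF assms] by blast
  then show "x \<in> Vec n" using x by (auto simp: free_mod_carrier) (metis Suc_leI le_neq_implies_less)
 qed
 show "\<zero>[n] \<in> {x \<in> K. x n = \<zero>}" using Free.submod_zero[OF assms] by simp
next
 fix a b assume "a \<in> {x \<in> K. x n = \<zero>}" "b \<in> {x \<in> K. x n = \<zero>}"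
 then show "a \<oplus>[n] b \<in> {x \<in> K. x n = \<zero>}" using Free.submod_add[OF assms, of a b] by simp
next
 fix a x assume "a \<in> carrier R" "x \<in> {x \<in> K. x n = \<zero>}"
 then show "a \<odot>[n] x \<in> {x \<in> K. x n = \<zero>}" using Free.submod_smult[OF assms, of a x] by simp
qed

lemma free_submod_coord:
 assumes "submodule K R (Free m)"
 shows "submodule ((\<lambda>x. x n) ` K) R (self_module R)"
proof (rule Self.submodI)
 show "(\<lambda>x. x n) ` K \<subseteq> carrier (self_module R)" using Free.submod_carrier[OF assms] Vec_closed by auto
 show "\<zero>\<^bsub>self_module R\<^esub> \<in> (\<lambda>x. x n) ` K"
  using Free.submod_zero[OF assms] by (intro image_eqI[of _ _ "\<lambda>i. \<zero>"]) auto
next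
 fix a b assume "a \<in> (\<lambda>x. x n) ` K" "b \<in> (\<lambda>x. x n) ` K"
 then show "a \<oplus>\<^bsub>self_module R\<^esub> b \<in> (\<lambda>x. x n) ` K" using Free.submod_add[OF assms] by fastforce
next
 fix a x assume "a \<in> carrier R" "x \<in> (\<lambda>x. x n) ` K"
 then show "a \<odot>\<^bsub>self_module R\<^esub> x \<in> (\<lambda>x. x n) ` K" using Free.submod_smult[OF assms] by fastforce
qed

text \<open>Induction on the rank: \<open>K\<close> is generated by generators of its part in R^n
  together with lifts of generators of the ideal of its last coordinates.\<close>

lemma noeth_free:
 assumes "noetherian_ring R"
 shows "noeth_mod R (Free n)"
proof (induction n)
 case 0
 have "Vec 0 = {\<lambda>i. \<zero>}" by (auto simp: free_mod_carrier)
 then show ?case unfolding noeth_mod_def fg_sub_def by (intro allI impI exI[of _ "{}"])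
   (use Free.submod_zero[where n=0] Free.submod_carrier[where n=0] in \<open>auto simp: mspan_def\<close>)
next
 case (Suc n)
 show ?case unfolding noeth_mod_def fg_sub_def
 proof (intro allI impI)
  fix K assume K: "submodule K R (Free (Suc n))"
  let ?K0 = "{x \<in> K. x n = \<zero>}"
  obtain A0 where A0: "finite A0" "A0 \<subseteq> Vec n" "?K0 = mspan R (Free n) A0"
   by (rule noeth_mod_obtain[OF Suc free_submod_restrict[OF K]])
  obtain A' where A': "finite A'" "A' \<subseteq> carrier R" "(\<lambda>x. x n) ` K = mspan R (self_module R) A'"
   using noeth_mod_obtain[OF noeth_self[OF assms] free_submod_coord[OF K, of n]] by auto
  have "A' \<subseteq> (\<lambda>x. x n) ` K" using A'(3) Self.mspan_incl by auto
  then obtain A1 where A1: "A1 \<subseteq> K" "finite A1" "A' = (\<lambda>x. x n) ` A1" using finite_subset_image[OF A'(1)] by meson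
  have A0K: "A0 \<subseteq> K" using A0(3) Free.mspan_incl by blast
  define L where "L = mspan R (Free (Suc n)) (A0 \<union> A1)"
  have Acarr: "A0 \<union> A1 \<subseteq> Vec (Suc n)" using A0K A1(1) Free.submod_carrier[OF K] by blast
  have L: "submodule L R (Free (Suc n))" unfolding L_def by (rule Free.mspan_submod[OF Acarr])
  have LK: "L \<subseteq> K" unfolding L_def by (rule Free.mspan_min[OF K]) (use A0K A1 in auto)
  have AL: "A0 \<union> A1 \<subseteq> L" unfolding L_def by (rule Free.mspan_incl)
  have "?K0 \<subseteq> {x \<in> L. x n = \<zero>}" unfolding A0(3) using AL A0 Free.mspan_incl[of A0 n]
   by (intro Free.mspan_min free_submod_restrict L) blast
  then have K0L: "?K0 \<subseteq> L" by blast
  have coord: "(\<lambda>x. x n) ` K \<subseteq> (\<lambda>x. x n) ` L"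
   unfolding A'(3) by (intro Self.mspan_min free_submod_coord[OF L]) (use A1 AL in auto)
  have "K \<subseteq> L"
  proof
   fix x assume x: "x \<in> K"
   then obtain l where l: "l \<in> L" "l n = x n" using coord by (metis (no_types, lifting) image_iff subset_iff)
   have lx: "l \<in> Vec (Suc n)" "x \<in> Vec (Suc n)" using x l LK Free.submod_carrier[OF K] by auto
   then have "x \<ominus>[Suc n] l \<in> ?K0" using Free.submod_minus[OF K x, of l] l LK Vec_closed[OF lx(2), of n]
    by (auto simp: free_mod_minus[OF lx(2,1)] minus_eq r_neg)
   then have "(x \<ominus>[Suc n] l) \<oplus>[Suc n] l \<in> L" using K0L l by (intro Free.submod_add[OF L]) auto
   moreover have "(x \<ominus>[Suc n] l) \<oplus>[Suc n] l = x" using Free.M.a_assoc[OF lx(2) _ lx(1)] lx Free.M.l_neg Free.M.r_zero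
    by (simp only: Free.M.minus_eq Free.M.a_inv_closed)
   ultimately show "x \<in> L" by simp
  qed
  then have "K = L" using LK by blast
  then show "\<exists>A. finite A \<and> A \<subseteq> Vec (Suc n) \<and> K = mspan R (Free (Suc n)) A"
   unfolding L_def using A0 A1 Acarr by blast
 qed
qed

end

context lmodule
begin

text \<open>A maximal one among the proper colon ideals \<open>col s\<close> of \<open>K\<close> by
  \<open>s w\<close> is prime: if it contains \<open>a b\<close> but not \<open>b\<close>, then
  \<open>col (b s)\<close> is proper and contains \<open>col s\<close>, hence equals it, and it
  contains \<open>a\<close>.\<close>

lemma assoc_prime_ex:
 assumes "noetherian_ring R" "submodule K R M" "w \<in> carrier M" "w \<notin> K"
 shows "\<exists>s\<in>carrier R. s \<odot>\<^sub>M w \<notin> K \<and> primeideal {r \<in> carrier R. r \<odot>\<^sub>M (s \<odot>\<^sub>M w) \<in> K} R"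
proof -
 define col where "col = (\<lambda>s. {r \<in> carrier R. r \<odot>\<^sub>M (s \<odot>\<^sub>M w) \<in> K})"
 let ?F = "{col s | s. s \<in> carrier R \<and> s \<odot>\<^sub>M w \<notin> K}"
 have "col \<one> \<in> ?F" using assms by auto
 then have "?F \<noteq> {}" by blast
 moreover have sub: "submodule (col s) R (self_module R)" if "s \<in> carrier R" for s
  unfolding col_def using assms that by (intro colon_submod) auto
 ultimately have "\<exists>N\<in>?F. \<forall>K\<in>?F. N \<subseteq> K --> K = N"
  by (intro Self.noeth_max noeth_self assms) auto
 then obtain N where N: "N \<in> ?F" "\<forall>K\<in>?F. N \<subseteq> K --> K = N" by (rule bexE)
 then obtain s where s: "s \<in> carrier R" "s \<odot>\<^sub>M w \<notin> K" "N = col s" by auto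
 have max: "col t = col s" if "t \<in> carrier R" "t \<odot>\<^sub>M w \<notin> K" "col s \<subseteq> col t" for t
  using N(2) that s(3) by auto
 have "primeideal (col s) R"
 proof (rule primeidealI)
  show "ideal (col s) R" using sub[OF s(1)] by (simp add: ideal_iff_submod)
  show "cring R" by (rule is_cring)
  have "\<one> \<notin> col s" using s assms by (simp add: col_def)
  then show "carrier R \<noteq> col s" by auto
  fix a b assume ab: "a \<in> carrier R" "b \<in> carrier R" "a \<otimes> b \<in> col s"
  show "a \<in> col s \<or> b \<in> col s"
  proof (rule disjCI)
   assume "b \<notin> col s"
   then have b: "(b \<otimes> s) \<odot>\<^sub>M w \<notin> K" using ab s assms by (simp add: col_def smult_assoc1)
   have "col s \<subseteq> col (b \<otimes> s)"
   proof
    fix r assume r: "r \<in> col s"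
    then have "b \<odot>\<^sub>M (r \<odot>\<^sub>M (s \<odot>\<^sub>M w)) \<in> K"
     using assms(2) ab by (simp add: col_def submod_smult)
    moreover have "b \<odot>\<^sub>M (r \<odot>\<^sub>M (s \<odot>\<^sub>M w)) = r \<odot>\<^sub>M ((b \<otimes> s) \<odot>\<^sub>M w)"
     using r ab s assms by (simp add: col_def smult_assoc1[symmetric] m_ac)
    ultimately show "r \<in> col (b \<otimes> s)" using r by (simp add: col_def)
   qed
   then have "col (b \<otimes> s) = col s" using max[of "b \<otimes> s"] b ab s by simp
   moreover have "a \<in> col (b \<otimes> s)" using ab s assms by (simp add: col_def smult_assoc1)
   ultimately show "a \<in> col s" by simp
  qed
 qed
 then show ?thesis using s unfolding col_def by blast
qed

text \<open>The submodule P N for N spanned by \<open>A\<close>. It is built from the generators,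
  since \<open>nakayama\<close> removes them one at a time.\<close>

definition prime_mult :: "'a set => 'x set => 'x set" where
 "prime_mult P A = mspan R M {p \<odot>\<^sub>M a | p a. p \<in> P \<and> a \<in> A}"

lemma prime_mult_submod:
 "ideal P R ==> A \<subseteq> carrier M ==> submodule (prime_mult P A) R M"
 unfolding prime_mult_def by (rule mspan_submod) (auto dest: ideal_carrier)

lemma prime_mult_insert:
 assumes "ideal P R" "a \<in> carrier M" "A \<subseteq> carrier M" "x \<in> prime_mult P (insert a A)"
 shows "\<exists>p\<in>P. \<exists>h\<in>prime_mult P A. x = p \<odot>\<^sub>M a \<oplus>\<^sub>M h"
proof -
 let ?Pa = "{p \<odot>\<^sub>M a | p. p \<in> P}"
 have Pa: "submodule ?Pa R M"
 proof (rule submodI)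
  show "\<zero>\<^sub>M \<in> ?Pa" using assms ideal_zero[OF assms(1)] by (auto intro!: exI[of _ \<zero>])
  show "x \<oplus>\<^sub>M y \<in> ?Pa" if "x \<in> ?Pa" "y \<in> ?Pa" for x y
   using that assms(2) ideal_carrier[OF assms(1)] ideal_add[OF assms(1)] by (auto simp: smult_l_distr[symmetric])
  show "s \<odot>\<^sub>M x \<in> ?Pa" if "s \<in> carrier R" "x \<in> ?Pa" for s x
   using that assms(2) ideal_carrier[OF assms(1)] ideal_mult[OF assms(1)] by (auto simp: smult_assoc1[symmetric])
 qed (use assms(2) ideal_carrier[OF assms(1)] in auto)
 have sub: "prime_mult P (insert a A) \<subseteq> {x \<oplus>\<^sub>M y | x y. x \<in> ?Pa \<and> y \<in> prime_mult P A}" (is "_ \<subseteq> ?H")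
  unfolding prime_mult_def[of P "insert a A"]
 proof (rule mspan_min)
  show "submodule ?H R M" by (intro submod_sum Pa prime_mult_submod assms)
  show "{p \<odot>\<^sub>M b | p b. p \<in> P \<and> b \<in> insert a A} \<subseteq> ?H"
  proof clarify
   fix p b assume p: "p \<in> P" and b: "b \<in> insert a A"
   show "\<exists>x y. p \<odot>\<^sub>M b = x \<oplus>\<^sub>M y \<and> x \<in> ?Pa \<and> y \<in> prime_mult P A"
   proof (cases "b = a")
    case True
    then show ?thesis using p assms ideal_carrier[OF assms(1)] submod_zero[OF prime_mult_submod[OF assms(1,3)]]
     by (intro exI[of _ "p \<odot>\<^sub>M a"] exI[of _ "\<zero>\<^sub>M"]) auto
   next
    case False
    then have "p \<odot>\<^sub>M b \<in> prime_mult P A" unfolding prime_mult_def using p b by (intro mspan_self) auto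
    then show ?thesis using p b assms ideal_carrier[OF assms(1)] submod_zero[OF Pa] submod_carrier[OF prime_mult_submod[OF assms(1,3)]]
     by (intro exI[of _ "\<zero>\<^sub>M"] exI[of _ "p \<odot>\<^sub>M b"]) auto
   qed
  qed
 qed
 show ?thesis using sub assms(4) by blast
qed

text \<open>Nakayama's lemma for the localization at \<open>P\<close>, with denominators cleared.\<close>

lemma nakayama:
 assumes "primeideal P R" "finite A" "A \<subseteq> carrier M" "submodule L R M"
  and "\<And>a. a \<in> A ==> \<exists>u\<in>carrier R - P. \<exists>l\<in>L. \<exists>h\<in>prime_mult P A. u \<odot>\<^sub>M a = l \<oplus>\<^sub>M h"
 shows "\<exists>u\<in>carrier R - P. \<forall>x\<in>mspan R M A. u \<odot>\<^sub>M x \<in> L" using assms(2,3,5)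
proof (induction A rule: finite_induct)
 case empty
 have "mspan R M {} \<subseteq> L" using assms(4) by (intro mspan_min) auto
 then show ?case using prime_one[OF assms(1)] submod_carrier[OF assms(4)] by (intro bexI[of _ \<one>]) auto
next
 case (insert a A)
 note P = prime_ideal[OF assms(1)] and Pc = ideal_carrier[OF prime_ideal[OF assms(1)]]
 have aA: "a \<in> carrier M" "A \<subseteq> carrier M" using insert.prems by auto
 note PA = prime_mult_submod[OF P aA(2)]
 note Lc = submod_carrier[OF assms(4)] and PAc = submod_carrier[OF PA]
 \<comment> \<open>The relation \<open>u a = l + p a + h\<close> is solved for \<open>a\<close>: as
   \<open>p\<close> lies in \<open>P\<close>, the new coefficient \<open>u - p\<close> stays outside
   \<open>P\<close>.\<close>
 obtain v l p h where v: "v \<in> carrier R - P" and l: "l \<in> L" and p: "p \<in> P"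
  and h: "h \<in> prime_mult P A" and va: "v \<odot>\<^sub>M a = l \<oplus>\<^sub>M h"
 proof -
  obtain u l x where u: "u \<in> carrier R - P" "l \<in> L" "x \<in> prime_mult P (insert a A)" "u \<odot>\<^sub>M a = l \<oplus>\<^sub>M x"
   using insert.prems(2)[of a] by auto
  then obtain p h where ph: "p \<in> P" "h \<in> prime_mult P A" "x = p \<odot>\<^sub>M a \<oplus>\<^sub>M h"
   using prime_mult_insert[OF P aA] by blast
  have c: "u \<in> carrier R" "l \<in> carrier M" "h \<in> carrier M" "p \<in> carrier R" using u ph Lc PAc Pc by auto
  have "(u \<ominus> p) \<odot>\<^sub>M a = u \<odot>\<^sub>M a \<ominus>\<^sub>M p \<odot>\<^sub>M a" using c aA by algebra
  also have "\<dots> = l \<oplus>\<^sub>M h" unfolding u(4) ph(3) using c aA by algebra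
  finally show thesis using that[of "u \<ominus> p"] prime_minus_notin[OF assms(1) u(1) ph(1)] u ph by blast
 qed
 have "\<exists>u\<in>carrier R - P. \<forall>x\<in>mspan R M A. u \<odot>\<^sub>M x \<in> L"
 proof (rule insert.IH[OF aA(2)])
  fix b assume b: "b \<in> A"
  then obtain u l' x where u: "u \<in> carrier R - P" "l' \<in> L" "x \<in> prime_mult P (insert a A)" "u \<odot>\<^sub>M b = l' \<oplus>\<^sub>M x"
   using insert.prems(2)[of b] by auto
  then obtain q h' where ph: "q \<in> P" "h' \<in> prime_mult P A" "x = q \<odot>\<^sub>M a \<oplus>\<^sub>M h'"
   using prime_mult_insert[OF P aA] by blast
  have c: "u \<in> carrier R" "v \<in> carrier R" "l \<in> carrier M" "l' \<in> carrier M" "h' \<in> carrier M" "h \<in> carrier M" "q \<in> carrier R" "b \<in> carrier M"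
   using u v l h b aA ph Lc PAc Pc by auto
  \<comment> \<open>The relation for \<open>b\<close> is multiplied by \<open>v\<close>, so that the
    value of \<open>v a\<close> can be substituted and \<open>a\<close> disappears from it.\<close>
  have "(v \<otimes> u) \<odot>\<^sub>M b = v \<odot>\<^sub>M (u \<odot>\<^sub>M b)" using c by (simp add: smult_assoc1)
  also have "\<dots> = v \<odot>\<^sub>M l' \<oplus>\<^sub>M (q \<odot>\<^sub>M (v \<odot>\<^sub>M a) \<oplus>\<^sub>M v \<odot>\<^sub>M h')"
   unfolding u(4) ph(3) using c aA by algebra
  also have "\<dots> = (v \<odot>\<^sub>M l' \<oplus>\<^sub>M q \<odot>\<^sub>M l) \<oplus>\<^sub>M (q \<odot>\<^sub>M h \<oplus>\<^sub>M v \<odot>\<^sub>M h')"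
   unfolding va using c by algebra
  finally have e: "(v \<otimes> u) \<odot>\<^sub>M b = (v \<odot>\<^sub>M l' \<oplus>\<^sub>M q \<odot>\<^sub>M l) \<oplus>\<^sub>M (q \<odot>\<^sub>M h \<oplus>\<^sub>M v \<odot>\<^sub>M h')" .
  show "\<exists>u\<in>carrier R - P. \<exists>l\<in>L. \<exists>h\<in>prime_mult P A. u \<odot>\<^sub>M b = l \<oplus>\<^sub>M h"
   using e prime_mult_notin[OF assms(1) v u(1)] c
    submod_add[OF assms(4) submod_smult[OF assms(4) c(2) u(2)] submod_smult[OF assms(4) c(7) l]]
    submod_add[OF PA submod_smult[OF PA c(7) h] submod_smult[OF PA c(2) ph(2)]] by blast
 qed
 then obtain u where u: "u \<in> carrier R - P" "\<And>x. x \<in> mspan R M A ==> u \<odot>\<^sub>M x \<in> L" by blast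
 have uc: "u \<in> carrier R" "v \<in> carrier R" using u v by auto
 have "prime_mult P A \<subseteq> mspan R M A" unfolding prime_mult_def
  by (intro mspan_min mspan_submod aA) (auto intro!: submod_smult[OF mspan_submod[OF aA(2)]] Pc simp: mspan_incl[THEN subsetD])
 then have uh: "u \<odot>\<^sub>M h \<in> L" using u h by blast
 have "mspan R M (insert a A) \<subseteq> {x \<in> carrier M. (u \<otimes> v) \<odot>\<^sub>M x \<in> L}"
 proof (rule mspan_min)
  show "submodule {x \<in> carrier M. (u \<otimes> v) \<odot>\<^sub>M x \<in> L} R M" using uc by (intro submod_vimage_smult assms) auto
  have "(u \<otimes> v) \<odot>\<^sub>M a = u \<odot>\<^sub>M l \<oplus>\<^sub>M u \<odot>\<^sub>M h"
   using uc aA va l h Lc PAc by (simp add: smult_assoc1 smult_r_distr)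
  then have "(u \<otimes> v) \<odot>\<^sub>M a \<in> L" using submod_add[OF assms(4) submod_smult[OF assms(4) uc(1) l] uh] by simp
  moreover have "(u \<otimes> v) \<odot>\<^sub>M b \<in> L" if b: "b \<in> A" for b
  proof -
   have "u \<odot>\<^sub>M b \<in> L" using u(2) b mspan_incl by blast
   then have "v \<odot>\<^sub>M (u \<odot>\<^sub>M b) \<in> L" using submod_smult[OF assms(4) uc(2)] by blast
   moreover have "v \<odot>\<^sub>M (u \<odot>\<^sub>M b) = (u \<otimes> v) \<odot>\<^sub>M b"
    using uc b aA by (auto simp: smult_assoc1[symmetric] m_comm)
   ultimately show ?thesis by simp
  qed
  ultimately show "insert a A \<subseteq> {x \<in> carrier M. (u \<otimes> v) \<odot>\<^sub>M x \<in> L}" using insert.prems(1) by auto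
 qed
 then show ?case using prime_mult_notin[OF assms(1) u(1) v] by blast
qed

text \<open>Serves the recurring situation that \<open>K\<close> lies in \<open>L + x K\<close> up
  to denominators because a factor \<open>x\<close> could be divided out; the finite generating set
  stays hidden.\<close>

lemma nakayama_single:
 assumes "primeideal P R" "fg_sub R M K" "submodule L R M" "x \<in> P"
  and "\<And>k. k \<in> K ==> \<exists>u\<in>carrier R - P. \<exists>l\<in>L. \<exists>k'\<in>K. u \<odot>\<^sub>M k = l \<oplus>\<^sub>M x \<odot>\<^sub>M k'"
 shows "\<exists>u\<in>carrier R - P. \<forall>k\<in>K. u \<odot>\<^sub>M k \<in> L"
proof -
 obtain A where A: "finite A" "A \<subseteq> carrier M" "K = mspan R M A" using assms(2) unfolding fg_sub_def by blast
 note P = prime_ideal[OF assms(1)]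
 have x: "x \<in> carrier R" using ideal_carrier[OF P assms(4)] .
 have "K \<subseteq> {k \<in> carrier M. x \<odot>\<^sub>M k \<in> prime_mult P A}" unfolding A(3)
  by (intro mspan_min submod_vimage_smult prime_mult_submod P A x)
   (use A assms(4) in \<open>auto simp: prime_mult_def intro!: mspan_incl[THEN subsetD]\<close>)
 moreover have "A \<subseteq> K" using A(3) mspan_incl by blast
 ultimately show ?thesis unfolding A(3) using assms(5) by (intro nakayama[OF assms(1) A(1,2) assms(3)]) (use A(3) in blast)
qed

end

section \<open>Krull's principal ideal theorem and regular local rings\<close>

text \<open>The ideals closed in this sense are the contractions of ideals of the localization at
  \<open>P\<close>, and \<open>saturation\<close> is extension followed by contraction. They stand
  in for the ideals of the local ring.\<close>

definition sat_closed :: "('a, 'r) ring_scheme => 'a set => 'a set => bool" where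
 "sat_closed R P J \<longleftrightarrow> (\<forall>a\<in>carrier R. \<forall>u\<in>carrier R - P. u \<otimes>\<^bsub>R\<^esub> a \<in> J --> a \<in> J)"

definition saturation :: "('a, 'r) ring_scheme => 'a set => 'a set => 'a set" where
 "saturation R P J = {a \<in> carrier R. \<exists>u\<in>carrier R - P. u \<otimes>\<^bsub>R\<^esub> a \<in> J}"

context cring
begin

lemma saturation_ideal:
 assumes P: "primeideal P R" and J: "ideal J R"
 shows "ideal (saturation R P J) R"
proof (rule idealI_simple)
 show "saturation R P J \<subseteq> carrier R" by (auto simp: saturation_def)
 show "\<zero> \<in> saturation R P J" using prime_one[OF P] ideal_zero[OF J] by (auto simp: saturation_def intro!: bexI[of _ \<one>])
 show "a \<oplus> b \<in> saturation R P J" if ab: "a \<in> saturation R P J" "b \<in> saturation R P J" for a b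
 proof -
  obtain u v where uv: "u \<in> carrier R - P" "v \<in> carrier R - P" "u \<otimes> a \<in> J" "v \<otimes> b \<in> J"
   and c: "a \<in> carrier R" "b \<in> carrier R" using ab by (auto simp: saturation_def)
  have "(u \<otimes> v) \<otimes> (a \<oplus> b) = v \<otimes> (u \<otimes> a) \<oplus> u \<otimes> (v \<otimes> b)"
   using uv(1,2) c by (simp add: r_distr m_ac)
  also have "\<dots> \<in> J" using uv by (simp add: ideal_add[OF J] ideal_mult[OF J])
  finally show ?thesis using prime_mult_notin[OF P uv(1,2)] c by (auto simp: saturation_def)
 qed
 show "s \<otimes> a \<in> saturation R P J" if s: "s \<in> carrier R" "a \<in> saturation R P J" for s a
 proof -
  obtain u where u: "u \<in> carrier R - P" "u \<otimes> a \<in> J" and c: "a \<in> carrier R" using s by (auto simp: saturation_def)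
  have "u \<otimes> (s \<otimes> a) = s \<otimes> (u \<otimes> a)" using u(1) c s by (simp add: m_ac)
  also have "\<dots> \<in> J" using u s by (simp add: ideal_mult[OF J])
  finally show ?thesis using u(1) c s by (auto simp: saturation_def)
 qed
qed

lemma saturation_closed:
 assumes P: "primeideal P R"
 shows "sat_closed R P (saturation R P J)" unfolding sat_closed_def
proof (intro ballI impI)
 fix a u assume a: "a \<in> carrier R" and u: "u \<in> carrier R - P" and "u \<otimes> a \<in> saturation R P J"
 then obtain v where v: "v \<in> carrier R - P" "v \<otimes> (u \<otimes> a) \<in> J" by (auto simp: saturation_def)
 then have "(v \<otimes> u) \<otimes> a \<in> J" using a u by (simp add: m_assoc)
 then show "a \<in> saturation R P J" using prime_mult_notin[OF P v(1) u] a by (auto simp: saturation_def)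
qed

lemma saturation_incl: "primeideal P R ==> J \<subseteq> carrier R ==> J \<subseteq> saturation R P J"
 using prime_one by (auto simp: saturation_def intro!: bexI[of _ \<one>])

lemma saturation_min:
 "sat_closed R P K ==> J \<subseteq> K ==> saturation R P J \<subseteq> K"
 by (auto simp: saturation_def sat_closed_def)

lemma sat_closedD: "sat_closed R P J ==> u \<in> carrier R - P ==> a \<in> carrier R ==> u \<otimes> a \<in> J ==> a \<in> J"
 by (auto simp: sat_closed_def)

lemma ideal_plus_principal:
 assumes J: "ideal J R" and s: "s \<in> carrier R"
 shows "ideal {n \<oplus> r \<otimes> s | n r. n \<in> J \<and> r \<in> carrier R} R" (is "ideal ?K R")
proof (rule idealI_simple)
 note Jc = ideal_carrier[OF J]
 show "?K \<subseteq> carrier R" using Jc s by auto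
 show "\<zero> \<in> ?K" using ideal_zero[OF J] s by (auto intro!: exI[of _ \<zero>])
 show "a \<oplus> b \<in> ?K" if ab: "a \<in> ?K" "b \<in> ?K" for a b
 proof -
  obtain n r n' r' where c: "n \<in> J" "r \<in> carrier R" "n' \<in> J" "r' \<in> carrier R"
   and e: "a = n \<oplus> r \<otimes> s" "b = n' \<oplus> r' \<otimes> s" using ab by auto
  have "a \<oplus> b = (n \<oplus> n') \<oplus> (r \<oplus> r') \<otimes> s" using c Jc s by (simp add: e l_distr a_ac)
  then show ?thesis using c ideal_add[OF J] by blast
 qed
 show "t \<otimes> a \<in> ?K" if ta: "t \<in> carrier R" "a \<in> ?K" for t a
 proof -
  obtain n r where c: "n \<in> J" "r \<in> carrier R" and e: "a = n \<oplus> r \<otimes> s" using ta by auto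
  have "t \<otimes> a = t \<otimes> n \<oplus> (t \<otimes> r) \<otimes> s" using c Jc s ta(1) by (simp add: e r_distr m_ac)
  then show ?thesis using c ta(1) ideal_mult[OF J] by blast
 qed
qed

text \<open>The ring \<open>R\<^sub>P / I R\<^sub>P\<close> is Artinian if \<open>P\<close> is minimal over \<open>I\<close>: the ideals \<open>N\<close> for which
 the chain becomes stationary after intersection with \<open>N\<close> have a maximal member, which must be the
 unit ideal, since a proper one can be enlarged by an element \<open>s\<close> with \<open>P s \<subseteq> N\<close>.\<close>

lemma artinian_chain:
 assumes noeth: "noetherian_ring R" and P: "primeideal P R" and I: "ideal I R"
  and min: "\<And>Q. primeideal Q R ==> I \<subseteq> Q ==> Q \<subseteq> P ==> Q = P"
  and W: "\<And>i. ideal (W i) R" "\<And>i::nat. I \<subseteq> W i" "\<And>i. W (Suc i) \<subseteq> W i" "\<And>i. sat_closed R P (W i)"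
 shows "\<exists>k. W (Suc k) = W k"
proof -
 have anti: "W j \<subseteq> W i" if "i \<le> j" for i j using lift_Suc_antimono_le[of W, OF W(3) that] .
 have Wc: "W i \<subseteq> carrier R" for i using ideal_carrier[OF W(1)] by blast
 define stat where "stat N \<longleftrightarrow> (\<exists>k. \<forall>i\<ge>k. W i \<inter> N = W k \<inter> N)" for N
 define F where "F = {N. ideal N R \<and> I \<subseteq> N \<and> sat_closed R P N \<and> stat N}"
 have Ic: "I \<subseteq> carrier R" using ideal_carrier[OF I] by blast
 have "saturation R P I \<in> F"
 proof -
  have "saturation R P I \<subseteq> W i" for i by (rule saturation_min[OF W(4,2)])
  then have "stat (saturation R P I)" unfolding stat_def by (intro exI[of _ 0]) blast
  then show ?thesis using saturation_ideal[OF P I] saturation_closed[OF P] saturation_incl[OF P Ic] by (simp add: F_def)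
 qed
 then have "F \<noteq> {}" by blast
 then have "\<exists>N\<in>F. \<forall>K\<in>F. N \<subseteq> K --> K = N"
  by (intro Self.noeth_max noeth_self noeth) (auto simp: F_def ideal_iff_submod[symmetric])
 then obtain N where NF: "N \<in> F" and max: "\<forall>K\<in>F. N \<subseteq> K --> K = N" by (rule bexE)
 have N: "ideal N R" "I \<subseteq> N" "sat_closed R P N" "stat N" using NF by (auto simp: F_def)
 note Nc = ideal_carrier[OF N(1)]
 have "\<one> \<in> N"
 proof (rule ccontr)
  assume one: "\<one> \<notin> N"
  obtain s where s: "s \<in> carrier R" "s \<notin> N" and Q: "primeideal {r \<in> carrier R. r \<otimes> s \<in> N} R"
   using Self.assoc_prime_ex[OF noeth, of N \<one>] one N(1) by (auto simp: ideal_iff_submod)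
  let ?Q = "{r \<in> carrier R. r \<otimes> s \<in> N}"
  have "N \<subseteq> ?Q" using Nc s ideal_mult[OF N(1) s(1)] by (auto simp: m_comm)
  moreover have "?Q \<subseteq> P" using sat_closedD[OF N(3) _ s(1)] s(2) by blast
  ultimately have "?Q = P" using min[OF Q] N(2) by blast
  then have Ps: "p \<otimes> s \<in> N" if "p \<in> P" for p using that by blast
  define K where "K = {n \<oplus> r \<otimes> s | n r. n \<in> N \<and> r \<in> carrier R}"
  have K: "ideal K R" unfolding K_def by (rule ideal_plus_principal[OF N(1) s(1)])
  have Kc: "K \<subseteq> carrier R" using ideal_carrier[OF K] by blast
  define N' where "N' = saturation R P K"
  have N': "ideal N' R" "sat_closed R P N'" "K \<subseteq> N'"
   unfolding N'_def using saturation_ideal[OF P K] saturation_closed[OF P] saturation_incl[OF P Kc] by auto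
  have NK: "N \<subseteq> K"
  proof
   fix n assume n: "n \<in> N"
   then have "n = n \<oplus> \<zero> \<otimes> s" using Nc s by simp
   then show "n \<in> K" unfolding K_def using n by blast
  qed
  have "s = \<zero> \<oplus> \<one> \<otimes> s" using s by simp
  then have sK: "s \<in> K" unfolding K_def using ideal_zero[OF N(1)] one_closed by blast
  have "stat N'"
  proof -
   obtain k where k: "\<And>i. i \<ge> k ==> W i \<inter> N = W k \<inter> N" using N(4) by (auto simp: stat_def)
   \<comment> \<open>After localization at \<open>P\<close>, N'/N is a one-dimensional vector space
     over the residue field, because \<open>P s\<close> lies in \<open>N\<close>. So the image of
     the chain in it is zero from some index on, or it is everything for all indices.\<close>
   show ?thesis
   proof (cases "\<exists>j. W j \<inter> N' \<subseteq> N")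
    case True
    then obtain j where j: "W j \<inter> N' \<subseteq> N" by blast
    have "W i \<inter> N' = W k \<inter> N" if "i \<ge> max j k" for i
    proof -
     have "W i \<subseteq> W j" using anti that by simp
     then have "W i \<inter> N' \<subseteq> N" using j by blast
     then have "W i \<inter> N' = W i \<inter> N" using NK N'(3) by blast
     then show ?thesis using k[of i] that by simp
    qed
    then show ?thesis unfolding stat_def by (intro exI[of _ "max j k"]) simp
   next
    case False
    have "W k \<inter> N' \<subseteq> W i" if ik: "i \<ge> k" for i
    proof
     fix w assume w: "w \<in> W k \<inter> N'"
     then have wc: "w \<in> carrier R" using Wc by blast
     obtain v where v: "v \<in> W i" "v \<in> N'" "v \<notin> N" using False by blast
     have vc: "v \<in> carrier R" using v Wc by blast
     obtain u n r where u: "u \<in> carrier R - P" "n \<in> N" "r \<in> carrier R" "u \<otimes> v = n \<oplus> r \<otimes> s"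
      using v(2) unfolding N'_def saturation_def K_def by auto
     obtain u' n' r' where u': "u' \<in> carrier R - P" "n' \<in> N" "r' \<in> carrier R" "u' \<otimes> w = n' \<oplus> r' \<otimes> s"
      using w unfolding N'_def saturation_def K_def by auto
     \<comment> \<open>A coefficient \<open>r\<close> in \<open>P\<close> would put
       \<open>r s\<close>, hence \<open>u v\<close>, hence \<open>v\<close> into
       \<open>N\<close>.\<close>
     have r: "r \<in> carrier R - P"
     proof (rule ccontr)
      assume "r \<notin> carrier R - P"
      then have "r \<in> P" using u(3) by blast
      then have "u \<otimes> v \<in> N" unfolding u(4) using u(2) Ps ideal_add[OF N(1)] by blast
      then show False using sat_closedD[OF N(3) u(1) vc] v(3) by blast
     qed
     have c: "u \<in> carrier R" "u' \<in> carrier R" "n \<in> carrier R" "n' \<in> carrier R" using u u' Nc by auto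
     \<comment> \<open>Cross multiplication cancels \<open>s\<close>, so \<open>y\<close> lies in
       \<open>N\<close>, where the chain is already stationary; from \<open>y\<close> and
       \<open>v\<close> in \<open>W i\<close> one gets back \<open>w\<close>.\<close>
     define y where "y = r \<otimes> (u' \<otimes> w) \<ominus> r' \<otimes> (u \<otimes> v)"
     have "y = r \<otimes> n' \<ominus> r' \<otimes> n" unfolding y_def u(4) u'(4) using c s u(3) u'(3) by algebra
     then have yN: "y \<in> N" using ideal_minus[OF N(1)] ideal_mult[OF N(1)] u u' by simp
     have "v \<in> W k" using v(1) anti[OF ik] by blast
     then have "y \<in> W k" unfolding y_def using w u(3) u'(3) c by (intro ideal_minus[OF W(1)] ideal_mult[OF W(1)]) auto
     then have yW: "y \<in> W i" using yN k[OF ik] by blast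
     have "y \<oplus> r' \<otimes> (u \<otimes> v) \<in> W i"
      using yW v(1) u'(3) c by (intro ideal_add[OF W(1)] ideal_mult[OF W(1)]) auto
     moreover have "y \<oplus> r' \<otimes> (u \<otimes> v) = (r \<otimes> u') \<otimes> w"
      unfolding y_def using c wc vc u(3) u'(3) by algebra
     ultimately show "w \<in> W i" using sat_closedD[OF W(4) prime_mult_notin[OF P r u'(1)] wc] by simp
    qed
    then have "W i \<inter> N' = W k \<inter> N'" if "i \<ge> k" for i using that anti[OF that] by blast
    then show ?thesis unfolding stat_def by blast
   qed
  qed
  then have "N' \<in> F" using N' NK N(2) by (auto simp: F_def)
  moreover have "N \<subseteq> N'" using NK N'(3) by blast
  ultimately have "N' = N" using max by blast
  then show False using sK N'(3) s(2) by blast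
 qed
 then have "N = carrier R" by (rule ideal.one_imp_carrier[OF N(1)])
 then obtain k where k: "\<And>i. i \<ge> k ==> W i \<inter> carrier R = W k \<inter> carrier R"
  using N(4) unfolding stat_def by blast
 have "W (Suc k) = W k" using k[of "Suc k"] Int_absorb2[OF Wc] by simp
 then show ?thesis ..
qed

lemma nat_pow_notin_prime:
 assumes "primeideal P R" "y \<in> carrier R - P"
 shows "y [^] (i::nat) \<in> carrier R - P"
proof (induction i)
 case 0
 then show ?case using prime_one[OF assms(1)] by simp
next
 case (Suc i)
 then show ?case using prime_mult_notin[OF assms(1) Suc assms(2)] by simp
qed

text \<open>If there is no such prime, then \<open>P\<close> is minimal over
  \<open>Q0 + (x)\<close>, and \<open>artinian_chain\<close> applies. The ideals
  \<open>Q0 + (y^i)\<close>, contracted from the localization at \<open>Q1\<close>, play the part of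
  symbolic powers: they stabilise modulo \<open>x\<close>, then by Nakayama at \<open>P\<close>, and
  this is impossible for \<open>y\<close> in \<open>Q1\<close> outside \<open>Q0\<close>.\<close>

lemma principal_ideal_theorem:
 assumes noeth: "noetherian_ring R" and Q0: "primeideal Q0 R" and Q1: "primeideal Q1 R" and P: "primeideal P R"
  and sub: "Q0 \<subset> Q1" "Q1 \<subset> P" and x: "x \<in> P"
 shows "\<exists>Q. primeideal Q R \<and> Q0 \<subset> Q \<and> Q \<subset> P \<and> x \<in> Q"
proof (rule ccontr)
 assume neg: "\<not> ?thesis"
 note i0 = prime_ideal[OF Q0] and i1 = prime_ideal[OF Q1] and iP = prime_ideal[OF P]
 have xQ1: "x \<notin> Q1" using neg Q1 sub by blast
 have xc: "x \<in> carrier R" using ideal_carrier[OF iP x] .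
 define I where "I = {n \<oplus> r \<otimes> x | n r. n \<in> Q0 \<and> r \<in> carrier R}"
 have I: "ideal I R" unfolding I_def by (rule ideal_plus_principal[OF i0 xc])
 have min: "Q = P" if Q: "primeideal Q R" "I \<subseteq> Q" "Q \<subseteq> P" for Q
 proof (rule ccontr)
  assume "Q \<noteq> P"
  have "x = \<zero> \<oplus> \<one> \<otimes> x" using xc by simp
  then have "x \<in> I" unfolding I_def using ideal_zero[OF i0] one_closed by blast
  moreover have "Q0 \<subseteq> I"
  proof
   fix n assume n: "n \<in> Q0"
   then have "n = n \<oplus> \<zero> \<otimes> x" using ideal_carrier[OF i0] xc by simp
   then show "n \<in> I" unfolding I_def using n by blast
  qed
  ultimately have "Q0 \<subset> Q" "x \<in> Q" using Q(2) xQ1 sub by blast+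
  then show False using neg Q(1,3) \<open>Q \<noteq> P\<close> by blast
 qed
 obtain y where y: "y \<in> Q1" "y \<notin> Q0" using sub by blast
 have yc: "y \<in> carrier R" using ideal_carrier[OF i1 y(1)] .
 define B where "B i = {n \<oplus> r \<otimes> y [^] i | n r. n \<in> Q0 \<and> r \<in> carrier R}" for i :: nat
 have B: "ideal (B i) R" for i unfolding B_def by (rule ideal_plus_principal[OF i0]) (use yc in simp)
 \<comment> \<open>Saturating at \<open>Q1\<close> allows division by \<open>x\<close>, which lies
   in \<open>P\<close> but not in \<open>Q1\<close>.\<close>
 define J where "J i = saturation R Q1 (B i)" for i
 have J: "ideal (J i) R" for i unfolding J_def by (rule saturation_ideal[OF Q1 B])
 have Jsat: "sat_closed R Q1 (J i)" for i unfolding J_def by (rule saturation_closed[OF Q1])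
 have Bc: "B i \<subseteq> carrier R" for i using ideal_carrier[OF B] by blast
 have BJ: "B i \<subseteq> J i" for i unfolding J_def by (rule saturation_incl[OF Q1 Bc])
 have Q0B: "Q0 \<subseteq> B i" for i
 proof
  fix n assume n: "n \<in> Q0"
  then have "n = n \<oplus> \<zero> \<otimes> y [^] i" using ideal_carrier[OF i0] yc by simp
  then show "n \<in> B i" unfolding B_def using n by blast
 qed
 have Bdec: "B (Suc i) \<subseteq> B i" for i
 proof
  fix a assume "a \<in> B (Suc i)"
  then obtain n r where nr: "n \<in> Q0" "r \<in> carrier R" "a = n \<oplus> r \<otimes> y [^] Suc i" unfolding B_def by blast
  then have "a = n \<oplus> (r \<otimes> y) \<otimes> y [^] i" using yc by (simp add: m_ac)
  then show "a \<in> B i" unfolding B_def using nr yc by blast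
 qed
 have Jdec: "J (Suc i) \<subseteq> J i" for i unfolding J_def[of "Suc i"] by (rule saturation_min[OF Jsat]) (use Bdec BJ in blast)
 define C where "C i = {n \<oplus> r \<otimes> x | n r. n \<in> J i \<and> r \<in> carrier R}" for i
 have C: "ideal (C i) R" for i unfolding C_def by (rule ideal_plus_principal[OF J xc])
 have Cc: "C i \<subseteq> carrier R" for i using ideal_carrier[OF C] by blast
 define W where "W i = saturation R P (C i)" for i
 have "\<exists>k. W (Suc k) = W k"
 proof (rule artinian_chain[OF noeth P I min])
  show "ideal (W i) R" for i unfolding W_def by (rule saturation_ideal[OF P C])
  show "I \<subseteq> W i" for i
  proof -
   have "I \<subseteq> C i" unfolding I_def C_def using Q0B[of i] BJ[of i] by blast
   then show ?thesis unfolding W_def using saturation_incl[OF P Cc] by blast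
  qed
  show "W (Suc i) \<subseteq> W i" for i
  proof -
   have "C (Suc i) \<subseteq> C i" unfolding C_def using Jdec[of i] by blast
   then show ?thesis unfolding W_def by (auto simp: saturation_def)
  qed
  show "sat_closed R P (W i)" for i unfolding W_def by (rule saturation_closed[OF P])
 qed
 then obtain k where k: "W (Suc k) = W k" ..
 \<comment> \<open>\<open>W k = W (Suc k)\<close> writes \<open>u a\<close> as
   \<open>l + r x\<close> with \<open>l\<close> in \<open>J (Suc k)\<close>. Then \<open>r x\<close>
   lies in \<open>J k\<close>, and \<open>r\<close> does too because \<open>x\<close> is a
   denominator at \<open>Q1\<close>. This gives J k = J (k + 1) + x J k at \<open>P\<close>.\<close>
 have JJ: "\<exists>u\<in>carrier R - P. \<exists>l\<in>J (Suc k). \<exists>a'\<in>J k. u \<otimes> a = l \<oplus> x \<otimes> a'" if a: "a \<in> J k" for a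
 proof -
  have ac: "a \<in> carrier R" using ideal_carrier[OF J a] .
  have "a = a \<oplus> \<zero> \<otimes> x" using ac xc by simp
  then have "a \<in> C k" unfolding C_def using a by blast
  then have "a \<in> W (Suc k)" using k saturation_incl[OF P Cc] unfolding W_def by blast
  then obtain u l r where u: "u \<in> carrier R - P" "l \<in> J (Suc k)" "r \<in> carrier R" "u \<otimes> a = l \<oplus> r \<otimes> x"
   unfolding W_def saturation_def C_def by auto
  have lc: "l \<in> carrier R" "u \<in> carrier R" using ideal_carrier[OF J u(2)] u(1) by auto
  have "l \<in> J k" using u(2) Jdec by blast
  then have "u \<otimes> a \<ominus> l \<in> J k" using a lc by (intro ideal_minus[OF J] ideal_mult[OF J])
  moreover have "u \<otimes> a \<ominus> l = x \<otimes> r" unfolding u(4) using lc xc u(3) by algebra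
  ultimately have "r \<in> J k" using sat_closedD[OF Jsat[of k] _ u(3), of x] xc xQ1 by simp
  moreover have "u \<otimes> a = l \<oplus> x \<otimes> r" unfolding u(4) using xc u(3) by (simp add: m_comm)
  ultimately show ?thesis using u(1,2) by blast
 qed
 have "\<exists>u\<in>carrier R - P. \<forall>a\<in>J k. u \<odot>\<^bsub>self_module R\<^esub> a \<in> J (Suc k)"
 proof (rule Self.nakayama_single[OF P])
  show "fg_sub R (self_module R) (J k)" using noeth_self[OF noeth] J unfolding noeth_mod_def by (simp add: ideal_iff_submod)
  show "submodule (J (Suc k)) R (self_module R)" using J by (simp add: ideal_iff_submod)
 qed (use JJ x in auto)
 then obtain u where u: "u \<in> carrier R - P" "\<And>a. a \<in> J k ==> u \<otimes> a \<in> J (Suc k)" by auto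
 have pc: "y [^] k \<in> carrier R" using yc by simp
 have "y [^] k = \<zero> \<oplus> \<one> \<otimes> y [^] k" using pc by simp
 then have "y [^] k \<in> B k" unfolding B_def using ideal_zero[OF i0] one_closed by blast
 then have "u \<otimes> y [^] k \<in> J (Suc k)" using u(2) BJ by blast
 then obtain s n r where s: "s \<in> carrier R - Q1" "n \<in> Q0" "r \<in> carrier R"
  and e: "s \<otimes> (u \<otimes> y [^] k) = n \<oplus> r \<otimes> y [^] Suc k" unfolding J_def saturation_def B_def by auto
 have uc: "u \<in> carrier R - Q1" "u \<in> carrier R" "s \<in> carrier R" using u(1) sub s(1) by auto
 have nc: "n \<in> carrier R" using ideal_carrier[OF i0 s(2)] .
 \<comment> \<open>As \<open>y^k\<close> is not in \<open>Q0\<close>, the other factor is, so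
   \<open>s u\<close> would lie in \<open>Q1\<close> although \<open>s\<close> and \<open>u\<close>
   do not.\<close>
 have "y [^] k \<otimes> (s \<otimes> u \<ominus> r \<otimes> y) = s \<otimes> (u \<otimes> y [^] k) \<ominus> r \<otimes> (y [^] k \<otimes> y)"
  using uc(2,3) pc yc s(3) by algebra
 also have "\<dots> = n" unfolding e using nc s(3) pc yc by (simp, algebra)
 finally have "y [^] k \<otimes> (s \<otimes> u \<ominus> r \<otimes> y) \<in> Q0" using s(2) by simp
 then have "s \<otimes> u \<ominus> r \<otimes> y \<in> Q0"
  using primeideal.I_prime[OF Q0 pc] nat_pow_notin_prime[OF Q0, of y k] yc y(2) uc s(3) by auto
 then have "s \<otimes> u \<ominus> r \<otimes> y \<oplus> r \<otimes> y \<in> Q1"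
  using sub s(3) y(1) by (intro ideal_add[OF i1] ideal_mult[OF i1]) auto
 moreover have "s \<otimes> u \<ominus> r \<otimes> y \<oplus> r \<otimes> y = s \<otimes> u" using uc(2,3) s(3) yc by algebra
 ultimately show False using prime_mult_notin[OF Q1 s(1) uc(1)] by simp
qed

section \<open>Chains of primes and regular systems of parameters\<close>

definition prime_chain :: "nat => (nat => 'a set) => bool" where
 "prime_chain k p \<longleftrightarrow> (\<forall>i\<le>k. primeideal (p i) R) \<and> (\<forall>i<k. p i \<subset> p (Suc i))"

lemma prime_chain_tail: "prime_chain (Suc k) p ==> prime_chain k (\<lambda>i. p (Suc i))" by (simp add: prime_chain_def)

lemma prime_chain_snoc:
 assumes "prime_chain k p" "primeideal Q R" "p k \<subset> Q"
 shows "prime_chain (Suc k) (p(Suc k := Q))"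
 using assms by (auto simp: prime_chain_def le_Suc_eq less_Suc_eq)

text \<open>\<open>x\<close> is pushed down the chain from its top, one prime at a time, each time
  by the principal ideal theorem. The two ends stay fixed, and only the lowest prime may fail to
  contain \<open>x\<close>.\<close>

lemma prime_chain_modify:
 assumes "noetherian_ring R" "prime_chain (Suc k) p" "x \<in> p (Suc k)"
 shows "\<exists>q. prime_chain (Suc k) q \<and> q 0 = p 0 \<and> q (Suc k) = p (Suc k) \<and> x \<in> q 1" using assms(2,3)
proof (induction k arbitrary: p)
 case 0
 then show ?case by (intro exI[of _ p]) auto
next
 case (Suc k)
 then have "\<exists>Q. primeideal Q R \<and> p k \<subset> Q \<and> Q \<subset> p (Suc (Suc k)) \<and> x \<in> Q"
  by (intro principal_ideal_theorem[OF assms(1), of "p k" "p (Suc k)"]) (auto simp: prime_chain_def)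
 then obtain Q where Q: "primeideal Q R" "p k \<subset> Q" "Q \<subset> p (Suc (Suc k))" "x \<in> Q" by blast
 define p' where "p' = p(Suc k := Q)"
 have p': "p' 0 = p 0" "p' (Suc k) = Q" by (auto simp: p'_def)
 have "prime_chain (Suc k) p'" unfolding p'_def using Suc.prems(1) Q by (intro prime_chain_snoc) (auto simp: prime_chain_def)
 then have "\<exists>q. prime_chain (Suc k) q \<and> q 0 = p' 0 \<and> q (Suc k) = p' (Suc k) \<and> x \<in> q 1"
  by (rule Suc.IH) (simp add: p' Q)
 then obtain q where q: "prime_chain (Suc k) q" "q 0 = p 0" "q (Suc k) = Q" "x \<in> q 1" unfolding p' by blast
 have "prime_chain (Suc (Suc k)) (q(Suc (Suc k) := p (Suc (Suc k))))"
  using q(1,3) Q(3) Suc.prems(1) by (intro prime_chain_snoc) (auto simp: prime_chain_def)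
 then show ?case using q by (intro exI[of _ "q(Suc (Suc k) := p (Suc (Suc k)))"] conjI) (assumption | simp)+
qed

primrec gen_ideal :: "(nat => 'a) => nat => 'a set" where
 "gen_ideal x 0 = {\<zero>}"
| "gen_ideal x (Suc j) = {n \<oplus> r \<otimes> x j | n r. n \<in> gen_ideal x j \<and> r \<in> carrier R}"

text \<open>Regularity in the weak sense: the nonzerodivisor conditions on the successive
  quotients.\<close>

definition regular_seq :: "nat => (nat => 'a) => bool" where
 "regular_seq n x \<longleftrightarrow>
   (\<forall>j<n. x j \<in> carrier R \<and> (\<forall>a\<in>carrier R. x j \<otimes> a \<in> gen_ideal x j --> a \<in> gen_ideal x j))"

lemma gen_ideal_ideal: "(\<And>i. i < j ==> x i \<in> carrier R) ==> ideal (gen_ideal x j) R"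
 by (induction j) (auto simp: zeroideal intro!: ideal_plus_principal)

lemma gen_ideal_Suc_incl:
 assumes "\<And>i. i \<le> j ==> x i \<in> carrier R"
 shows "gen_ideal x j \<subseteq> gen_ideal x (Suc j)" "x j \<in> gen_ideal x (Suc j)"
proof -
 have I: "ideal (gen_ideal x j) R" using assms by (intro gen_ideal_ideal) auto
 have xj: "x j \<in> carrier R" using assms by simp
 show "gen_ideal x j \<subseteq> gen_ideal x (Suc j)"
 proof
  fix a assume a: "a \<in> gen_ideal x j"
  then have "a = a \<oplus> \<zero> \<otimes> x j" using ideal_carrier[OF I] xj by simp
  then show "a \<in> gen_ideal x (Suc j)" using a by auto
 qed
 have "x j = \<zero> \<oplus> \<one> \<otimes> x j" using xj by simp
 then show "x j \<in> gen_ideal x (Suc j)" using ideal_zero[OF I] one_closed by auto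
qed

lemma gen_ideal_min:
 assumes "ideal I R" "\<And>i. i < j ==> x i \<in> I"
 shows "gen_ideal x j \<subseteq> I" using assms(2)
 by (induction j) (use ideal_zero[OF assms(1)] ideal_add[OF assms(1)] ideal_mult[OF assms(1)] in auto)

lemma gen_ideal_Suc_min:
 assumes "ideal I R" "gen_ideal x j \<subseteq> I" "x j \<in> I"
 shows "gen_ideal x (Suc j) \<subseteq> I"
proof
 fix a assume "a \<in> gen_ideal x (Suc j)"
 then obtain n r where "n \<in> gen_ideal x j" "r \<in> carrier R" "a = n \<oplus> r \<otimes> x j" by auto
 then show "a \<in> I" using assms(2,3) ideal_add[OF assms(1)] ideal_mult[OF assms(1)] by auto
qed

lemma gen_ideal_elem:
 assumes "\<And>i. i < j ==> x i \<in> carrier R" "i < j"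
 shows "x i \<in> gen_ideal x j" using assms
proof (induction j)
 case (Suc j)
 then show ?case using gen_ideal_Suc_incl[of j x] by (cases "i = j") (auto simp del: gen_ideal.simps)
qed simp

lemma proper_ideal_in_maximal:
 assumes "noetherian_ring R" "ideal I R" "I \<noteq> carrier R"
 shows "\<exists>M. maximalideal M R \<and> I \<subseteq> M"
proof -
 let ?F = "{J. ideal J R \<and> I \<subseteq> J \<and> J \<noteq> carrier R}"
 have "\<exists>N\<in>?F. \<forall>K\<in>?F. N \<subseteq> K --> K = N"
  by (intro Self.noeth_max noeth_self assms) (use assms in \<open>auto simp: ideal_iff_submod[symmetric]\<close>)
 then obtain N where N: "N \<in> ?F" "\<forall>K\<in>?F. N \<subseteq> K --> K = N" by (rule bexE)
 have "maximalideal N R"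
 proof (rule maximalidealI)
  fix J assume J: "ideal J R" "N \<subseteq> J" "J \<subseteq> carrier R"
  show "J = N \<or> J = carrier R"
  proof (rule disjCI)
   assume "J \<noteq> carrier R"
   then have "J \<in> ?F" using J N(1) by auto
   then show "J = N" using N(2) J(2) by blast
  qed
 qed (use N(1) in auto)
 then show ?thesis using N(1) by blast
qed

lemma local_ring_prime: "local_ring R \<mm> ==> primeideal \<mm> R"
 unfolding local_ring_def by (intro maximalideal_prime) simp

lemma local_ring_proper_ideal:
 assumes "local_ring R \<mm>" "ideal I R" "I \<noteq> carrier R"
 shows "I \<subseteq> \<mm>"
 using proper_ideal_in_maximal[OF _ assms(2,3)] assms(1) unfolding local_ring_def by blast

lemma local_ring_unit:
 assumes "local_ring R \<mm>" "u \<in> carrier R - \<mm>"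
 obtains v where "v \<in> carrier R" "v \<otimes> u = \<one>"
proof -
 have u: "u \<in> carrier R" using assms by blast
 have "PIdl u = carrier R"
 proof (rule ccontr)
  assume "PIdl u \<noteq> carrier R"
  then have "PIdl u \<subseteq> \<mm>" using local_ring_proper_ideal[OF assms(1) cgenideal_ideal[OF u]] by blast
  then show False using cgenideal_self[OF u] assms(2) by blast
 qed
 then obtain v where "v \<in> carrier R" "\<one> = v \<otimes> u" using one_closed unfolding cgenideal_def by auto
 then show thesis using that by simp
qed

text \<open>The ideals generated by the initial segments of a minimal system of generators are prime, by
 descending induction: chains of primes above \<open>gen_ideal x j\<close> have length at most \<open>n - j\<close>, with
 equality attained by a chain whose second member contains \<open>x j\<close>.\<close>

lemma regular_seq_of_chain:
 assumes loc: "local_ring R \<mm>" and x: "\<And>i. i < n ==> x i \<in> \<mm>" and gen: "gen_ideal x n = \<mm>"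
  and chain: "prime_chain n p"
 shows "regular_seq n x"
proof -
 have noeth: "noetherian_ring R" using loc by (simp add: local_ring_def)
 note mp = local_ring_prime[OF loc]
 note mi = prime_ideal[OF mp]
 have xc: "x i \<in> carrier R" if "i < n" for i using ideal_carrier[OF mi x[OF that]] .
 have prime_le: "P \<subseteq> \<mm>" if "primeideal P R" for P
  using local_ring_proper_ideal[OF loc prime_ideal[OF that]] primeideal.I_notcarr[OF that] by blast
 have gi: "ideal (gen_ideal x j) R" if "j \<le> n" for j using that xc by (intro gen_ideal_ideal) auto
 \<comment> \<open>The chain is modified so that its second member contains \<open>x j\<close>;
   without its first member it lies above the next ideal. The discarded prime is recorded as
   \<open>Q\<close>, for the proof of primality below.\<close>
 have step: "\<exists>q. prime_chain k q \<and> gen_ideal x (Suc j) \<subseteq> q 0 \<and> q k = \<mm> \<and> (\<exists>Q. primeideal Q R \<and> gen_ideal x j \<subseteq> Q \<and> Q \<subset> q 0)"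
  if j: "j < n" and q: "prime_chain (Suc k) q" "gen_ideal x j \<subseteq> q 0" "q (Suc k) = \<mm>" for j k q
 proof -
  obtain q' where q': "prime_chain (Suc k) q'" "q' 0 = q 0" "q' (Suc k) = \<mm>" "x j \<in> q' 1"
   using prime_chain_modify[OF noeth q(1), of "x j"] x[OF j] q(3) by auto
  have p0: "primeideal (q' 0) R" "q' 0 \<subset> q' 1" "primeideal (q' 1) R" using q'(1) by (auto simp: prime_chain_def)
  have "gen_ideal x (Suc j) \<subseteq> q' 1" using q(2) q'(2,4) p0 by (intro gen_ideal_Suc_min prime_ideal) auto
  then show ?thesis using prime_chain_tail[OF q'(1)] q' q(2) p0 by (intro exI[of _ "\<lambda>i. q' (Suc i)"] conjI exI[of _ "q' 0"]) auto
 qed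
 have up_m: "\<exists>k'\<ge>k. \<exists>q'. prime_chain k' q' \<and> q' 0 = q 0 \<and> q' k' = \<mm>" if q: "prime_chain k q" for k q
 proof (cases "q k = \<mm>")
  case False
  then have "q k \<subset> \<mm>" using prime_le q by (auto simp: prime_chain_def)
  then show ?thesis using prime_chain_snoc[OF q mp] by (intro exI[of _ "Suc k"] conjI exI[of _ "q(Suc k := \<mm>)"]) auto
 qed (use q in blast)
 \<comment> \<open>\<open>step\<close> wants a chain that ends in the maximal ideal, so the chain is
   extended to it first; every generator adjoined then costs one prime.\<close>
 have bound: "k \<le> n - j" if "j \<le> n" "prime_chain k q" "gen_ideal x j \<subseteq> q 0" for j k q using that
 proof (induction "n - j" arbitrary: j k q)
  case 0
  then have *: "\<mm> \<subseteq> q 0" using gen by simp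
  show ?case
  proof (rule ccontr)
   assume "\<not> k \<le> n - j"
   then have "q 0 \<subset> q 1" "primeideal (q 1) R" using 0 by (auto simp: prime_chain_def)
   then show False using prime_le[of "q 1"] * by blast
  qed
 next
  case (Suc d)
  show ?case
  proof (cases k)
   case (Suc k0)
   obtain k' q' where q': "k' \<ge> k" "prime_chain k' q'" "q' 0 = q 0" "q' k' = \<mm>" using up_m[OF Suc.prems(2)] by blast
   then obtain l where l: "k' = Suc l" using Suc by (cases k') auto
   have "j < n" using \<open>Suc d = n - j\<close> by simp
   then obtain r where "prime_chain l r" "gen_ideal x (Suc j) \<subseteq> r 0" using step[of j l q'] q' l Suc.prems(3) by auto
   then have "l \<le> n - Suc j" using Suc.hyps(1)[of "Suc j" l r] Suc.hyps(2) by simp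
   then show ?thesis using l q'(1) \<open>j < n\<close> by simp
  qed simp
 qed
 have exist: "\<exists>q. prime_chain (n - j) q \<and> gen_ideal x j \<subseteq> q 0 \<and> q (n - j) = \<mm>" if "j \<le> n" for j
  using that
 proof (induction j)
  case 0
  obtain k' q' where q': "k' \<ge> n" "prime_chain k' q'" "q' 0 = p 0" "q' k' = \<mm>" using up_m[OF chain] by blast
  have "primeideal (q' 0) R" using q'(2) by (simp add: prime_chain_def)
  then have g: "gen_ideal x 0 \<subseteq> q' 0" using ideal_zero[OF prime_ideal] by auto
  then have "k' = n" using bound[of 0 k' q'] q' by simp
  then show ?case using q' g by (intro exI[of _ q']) simp
 next
  case (Suc j)
  then obtain q where q: "prime_chain (n - j) q" "gen_ideal x j \<subseteq> q 0" "q (n - j) = \<mm>" by auto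
  have "n - j = Suc (n - Suc j)" using Suc.prems by simp
  then show ?case using step[of j "n - Suc j" q] q Suc.prems by auto
 qed
 have prime: "primeideal (gen_ideal x j) R \<and> (j < n --> x j \<notin> gen_ideal x j)" if "j \<le> n" for j using that
 proof (induction "n - j" arbitrary: j)
  case 0
  then show ?case using gen mp by simp
 next
  case (Suc d)
  have jn: "j < n" using Suc.hyps(2) by simp
  have IH: "primeideal (gen_ideal x (Suc j)) R" using Suc.hyps(1)[of "Suc j"] Suc.hyps(2) by simp
  obtain q where q: "prime_chain (n - j) q" "gen_ideal x j \<subseteq> q 0" "q (n - j) = \<mm>" using exist[of j] jn by auto
  have nj: "n - j = Suc (n - Suc j)" using jn by simp
  obtain r Q where r: "prime_chain (n - Suc j) r" "gen_ideal x (Suc j) \<subseteq> r 0"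
   and Q: "primeideal Q R" "gen_ideal x j \<subseteq> Q" "Q \<subset> r 0" using step[of j "n - Suc j" q] q jn nj by auto
  \<comment> \<open>Otherwise \<open>gen_ideal x (Suc j)\<close>, prime by induction, could be put
    below the chain \<open>r\<close>, which already has the maximal length.\<close>
  have r0: "r 0 = gen_ideal x (Suc j)"
  proof (rule ccontr)
   assume "r 0 \<noteq> gen_ideal x (Suc j)"
   then have "gen_ideal x (Suc j) \<subset> r 0" using r(2) by blast
   then have "prime_chain (Suc (n - Suc j)) (\<lambda>i. case i of 0 => gen_ideal x (Suc j) | Suc i => r i)"
    using r(1) IH by (auto simp: prime_chain_def split: nat.split)
   then show False using bound[of "Suc j" "Suc (n - Suc j)"] jn by fastforce
  qed
  have xj: "x j \<in> carrier R" "x j \<in> \<mm>" using xc x jn by auto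
  note iQ = prime_ideal[OF Q(1)]
  have xQ: "x j \<notin> Q"
  proof
   assume "x j \<in> Q"
   then have "gen_ideal x (Suc j) \<subseteq> Q" using Q(2) by (intro gen_ideal_Suc_min iQ)
   then show False using Q(3) r0 by simp
  qed
  \<comment> \<open>An element of \<open>Q\<close> is \<open>l + s x_j\<close> with \<open>l\<close>
    in the smaller ideal, and as \<open>x_j\<close> is not in the prime \<open>Q\<close>, the
    cofactor \<open>s\<close> is in \<open>Q\<close>. So \<open>Q\<close> lies in
    \<open>gen_ideal x j + x_j Q\<close> and Nakayama gives equality.\<close>
  have "\<exists>u\<in>carrier R - \<mm>. \<forall>k\<in>Q. u \<odot>\<^bsub>self_module R\<^esub> k \<in> gen_ideal x j"
  proof (rule Self.nakayama_single[OF mp])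
   show "fg_sub R (self_module R) Q" using noeth_self[OF noeth] iQ unfolding noeth_mod_def by (simp add: ideal_iff_submod)
   show "submodule (gen_ideal x j) R (self_module R)" using gi[of j] jn by (simp add: ideal_iff_submod)
   show "x j \<in> \<mm>" by (rule xj)
   fix k assume k: "k \<in> Q"
   then have kc: "k \<in> carrier R" using ideal_carrier[OF iQ] by blast
   have "k \<in> gen_ideal x (Suc j)" using k Q(3) r0 by blast
   then obtain l s where ls: "l \<in> gen_ideal x j" "s \<in> carrier R" "k = l \<oplus> s \<otimes> x j" by auto
   have lQ: "l \<in> Q" using ls(1) Q(2) by blast
   have lc: "l \<in> carrier R" using ideal_carrier[OF iQ lQ] .
   have "k \<ominus> l \<in> Q" using k lQ by (rule ideal_minus[OF iQ])
   moreover have "k \<ominus> l = s \<otimes> x j" unfolding ls(3) using lc ls(2) xj(1) by algebra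
   ultimately have "s \<in> Q" using primeideal.I_prime[OF Q(1) ls(2) xj(1)] xQ by simp
   then show "\<exists>u\<in>carrier R - \<mm>. \<exists>l\<in>gen_ideal x j. \<exists>k'\<in>Q. u \<odot>\<^bsub>self_module R\<^esub> k = l \<oplus>\<^bsub>self_module R\<^esub> x j \<odot>\<^bsub>self_module R\<^esub> k'"
    using ls kc xj(1) prime_one[OF mp] by (intro bexI[of _ \<one>] bexI[of _ l] bexI[of _ s]) (auto simp: m_comm)
  qed
  then obtain u where u: "u \<in> carrier R - \<mm>" "\<And>k. k \<in> Q ==> u \<otimes> k \<in> gen_ideal x j" by auto
  obtain v where v: "v \<in> carrier R" "v \<otimes> u = \<one>" using local_ring_unit[OF loc u(1)] .
  have "Q \<subseteq> gen_ideal x j"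
  proof
   fix k assume k: "k \<in> Q"
   then have kc: "k \<in> carrier R" using ideal_carrier[OF iQ] by blast
   have "v \<otimes> (u \<otimes> k) \<in> gen_ideal x j" using ideal_mult[OF gi[of j] v(1) u(2)[OF k]] jn by simp
   moreover have "v \<otimes> (u \<otimes> k) = k" using v u(1) kc by (simp add: m_assoc[symmetric])
   ultimately show "k \<in> gen_ideal x j" by simp
  qed
  then have "Q = gen_ideal x j" using Q(2) by blast
  then show ?case using Q(1) xQ by simp
 qed
 show ?thesis unfolding regular_seq_def
 proof (intro allI impI conjI ballI)
  fix j assume j: "j < n"
  then show "x j \<in> carrier R" by (rule xc)
  fix a assume "a \<in> carrier R" "x j \<otimes> a \<in> gen_ideal x j"
  then show "a \<in> gen_ideal x j" using prime[of j] j primeideal.I_prime xc[OF j] by fastforce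
 qed
qed

end

text \<open>A finite supremum of natural numbers is attained; the empty set is excluded because its
  supremum is \<open>- \<infinity>\<close>.\<close>

lemma krull_dim_chain:
 assumes "krull_dim A = ereal (real n)"
 shows "\<exists>p. (\<forall>i\<le>n. primeideal (p i) A) \<and> (\<forall>i<n. p i \<subset> p (Suc i))"
proof -
 let ?X = "{n. \<exists>p. (\<forall>i\<le>n. primeideal (p i) A) \<and> (\<forall>i<n. p i \<subset> p (Suc i))}"
 have le: "k \<le> n" if "k \<in> ?X" for k
 proof -
  have "ereal (real k) \<le> krull_dim A" unfolding krull_dim_def by (rule SUP_upper[OF that])
  then show ?thesis using assms by simp
 qed
 have "?X \<noteq> {}"
 proof
  assume e: "?X = {}"
  have "krull_dim A = - \<infinity>" unfolding krull_dim_def e by (simp add: bot_ereal_def)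
  then show False using assms by simp
 qed
 have fin: "finite ?X" using le by (meson finite_nat_set_iff_bounded_le)
 have "krull_dim A \<le> ereal (real (Max ?X))" unfolding krull_dim_def by (intro SUP_least) (use Max_ge[OF fin] in auto)
 then have "n \<le> Max ?X" using assms by simp
 then have "Max ?X = n" using le[OF Max_in[OF fin \<open>?X \<noteq> {}\<close>]] by simp
 then have "n \<in> ?X" using Max_in[OF fin \<open>?X \<noteq> {}\<close>] by simp
 then show ?thesis by simp
qed

lemma krull_dim_ge:
 assumes "\<forall>i\<le>n. primeideal (p i) A" "\<forall>i<n. p i \<subset> p (Suc i)"
 shows "ereal (real n) \<le> krull_dim A"
 unfolding krull_dim_def using assms by (intro SUP_upper) auto

text \<open>An enumeration of a smallest generating set of the maximal ideal; regularity of the ring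
  provides a chain of primes whose length is the size of that set.\<close>

lemma (in cring) regular_local_regular_seq:
 assumes "regular_local_ring R \<mm>"
 obtains n x where "krull_dim R = ereal (real n)" "regular_seq n x" "\<And>i. i < n ==> x i \<in> \<mm>"
proof -
 have loc: "local_ring R \<mm>" and dim: "krull_dim R = ereal (real (min_generators R \<mm>))"
  using assms by (auto simp: regular_local_ring_def)
 define n where "n = min_generators R \<mm>"
 have noeth: "noetherian_ring R" using loc by (simp add: local_ring_def)
 note mi = prime_ideal[OF local_ring_prime[OF loc]]
 obtain A0 where "A0 \<subseteq> carrier R" "finite A0" "\<mm> = Idl A0" using noetherian_ring.finetely_gen[OF noeth mi] by blast
 then have "\<exists>A. finite A \<and> card A = card A0 \<and> A \<subseteq> carrier R \<and> Idl A = \<mm>" by blast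
 then have "\<exists>A. finite A \<and> card A = n \<and> A \<subseteq> carrier R \<and> Idl A = \<mm>"
  unfolding n_def min_generators_def by (rule LeastI)
 then obtain A where A: "finite A" "card A = n" "A \<subseteq> carrier R" "Idl A = \<mm>" by blast
 obtain x where x: "bij_betw x {0..<n} A" using ex_bij_betw_nat_finite[OF A(1)] A(2) by blast
 have Am: "A \<subseteq> \<mm>" using genideal_self[OF A(3)] A(4) by simp
 have xm: "x i \<in> \<mm>" if "i < n" for i using that x Am by (auto simp: bij_betw_def)
 have xc: "x i \<in> carrier R" if "i < n" for i using ideal_carrier[OF mi xm[OF that]] .
 have "gen_ideal x n = \<mm>"
 proof
  show "gen_ideal x n \<subseteq> \<mm>" by (rule gen_ideal_min[OF mi xm])
  have "A \<subseteq> gen_ideal x n" using gen_ideal_elem[of n x] xc x by (auto simp: bij_betw_def)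
  then show "\<mm> \<subseteq> gen_ideal x n" unfolding A(4)[symmetric] by (intro genideal_minimal gen_ideal_ideal xc)
 qed
 moreover obtain p where "prime_chain n p" using krull_dim_chain[OF dim] by (auto simp: prime_chain_def n_def)
 ultimately have "regular_seq n x" by (intro regular_seq_of_chain[OF loc xm])
 then show thesis using that dim xm unfolding n_def by blast
qed

section \<open>Associated primes of modules with a finite free resolution\<close>

text \<open>Exact everywhere except at position 0. The module resolved is the cokernel of
  \<open>d 0\<close>, which is never formed; statements about it are made modulo the image of
  \<open>d 0\<close>.\<close>

definition exact_free :: "('a, 'r) ring_scheme => (nat => nat) => (nat => (nat => 'a) => nat => 'a) => bool" where
 "exact_free S b d \<longleftrightarrow> (\<forall>i. d i \<in> mod_hom S (free_mod S (b (Suc i))) (free_mod S (b i))) \<and>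
   (\<forall>i. d (Suc i) ` carrier (free_mod S (b (Suc (Suc i)))) = mod_ker (free_mod S (b (Suc i))) (free_mod S (b i)) (d i))"

context lmodule
begin

lemma minus_zero_right: "x \<in> carrier M ==> x \<ominus>\<^sub>M \<zero>\<^sub>M = x" by (simp add: M.minus_eq)

text \<open>For a submodule \<open>N\<close> containing \<open>K\<close> these are the associated
  primes of N/K.\<close>

definition assoc_primes :: "'x set => 'x set => 'a set set" where
 "assoc_primes N K = {P. primeideal P R \<and> (\<exists>z\<in>N - K. P = {r \<in> carrier R. r \<odot>\<^sub>M z \<in> K})}"

lemma submod_plus_cyclic:
 assumes K: "submodule K R M" and w: "w \<in> carrier M"
 shows "submodule {k \<oplus>\<^sub>M r \<odot>\<^sub>M w | k r. k \<in> K \<and> r \<in> carrier R} R M" (is "submodule ?N R M")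
proof (rule submodI)
 note Kc = submod_carrier[OF K]
 show "?N \<subseteq> carrier M" using Kc w by auto
 show "\<zero>\<^sub>M \<in> ?N" using submod_zero[OF K] w by (auto intro!: exI[of _ "\<zero>\<^sub>M"] exI[of _ \<zero>])
 show "a \<oplus>\<^sub>M b \<in> ?N" if ab: "a \<in> ?N" "b \<in> ?N" for a b
 proof -
  obtain n r n' r' where c: "n \<in> K" "r \<in> carrier R" "n' \<in> K" "r' \<in> carrier R"
   and e: "a = n \<oplus>\<^sub>M r \<odot>\<^sub>M w" "b = n' \<oplus>\<^sub>M r' \<odot>\<^sub>M w" using ab by auto
  have "a \<oplus>\<^sub>M b = (n \<oplus>\<^sub>M n') \<oplus>\<^sub>M (r \<oplus> r') \<odot>\<^sub>M w"
   using c Kc w by (simp add: e smult_l_distr M.a_ac)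
  then show ?thesis using c submod_add[OF K] by blast
 qed
 show "t \<odot>\<^sub>M a \<in> ?N" if ta: "t \<in> carrier R" "a \<in> ?N" for t a
 proof -
  obtain n r where c: "n \<in> K" "r \<in> carrier R" and e: "a = n \<oplus>\<^sub>M r \<odot>\<^sub>M w" using ta by auto
  have "t \<odot>\<^sub>M a = t \<odot>\<^sub>M n \<oplus>\<^sub>M (t \<otimes> r) \<odot>\<^sub>M w"
   using c Kc w ta(1) by (simp add: e smult_r_distr smult_assoc1)
  then show ?thesis using c ta(1) submod_smult[OF K] by blast
 qed
qed

text \<open>Noetherian induction from below: enlarging \<open>N\<close> by an element
  \<open>w\<close> whose colon ideal modulo \<open>N\<close> is a prime \<open>P\<close> adds at
  most \<open>P\<close> to the associated primes of N/K.\<close>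

lemma assoc_primes_finite:
 assumes noeth: "noetherian_ring R" "noeth_mod R M" and K: "submodule K R M"
 shows "finite (assoc_primes (carrier M) K)"
proof -
 let ?F = "{N. submodule N R M \<and> K \<subseteq> N \<and> finite (assoc_primes N K)}"
 have "assoc_primes K K = {}" by (auto simp: assoc_primes_def)
 then have "K \<in> ?F" using K by simp
 then have "?F \<noteq> {}" by blast
 then have "\<exists>N\<in>?F. \<forall>L\<in>?F. N \<subseteq> L --> L = N" by (intro noeth_max noeth) auto
 then obtain N where NF: "N \<in> ?F" and max: "\<forall>L\<in>?F. N \<subseteq> L --> L = N" by (rule bexE)
 have N: "submodule N R M" "K \<subseteq> N" "finite (assoc_primes N K)" using NF by auto
 note Nc = submod_carrier[OF N(1)] and Kc = submod_carrier[OF K]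
 have "carrier M \<subseteq> N"
 proof (rule ccontr)
  assume "\<not> carrier M \<subseteq> N"
  then obtain w0 where w0: "w0 \<in> carrier M" "w0 \<notin> N" by blast
  obtain s where s: "s \<in> carrier R" "s \<odot>\<^sub>M w0 \<notin> N"
   and "primeideal {r \<in> carrier R. r \<odot>\<^sub>M (s \<odot>\<^sub>M w0) \<in> N} R"
   using assoc_prime_ex[OF noeth(1) N(1) w0] by blast
  define w where "w = s \<odot>\<^sub>M w0"
  define P where "P = {r \<in> carrier R. r \<odot>\<^sub>M w \<in> N}"
  have w: "w \<in> carrier M" "w \<notin> N" and P: "primeideal P R" using s w0 \<open>primeideal _ R\<close> by (auto simp: w_def P_def)
  define N' where "N' = {k \<oplus>\<^sub>M r \<odot>\<^sub>M w | k r. k \<in> N \<and> r \<in> carrier R}"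
  have N': "submodule N' R M" unfolding N'_def by (rule submod_plus_cyclic[OF N(1) w(1)])
  have NN': "N \<subseteq> N'"
  proof
   fix n assume n: "n \<in> N"
   then have "n = n \<oplus>\<^sub>M \<zero> \<odot>\<^sub>M w" using Nc w by simp
   then show "n \<in> N'" unfolding N'_def using n by blast
  qed
  have "w = \<zero>\<^sub>M \<oplus>\<^sub>M \<one> \<odot>\<^sub>M w" using w by simp
  then have wN': "w \<in> N'" unfolding N'_def using submod_zero[OF N(1)] by blast
  have "assoc_primes N' K \<subseteq> insert P (assoc_primes N K)"
  proof
   fix Q assume "Q \<in> assoc_primes N' K"
   then obtain z where Q: "primeideal Q R" and z: "z \<in> N'" "z \<notin> K"
    and Qz: "Q = {r \<in> carrier R. r \<odot>\<^sub>M z \<in> K}" by (auto simp: assoc_primes_def)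
   have zc: "z \<in> carrier M" using submod_carrier[OF N' z(1)] .
   \<comment> \<open>If some multiple of \<open>z\<close> lies in \<open>N\<close> outside
     \<open>K\<close>, it has the same annihilator \<open>Q\<close> modulo \<open>K\<close>.
     Otherwise the multiples of \<open>z\<close> meet \<open>N\<close> only in \<open>K\<close>, so
     \<open>Q\<close> can be computed modulo \<open>N\<close>, where \<open>z\<close> is a multiple
     of \<open>w\<close>.\<close>
   show "Q \<in> insert P (assoc_primes N K)"
   proof (cases "\<exists>t\<in>carrier R. t \<odot>\<^sub>M z \<in> N - K")
    case True
    then obtain t where t: "t \<in> carrier R" "t \<odot>\<^sub>M z \<in> N - K" by blast
    have tQ: "t \<notin> Q" using t Qz by auto
    have "r \<in> Q \<longleftrightarrow> r \<odot>\<^sub>M (t \<odot>\<^sub>M z) \<in> K" if r: "r \<in> carrier R" for r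
    proof -
     have "r \<odot>\<^sub>M (t \<odot>\<^sub>M z) \<in> K \<longleftrightarrow> r \<otimes> t \<in> Q"
      using r t zc by (simp add: Qz smult_assoc1)
     also have "\<dots> \<longleftrightarrow> r \<in> Q"
      using primeideal.I_prime[OF Q r t(1)] tQ ideal_mult[OF prime_ideal[OF Q] t(1), of r] r t(1) by (auto simp: m_comm)
     finally show ?thesis by simp
    qed
    then have "Q = {r \<in> carrier R. r \<odot>\<^sub>M (t \<odot>\<^sub>M z) \<in> K}"
     using ideal_carrier[OF prime_ideal[OF Q]] by blast
    then show ?thesis using Q t(2) unfolding assoc_primes_def by blast
   next
    case False
    then have tz: "t \<odot>\<^sub>M z \<in> K \<longleftrightarrow> t \<odot>\<^sub>M z \<in> N" if "t \<in> carrier R" for t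
     using that N(2) by blast
    obtain n r where nr: "n \<in> N" "r \<in> carrier R" "z = n \<oplus>\<^sub>M r \<odot>\<^sub>M w"
     using z(1) unfolding N'_def by blast
    have col: "t \<odot>\<^sub>M z \<in> N \<longleftrightarrow> t \<otimes> r \<in> P" if t: "t \<in> carrier R" for t
    proof -
     have nc: "n \<in> carrier M" using Nc nr(1) .
     have tn: "t \<odot>\<^sub>M n \<in> N" using submod_smult[OF N(1) t nr(1)] .
     have e1: "t \<odot>\<^sub>M z = t \<odot>\<^sub>M n \<oplus>\<^sub>M (t \<otimes> r) \<odot>\<^sub>M w"
      using nr nc w t by (simp add: smult_r_distr smult_assoc1)
     have e2: "(t \<otimes> r) \<odot>\<^sub>M w = t \<odot>\<^sub>M z \<ominus>\<^sub>M t \<odot>\<^sub>M n"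
      unfolding e1 using t nc w nr(2) by algebra
     show ?thesis
     proof
      assume "t \<odot>\<^sub>M z \<in> N"
      then have "(t \<otimes> r) \<odot>\<^sub>M w \<in> N" unfolding e2 using tn by (rule submod_minus[OF N(1)])
      then show "t \<otimes> r \<in> P" using t nr(2) by (simp add: P_def)
     next
      assume "t \<otimes> r \<in> P"
      then have "(t \<otimes> r) \<odot>\<^sub>M w \<in> N" by (simp add: P_def)
      then show "t \<odot>\<^sub>M z \<in> N" unfolding e1 using tn by (intro submod_add[OF N(1)])
     qed
    qed
    have "\<one> \<odot>\<^sub>M z \<notin> K" using z(2) zc by simp
    then have rP: "r \<notin> P" using tz[of \<one>] col[of \<one>] nr(2) by simp
    have "t \<in> Q \<longleftrightarrow> t \<in> P" if t: "t \<in> carrier R" for t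
    proof -
     have "t \<in> Q \<longleftrightarrow> t \<otimes> r \<in> P" using tz[OF t] col[OF t] t by (simp add: Qz)
     also have "\<dots> \<longleftrightarrow> t \<in> P"
      using primeideal.I_prime[OF P t nr(2)] rP ideal_mult[OF prime_ideal[OF P] nr(2), of t] t nr(2) by (auto simp: m_comm)
     finally show ?thesis .
    qed
    then have "Q = P" using ideal_carrier[OF prime_ideal[OF P]] ideal_carrier[OF prime_ideal[OF Q]] by blast
    then show ?thesis by simp
   qed
  qed
  then have "finite (assoc_primes N' K)" using N(3) finite_subset by blast
  then have "N' \<in> ?F" using N' NN' N(2) by auto
  then have "N' = N" using max NN' by blast
  then show False using wN' w(2) by simp
 qed
 then have "N = carrier M" using Nc by blast
 then show ?thesis using N(3) by simp
qed

end

section \<open>Prime avoidance and regular elements\<close>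

context cring
begin

text \<open>The element is a product of members of the ideals, each chosen outside
  \<open>P\<close>.\<close>

lemma prime_contains_product:
 assumes "finite F" "primeideal P R" "\<And>Q. Q \<in> F ==> ideal Q R \<and> \<not> Q \<subseteq> P"
 shows "\<exists>z\<in>carrier R - P. \<forall>Q\<in>F. z \<in> Q" using assms(1,3)
proof (induction F rule: finite_induct)
 case empty
 show ?case using prime_one[OF assms(2)] by (intro bexI[of _ \<one>]) auto
next
 case (insert Q F)
 then obtain z where z: "z \<in> carrier R - P" "\<forall>Q\<in>F. z \<in> Q" by auto
 have Q: "ideal Q R" "\<not> Q \<subseteq> P" using insert.prems[of Q] by auto
 then obtain q where q: "q \<in> Q" "q \<notin> P" by blast
 have qc: "q \<in> carrier R" using ideal_carrier[OF Q(1) q(1)] .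
 have "q \<otimes> z \<in> carrier R - P" using z q qc by (intro prime_mult_notin[OF assms(2)]) auto
 moreover have "q \<otimes> z \<in> Q'" if "Q' \<in> insert Q F" for Q'
 proof (cases "Q' = Q")
  case True
  then show ?thesis using ideal_mult[OF Q(1) _ q(1), of z] z(1) qc by (simp add: m_comm)
 next
  case False
  then have "ideal Q' R" "z \<in> Q'" using that insert.prems[of Q'] z(2) by auto
  then show ?thesis using ideal_mult qc by blast
 qed
 ultimately show ?case by blast
qed

text \<open>Comparable primes are thinned out first. If \<open>x\<close> avoids all primes except
  \<open>P\<close>, it is corrected by \<open>z i\<close>, where \<open>i\<close> is in
  \<open>I\<close> but not in \<open>P\<close> and \<open>z\<close> lies in all the other primes but
  not in \<open>P\<close>.\<close>

lemma prime_avoidance: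
 assumes "finite F" "\<And>P. P \<in> F ==> primeideal P R" "ideal I R" "\<And>P. P \<in> F ==> \<not> I \<subseteq> P"
 shows "\<exists>x\<in>I. \<forall>P\<in>F. x \<notin> P" using assms(1,2,4)
proof (induction "card F" arbitrary: F)
 case 0
 then have "F = {}" by simp
 then show ?case using ideal_zero[OF assms(3)] by blast
next
 case (Suc k)
 show ?case
 proof (cases "\<exists>P\<in>F. \<exists>Q\<in>F. P \<noteq> Q \<and> Q \<subseteq> P")
  case True
  then obtain P Q where PQ: "P \<in> F" "Q \<in> F" "P \<noteq> Q" "Q \<subseteq> P" by blast
  have "\<exists>x\<in>I. \<forall>P\<in>F - {Q}. x \<notin> P" using Suc.hyps(2) Suc.prems PQ by (intro Suc.hyps(1)) auto
  then show ?thesis using PQ by blast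
 next
  case False
  then obtain P where P: "P \<in> F" using Suc.hyps(2) by fastforce
  have "\<exists>x\<in>I. \<forall>P\<in>F - {P}. x \<notin> P" using Suc.hyps(2) Suc.prems P by (intro Suc.hyps(1)) auto
  then obtain x where x: "x \<in> I" "\<And>Q. Q \<in> F ==> Q \<noteq> P ==> x \<notin> Q" by blast
  show ?thesis
  proof (cases "x \<in> P")
   case xP: True
   have pP: "primeideal P R" using Suc.prems P by blast
   have "\<exists>z\<in>carrier R - P. \<forall>Q\<in>F - {P}. z \<in> Q"
    using Suc.prems pP False P prime_ideal by (intro prime_contains_product) auto
   then obtain z where z: "z \<in> carrier R - P" "\<forall>Q\<in>F - {P}. z \<in> Q" by blast
   obtain i where i: "i \<in> I" "i \<notin> P" using Suc.prems P by blast
   have ic: "i \<in> carrier R" "x \<in> carrier R" using ideal_carrier[OF assms(3)] i(1) x(1) by auto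
   have zi: "z \<otimes> i \<in> carrier R - P" using z i ic by (intro prime_mult_notin[OF pP]) auto
   have ziI: "z \<otimes> i \<in> I" using ideal_mult[OF assms(3)] z(1) i(1) by blast
   have "x \<oplus> z \<otimes> i \<notin> Q" if Q: "Q \<in> F" for Q
   proof
    assume a: "x \<oplus> z \<otimes> i \<in> Q"
    have iQ: "ideal Q R" using Suc.prems Q prime_ideal by blast
    show False
    proof (cases "Q = P")
     case True
     have "(x \<oplus> z \<otimes> i) \<ominus> x \<in> P" using a xP iQ True by (auto intro!: ideal_minus)
     moreover have "(x \<oplus> z \<otimes> i) \<ominus> x = z \<otimes> i" using ic z(1) zi by (auto, algebra)
     ultimately show False using zi by simp
    next
     case QP: False
     have "i \<otimes> z \<in> Q" using z(2) Q QP ideal_mult[OF iQ ic(1)] by blast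
     then have "(x \<oplus> z \<otimes> i) \<ominus> z \<otimes> i \<in> Q" using a iQ ic z(1) by (intro ideal_minus) (auto simp: m_comm)
     moreover have "(x \<oplus> z \<otimes> i) \<ominus> z \<otimes> i = x" using ic z(1) zi by (auto, algebra)
     ultimately show False using x(2)[OF Q QP] by simp
    qed
   qed
   then show ?thesis using ideal_add[OF assms(3) x(1) ziI] by blast
  qed (use x in blast)
 qed
qed

end

context lmodule
begin

text \<open>By \<open>kill\<close>, the maximal ideal lies in none of the finitely many associated
  primes of M/K, so some \<open>y\<close> in it avoids them all; a zero divisor on M/K would lie in
  one of them by \<open>assoc_prime_ex\<close>.\<close>

lemma nonzerodivisor_ex:
 assumes loc: "local_ring R \<mm>" and noeth: "noeth_mod R M" and K: "submodule K R M"
  and kill: "\<And>z. z \<in> carrier M ==> (\<And>r. r \<in> \<mm> ==> r \<odot>\<^sub>M z \<in> K) ==> z \<in> K"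
 shows "\<exists>y\<in>\<mm>. \<forall>z\<in>carrier M. y \<odot>\<^sub>M z \<in> K --> z \<in> K"
proof -
 have nr: "noetherian_ring R" using loc by (simp add: local_ring_def)
 note mi = prime_ideal[OF local_ring_prime[OF loc]]
 have "\<exists>y\<in>\<mm>. \<forall>P\<in>assoc_primes (carrier M) K. y \<notin> P"
 proof (rule prime_avoidance[OF assoc_primes_finite[OF nr noeth K] _ mi])
  fix P assume "P \<in> assoc_primes (carrier M) K"
  then obtain z where P: "primeideal P R" and z: "z \<in> carrier M" "z \<notin> K" "P = {r \<in> carrier R. r \<odot>\<^sub>M z \<in> K}"
   by (auto simp: assoc_primes_def)
  show "primeideal P R" by (rule P)
  show "\<not> \<mm> \<subseteq> P" using kill[OF z(1)] z(2,3) by blast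
 qed
 then obtain y where y: "y \<in> \<mm>" "\<And>P. P \<in> assoc_primes (carrier M) K ==> y \<notin> P" by blast
 have yc: "y \<in> carrier R" using ideal_carrier[OF mi y(1)] .
 have "z \<in> K" if z: "z \<in> carrier M" "y \<odot>\<^sub>M z \<in> K" for z
 proof (rule ccontr)
  assume "z \<notin> K"
  then obtain s where s: "s \<in> carrier R" "s \<odot>\<^sub>M z \<notin> K"
   and P: "primeideal {r \<in> carrier R. r \<odot>\<^sub>M (s \<odot>\<^sub>M z) \<in> K} R" using assoc_prime_ex[OF nr K z(1)] by blast
  have "y \<odot>\<^sub>M (s \<odot>\<^sub>M z) = s \<odot>\<^sub>M (y \<odot>\<^sub>M z)"
   using yc s z by (simp add: smult_assoc1[symmetric] m_comm)
  also have "\<dots> \<in> K" using submod_smult[OF K s(1) z(2)] .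
  finally have "y \<in> {r \<in> carrier R. r \<odot>\<^sub>M (s \<odot>\<^sub>M z) \<in> K}" using yc by simp
  moreover have "{r \<in> carrier R. r \<odot>\<^sub>M (s \<odot>\<^sub>M z) \<in> K} \<in> assoc_primes (carrier M) K"
   unfolding assoc_primes_def using P s z by blast
  ultimately show False using y(2) by blast
 qed
 then show ?thesis using y(1) by blast
qed

text \<open>If \<open>P\<close> is associated to \<open>M/K\<close> and \<open>y\<close> is regular on \<open>M/K\<close>, then some associated prime of
 \<open>M/(K + y M)\<close> properly contains \<open>P\<close>.\<close>

lemma assoc_prime_step:
 assumes loc: "local_ring R \<mm>" and noeth: "noeth_mod R M" and K: "submodule K R M"
  and z: "z \<in> carrier M" "z \<notin> K" and P: "P = {r \<in> carrier R. r \<odot>\<^sub>M z \<in> K}"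
  and y: "y \<in> \<mm>" "\<And>z. z \<in> carrier M ==> y \<odot>\<^sub>M z \<in> K ==> z \<in> K"
  and K': "submodule K' R M" "\<And>x. x \<in> K' \<longleftrightarrow> (\<exists>k\<in>K. \<exists>v\<in>carrier M. x = k \<oplus>\<^sub>M y \<odot>\<^sub>M v)"
 shows "\<exists>w\<in>carrier M. w \<notin> K' \<and> primeideal {r \<in> carrier R. r \<odot>\<^sub>M w \<in> K'} R \<and> P \<subset> {r \<in> carrier R. r \<odot>\<^sub>M w \<in> K'}"
proof -
 have nr: "noetherian_ring R" using loc by (simp add: local_ring_def)
 note mp = local_ring_prime[OF loc]
 note mi = prime_ideal[OF mp] and Kc = submod_carrier[OF K]
 have yc: "y \<in> carrier R" using ideal_carrier[OF mi y(1)] .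
 have Pc: "P \<subseteq> carrier R" using P by blast
 have KK': "k \<in> K'" if "k \<in> K" for k
 proof -
  have "k = k \<oplus>\<^sub>M y \<odot>\<^sub>M \<zero>\<^sub>M" using Kc that yc by simp
  then show ?thesis using K'(2) that by blast
 qed
 \<comment> \<open>The preimage in \<open>M\<close> of the elements of M/K killed by
   \<open>P\<close>.\<close>
 define U where "U = {u \<in> carrier M. \<forall>r\<in>P. r \<odot>\<^sub>M u \<in> K}"
 have U: "submodule U R M"
 proof (rule submodI)
  show "\<zero>\<^sub>M \<in> U" using submod_zero[OF K] Pc by (auto simp: U_def subset_iff)
  show "a \<oplus>\<^sub>M b \<in> U" if "a \<in> U" "b \<in> U" for a b
   using that Pc submod_add[OF K] by (auto simp: U_def subset_iff smult_r_distr)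
  show "s \<odot>\<^sub>M a \<in> U" if s: "s \<in> carrier R" "a \<in> U" for s a
  proof -
   have "r \<odot>\<^sub>M (s \<odot>\<^sub>M a) \<in> K" if r: "r \<in> P" for r
   proof -
    have "r \<odot>\<^sub>M (s \<odot>\<^sub>M a) = s \<odot>\<^sub>M (r \<odot>\<^sub>M a)"
     using r Pc s by (auto simp: U_def smult_assoc1[symmetric] m_comm subset_iff)
    then show ?thesis using submod_smult[OF K s(1)] s(2) r by (simp add: U_def)
   qed
   then show ?thesis using s by (simp add: U_def)
  qed
 qed (auto simp: U_def)
 have zU: "z \<in> U" using z P by (simp add: U_def)
 \<comment> \<open>If \<open>U\<close> were contained in K + y M, then by regularity of
   \<open>y\<close> even in K + y U, and Nakayama would put \<open>U\<close>, and with it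
   \<open>z\<close>, into \<open>K\<close>.\<close>
 have "\<exists>u\<in>U. u \<notin> K'"
 proof (rule ccontr)
  assume "\<not> ?thesis"
  then have UK: "u \<in> K'" if "u \<in> U" for u using that by blast
  have "\<exists>u\<in>carrier R - \<mm>. \<forall>k\<in>U. u \<odot>\<^sub>M k \<in> K"
  proof (rule nakayama_single[OF mp _ K y(1)])
   show "fg_sub R M U" using noeth U by (simp add: noeth_mod_def)
   fix u assume u: "u \<in> U"
   then obtain k v where kv: "k \<in> K" "v \<in> carrier M" "u = k \<oplus>\<^sub>M y \<odot>\<^sub>M v" using UK K'(2) by blast
   have kc: "k \<in> carrier M" using Kc kv(1) .
   have "r \<odot>\<^sub>M v \<in> K" if r: "r \<in> P" for r
   proof (rule y(2))
    have rc: "r \<in> carrier R" using Pc r by blast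
    show "r \<odot>\<^sub>M v \<in> carrier M" using rc kv by simp
    have "y \<odot>\<^sub>M (r \<odot>\<^sub>M v) = r \<odot>\<^sub>M u \<ominus>\<^sub>M r \<odot>\<^sub>M k"
     unfolding kv(3) using rc kv(2) kc yc by algebra
    also have "\<dots> \<in> K"
    proof (rule submod_minus[OF K])
     show "r \<odot>\<^sub>M u \<in> K" using u r by (simp add: U_def)
     show "r \<odot>\<^sub>M k \<in> K" using submod_smult[OF K rc kv(1)] .
    qed
    finally show "y \<odot>\<^sub>M (r \<odot>\<^sub>M v) \<in> K" .
   qed
   then have "v \<in> U" using kv(2) by (simp add: U_def)
   moreover have "\<one> \<odot>\<^sub>M u = k \<oplus>\<^sub>M y \<odot>\<^sub>M v" using u kv(3) by (simp add: U_def)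
   ultimately show "\<exists>t\<in>carrier R - \<mm>. \<exists>l\<in>K. \<exists>k'\<in>U. t \<odot>\<^sub>M u = l \<oplus>\<^sub>M y \<odot>\<^sub>M k'"
    using prime_one[OF mp] kv(1) by blast
  qed
  then obtain u where u: "u \<in> carrier R - \<mm>" "u \<odot>\<^sub>M z \<in> K" using zU by blast
  obtain v where v: "v \<in> carrier R" "v \<otimes> u = \<one>" using local_ring_unit[OF loc u(1)] .
  have "z = v \<odot>\<^sub>M (u \<odot>\<^sub>M z)" using v u z by (simp add: smult_assoc1[symmetric])
  then show False using submod_smult[OF K v(1) u(2)] z(2) by simp
 qed
 then obtain u where u: "u \<in> U" "u \<notin> K'" by blast
 have uc: "u \<in> carrier M" using u by (simp add: U_def)
 \<comment> \<open>An associated prime of M/K' found below such a \<open>u\<close> contains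
   \<open>P\<close>, which kills \<open>u\<close> modulo \<open>K\<close>, and it contains
   \<open>y\<close>, which is not in \<open>P\<close>.\<close>
 obtain s where s: "s \<in> carrier R" "s \<odot>\<^sub>M u \<notin> K'"
  and Q: "primeideal {r \<in> carrier R. r \<odot>\<^sub>M (s \<odot>\<^sub>M u) \<in> K'} R"
  using assoc_prime_ex[OF nr K'(1) uc u(2)] by blast
 let ?Q = "{r \<in> carrier R. r \<odot>\<^sub>M (s \<odot>\<^sub>M u) \<in> K'}"
 have suU: "s \<odot>\<^sub>M u \<in> U" using submod_smult[OF U s(1) u(1)] .
 then have "P \<subseteq> ?Q" using Pc KK' by (auto simp: U_def)
 moreover have "y \<in> ?Q"
 proof -
  have "y \<odot>\<^sub>M (s \<odot>\<^sub>M u) = \<zero>\<^sub>M \<oplus>\<^sub>M y \<odot>\<^sub>M (s \<odot>\<^sub>M u)" using yc s uc by simp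
  then have "y \<odot>\<^sub>M (s \<odot>\<^sub>M u) \<in> K'" unfolding K'(2) using submod_zero[OF K] s(1) uc by blast
  then show ?thesis using yc by simp
 qed
 moreover have "y \<notin> P" using y(2)[OF z(1)] z(2) P by blast
 ultimately show ?thesis using Q s uc by (intro bexI[of _ "s \<odot>\<^sub>M u"]) auto
qed

end

section \<open>Regular sequences acting on free complexes\<close>

context cring
begin

text \<open>For an ideal \<open>J\<close> this is the submodule J R^n, described by
  coordinates.\<close>

definition vecs :: "'a set => nat => (nat => 'a) set" where
 "vecs J n = {v \<in> Vec n. \<forall>i. v i \<in> J}"

lemma vecs_submod:
 assumes J: "ideal J R"
 shows "submodule (vecs J n) R (Free n)"
proof (rule Free.submodI)
 show "a \<oplus>[n] b \<in> vecs J n" if "a \<in> vecs J n" "b \<in> vecs J n" for a b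
  using that Free.M.a_closed[of a n b] ideal_add[OF J] by (auto simp: vecs_def)
 show "s \<odot>[n] a \<in> vecs J n" if "s \<in> carrier R" "a \<in> vecs J n" for s a
  using that Free.smult_closed[of s a n] ideal_mult[OF J] by (auto simp: vecs_def)
qed (use Free.M.zero_closed[of n] ideal_zero[OF J] in \<open>auto simp: vecs_def\<close>)

lemma vecs_zero: "vecs {\<zero>} n = {\<zero>[n]}" using Free.M.zero_closed[of n] by (auto simp: vecs_def)

lemma vecs_gen_Suc:
 assumes "\<And>i. i \<le> j ==> x i \<in> carrier R"
 shows "v \<in> vecs (gen_ideal x (Suc j)) n \<longleftrightarrow>
  (\<exists>a\<in>vecs (gen_ideal x j) n. \<exists>w\<in>Vec n. v = a \<oplus>[n] x j \<odot>[n] w)"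
proof
 have I: "ideal (gen_ideal x j) R" and I': "ideal (gen_ideal x (Suc j)) R" using assms by (intro gen_ideal_ideal; simp)+
 have xj: "x j \<in> carrier R" using assms by simp
 assume v: "v \<in> vecs (gen_ideal x (Suc j)) n"
 have "\<forall>i. \<exists>a r. a \<in> gen_ideal x j \<and> r \<in> carrier R \<and> v i = a \<oplus> r \<otimes> x j"
  using v by (auto simp: vecs_def)
 then obtain a r where ar: "\<And>i. a i \<in> gen_ideal x j" "\<And>i. r i \<in> carrier R" "\<And>i. v i = a i \<oplus> r i \<otimes> x j"
  by metis
 have ac: "a i \<in> carrier R" for i using ideal_carrier[OF I ar(1)] .
 let ?a = "\<lambda>i. if i < n then a i else \<zero>" and ?w = "\<lambda>i. if i < n then r i else \<zero>"
 have "?a \<in> vecs (gen_ideal x j) n" using ac ar(1) ideal_zero[OF I] by (auto simp: vecs_def intro!: free_modI)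
 moreover have "?w \<in> Vec n" using ar(2) by (auto intro!: free_modI)
 moreover have "v i = ?a i \<oplus> x j \<otimes> ?w i" for i
  using ar(2,3)[of i] ac[of i] xj v free_mod_beyond[of v n i] by (auto simp: vecs_def m_comm)
 then have "v = ?a \<oplus>[n] x j \<odot>[n] ?w" by (simp add: fun_eq_iff)
 ultimately show "\<exists>a\<in>vecs (gen_ideal x j) n. \<exists>w\<in>Vec n. v = a \<oplus>[n] x j \<odot>[n] w" by blast
next
 have xj: "x j \<in> carrier R" using assms by simp
 assume "\<exists>a\<in>vecs (gen_ideal x j) n. \<exists>w\<in>Vec n. v = a \<oplus>[n] x j \<odot>[n] w"
 then obtain a w where aw: "a \<in> vecs (gen_ideal x j) n" "w \<in> Vec n" "v = a \<oplus>[n] x j \<odot>[n] w" by blast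
 have "v \<in> Vec n" unfolding aw(3) using aw(1,2) xj by (intro Free.M.a_closed Free.smult_closed) (auto simp: vecs_def)
 moreover have "v i = a i \<oplus> w i \<otimes> x j" for i using aw(3) xj Vec_closed[OF aw(2)] by (simp add: m_comm)
 moreover have "a i \<in> gen_ideal x j" "w i \<in> carrier R" for i using aw(1) Vec_closed[OF aw(2)] by (auto simp: vecs_def)
 ultimately have "v \<in> Vec n" "v i \<in> gen_ideal x (Suc j)" for i by (simp, unfold gen_ideal.simps, blast)
 then show "v \<in> vecs (gen_ideal x (Suc j)) n" by (simp add: vecs_def)
qed

lemma vecs_gen_hom:
 assumes "\<And>i. i < j ==> x i \<in> carrier R" "f \<in> Lin p q" "v \<in> vecs (gen_ideal x j) p"
 shows "f v \<in> vecs (gen_ideal x j) q" using assms(1,3)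
proof (induction j arbitrary: v)
 case 0
 then show ?case using mod_hom_zero[OF free_module free_module assms(2)] by (simp add: vecs_zero)
next
 case (Suc j)
 have xc: "x i \<in> carrier R" if "i \<le> j" for i using Suc.prems(1) that by simp
 obtain a w where aw: "a \<in> vecs (gen_ideal x j) p" "w \<in> Vec p" "v = a \<oplus>[p] x j \<odot>[p] w"
  using Suc.prems(2) vecs_gen_Suc[of j x v p, OF xc] by blast
 have "a \<in> Vec p" using aw(1) by (simp add: vecs_def)
 then have "f v = f a \<oplus>[q] x j \<odot>[q] f w" unfolding aw(3) using xc[of j] aw(2)
  by (simp only: mod_hom_add[OF assms(2)] mod_hom_smult[OF assms(2)] Free.smult_closed le_refl)
 moreover have "f a \<in> vecs (gen_ideal x j) q" using Suc.IH[OF _ aw(1)] Suc.prems(1) by simp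
 ultimately show ?case using vecs_gen_Suc[of j x "f v" q, OF xc] mod_hom_closed[OF assms(2) aw(2)] by blast
qed

lemma vecs_regular:
 assumes "regular_seq n x" "j < n" "v \<in> Vec p" "x j \<odot>[p] v \<in> vecs (gen_ideal x j) p"
 shows "v \<in> vecs (gen_ideal x j) p"
 using assms Vec_closed[OF assms(3)] by (auto simp: vecs_def regular_seq_def)

lemma exact_freeD:
 assumes "exact_free R b d"
 shows "d i \<in> Lin (b (Suc i)) (b i)"
  and "v \<in> Vec (b (Suc i)) ==> d i v = \<zero>[b i] ==> \<exists>w\<in>Vec (b (Suc (Suc i))). v = d (Suc i) w"
  and "w \<in> Vec (b (Suc (Suc i))) ==> d i (d (Suc i) w) = \<zero>[b i]"
proof -
 have e: "d (Suc i) ` Vec (b (Suc (Suc i))) = {x \<in> Vec (b (Suc i)). d i x = \<zero>[b i]}"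
  using assms by (simp add: exact_free_def mod_ker_def)
 show "d i \<in> Lin (b (Suc i)) (b i)" using assms by (simp add: exact_free_def)
 show "\<exists>w\<in>Vec (b (Suc (Suc i))). v = d (Suc i) w" if "v \<in> Vec (b (Suc i))" "d i v = \<zero>[b i]" using e that by blast
 show "d i (d (Suc i) w) = \<zero>[b i]" if "w \<in> Vec (b (Suc (Suc i)))" using e that by blast
qed

text \<open>The vanishing of Tor_(i+1)(M, R/(y_0, ..., y_(j-1))) for j \<le> i, where M is the
  cokernel of \<open>d 0\<close>, proved by dividing by one \<open>y_j\<close> at a time.\<close>

lemma exact_free_mod_regular:
 assumes ex: "exact_free R b d" and reg: "regular_seq k y" and "j \<le> k" "j \<le> i"
  and "z \<in> Vec (b (Suc i))" "d i z \<in> vecs (gen_ideal y j) (b i)"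
 shows "\<exists>w\<in>Vec (b (Suc (Suc i))). z \<ominus>[b (Suc i)] d (Suc i) w \<in> vecs (gen_ideal y j) (b (Suc i))" using assms(3-)
proof (induction j arbitrary: i z)
 case 0
 then have "d i z = \<zero>[b i]" by (simp add: vecs_zero)
 then obtain w where w: "w \<in> Vec (b (Suc (Suc i)))" "z = d (Suc i) w" using exact_freeD(2)[OF ex] 0 by blast
 then have "z \<ominus>[b (Suc i)] d (Suc i) w = \<zero>[b (Suc i)]" using 0 by (simp only: Free.minus_self)
 then show ?case using w(1) by (intro bexI[of _ w]) (simp_all add: vecs_zero)
next
 case (Suc j)
 have yc: "y l \<in> carrier R" if "l \<le> j" for l using reg that Suc.prems(1) by (simp add: regular_seq_def)
 have yj: "y j \<in> carrier R" using yc by simp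
 have V: "submodule (vecs (gen_ideal y j) n) R (Free n)" for n using yc by (intro vecs_submod gen_ideal_ideal) simp
 note Vc = Free.submod_carrier[OF V]
 obtain i' where i: "i = Suc i'" "j \<le> i'" using Suc.prems(2) by (cases i) auto
 note d = exact_freeD(1)[OF ex]
 note dc = mod_hom_closed[OF d]
 note dadd = mod_hom_add[OF d] and dsm = mod_hom_smult[OF d] and dmin = mod_hom_minus[OF free_module free_module d]
 \<comment> \<open>Applying the differential to \<open>d z = a + y_j c\<close> shows that
   \<open>y_j d c\<close> lies in the smaller ideal, so \<open>d c\<close> does. By induction one
   degree lower, \<open>c\<close> is a boundary \<open>d w\<close> up to that ideal, and subtracting
   \<open>y_j w\<close> from \<open>z\<close> reduces to \<open>j\<close>.\<close>
 obtain a c where a: "a \<in> vecs (gen_ideal y j) (b i)" and c: "c \<in> Vec (b i)" and e: "d i z = a \<oplus>[b i] y j \<odot>[b i] c"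
  using Suc.prems(4) vecs_gen_Suc[of j y _ "b i", OF yc] by blast
 have ac: "a \<in> Vec (b i)" using Vc[OF a] .
 have ysc: "y j \<odot>[b i] c \<in> Vec (b i)" using yj c by (rule Free.smult_closed)
 have "d i' a \<oplus>[b i'] y j \<odot>[b i'] d i' c = d i' (d i z)"
  unfolding e using dadd[of a i' "y j \<odot>[b i] c"] dsm[OF yj, of c i'] ac c ysc i by (simp only:)
 also have "\<dots> = \<zero>[b i']" using exact_freeD(3)[OF ex] Suc.prems(3) i by simp
 finally have e2: "d i' a \<oplus>[b i'] y j \<odot>[b i'] d i' c = \<zero>[b i']" .
 have dac: "d i' a \<in> Vec (b i')" "d i' c \<in> Vec (b i')" using dc[of _ i'] ac c i by auto
 have "y j \<odot>[b i'] d i' c = (d i' a \<oplus>[b i'] y j \<odot>[b i'] d i' c) \<ominus>[b i'] d i' a" using dac yj by algebra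
 also have "\<dots> = \<ominus>[b i'] d i' a" unfolding e2 using dac by algebra
 finally have "y j \<odot>[b i'] d i' c = \<ominus>[b i'] d i' a" .
 moreover have "d i' a \<in> vecs (gen_ideal y j) (b i')" using vecs_gen_hom[OF _ d, of j y a i'] a yc i by simp
 ultimately have "y j \<odot>[b i'] d i' c \<in> vecs (gen_ideal y j) (b i')" using Free.submod_uminus[OF V] by metis
 then have "d i' c \<in> vecs (gen_ideal y j) (b i')" using vecs_regular[OF reg, of j "d i' c" "b i'"] dac Suc.prems(1) by simp
 then have "\<exists>w\<in>Vec (b (Suc (Suc i'))). c \<ominus>[b (Suc i')] d (Suc i') w \<in> vecs (gen_ideal y j) (b (Suc i'))"
  using c i Suc.prems(1) by (intro Suc.IH) auto
 then obtain w where w: "w \<in> Vec (b (Suc i))" "c \<ominus>[b i] d i w \<in> vecs (gen_ideal y j) (b i)" using i by auto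
 have wc: "d i w \<in> Vec (b i)" using dc w(1) .
 define z' where "z' = z \<ominus>[b (Suc i)] y j \<odot>[b (Suc i)] w"
 have yw: "y j \<odot>[b (Suc i)] w \<in> Vec (b (Suc i))" using yj w(1) by (rule Free.smult_closed)
 have z'c: "z' \<in> Vec (b (Suc i))" unfolding z'_def using Suc.prems(3) yw by (rule Free.M.minus_closed)
 have "d i z' = d i z \<ominus>[b i] y j \<odot>[b i] d i w"
  unfolding z'_def using dmin[OF Suc.prems(3) yw] dsm[OF yj w(1)] by (simp only:)
 also have "\<dots> = a \<oplus>[b i] y j \<odot>[b i] (c \<ominus>[b i] d i w)" unfolding e using ac c wc yj by algebra
 finally have "d i z' \<in> vecs (gen_ideal y j) (b i)" using Free.submod_add[OF V a Free.submod_smult[OF V yj w(2)]] by metis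
 then have "\<exists>u\<in>Vec (b (Suc (Suc i))). z' \<ominus>[b (Suc i)] d (Suc i) u \<in> vecs (gen_ideal y j) (b (Suc i))"
  using Suc.IH[of i z'] Suc.prems z'c by simp
 then obtain u where u: "u \<in> Vec (b (Suc (Suc i)))" "z' \<ominus>[b (Suc i)] d (Suc i) u \<in> vecs (gen_ideal y j) (b (Suc i))" by blast
 have du: "d (Suc i) u \<in> Vec (b (Suc i))" using dc u(1) .
 have "z \<ominus>[b (Suc i)] d (Suc i) u = (z' \<ominus>[b (Suc i)] d (Suc i) u) \<oplus>[b (Suc i)] y j \<odot>[b (Suc i)] w"
  unfolding z'_def using Suc.prems(3) w(1) yj du by algebra
 then have "z \<ominus>[b (Suc i)] d (Suc i) u \<in> vecs (gen_ideal y (Suc j)) (b (Suc i))"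
  using vecs_gen_Suc[of j y _ "b (Suc i)", OF yc] u(2) w(1) by blast
 then show ?case using u(1) by blast
qed

text \<open>Dimension shifting: an element of degree j killed modulo boundaries and modulo the first
  j terms by the remaining ones leads to such an element \<open>w\<close> of degree j + 1. In degree
  c there are no boundaries, and regularity of \<open>y_c\<close> settles it.\<close>

lemma regular_seq_kill_aux:
 assumes ex: "exact_free R b d" and reg: "regular_seq (Suc c) y" and b: "b (Suc c) = 0" and "j \<le> c" and "v \<in> Vec (b j)"
  and "\<And>i. j \<le> i ==> i \<le> c ==> \<exists>w\<in>Vec (b (Suc j)). y i \<odot>[b j] v \<ominus>[b j] d j w \<in> vecs (gen_ideal y j) (b j)"
 shows "\<exists>w\<in>Vec (b (Suc j)). v \<ominus>[b j] d j w \<in> vecs (gen_ideal y j) (b j)" using assms(4-)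
proof (induction "c - j" arbitrary: j v)
 case 0
 then have jc: "j = c" by simp
 note d = exact_freeD(1)[OF ex]
 have d0: "d j w = \<zero>[b j]" if w: "w \<in> Vec (b (Suc j))" for w
 proof -
  have "w = \<zero>[b (Suc j)]" using w by (simp add: jc b free_mod_carrier fun_eq_iff)
  then show ?thesis using mod_hom_zero[OF free_module free_module d] by simp
 qed
 have yj: "y j \<in> carrier R" using reg jc by (simp add: regular_seq_def)
 have m0: "u \<ominus>[b j] \<zero>[b j] = u" if "u \<in> Vec (b j)" for u using that by (rule Free.minus_zero_right)
 obtain w where "w \<in> Vec (b (Suc j))" "y j \<odot>[b j] v \<ominus>[b j] d j w \<in> vecs (gen_ideal y j) (b j)"
  using 0(4)[of j] jc by blast
 then have "y j \<odot>[b j] v \<in> vecs (gen_ideal y j) (b j)" using d0 m0[OF Free.smult_closed[OF yj 0(3)]] by metis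
 then have "v \<in> vecs (gen_ideal y j) (b j)" using vecs_regular[OF reg, of j v] 0(3) jc by simp
 then show ?case using d0[OF Free.M.zero_closed] m0[OF 0(3)] by (intro bexI[OF _ Free.M.zero_closed]) (simp only:)
next
 case (Suc k)
 have jc: "j < c" using Suc.hyps(2) by simp
 have yc: "y l \<in> carrier R" if "l \<le> c" for l using reg that by (simp add: regular_seq_def)
 have yj: "y j \<in> carrier R" using yc jc by simp
 have V: "submodule (vecs (gen_ideal y j) n) R (Free n)" for n using yc jc by (intro vecs_submod gen_ideal_ideal) simp
 note Vc = Free.submod_carrier[OF V]
 note d = exact_freeD(1)[OF ex]
 note dc = mod_hom_closed[OF d]
 note dadd = mod_hom_add[OF d] and dsm = mod_hom_smult[OF d] and dmin = mod_hom_minus[OF free_module free_module d]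
 obtain w where w: "w \<in> Vec (b (Suc j))" "y j \<odot>[b j] v \<ominus>[b j] d j w \<in> vecs (gen_ideal y j) (b j)"
  using Suc.prems(3)[of j] jc by auto
 have dw: "d j w \<in> Vec (b j)" using dc w(1) .
 have "\<exists>s\<in>Vec (b (Suc (Suc j))). w \<ominus>[b (Suc j)] d (Suc j) s \<in> vecs (gen_ideal y (Suc j)) (b (Suc j))"
 proof (rule Suc.hyps(1))
  show "k = c - Suc j" "Suc j \<le> c" "w \<in> Vec (b (Suc j))" using Suc.hyps(2) jc w by auto
  fix i assume i: "Suc j \<le> i" "i \<le> c"
  have yi: "y i \<in> carrier R" using yc i by simp
  obtain wi where wi: "wi \<in> Vec (b (Suc j))" "y i \<odot>[b j] v \<ominus>[b j] d j wi \<in> vecs (gen_ideal y j) (b j)"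
   using Suc.prems(3)[of i] i by auto
  have dwi: "d j wi \<in> Vec (b j)" using dc wi(1) .
  \<comment> \<open>The combination in which \<open>v\<close> cancels between the relations for
    \<open>y_i\<close> and \<open>y_j\<close>: a cycle modulo \<open>gen_ideal y j\<close>, hence a
    boundary by the previous lemma.\<close>
  define t where "t = y i \<odot>[b (Suc j)] w \<ominus>[b (Suc j)] y j \<odot>[b (Suc j)] wi"
  have yw: "y i \<odot>[b (Suc j)] w \<in> Vec (b (Suc j))" "y j \<odot>[b (Suc j)] wi \<in> Vec (b (Suc j))"
   using yi yj w(1) wi(1) by (auto simp del: free_mod_simps)
  have tc: "t \<in> Vec (b (Suc j))" unfolding t_def using yw by (rule Free.M.minus_closed)
  have "d j t = y i \<odot>[b j] d j w \<ominus>[b j] y j \<odot>[b j] d j wi"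
   unfolding t_def using dmin[OF yw] dsm[OF yi w(1)] dsm[OF yj wi(1)] by (simp only:)
  also have "\<dots> = y j \<odot>[b j] (y i \<odot>[b j] v \<ominus>[b j] d j wi) \<ominus>[b j] y i \<odot>[b j] (y j \<odot>[b j] v \<ominus>[b j] d j w)"
   using dw dwi yi yj Suc.prems(2) by algebra
  finally have "d j t \<in> vecs (gen_ideal y j) (b j)"
   using Free.submod_minus[OF V Free.submod_smult[OF V yj wi(2)] Free.submod_smult[OF V yi w(2)]] by metis
  then obtain s where s: "s \<in> Vec (b (Suc (Suc j)))" "t \<ominus>[b (Suc j)] d (Suc j) s \<in> vecs (gen_ideal y j) (b (Suc j))"
   using exact_free_mod_regular[OF ex reg _ _ tc, of j] jc by auto
  have ds: "d (Suc j) s \<in> Vec (b (Suc j))" using dc s(1) .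
  have "y i \<odot>[b (Suc j)] w \<ominus>[b (Suc j)] d (Suc j) s = (t \<ominus>[b (Suc j)] d (Suc j) s) \<oplus>[b (Suc j)] y j \<odot>[b (Suc j)] wi"
   unfolding t_def using w(1) wi(1) yi yj ds by algebra
  moreover have "y l \<in> carrier R" if "l \<le> j" for l using yc that jc by simp
  ultimately have "y i \<odot>[b (Suc j)] w \<ominus>[b (Suc j)] d (Suc j) s \<in> vecs (gen_ideal y (Suc j)) (b (Suc j))"
   using vecs_gen_Suc[of j y _ "b (Suc j)"] s(2) wi(1) by blast
  then show "\<exists>s\<in>Vec (b (Suc (Suc j))). y i \<odot>[b (Suc j)] w \<ominus>[b (Suc j)] d (Suc j) s \<in> vecs (gen_ideal y (Suc j)) (b (Suc j))"
   using s(1) by blast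
 qed
 then obtain s where s: "s \<in> Vec (b (Suc (Suc j)))" "w \<ominus>[b (Suc j)] d (Suc j) s \<in> vecs (gen_ideal y (Suc j)) (b (Suc j))" by blast
 have "y l \<in> carrier R" if "l \<le> j" for l using yc that jc by simp
 then obtain a u where a: "a \<in> vecs (gen_ideal y j) (b (Suc j))" and u: "u \<in> Vec (b (Suc j))"
  and e: "w \<ominus>[b (Suc j)] d (Suc j) s = a \<oplus>[b (Suc j)] y j \<odot>[b (Suc j)] u"
  using s(2) vecs_gen_Suc[of j y _ "b (Suc j)"] by blast
 have ac: "a \<in> Vec (b (Suc j))" using Vc[OF a] .
 have ds: "d (Suc j) s \<in> Vec (b (Suc j))" using dc s(1) .
 have yu: "y j \<odot>[b (Suc j)] u \<in> Vec (b (Suc j))" using yj u by (rule Free.smult_closed)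
 have du: "d j u \<in> Vec (b j)" "d j a \<in> Vec (b j)" using dc u ac by auto
 have "d j w \<ominus>[b j] d j (d (Suc j) s) = d j a \<oplus>[b j] y j \<odot>[b j] d j u"
  using dmin[OF w(1) ds] dadd[OF ac yu] dsm[OF yj u] e by metis
 then have dwe: "d j w \<ominus>[b j] \<zero>[b j] = d j a \<oplus>[b j] y j \<odot>[b j] d j u" using exact_freeD(3)[OF ex s(1)] by metis
 have "d j w \<ominus>[b j] \<zero>[b j] = d j w" using dw by (rule Free.minus_zero_right)
 with dwe have dwe: "d j w = d j a \<oplus>[b j] y j \<odot>[b j] d j u" by metis
 have "y j \<odot>[b j] (v \<ominus>[b j] d j u) = (y j \<odot>[b j] v \<ominus>[b j] d j w) \<oplus>[b j] d j a"
  unfolding dwe using Suc.prems(2) du yj by algebra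
 moreover have "d j a \<in> vecs (gen_ideal y j) (b j)" using yc jc by (intro vecs_gen_hom[OF _ d a]) simp
 ultimately have "y j \<odot>[b j] (v \<ominus>[b j] d j u) \<in> vecs (gen_ideal y j) (b j)" using Free.submod_add[OF V w(2)] by metis
 then have "v \<ominus>[b j] d j u \<in> vecs (gen_ideal y j) (b j)"
  using vecs_regular[OF reg, of j "v \<ominus>[b j] d j u" "b j"] jc Free.M.minus_closed[OF Suc.prems(2) du(1)] by simp
 then show ?case using u by blast
qed

text \<open>An ideal containing a regular sequence of length \<open>c + 1\<close> annihilates no nonzero element of a
 module with a free resolution of length \<open>c\<close>.\<close>

lemma regular_seq_kill:
 assumes ex: "exact_free R b d" and reg: "regular_seq (Suc c) y" and b: "b (Suc c) = 0" and v: "v \<in> Vec (b 0)"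
  and yv: "\<And>i. i \<le> c ==> y i \<odot>[b 0] v \<in> d 0 ` Vec (b 1)"
 shows "v \<in> d 0 ` Vec (b 1)"
proof -
 note dc = mod_hom_closed[OF exact_freeD(1)[OF ex]]
 have "\<exists>w\<in>Vec (b (Suc 0)). v \<ominus>[b 0] d 0 w \<in> vecs (gen_ideal y 0) (b 0)"
 proof (rule regular_seq_kill_aux[OF ex reg b _ v])
  fix i assume "i \<le> c"
  then obtain w where w: "w \<in> Vec (b 1)" "y i \<odot>[b 0] v = d 0 w" using yv[of i] by auto
  have "d 0 w \<in> Vec (b 0)" using dc[of w 0] w(1) by simp
  then have "y i \<odot>[b 0] v \<ominus>[b 0] d 0 w = \<zero>[b 0]" unfolding w(2) by (rule Free.minus_self)
  then show "\<exists>w\<in>Vec (b (Suc 0)). y i \<odot>[b 0] v \<ominus>[b 0] d 0 w \<in> vecs (gen_ideal y 0) (b 0)"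
   using w(1) by (intro bexI[of _ w]) (simp_all only: gen_ideal.simps vecs_zero singleton_iff One_nat_def)
 qed simp
 then obtain w where w: "w \<in> Vec (b (Suc 0))" "v \<ominus>[b 0] d 0 w \<in> vecs (gen_ideal y 0) (b 0)" ..
 have "v \<ominus>[b 0] d 0 w = \<zero>[b 0]" using w(2) by (simp only: gen_ideal.simps vecs_zero singleton_iff)
 then have "v = d 0 w" by (rule Free.eq_of_minus_zero[OF v dc[OF w(1)]])
 then show ?thesis using w(1) by auto
qed

end

section \<open>Mapping cones and chains of primes above an associated prime\<close>

primrec cone_rank :: "(nat => nat) => nat => nat" where
 "cone_rank b 0 = b 0"
| "cone_rank b (Suc i) = b (Suc i) + b i"

context cring
begin

text \<open>The direct sum of R^p and R^q is realised as R^(p+q), split at coordinate p, so that a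
  cone is again a complex of modules \<open>Free n\<close>.\<close>

definition vec_fst :: "nat => (nat => 'a) => nat => 'a" where
 "vec_fst p x = (\<lambda>i. if i < p then x i else \<zero>)"

definition vec_snd :: "nat => (nat => 'a) => nat => 'a" where
 "vec_snd p x = (\<lambda>i. x (p + i))"

definition vec_cat :: "nat => (nat => 'a) => (nat => 'a) => nat => 'a" where
 "vec_cat p u v = (\<lambda>i. if i < p then u i else v (i - p))"

lemma vec_fst_hom: "vec_fst p \<in> Lin (p + q) p" by (rule mod_homI) (auto simp: vec_fst_def fun_eq_iff Vec_closed intro!: free_modI)

lemma vec_snd_hom: "vec_snd p \<in> Lin (p + q) q"
 by (rule mod_homI) (auto simp: vec_snd_def fun_eq_iff Vec_closed free_mod_beyond intro!: free_modI)

lemma vec_cat_closed: "u \<in> Vec p ==> v \<in> Vec q ==> vec_cat p u v \<in> Vec (p + q)"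
 by (auto simp: vec_cat_def Vec_closed free_mod_beyond intro!: free_modI)

lemma vec_cat_hom:
 assumes "f \<in> mod_hom R L (Free p)" "g \<in> mod_hom R L (Free q)"
 shows "(\<lambda>x. vec_cat p (f x) (g x)) \<in> mod_hom R L (Free (p + q))"
proof (rule mod_homI)
 show "vec_cat p (f x) (g x) \<in> Vec (p + q)" if "x \<in> carrier L" for x
  using mod_hom_closed[OF assms(1) that] mod_hom_closed[OF assms(2) that] by (rule vec_cat_closed)
 show "vec_cat p (f (x \<oplus>\<^bsub>L\<^esub> y)) (g (x \<oplus>\<^bsub>L\<^esub> y)) = vec_cat p (f x) (g x) \<oplus>[p + q] vec_cat p (f y) (g y)"
  if "x \<in> carrier L" "y \<in> carrier L" for x y
  using mod_hom_add[OF assms(1) that] mod_hom_add[OF assms(2) that] by (simp add: vec_cat_def fun_eq_iff)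
 show "vec_cat p (f (s \<odot>\<^bsub>L\<^esub> x)) (g (s \<odot>\<^bsub>L\<^esub> x)) = s \<odot>[p + q] vec_cat p (f x) (g x)"
  if "s \<in> carrier R" "x \<in> carrier L" for s x
  using mod_hom_smult[OF assms(1) that] mod_hom_smult[OF assms(2) that] by (simp add: vec_cat_def fun_eq_iff)
qed

lemma vec_fst_cat: "u \<in> Vec p ==> vec_fst p (vec_cat p u v) = u"
 by (auto simp: vec_fst_def vec_cat_def fun_eq_iff free_mod_beyond)

lemma vec_snd_cat: "vec_snd p (vec_cat p u v) = v" by (auto simp: vec_snd_def vec_cat_def)

lemma vec_cat_fst_snd: "vec_cat p (vec_fst p x) (vec_snd p x) = x" by (auto simp: vec_cat_def vec_fst_def vec_snd_def)

lemma vec_cat_zero: "vec_cat p (\<lambda>i. \<zero>) (\<lambda>i. \<zero>) = (\<lambda>i. \<zero>)" by (auto simp: vec_cat_def)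

lemma vec_cat_inj:
 "u \<in> Vec p ==> u' \<in> Vec p ==> vec_cat p u v = vec_cat p u' v' \<longleftrightarrow> u = u' \<and> v = v'"
 by (metis vec_fst_cat vec_snd_cat)

text \<open>The mapping cone of multiplication by \<open>y\<close>.\<close>

primrec cone_diff :: "(nat => nat) => (nat => (nat => 'a) => nat => 'a) => 'a => nat => (nat => 'a) => nat => 'a" where
 "cone_diff b d y 0 = (\<lambda>x. d 0 (vec_fst (b 1) x) \<oplus>[b 0] y \<odot>[b 0] vec_snd (b 1) x)"
| "cone_diff b d y (Suc i) = (\<lambda>x. vec_cat (b (Suc i))
   (d (Suc i) (vec_fst (b (Suc (Suc i))) x) \<oplus>[b (Suc i)] y \<odot>[b (Suc i)] vec_snd (b (Suc (Suc i))) x)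
   ((\<ominus> \<one>) \<odot>[b i] d i (vec_snd (b (Suc (Suc i))) x)))"

lemma neg_one_smult: "x \<in> Vec n ==> (\<ominus> \<one>) \<odot>[n] x = \<ominus>[n] x"
 using Free.smult_l_minus[OF one_closed, of x n] Free.smult_one[of x n] by metis

lemma cone_diff_hom:
 assumes "\<And>i. d i \<in> Lin (b (Suc i)) (b i)" "y \<in> carrier R"
 shows "cone_diff b d y i \<in> Lin (cone_rank b (Suc i)) (cone_rank b i)"
proof (cases i)
 case 0
 have "(\<lambda>x. cone_diff b d y 0 x) \<in> Lin (b 1 + b 0) (b 0)" unfolding cone_diff.simps using assms(1)[of 0]
  by (intro Free.mod_hom_addf Free.mod_hom_smultf[OF _ assms(2)] mod_hom_comp[OF vec_fst_hom] mod_hom_comp[OF vec_snd_hom]) (simp_all add: mod_hom_id)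
 then show ?thesis using 0 by simp
next
 case (Suc k)
 have "(\<lambda>x. cone_diff b d y (Suc k) x) \<in> Lin (b (Suc (Suc k)) + b (Suc k)) (b (Suc k) + b k)"
  unfolding cone_diff.simps using assms(1)
  by (intro vec_cat_hom Free.mod_hom_addf Free.mod_hom_smultf[OF _ assms(2)] Free.mod_hom_smultf[OF _ a_inv_closed[OF one_closed]]
    mod_hom_comp[OF vec_fst_hom] mod_hom_comp[OF vec_snd_hom]) (simp_all add: mod_hom_id)
 then show ?thesis using Suc by simp
qed

lemma neg_smult_zero_iff:
 "x \<in> Vec n ==> (\<ominus> \<one>) \<odot>[n] x = \<zero>[n] \<longleftrightarrow> x = \<zero>[n]"
 using neg_one_smult[of x n] by (metis Free.M.add.inv_eq_1_iff)

lemma cone_diff_eq_zero: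
 assumes "\<And>i. d i \<in> Lin (b (Suc i)) (b i)" "y \<in> carrier R"
  and u: "u \<in> Vec (b (Suc (Suc i)))" and v: "v \<in> Vec (b (Suc i))"
 shows "cone_diff b d y (Suc i) (vec_cat (b (Suc (Suc i))) u v) = \<zero>[cone_rank b (Suc i)] \<longleftrightarrow>
  d (Suc i) u \<oplus>[b (Suc i)] y \<odot>[b (Suc i)] v = \<zero>[b (Suc i)] \<and> d i v = \<zero>[b i]"
proof -
 have c: "d (Suc i) u \<oplus>[b (Suc i)] y \<odot>[b (Suc i)] v \<in> Vec (b (Suc i))"
  using mod_hom_closed[OF assms(1) u] v assms(2) by (intro Free.M.a_closed Free.smult_closed)
 have "cone_diff b d y (Suc i) (vec_cat (b (Suc (Suc i))) u v) = \<zero>[cone_rank b (Suc i)] \<longleftrightarrow>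
   vec_cat (b (Suc i)) (d (Suc i) u \<oplus>[b (Suc i)] y \<odot>[b (Suc i)] v) ((\<ominus> \<one>) \<odot>[b i] d i v)
   = vec_cat (b (Suc i)) \<zero>[b (Suc i)] \<zero>[b i]"
  unfolding cone_diff.simps vec_fst_cat[OF u] vec_snd_cat by (simp only: free_mod_simps(1) vec_cat_zero)
 also have "\<dots> \<longleftrightarrow> d (Suc i) u \<oplus>[b (Suc i)] y \<odot>[b (Suc i)] v = \<zero>[b (Suc i)] \<and> d i v = \<zero>[b i]"
  using vec_cat_inj[OF c Free.M.zero_closed] neg_smult_zero_iff[OF mod_hom_closed[OF assms(1) v]] by (simp only:)
 finally show ?thesis .
qed

text \<open>If \<open>y\<close> is regular on the cokernel M of \<open>d 0\<close>, the cone
  resolves M/y M. In positive degrees exactness is that of the given complex.\<close>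

lemma cone_exact:
 assumes ex: "exact_free R b d" and y: "y \<in> carrier R"
  and nzd: "\<And>z. z \<in> Vec (b 0) ==> y \<odot>[b 0] z \<in> d 0 ` Vec (b 1) ==> z \<in> d 0 ` Vec (b 1)"
 shows "exact_free R (cone_rank b) (cone_diff b d y)" unfolding exact_free_def
proof (intro conjI allI)
 note d = exact_freeD(1)[OF ex]
 note dc = mod_hom_closed[OF d]
 note dadd = mod_hom_add[OF d] and dsm = mod_hom_smult[OF d]
 have mone: "\<ominus> \<one> \<in> carrier R" by simp
 fix i
 show "cone_diff b d y i \<in> Lin (cone_rank b (Suc i)) (cone_rank b i)" by (rule cone_diff_hom[of d b y, OF d y])
 have dd: "d i (d (Suc i) w) = \<zero>[b i]" if "w \<in> Vec (b (Suc (Suc i)))" for i w using exact_freeD(3)[OF ex that] .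
 have in_ker: "cone_diff b d y i (cone_diff b d y (Suc i) x) = \<zero>[cone_rank b i]"
  if x: "x \<in> Vec (cone_rank b (Suc (Suc i)))" for x
 proof -
  define u v where "u = vec_fst (b (Suc (Suc i))) x" and "v = vec_snd (b (Suc (Suc i))) x"
  have xc: "x \<in> Vec (b (Suc (Suc i)) + b (Suc i))" using x by simp
  have u: "u \<in> Vec (b (Suc (Suc i)))" and v: "v \<in> Vec (b (Suc i))"
   unfolding u_def v_def using mod_hom_closed[OF vec_fst_hom xc] mod_hom_closed[OF vec_snd_hom xc] by auto
  have du: "d (Suc i) u \<in> Vec (b (Suc i))" and dv: "d i v \<in> Vec (b i)" using dc u v by auto
  define a where "a = d (Suc i) u \<oplus>[b (Suc i)] y \<odot>[b (Suc i)] v"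
  define e where "e = (\<ominus> \<one>) \<odot>[b i] d i v"
  have yv: "y \<odot>[b (Suc i)] v \<in> Vec (b (Suc i))" using y v by (rule Free.smult_closed)
  have a: "a \<in> Vec (b (Suc i))" unfolding a_def using du yv by (rule Free.M.a_closed)
  have e: "e \<in> Vec (b i)" unfolding e_def using mone dv by (rule Free.smult_closed)
  have cx: "cone_diff b d y (Suc i) x = vec_cat (b (Suc i)) a e" unfolding cone_diff.simps a_def e_def u_def v_def by simp
  have da: "d i a = \<zero>[b i] \<oplus>[b i] y \<odot>[b i] d i v" unfolding a_def dadd[OF du yv] dd[OF u] dsm[OF y v] ..
  have z: "d i a \<oplus>[b i] y \<odot>[b i] e = \<zero>[b i]" unfolding da e_def using dv y mone by algebra
  show ?thesis
  proof (cases i)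
   case 0
   then show ?thesis unfolding cx using z a by (simp only: cone_diff.simps vec_snd_cat vec_fst_cat One_nat_def cone_rank.simps)
  next
   case (Suc k)
   have "d k e = (\<ominus> \<one>) \<odot>[b k] d k (d (Suc k) v)"
    unfolding e_def Suc using dsm[OF mone, of "d (Suc k) v" k] dv Suc by (simp only:)
   also have "\<dots> = \<zero>[b k]" using dd[of v k] v Suc Free.smult_r_null[OF mone] by (simp only:)
   finally have "d k e = \<zero>[b k]" .
   then show ?thesis unfolding cx using cone_diff_eq_zero[of d b y a k e, OF d y] a e z Suc by (simp only:)
  qed
 qed
 have onto: "\<exists>x\<in>Vec (cone_rank b (Suc (Suc i))). z = cone_diff b d y (Suc i) x"
  if z: "z \<in> Vec (cone_rank b (Suc i))" and z0: "cone_diff b d y i z = \<zero>[cone_rank b i]" for z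
 proof -
  define u v where "u = vec_fst (b (Suc i)) z" and "v = vec_snd (b (Suc i)) z"
  have zc: "z \<in> Vec (b (Suc i) + b i)" using z by simp
  have u: "u \<in> Vec (b (Suc i))" and v: "v \<in> Vec (b i)"
   unfolding u_def v_def using mod_hom_closed[OF vec_fst_hom zc] mod_hom_closed[OF vec_snd_hom zc] by auto
  have z_cat: "z = vec_cat (b (Suc i)) u v" unfolding u_def v_def by (simp add: vec_cat_fst_snd)
  have uv: "d i u \<oplus>[b i] y \<odot>[b i] v = \<zero>[b i] \<and> (\<exists>w\<in>Vec (b (Suc i)). v = d i w)"
  proof (cases i)
   case 0
   have e0: "d 0 u \<oplus>[b 0] y \<odot>[b 0] v = \<zero>[b 0]" using z0 unfolding 0 cone_diff.simps u_def v_def by simp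
   have u0: "u \<in> Vec (b (Suc 0))" "v \<in> Vec (b 0)" "d 0 u \<in> Vec (b 0)" using u v dc[OF u] 0 by auto
   \<comment> \<open>The place where \<open>nzd\<close> enters: for a cycle (u, v) of degree 1,
     \<open>y v\<close> is in the image of \<open>d 0\<close>, therefore \<open>v\<close>
     is.\<close>
   have "y \<odot>[b 0] v = (d 0 u \<oplus>[b 0] y \<odot>[b 0] v) \<ominus>[b 0] d 0 u" using u0 y by algebra
   also have "\<dots> = (\<ominus> \<one>) \<odot>[b 0] d 0 u" unfolding e0 using u0(3) by algebra
   also have "\<dots> = d 0 ((\<ominus> \<one>) \<odot>[b (Suc 0)] u)" using dsm[OF mone u0(1)] by metis
   finally have "y \<odot>[b 0] v \<in> d 0 ` Vec (b 1)" using Free.smult_closed[OF mone u0(1)] by (metis One_nat_def imageI)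
   then have "v \<in> d 0 ` Vec (b 1)" using nzd u0(2) by blast
   then show ?thesis using e0 0 by auto
  next
   case (Suc k)
   have "d (Suc k) u \<oplus>[b (Suc k)] y \<odot>[b (Suc k)] v = \<zero>[b (Suc k)] \<and> d k v = \<zero>[b k]"
    using cone_diff_eq_zero[of d b y u k v, OF d y] u v z0 z_cat Suc by (simp only:)
   then show ?thesis using exact_freeD(2)[OF ex, of v k] v Suc by blast
  qed
  then obtain w where w: "w \<in> Vec (b (Suc i))" "v = d i w" by blast
  \<comment> \<open>The second component of the cone differential is \<open>- d\<close>, so the
    preimage of \<open>v = d w\<close> is built from \<open>- w\<close>.\<close>
  define w' where "w' = (\<ominus> \<one>) \<odot>[b (Suc i)] w"
  have w': "w' \<in> Vec (b (Suc i))" unfolding w'_def using mone w(1) by (rule Free.smult_closed)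
  have dw: "d i w \<in> Vec (b i)" using dc w(1) .
  have dw': "d i w' = (\<ominus> \<one>) \<odot>[b i] d i w" unfolding w'_def by (rule dsm[OF mone w(1)])
  have vw': "(\<ominus> \<one>) \<odot>[b i] d i w' = v" unfolding dw' w(2) using dw by algebra
  have yw: "y \<odot>[b (Suc i)] w' \<in> Vec (b (Suc i))" using y w' by (rule Free.smult_closed)
  have "d i (u \<ominus>[b (Suc i)] y \<odot>[b (Suc i)] w') = d i u \<ominus>[b i] y \<odot>[b i] d i w'"
   using mod_hom_minus[OF free_module free_module d u yw] dsm[OF y w'] by (simp only:)
  also have "\<dots> = d i u \<oplus>[b i] y \<odot>[b i] v" unfolding dw' w(2) using dc[OF u] dw y by algebra
  also have "\<dots> = \<zero>[b i]" using uv by blast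
  finally obtain s where s: "s \<in> Vec (b (Suc (Suc i)))" "u \<ominus>[b (Suc i)] y \<odot>[b (Suc i)] w' = d (Suc i) s"
   using exact_freeD(2)[OF ex Free.M.minus_closed[OF u yw]] by blast
  have us: "d (Suc i) s \<oplus>[b (Suc i)] y \<odot>[b (Suc i)] w' = u" unfolding s(2)[symmetric] using u w' y by algebra
  have "cone_diff b d y (Suc i) (vec_cat (b (Suc (Suc i))) s w') = z"
   unfolding cone_diff.simps vec_fst_cat[OF s(1)] vec_snd_cat us vw' z_cat ..
  moreover have "vec_cat (b (Suc (Suc i))) s w' \<in> Vec (cone_rank b (Suc (Suc i)))" using vec_cat_closed[OF s(1) w'] by simp
  ultimately show ?thesis by blast
 qed
 show "cone_diff b d y (Suc i) ` Vec (cone_rank b (Suc (Suc i))) =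
   mod_ker (Free (cone_rank b (Suc i))) (Free (cone_rank b i)) (cone_diff b d y i)"
  unfolding mod_ker_def using onto in_ker mod_hom_closed[OF cone_diff_hom[of d b y, OF d y, of "Suc i"]] by blast
qed

lemma image_submod:
 assumes "module R L" "f \<in> mod_hom R L (Free n)"
 shows "submodule (f ` carrier L) R (Free n)"
proof -
 interpret L: module R L by fact
 show ?thesis
 proof (rule Free.submodI)
  show "f ` carrier L \<subseteq> Vec n" using mod_hom_closed[OF assms(2)] by blast
  show "\<zero>[n] \<in> f ` carrier L" using mod_hom_zero[OF assms(1) free_module assms(2)] L.M.zero_closed by (metis imageI)
  show "a \<oplus>[n] b \<in> f ` carrier L" if ab: "a \<in> f ` carrier L" "b \<in> f ` carrier L" for a b
  proof -
   obtain u v where uv: "u \<in> carrier L" "v \<in> carrier L" and e: "a = f u" "b = f v" using ab by blast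
   show ?thesis unfolding e mod_hom_add[OF assms(2) uv, symmetric] using uv by (intro imageI L.M.a_closed)
  qed
  show "s \<odot>[n] a \<in> f ` carrier L" if s: "s \<in> carrier R" and a: "a \<in> f ` carrier L" for s a
  proof -
   obtain u where u: "u \<in> carrier L" and e: "a = f u" using a by blast
   show ?thesis unfolding e mod_hom_smult[OF assms(2) s u, symmetric] using s u by (intro imageI L.smult_closed)
  qed
 qed
qed

text \<open>For \<open>M = Free (b 0) / im (d 0)\<close> this says that \<open>dim R/P \<ge> n - pd M\<close> for \<open>P\<close> associated to \<open>M\<close>.\<close>

lemma assoc_prime_chain:
 assumes loc: "local_ring R \<mm>" and reg: "regular_seq n x" and x: "\<And>i. i < n ==> x i \<in> \<mm>"
  and "exact_free R b d" "\<And>i. c < i ==> b i = 0" and "z \<in> Vec (b 0)" "z \<notin> d 0 ` Vec (b 1)"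
  and "P = {r \<in> carrier R. r \<odot>[b 0] z \<in> d 0 ` Vec (b 1)}" "primeideal P R"
 shows "\<exists>p. prime_chain (n - c) p \<and> p 0 = P" using assms(4-)
proof (induction "n - c" arbitrary: b d c z P)
 case 0
 then show ?case by (intro exI[of _ "\<lambda>_. P"]) (auto simp: prime_chain_def)
next
 case (Suc k)
 have nr: "noetherian_ring R" using loc by (simp add: local_ring_def)
 note ex = Suc.prems(1)
 note d = exact_freeD(1)[OF ex]
 define K where "K = d 0 ` Vec (b 1)"
 have K: "submodule K R (Free (b 0))" unfolding K_def One_nat_def by (rule image_submod[OF free_module d])
 have cn: "c < n" using Suc.hyps(2) by simp
 have regc: "regular_seq (Suc c) x" using reg cn by (simp add: regular_seq_def)
 \<comment> \<open>Since \<open>c < n\<close>, the terms \<open>x_0, ..., x_c\<close> form a regular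
   sequence in the maximal ideal that is longer than the resolution; so the maximal ideal kills
   nothing and a regular element exists.\<close>
 have "\<exists>y\<in>\<mm>. \<forall>z\<in>Vec (b 0). y \<odot>[b 0] z \<in> K --> z \<in> K"
 proof (rule Free.nonzerodivisor_ex[OF loc noeth_free[OF nr] K])
  fix w assume w: "w \<in> Vec (b 0)" and kill: "\<And>r. r \<in> \<mm> ==> r \<odot>[b 0] w \<in> K"
  show "w \<in> K" unfolding K_def
  proof (rule regular_seq_kill[OF ex regc _ w])
   show "b (Suc c) = 0" by (rule Suc.prems(2)) simp
   show "x i \<odot>[b 0] w \<in> d 0 ` Vec (b 1)" if "i \<le> c" for i using kill[OF x] that cn unfolding K_def by simp
  qed
 qed
 then obtain y where y: "y \<in> \<mm>" and nzd: "\<And>z. z \<in> Vec (b 0) ==> y \<odot>[b 0] z \<in> K ==> z \<in> K"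
  by blast
 have yc: "y \<in> carrier R" using ideal_carrier[OF prime_ideal[OF local_ring_prime[OF loc]] y] .
 \<comment> \<open>Induction step: the module is replaced by its quotient by \<open>y\<close>, whose
   resolution, the cone, is longer by one, and \<open>P\<close> by a strictly larger associated
   prime.\<close>
 have ex': "exact_free R (cone_rank b) (cone_diff b d y)" by (rule cone_exact[OF ex yc nzd[unfolded K_def]])
 define K' where "K' = cone_diff b d y 0 ` Vec (cone_rank b 1)"
 have K': "submodule K' R (Free (b 0))" unfolding K'_def One_nat_def
  by (rule image_submod[OF free_module cone_diff_hom[of d b y, OF d yc, of 0, unfolded cone_rank.simps(1)]])
 have K'_iff: "v \<in> K' \<longleftrightarrow> (\<exists>k\<in>K. \<exists>w\<in>Vec (b 0). v = k \<oplus>[b 0] y \<odot>[b 0] w)" for v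
 proof
  assume "v \<in> K'"
  then obtain u where u: "u \<in> Vec (b 1 + b 0)" "v = cone_diff b d y 0 u" unfolding K'_def by auto
  have "d 0 (vec_fst (b 1) u) \<in> K" "vec_snd (b 1) u \<in> Vec (b 0)"
   unfolding K_def using mod_hom_closed[OF vec_fst_hom u(1)] mod_hom_closed[OF vec_snd_hom u(1)] by auto
  then show "\<exists>k\<in>K. \<exists>w\<in>Vec (b 0). v = k \<oplus>[b 0] y \<odot>[b 0] w"
   using u(2) unfolding cone_diff.simps by blast
 next
  assume "\<exists>k\<in>K. \<exists>w\<in>Vec (b 0). v = k \<oplus>[b 0] y \<odot>[b 0] w"
  then obtain u w where u: "u \<in> Vec (b 1)" and w: "w \<in> Vec (b 0)"
   and v: "v = d 0 u \<oplus>[b 0] y \<odot>[b 0] w" unfolding K_def by blast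
  have "v = cone_diff b d y 0 (vec_cat (b 1) u w)" unfolding v cone_diff.simps vec_fst_cat[OF u] vec_snd_cat ..
  then show "v \<in> K'" unfolding K'_def using vec_cat_closed[OF u w] by (simp del: cone_diff.simps)
 qed
 have zK: "z \<notin> K" and PK: "P = {r \<in> carrier R. r \<odot>[b 0] z \<in> K}" using Suc.prems(4,5) unfolding K_def .
 have "\<exists>w\<in>Vec (b 0). w \<notin> K' \<and> primeideal {r \<in> carrier R. r \<odot>[b 0] w \<in> K'} R \<and>
   P \<subset> {r \<in> carrier R. r \<odot>[b 0] w \<in> K'}"
  by (rule Free.assoc_prime_step[OF loc noeth_free[OF nr] K Suc.prems(3) zK PK y _ K' K'_iff]) (rule nzd)
 then obtain w where w: "w \<in> Vec (b 0)" "w \<notin> K'" and Q: "primeideal {r \<in> carrier R. r \<odot>[b 0] w \<in> K'} R"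
  and PQ: "P \<subset> {r \<in> carrier R. r \<odot>[b 0] w \<in> K'}" by (elim bexE conjE) (rule that)
 have "\<exists>p. prime_chain (n - Suc c) p \<and> p 0 = {r \<in> carrier R. r \<odot>[b 0] w \<in> K'}"
 proof (rule Suc.hyps(1)[OF _ ex'])
  show "k = n - Suc c" using Suc.hyps(2) by simp
  show "cone_rank b i = 0" if "Suc c < i" for i using that Suc.prems(2) by (cases i) auto
  show "w \<in> Vec (cone_rank b 0)" using w(1) by (simp only: cone_rank.simps)
  show "w \<notin> cone_diff b d y 0 ` Vec (cone_rank b 1)" using w(2) unfolding K'_def .
  show "{r \<in> carrier R. r \<odot>[b 0] w \<in> K'} =
    {r \<in> carrier R. r \<odot>[cone_rank b 0] w \<in> cone_diff b d y 0 ` Vec (cone_rank b 1)}"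
   unfolding K'_def cone_rank.simps(1) ..
 qed (rule Q)
 then obtain p where p: "prime_chain (n - Suc c) p" "p 0 = {r \<in> carrier R. r \<odot>[b 0] w \<in> K'}" by blast
 have "prime_chain (Suc (n - Suc c)) (\<lambda>i. case i of 0 => P | Suc i => p i)"
  using p PQ Suc.prems(6) by (auto simp: prime_chain_def split: nat.split)
 moreover have "n - c = Suc (n - Suc c)" using cn by simp
 ultimately show ?case by (intro exI[of _ "\<lambda>i. case i of 0 => P | Suc i => p i"]) simp
qed

end

section \<open>Associated primes of the algebra\<close>

lemma (in cring) rcos_mem_image_iff:
 assumes "ideal I R" "ideal J R" "I \<subseteq> J" "a \<in> carrier R"
 shows "I +>\<^bsub>R\<^esub> a \<in> (+>\<^bsub>R\<^esub>) I ` J \<longleftrightarrow> a \<in> J"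
proof
 assume "I +>\<^bsub>R\<^esub> a \<in> (+>\<^bsub>R\<^esub>) I ` J"
 then obtain b where b: "b \<in> J" "I +>\<^bsub>R\<^esub> a = I +>\<^bsub>R\<^esub> b" by blast
 have bc: "b \<in> carrier R" using ideal_carrier[OF assms(2) b(1)] .
 have "a \<ominus> b \<in> I" using quotient_eq_iff_same_a_r_cos[OF assms(1,4) bc] b(2) by simp
 then have "(a \<ominus> b) \<oplus> b \<in> J" using assms(3) b(1) by (intro ideal_add[OF assms(2)]) auto
 moreover have "(a \<ominus> b) \<oplus> b = a" using assms(4) bc by algebra
 ultimately show "a \<in> J" by simp
qed blast

lemma (in cring) quot_carrier_ex:
 assumes "Z \<in> carrier (R Quot I)"
 shows "\<exists>a\<in>carrier R. Z = I +>\<^bsub>R\<^esub> a"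
 using assms by (auto simp: FactRing_def A_RCOSETS_def')

lemma (in cring) rcos_closed: "a \<in> carrier R ==> I +>\<^bsub>R\<^esub> a \<in> carrier (R Quot I)"
 by (auto simp: FactRing_def A_RCOSETS_def')

lemma (in cring) quot_prime:
 assumes I: "ideal I R" and J: "primeideal J R" and IJ: "I \<subseteq> J"
 shows "primeideal ((+>\<^bsub>R\<^esub>) I ` J) (R Quot I)"
proof (rule primeidealI)
 note iJ = prime_ideal[OF J]
 note mem = rcos_mem_image_iff[OF I iJ IJ]
 show "ideal ((+>\<^bsub>R\<^esub>) I ` J) (R Quot I)" by (rule ring_ideal_imp_quot_ideal[OF I iJ])
 show "cring (R Quot I)" by (rule ideal.quotient_is_cring[OF I is_cring])
 show "carrier (R Quot I) \<noteq> (+>\<^bsub>R\<^esub>) I ` J"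
  using rcos_closed[OF one_closed, of I] mem[OF one_closed] prime_one[OF J] by auto
 fix Z Y assume XY: "Z \<in> carrier (R Quot I)" "Y \<in> carrier (R Quot I)" "Z \<otimes>\<^bsub>R Quot I\<^esub> Y \<in> (+>\<^bsub>R\<^esub>) I ` J"
 obtain a b where ab: "a \<in> carrier R" "b \<in> carrier R" "Z = I +>\<^bsub>R\<^esub> a" "Y = I +>\<^bsub>R\<^esub> b"
  using quot_carrier_ex XY(1,2) by metis
 have "Z \<otimes>\<^bsub>R Quot I\<^esub> Y = I +>\<^bsub>R\<^esub> (a \<otimes> b)"
  unfolding ab(3,4) using ring_hom_mult[OF ideal.rcos_ring_hom[OF I] ab(1,2)] by simp
 then have "a \<otimes> b \<in> J" using XY(3) mem[of "a \<otimes> b"] ab by simp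
 then have "a \<in> J \<or> b \<in> J" using primeideal.I_prime[OF J] ab by simp
 then show "Z \<in> (+>\<^bsub>R\<^esub>) I ` J \<or> Y \<in> (+>\<^bsub>R\<^esub>) I ` J" using ab by blast
qed

lemma (in cring) quot_psubset:
 assumes I: "ideal I R" and J: "ideal J R" "ideal J' R" and "I \<subseteq> J" "J \<subset> J'"
 shows "(+>\<^bsub>R\<^esub>) I ` J \<subset> (+>\<^bsub>R\<^esub>) I ` J'"
proof -
 obtain a where a: "a \<in> J'" "a \<notin> J" using assms by blast
 then have "a \<in> carrier R" using ideal_carrier[OF J(2)] by blast
 then have "I +>\<^bsub>R\<^esub> a \<notin> (+>\<^bsub>R\<^esub>) I ` J" using rcos_mem_image_iff[OF I J(1) assms(4)] a by blast
 moreover have "I +>\<^bsub>R\<^esub> a \<in> (+>\<^bsub>R\<^esub>) I ` J'" using a by blast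
 moreover have "(+>\<^bsub>R\<^esub>) I ` J \<subseteq> (+>\<^bsub>R\<^esub>) I ` J'" using assms(5) by blast
 ultimately show ?thesis by blast
qed

text \<open>Since \<open>R\<close> has depth \<open>dim S - c = dim R\<close>, its associated primes are minimal over the annihilator.
 Hence the fractions that express the elements of \<open>R\<close> at the minimal primes have denominators outside
 any given associated prime.\<close>

lemma birational_denominator:
 fixes S :: "('a, 'r) ring_scheme" and R :: "('b, 'q) ring_scheme" and \<phi> :: "'a => 'b"
 defines "RS \<equiv> restrict_scalars \<phi> R"
 defines "S' \<equiv> S Quot annihilator S RS"
 defines "\<phi>' \<equiv> \<lambda>P. the_elem (\<phi> ` P)"
 assumes reg: "regular_local_ring S \<mm>" and R: "cring R" and \<phi>: "\<phi> \<in> ring_hom S R"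
  and loc_iso: "\<And>p. minimal_prime S' p ==>
      localization_map R (carrier S' - p) \<phi>'
       \<in> ring_iso (localization S' (carrier S' - p)) (localization R (\<phi>' ` (carrier S' - p)))"
  and codim: "codimension S RS = ereal (real c)" and ex: "exact_free S b d" and b: "\<And>i. c < i ==> b i = 0"
  and \<epsilon>: "\<epsilon> \<in> mod_hom S (free_mod S (b 0)) RS" "\<epsilon> ` carrier (free_mod S (b 0)) = carrier RS"
   "d 0 ` carrier (free_mod S (b 1)) = mod_ker (free_mod S (b 0)) RS \<epsilon>"
  and y: "y \<in> carrier R" "y \<noteq> \<zero>\<^bsub>R\<^esub>" and P: "P = {s \<in> carrier S. \<phi> s \<otimes>\<^bsub>R\<^esub> y = \<zero>\<^bsub>R\<^esub>}" "primeideal P S"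
  and r: "r \<in> carrier R"
 shows "\<exists>u\<in>carrier S - P. \<exists>a\<in>carrier S. \<phi> u \<otimes>\<^bsub>R\<^esub> r = \<phi> a"
proof -
 have locS: "local_ring S \<mm>" using reg by (simp add: regular_local_ring_def)
 then interpret S: cring S by (simp add: local_ring_def)
 interpret R: cring R by fact
 interpret \<phi>: ring_hom_cring S R \<phi> using \<phi> by unfold_locales
 define I where "I = annihilator S RS"
 have I_eq: "I = {s \<in> carrier S. \<phi> s = \<zero>\<^bsub>R\<^esub>}"
 proof -
  have "\<phi> s = \<zero>\<^bsub>R\<^esub>" if "s \<in> carrier S" "\<forall>x\<in>carrier R. \<phi> s \<otimes>\<^bsub>R\<^esub> x = \<zero>\<^bsub>R\<^esub>" for s
   using that(2)[rule_format, OF R.one_closed] that(1) by simp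
  then show ?thesis unfolding I_def annihilator_def RS_def by auto
 qed
 have I: "ideal I S" unfolding I_eq by (rule S.idealI_simple) auto
 obtain n x where n: "krull_dim S = ereal (real n)" and x: "S.regular_seq n x" "\<And>i. i < n ==> x i \<in> \<mm>"
  by (rule S.regular_local_regular_seq[OF reg]) (rule that)
 have dimA: "krull_dim S' = ereal (real n - real c)"
 proof -
  have "ereal (real n) - krull_dim S' = ereal (real c)" using codim n by (simp add: codimension_def module_dim_def S'_def)
  then show ?thesis by (cases "krull_dim S'") auto
 qed
 obtain z where z: "z \<in> S.Vec (b 0)" "\<epsilon> z = y"
  using \<epsilon>(2) y(1) unfolding RS_def restrict_scalars_simps by (metis imageE)
 have kerI: "v \<in> d 0 ` S.Vec (b 1) \<longleftrightarrow> v \<in> S.Vec (b 0) \<and> \<epsilon> v = \<zero>\<^bsub>R\<^esub>" for v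
  unfolding \<epsilon>(3) mod_ker_def RS_def by simp
 \<comment> \<open>\<open>P\<close> is the annihilator of \<open>y\<close>, hence associated to the
   module with resolution \<open>b\<close>, and a chain of length \<open>n - c\<close> starts at
   it.\<close>
 have "\<exists>p. S.prime_chain (n - c) p \<and> p 0 = P"
 proof (rule S.assoc_prime_chain[OF locS x ex b z(1) _ _ P(2)])
  show "z \<notin> d 0 ` S.Vec (b 1)" using kerI z y by simp
  have "s \<odot>\<^bsub>S.Free (b 0)\<^esub> z \<in> d 0 ` S.Vec (b 1) \<longleftrightarrow> \<phi> s \<otimes>\<^bsub>R\<^esub> y = \<zero>\<^bsub>R\<^esub>"
   if s: "s \<in> carrier S" for s
   using kerI[of "s \<odot>\<^bsub>S.Free (b 0)\<^esub> z"] mod_hom_smult[OF \<epsilon>(1) s z(1)] S.Free.smult_closed[OF s z(1)] z(2)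
   unfolding RS_def restrict_scalars_simps by (simp only: simp_thms)
  then show "P = {s \<in> carrier S. s \<odot>\<^bsub>S.Free (b 0)\<^esub> z \<in> d 0 ` S.Vec (b 1)}" unfolding P(1) by blast
 qed
 then obtain p where p: "S.prime_chain (n - c) p" "p 0 = P" by blast
 have IP: "I \<subseteq> P" unfolding I_eq P(1) using y by auto
 have pp: "primeideal (p i) S" if "i \<le> n - c" for i using p(1) that by (simp add: S.prime_chain_def)
 have Ip: "I \<subseteq> p i" if "i \<le> n - c" for i using that
 proof (induction i)
  case 0
  then show ?case using IP p by simp
 next
  case (Suc i)
  then have "p i \<subset> p (Suc i)" using p(1) by (simp add: S.prime_chain_def)
  then show ?case using Suc by simp
 qed
 define q where "q i = (+>\<^bsub>S\<^esub>) I ` p i" for i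
 have S'_eq: "S' = S Quot I" by (simp add: S'_def I_def)
 have qp: "primeideal (q i) S'" if "i \<le> n - c" for i unfolding q_def S'_eq by (rule S.quot_prime[OF I pp[OF that] Ip[OF that]])
 have qs: "q i \<subset> q (Suc i)" if "i < n - c" for i unfolding q_def using that p(1)
  by (intro S.quot_psubset[OF I S.prime_ideal[OF pp] S.prime_ideal[OF pp] Ip]) (auto simp: S.prime_chain_def)
 \<comment> \<open>A prime strictly below \<open>q 0\<close> would prolong the chain to length n - c
   + 1, more than the dimension of \<open>S'\<close>.\<close>
 have min: "minimal_prime S' (q 0)" unfolding minimal_prime_def
 proof (intro conjI allI impI)
  show "primeideal (q 0) S'" by (rule qp) simp
  fix q' assume q': "primeideal q' S'" "q' \<subseteq> q 0"
  show "q' = q 0"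
  proof (rule ccontr)
   assume "q' \<noteq> q 0"
   then have "q' \<subset> q 0" using q' by blast
   then have "ereal (real (Suc (n - c))) \<le> krull_dim S'" using q'(1) qp qs
    by (intro krull_dim_ge[of _ "\<lambda>i. case i of 0 => q' | Suc i => q i"]) (auto split: nat.split)
   then show False unfolding dimA by simp
  qed
 qed
 define U where "U = carrier S' - q 0"
 have iso: "localization_map R U \<phi>' \<in> ring_iso (localization S' U) (localization R (\<phi>' ` U))"
  unfolding U_def by (rule loc_iso[OF min])
 have \<phi>'_rcos: "\<phi>' (I +>\<^bsub>S\<^esub> a) = \<phi> a" if a: "a \<in> carrier S" for a
 proof -
  have "\<phi> ` (I +>\<^bsub>S\<^esub> a) = {\<phi> a}"
  proof
   show "\<phi> ` (I +>\<^bsub>S\<^esub> a) \<subseteq> {\<phi> a}" using a by (auto simp: a_r_coset_def' I_eq)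
   have "\<zero>\<^bsub>S\<^esub> \<oplus>\<^bsub>S\<^esub> a \<in> I +>\<^bsub>S\<^esub> a" unfolding a_r_coset_def' using S.ideal_zero[OF I] by blast
   then show "{\<phi> a} \<subseteq> \<phi> ` (I +>\<^bsub>S\<^esub> a)" using a by auto
  qed
  then show ?thesis by (simp add: \<phi>'_def)
 qed
 have U_ex: "\<exists>a\<in>carrier S - P. Z = I +>\<^bsub>S\<^esub> a" if Z: "Z \<in> U" for Z
 proof -
  obtain a where a: "a \<in> carrier S" "Z = I +>\<^bsub>S\<^esub> a" using S.quot_carrier_ex[of Z I] Z unfolding U_def S'_eq by blast
  then have "a \<notin> P" using Z unfolding U_def q_def p(2) by blast
  then show ?thesis using a by blast
 qed
 have mem0: "I +>\<^bsub>S\<^esub> a \<in> q 0 \<longleftrightarrow> a \<in> P" if "a \<in> carrier S" for a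
  unfolding q_def p(2) by (rule S.rcos_mem_image_iff[OF I S.prime_ideal[OF P(2)] IP that])
 have oneU: "I +>\<^bsub>S\<^esub> \<one>\<^bsub>S\<^esub> \<in> U"
  using S.rcos_closed[OF S.one_closed, of I] mem0[OF S.one_closed] S.prime_one[OF P(2)] by (simp add: U_def S'_eq)
 have one': "\<one>\<^bsub>R\<^esub> \<in> \<phi>' ` U" using oneU \<phi>'_rcos[OF S.one_closed] by (metis \<phi>.hom_one imageI)
 \<comment> \<open>By surjectivity of the localized map at the minimal prime \<open>q 0\<close>,
   \<open>r/1\<close> is the image of a fraction; reading equality of fractions and multiplying by
   the two denominators gives the claim.\<close>
 have "fraction R (\<phi>' ` U) r \<one>\<^bsub>R\<^esub> \<in> carrier (localization R (\<phi>' ` U))"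
  unfolding localization_def partial_object.simps using r one' by blast
 moreover have "localization_map R U \<phi>' ` carrier (localization S' U) = carrier (localization R (\<phi>' ` U))"
  using iso by (simp add: ring_iso_def bij_betw_def)
 ultimately obtain Z where Z: "Z \<in> carrier (localization S' U)" "localization_map R U \<phi>' Z = fraction R (\<phi>' ` U) r \<one>\<^bsub>R\<^esub>"
  by (metis imageE)
 have "(r, \<one>\<^bsub>R\<^esub>) \<in> fraction R (\<phi>' ` U) r \<one>\<^bsub>R\<^esub>"
 proof -
  have "\<one>\<^bsub>R\<^esub> \<otimes>\<^bsub>R\<^esub> (\<one>\<^bsub>R\<^esub> \<otimes>\<^bsub>R\<^esub> r \<ominus>\<^bsub>R\<^esub> \<one>\<^bsub>R\<^esub> \<otimes>\<^bsub>R\<^esub> r) = \<zero>\<^bsub>R\<^esub>"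
   using r by (simp add: R.minus_eq R.r_neg)
  then show ?thesis unfolding fraction_def using r one' by blast
 qed
 then have "(r, \<one>\<^bsub>R\<^esub>) \<in> localization_map R U \<phi>' Z" using Z(2) by simp
 then obtain B V where BV: "(B, V) \<in> Z" "(r, \<one>\<^bsub>R\<^esub>) \<in> fraction R (\<phi>' ` U) (\<phi>' B) (\<phi>' V)"
  unfolding localization_map_def by auto
 have BVc: "B \<in> carrier S'" "V \<in> U" using Z(1) BV(1) unfolding localization_def fraction_def by auto
 obtain W where W: "W \<in> U" "\<phi>' W \<otimes>\<^bsub>R\<^esub> (\<one>\<^bsub>R\<^esub> \<otimes>\<^bsub>R\<^esub> \<phi>' B \<ominus>\<^bsub>R\<^esub> \<phi>' V \<otimes>\<^bsub>R\<^esub> r) = \<zero>\<^bsub>R\<^esub>"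
  using BV(2) unfolding fraction_def by auto
 obtain w where w: "w \<in> carrier S - P" "W = I +>\<^bsub>S\<^esub> w" using U_ex[OF W(1)] by (rule bexE)
 obtain v where v: "v \<in> carrier S - P" "V = I +>\<^bsub>S\<^esub> v" using U_ex[OF BVc(2)] by (rule bexE)
 obtain a where a: "a \<in> carrier S" "B = I +>\<^bsub>S\<^esub> a" using S.quot_carrier_ex[OF BVc(1)[unfolded S'_eq]] by (rule bexE)
 have c: "\<phi> w \<in> carrier R" "\<phi> v \<in> carrier R" "\<phi> a \<in> carrier R" using w v a by auto
 have "\<phi> w \<otimes>\<^bsub>R\<^esub> (\<one>\<^bsub>R\<^esub> \<otimes>\<^bsub>R\<^esub> \<phi> a \<ominus>\<^bsub>R\<^esub> \<phi> v \<otimes>\<^bsub>R\<^esub> r) = \<zero>\<^bsub>R\<^esub>"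
  using W(2) w v a by (simp add: \<phi>'_rcos)
 then have "(\<phi> w \<otimes>\<^bsub>R\<^esub> \<phi> v) \<otimes>\<^bsub>R\<^esub> r \<oplus>\<^bsub>R\<^esub> \<phi> w \<otimes>\<^bsub>R\<^esub> (\<one>\<^bsub>R\<^esub> \<otimes>\<^bsub>R\<^esub> \<phi> a \<ominus>\<^bsub>R\<^esub> \<phi> v \<otimes>\<^bsub>R\<^esub> r) = (\<phi> w \<otimes>\<^bsub>R\<^esub> \<phi> v) \<otimes>\<^bsub>R\<^esub> r"
  using c r by simp
 moreover have "(\<phi> w \<otimes>\<^bsub>R\<^esub> \<phi> v) \<otimes>\<^bsub>R\<^esub> r \<oplus>\<^bsub>R\<^esub> \<phi> w \<otimes>\<^bsub>R\<^esub> (\<one>\<^bsub>R\<^esub> \<otimes>\<^bsub>R\<^esub> \<phi> a \<ominus>\<^bsub>R\<^esub> \<phi> v \<otimes>\<^bsub>R\<^esub> r) = \<phi> w \<otimes>\<^bsub>R\<^esub> \<phi> a"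
  using c r by algebra
 ultimately have e: "\<phi> w \<otimes>\<^bsub>R\<^esub> \<phi> a = (\<phi> w \<otimes>\<^bsub>R\<^esub> \<phi> v) \<otimes>\<^bsub>R\<^esub> r" by simp
 have "w \<in> carrier S" "v \<in> carrier S" using w v by auto
 then have "\<phi> (w \<otimes>\<^bsub>S\<^esub> v) \<otimes>\<^bsub>R\<^esub> r = \<phi> (w \<otimes>\<^bsub>S\<^esub> a)"
  using e a(1) by simp
 moreover have "w \<otimes>\<^bsub>S\<^esub> v \<in> carrier S - P" by (rule S.prime_mult_notin[OF P(2) w(1) v(1)])
 moreover have "w \<otimes>\<^bsub>S\<^esub> a \<in> carrier S" using w a by simp
 ultimately show ?thesis by blast
qed

section \<open>Comparison of resolutions\<close>

text \<open>The property by which \<open>chain_lift\<close> is chosen, for arbitrary complexes whose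
  modules may have elements of different types.\<close>

definition chain_map_over where
 "chain_map_over S P dP \<epsilon>P Q dQ \<epsilon>Q f \<theta> \<longleftrightarrow>
   (\<forall>i::nat. \<theta> i \<in> mod_hom S (P i) (Q i)) \<and>
   (\<forall>x\<in>carrier (P 0). \<epsilon>Q (\<theta> 0 x) = f (\<epsilon>P x)) \<and>
   (\<forall>i. \<forall>x\<in>carrier (P (Suc i)). dQ i (\<theta> (Suc i) x) = \<theta> i (dP i x))"

lemma chain_map_overD:
 assumes "chain_map_over S P dP \<epsilon>P Q dQ \<epsilon>Q f \<theta>"
 shows "\<theta> i \<in> mod_hom S (P i) (Q i)"
  and "x \<in> carrier (P 0) ==> \<epsilon>Q (\<theta> 0 x) = f (\<epsilon>P x)"
  and "y \<in> carrier (P (Suc i)) ==> dQ i (\<theta> (Suc i) y) = \<theta> i (dP i y)"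
 using assms by (auto simp: chain_map_over_def)

lemma resolutionD:
 assumes "resolution S M C d \<epsilon>"
 shows "module S (C i)" and "\<epsilon> \<in> mod_hom S (C 0) M" and "d i \<in> mod_hom S (C (Suc i)) (C i)"
  and "y \<in> carrier M ==> \<exists>x\<in>carrier (C 0). y = \<epsilon> x"
  and "x \<in> carrier (C 0) ==> \<epsilon> x = \<zero>\<^bsub>M\<^esub> ==> \<exists>w\<in>carrier (C (Suc 0)). x = d 0 w"
  and "w \<in> carrier (C (Suc 0)) ==> \<epsilon> (d 0 w) = \<zero>\<^bsub>M\<^esub>"
  and "v \<in> carrier (C (Suc i)) ==> d i v = \<zero>\<^bsub>C i\<^esub> ==> \<exists>w\<in>carrier (C (Suc (Suc i))). v = d (Suc i) w"
  and "u \<in> carrier (C (Suc (Suc i))) ==> d i (d (Suc i) u) = \<zero>\<^bsub>C i\<^esub>"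
proof -
 note a = assms[unfolded resolution_def mod_ker_def One_nat_def]
 show "module S (C i)" "\<epsilon> \<in> mod_hom S (C 0) M" "d i \<in> mod_hom S (C (Suc i)) (C i)" using a by auto
 have e0: "\<epsilon> ` carrier (C 0) = carrier M" and e1: "d 0 ` carrier (C (Suc 0)) = {x \<in> carrier (C 0). \<epsilon> x = \<zero>\<^bsub>M\<^esub>}"
  and e2: "d (Suc i) ` carrier (C (Suc (Suc i))) = {x \<in> carrier (C (Suc i)). d i x = \<zero>\<^bsub>C i\<^esub>}" using a by auto
 show "y \<in> carrier M ==> \<exists>x\<in>carrier (C 0). y = \<epsilon> x" using e0 by blast
 show "x \<in> carrier (C 0) ==> \<epsilon> x = \<zero>\<^bsub>M\<^esub> ==> \<exists>w\<in>carrier (C (Suc 0)). x = d 0 w" using e1 by blast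
 show "w \<in> carrier (C (Suc 0)) ==> \<epsilon> (d 0 w) = \<zero>\<^bsub>M\<^esub>" using e1 by blast
 show "v \<in> carrier (C (Suc i)) ==> d i v = \<zero>\<^bsub>C i\<^esub> ==> \<exists>w\<in>carrier (C (Suc (Suc i))). v = d (Suc i) w" using e2 by blast
 show "u \<in> carrier (C (Suc (Suc i))) ==> d i (d (Suc i) u) = \<zero>\<^bsub>C i\<^esub>" using e2 by blast
qed

context cring
begin

lemma fg_projective_free: "fg_projective R (Free n)" unfolding fg_projective_def
 by (intro conjI free_module exI[of _ n] bexI[OF _ mod_hom_id] ballI refl)

text \<open>The images of the basis of R^n under the retraction onto \<open>P\<close> are lifted one
  by one; the section into R^n then gives the lift on \<open>P\<close>.\<close>

lemma projective_lift:
 fixes P :: "('a, 'x) module" and M :: "('a, 'y) module" and N :: "('a, 'z) module"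
 assumes P: "fg_projective R P" and M: "module R M" and N: "module R N" and g: "g \<in> mod_hom R M N" and f: "f \<in> mod_hom R P N"
  and im: "\<And>x. x \<in> carrier P ==> f x \<in> g ` carrier M"
 shows "\<exists>h\<in>mod_hom R P M. \<forall>x\<in>carrier P. g (h x) = f x"
proof -
 interpret M: lmodule R M by (rule lmodule.intro) fact
 interpret N: lmodule R N by (rule lmodule.intro) fact
 obtain n \<iota> \<pi> where \<iota>: "\<iota> \<in> mod_hom R P (Free n)" and \<pi>: "\<pi> \<in> mod_hom R (Free n) P"
  and \<pi>\<iota>: "\<forall>x\<in>carrier P. \<pi> (\<iota> x) = x" using P unfolding fg_projective_def by blast
 have "\<forall>k\<in>{..<n}. \<exists>u. u \<in> carrier M \<and> g u = f (\<pi> (unitvec k))"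
 proof
  fix k assume "k \<in> {..<n}"
  then have "\<pi> (unitvec k) \<in> carrier P" using mod_hom_closed[OF \<pi>] unitvec_closed by simp
  from im[OF this] show "\<exists>u. u \<in> carrier M \<and> g u = f (\<pi> (unitvec k))" by (metis imageE)
 qed
 then have "\<exists>u. \<forall>k\<in>{..<n}. u k \<in> carrier M \<and> g (u k) = f (\<pi> (unitvec k))" by (rule bchoice)
 then obtain u where u: "\<And>k. k < n ==> u k \<in> carrier M" "\<And>k. k < n ==> g (u k) = f (\<pi> (unitvec k))"
  by auto
 let ?h = "\<lambda>v. lincomb M n v u"
 have h: "?h \<in> mod_hom R (Free n) M" using u(1) by (rule M.lincomb_hom)
 have gh: "g (?h v) = f (\<pi> v)" if v: "v \<in> Vec n" for v
 proof (rule N.free_hom_eqI[OF mod_hom_comp[OF h g] mod_hom_comp[OF \<pi> f] _ v])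
  fix k assume k: "k < n"
  show "g (lincomb M n (unitvec k) u) = f (\<pi> (unitvec k))" using M.lincomb_unit[OF k u(1)] u(2)[OF k] by simp
 qed
 have "g (?h (\<iota> x)) = f x" if "x \<in> carrier P" for x using gh[OF mod_hom_closed[OF \<iota> that]] \<pi>\<iota> that by simp
 then show ?thesis by (intro bexI[OF _ mod_hom_comp[OF \<iota> h]] ballI)
qed

lemma chain_map_ex:
 fixes M :: "('a, 'y) module" and N :: "('a, 'z) module"
  and P :: "nat => ('a, 'u) module" and Q :: "nat => ('a, 'v) module"
 assumes P: "resolution R M P dP \<epsilon>P" and proj: "\<And>i. fg_projective R (P i)"
  and Q: "resolution R N Q dQ \<epsilon>Q" and M: "module R M" and N: "module R N" and f: "f \<in> mod_hom R M N"
 shows "\<exists>\<theta>. chain_map_over R P dP \<epsilon>P Q dQ \<epsilon>Q f \<theta>"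
proof -
 note p = resolutionD[OF P] and q = resolutionD[OF Q]
 note dPc = mod_hom_closed[OF p(3)]
 \<comment> \<open>The last clause, that \<open>t\<close> maps boundaries to boundaries, is exactly
   what makes the next lift possible.\<close>
 define good where "good n t \<longleftrightarrow> t \<in> mod_hom R (P n) (Q n) \<and>
  (n = 0 --> (\<forall>x\<in>carrier (P 0). \<epsilon>Q (t x) = f (\<epsilon>P x))) \<and>
  (\<forall>x\<in>carrier (P (Suc n)). t (dP n x) \<in> dQ n ` carrier (Q (Suc n)))" for n t
 define nxt where "nxt n t t' \<longleftrightarrow> (\<forall>x\<in>carrier (P (Suc n)). dQ n (t' x) = t (dP n x))" for n t t'
 have "\<exists>t. good 0 t"
 proof -
  have "\<exists>t\<in>mod_hom R (P 0) (Q 0). \<forall>x\<in>carrier (P 0). \<epsilon>Q (t x) = f (\<epsilon>P x)"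
  proof (rule projective_lift[OF proj q(1) N q(2) mod_hom_comp[OF p(2) f]])
   fix x assume "x \<in> carrier (P 0)"
   then have "f (\<epsilon>P x) \<in> carrier N" using mod_hom_closed[OF f mod_hom_closed[OF p(2)]] by blast
   then show "f (\<epsilon>P x) \<in> \<epsilon>Q ` carrier (Q 0)" using q(4) by blast
  qed
  then obtain t where t: "t \<in> mod_hom R (P 0) (Q 0)" "\<And>x. x \<in> carrier (P 0) ==> \<epsilon>Q (t x) = f (\<epsilon>P x)" by blast
  have "t (dP 0 x) \<in> dQ 0 ` carrier (Q (Suc 0))" if x: "x \<in> carrier (P (Suc 0))" for x
  proof -
   have "\<epsilon>Q (t (dP 0 x)) = f \<zero>\<^bsub>M\<^esub>" using t(2)[OF dPc[OF x]] p(6)[OF x] by simp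
   then have "\<epsilon>Q (t (dP 0 x)) = \<zero>\<^bsub>N\<^esub>" using mod_hom_zero[OF M N f] by simp
   then show ?thesis using q(5)[OF mod_hom_closed[OF t(1) dPc[OF x]]] by blast
  qed
  then show ?thesis using t by (auto simp: good_def)
 qed
 moreover have "\<exists>t'. good (Suc n) t' \<and> nxt n t t'" if t: "good n t" for n t
 proof -
  have th: "t \<in> mod_hom R (P n) (Q n)" using t by (simp add: good_def)
  have "\<exists>t'\<in>mod_hom R (P (Suc n)) (Q (Suc n)). \<forall>x\<in>carrier (P (Suc n)). dQ n (t' x) = t (dP n x)"
   by (rule projective_lift[OF proj q(1) q(1) q(3) mod_hom_comp[OF p(3) th]]) (use t in \<open>simp add: good_def\<close>)
  then obtain t' where t': "t' \<in> mod_hom R (P (Suc n)) (Q (Suc n))" "\<And>x. x \<in> carrier (P (Suc n)) ==> dQ n (t' x) = t (dP n x)"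
   by blast
  have "t' (dP (Suc n) x) \<in> dQ (Suc n) ` carrier (Q (Suc (Suc n)))" if x: "x \<in> carrier (P (Suc (Suc n)))" for x
  proof -
   have "dQ n (t' (dP (Suc n) x)) = t \<zero>\<^bsub>P n\<^esub>" using t'(2)[OF dPc[OF x]] p(8)[OF x] by simp
   then have "dQ n (t' (dP (Suc n) x)) = \<zero>\<^bsub>Q n\<^esub>" using mod_hom_zero[OF p(1) q(1) th] by simp
   then show ?thesis using q(7)[OF mod_hom_closed[OF t'(1) dPc[OF x]]] by blast
  qed
  then show ?thesis using t' by (auto simp: good_def nxt_def)
 qed
 ultimately have "\<exists>\<theta>. \<forall>n. good n (\<theta> n) \<and> nxt n (\<theta> n) (\<theta> (Suc n))"
  by (intro dependent_nat_choice) auto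
 then obtain \<theta> where \<theta>: "\<forall>n. good n (\<theta> n) \<and> nxt n (\<theta> n) (\<theta> (Suc n))" by (rule exE)
 have "chain_map_over R P dP \<epsilon>P Q dQ \<epsilon>Q f \<theta>" using \<theta> by (simp add: good_def nxt_def chain_map_over_def)
 then show ?thesis by blast
qed

lemma chain_homotopy_ex:
 fixes M :: "('a, 'y) module" and N :: "('a, 'z) module"
  and P :: "nat => ('a, 'u) module" and Q :: "nat => ('a, 'v) module"
 assumes P: "resolution R M P dP \<epsilon>P" and proj: "\<And>i. fg_projective R (P i)"
  and Q: "resolution R N Q dQ \<epsilon>Q" and N: "module R N"
  and t: "chain_map_over R P dP \<epsilon>P Q dQ \<epsilon>Q f t" and t': "chain_map_over R P dP \<epsilon>P Q dQ \<epsilon>Q f t'"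
 shows "\<exists>s. (\<forall>i. s i \<in> mod_hom R (P i) (Q (Suc i))) \<and>
  (\<forall>x\<in>carrier (P 0). t 0 x \<ominus>\<^bsub>Q 0\<^esub> t' 0 x = dQ 0 (s 0 x)) \<and>
  (\<forall>i. \<forall>x\<in>carrier (P (Suc i)). t (Suc i) x \<ominus>\<^bsub>Q (Suc i)\<^esub> t' (Suc i) x \<ominus>\<^bsub>Q (Suc i)\<^esub> s i (dP i x) = dQ (Suc i) (s (Suc i) x))"
proof -
 note p = resolutionD[OF P] and q = resolutionD[OF Q]
 note dPc = mod_hom_closed[OF p(3)]
 note th = chain_map_overD(1)[OF t] and th' = chain_map_overD(1)[OF t']
 interpret Qm: lmodule R "Q k" for k by (rule lmodule.intro) (rule q(1))
 interpret Nm: lmodule R N by (rule lmodule.intro) (rule N)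
 have diffh: "(\<lambda>x. t i x \<ominus>\<^bsub>Q i\<^esub> t' i x) \<in> mod_hom R (P i) (Q i)" for i
  by (rule Qm.mod_hom_subf[OF th th' p(1)])
 \<comment> \<open>The last clause says that in the next degree the difference minus
   \<open>s d\<close> is a cycle, hence can be lifted.\<close>
 define good where "good n s \<longleftrightarrow> s \<in> mod_hom R (P n) (Q (Suc n)) \<and>
  (n = 0 --> (\<forall>x\<in>carrier (P 0). t 0 x \<ominus>\<^bsub>Q 0\<^esub> t' 0 x = dQ 0 (s x))) \<and>
  (\<forall>x\<in>carrier (P (Suc n)). t n (dP n x) \<ominus>\<^bsub>Q n\<^esub> t' n (dP n x) = dQ n (s (dP n x)))" for n s
 define nxt where "nxt n s s' \<longleftrightarrow> (\<forall>x\<in>carrier (P (Suc n)).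
   t (Suc n) x \<ominus>\<^bsub>Q (Suc n)\<^esub> t' (Suc n) x \<ominus>\<^bsub>Q (Suc n)\<^esub> s (dP n x) = dQ (Suc n) (s' x))" for n s s'
 have "\<exists>s. good 0 s"
 proof -
  have "\<exists>s\<in>mod_hom R (P 0) (Q (Suc 0)). \<forall>x\<in>carrier (P 0). dQ 0 (s x) = t 0 x \<ominus>\<^bsub>Q 0\<^esub> t' 0 x"
  proof (rule projective_lift[OF proj q(1) q(1) q(3) diffh])
   fix x assume x: "x \<in> carrier (P 0)"
   have tc: "t 0 x \<in> carrier (Q 0)" "t' 0 x \<in> carrier (Q 0)" using mod_hom_closed[OF th x] mod_hom_closed[OF th' x] by auto
   have "\<epsilon>Q (t 0 x \<ominus>\<^bsub>Q 0\<^esub> t' 0 x) = \<epsilon>Q (t 0 x) \<ominus>\<^bsub>N\<^esub> \<epsilon>Q (t' 0 x)"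
    by (rule mod_hom_minus[OF q(1) N q(2) tc])
   also have "\<epsilon>Q (t' 0 x) = \<epsilon>Q (t 0 x)" using chain_map_overD(2)[OF t x] chain_map_overD(2)[OF t' x] by simp
   also have "\<epsilon>Q (t 0 x) \<ominus>\<^bsub>N\<^esub> \<epsilon>Q (t 0 x) = \<zero>\<^bsub>N\<^esub>"
    by (rule Nm.minus_self[OF mod_hom_closed[OF q(2) tc(1)]])
   finally show "t 0 x \<ominus>\<^bsub>Q 0\<^esub> t' 0 x \<in> dQ 0 ` carrier (Q (Suc 0))"
    using q(5)[OF Qm.M.minus_closed[OF tc]] by blast
  qed
  then obtain s where "s \<in> mod_hom R (P 0) (Q (Suc 0))" "\<And>x. x \<in> carrier (P 0) ==> dQ 0 (s x) = t 0 x \<ominus>\<^bsub>Q 0\<^esub> t' 0 x" by blast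
  then show ?thesis using dPc[of _ 0] by (auto simp: good_def intro!: exI[of _ s])
 qed
 moreover have "\<exists>s'. good (Suc n) s' \<and> nxt n s s'" if s: "good n s" for n s
 proof -
  have sh: "s \<in> mod_hom R (P n) (Q (Suc n))" using s by (simp add: good_def)
  let ?f = "\<lambda>x. t (Suc n) x \<ominus>\<^bsub>Q (Suc n)\<^esub> t' (Suc n) x \<ominus>\<^bsub>Q (Suc n)\<^esub> s (dP n x)"
  have fh: "?f \<in> mod_hom R (P (Suc n)) (Q (Suc n))" by (rule Qm.mod_hom_subf[OF diffh mod_hom_comp[OF p(3) sh] p(1)])
  have "\<exists>s'\<in>mod_hom R (P (Suc n)) (Q (Suc (Suc n))). \<forall>x\<in>carrier (P (Suc n)). dQ (Suc n) (s' x) = ?f x"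
  proof (rule projective_lift[OF proj q(1) q(1) q(3) fh])
   fix x assume x: "x \<in> carrier (P (Suc n))"
   have tc: "t (Suc n) x \<in> carrier (Q (Suc n))" "t' (Suc n) x \<in> carrier (Q (Suc n))" "s (dP n x) \<in> carrier (Q (Suc n))"
    using mod_hom_closed[OF th x] mod_hom_closed[OF th' x] mod_hom_closed[OF sh dPc[OF x]] by auto
   note dmin = mod_hom_minus[OF q(1) q(1) q(3)]
   have "dQ n (?f x) = dQ n (t (Suc n) x) \<ominus>\<^bsub>Q n\<^esub> dQ n (t' (Suc n) x) \<ominus>\<^bsub>Q n\<^esub> dQ n (s (dP n x))"
    using dmin[OF Qm.M.minus_closed[OF tc(1,2)] tc(3)] dmin[OF tc(1,2)] by simp
   also have "dQ n (t (Suc n) x) \<ominus>\<^bsub>Q n\<^esub> dQ n (t' (Suc n) x) = dQ n (s (dP n x))"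
    using chain_map_overD(3)[OF t x] chain_map_overD(3)[OF t' x] s x by (simp add: good_def)
   also have "dQ n (s (dP n x)) \<ominus>\<^bsub>Q n\<^esub> dQ n (s (dP n x)) = \<zero>\<^bsub>Q n\<^esub>"
    by (rule Qm.minus_self[OF mod_hom_closed[OF q(3) tc(3)]])
   finally show "?f x \<in> dQ (Suc n) ` carrier (Q (Suc (Suc n)))" using q(7)[OF mod_hom_closed[OF fh x]] by blast
  qed
  then obtain s' where s': "s' \<in> mod_hom R (P (Suc n)) (Q (Suc (Suc n)))" "\<And>x. x \<in> carrier (P (Suc n)) ==> dQ (Suc n) (s' x) = ?f x" by blast
  have "t (Suc n) (dP (Suc n) x) \<ominus>\<^bsub>Q (Suc n)\<^esub> t' (Suc n) (dP (Suc n) x) = dQ (Suc n) (s' (dP (Suc n) x))"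
   if x: "x \<in> carrier (P (Suc (Suc n)))" for x
  proof -
   have "s (dP n (dP (Suc n) x)) = \<zero>\<^bsub>Q (Suc n)\<^esub>" using p(8)[OF x] mod_hom_zero[OF p(1) q(1) sh] by simp
   then show ?thesis using s'(2)[OF dPc[OF x]] Qm.minus_zero_right[OF mod_hom_closed[OF diffh dPc[OF x]]] by simp
  qed
  then show ?thesis using s' by (auto simp: good_def nxt_def intro!: exI[of _ s'])
 qed
 ultimately have "\<exists>s. \<forall>n. good n (s n) \<and> nxt n (s n) (s (Suc n))" by (intro dependent_nat_choice) auto
 then obtain s where s: "\<forall>n. good n (s n) \<and> nxt n (s n) (s (Suc n))" by (rule exE)
 show ?thesis by (rule exI[of _ s]) (use s in \<open>simp add: good_def nxt_def\<close>)
qed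

section \<open>Cohomology classes\<close>

text \<open>Cochains are functions of which only the values on the carrier count; the extensional
  functions of \<open>hom_mod\<close> come in only where \<open>Ext\<close> itself is met.\<close>

definition functional :: "('a, 'x) module => ('x => 'a) => bool" where
 "functional M \<psi> \<longleftrightarrow> \<psi> \<in> mod_hom R M (self_module R)"

definition cocycle :: "(nat => ('a, 'x) module) => (nat => 'x => 'x) => nat => ('x => 'a) => bool" where
 "cocycle P d i \<psi> \<longleftrightarrow> functional (P i) \<psi> \<and> (\<forall>x\<in>carrier (P (Suc i)). \<psi> (d i x) = \<zero>)"

definition coboundary :: "(nat => ('a, 'x) module) => (nat => 'x => 'x) => nat => ('x => 'a) => bool" where
 "coboundary P d i \<psi> \<longleftrightarrow> (case i of 0 => \<forall>x\<in>carrier (P 0). \<psi> x = \<zero>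
   | Suc j => \<exists>h. functional (P j) h \<and> (\<forall>x\<in>carrier (P (Suc j)). \<psi> x = h (d j x)))"

lemma functionalD:
 assumes "functional M \<psi>"
 shows "x \<in> carrier M ==> \<psi> x \<in> carrier R"
  and "x \<in> carrier M ==> y \<in> carrier M ==> \<psi> (x \<oplus>\<^bsub>M\<^esub> y) = \<psi> x \<oplus> \<psi> y"
  and "s \<in> carrier R ==> x \<in> carrier M ==> \<psi> (s \<odot>\<^bsub>M\<^esub> x) = s \<otimes> \<psi> x"
  and "module R M ==> \<psi> \<zero>\<^bsub>M\<^esub> = \<zero>"
  and "module R M ==> x \<in> carrier M ==> y \<in> carrier M ==> \<psi> (x \<ominus>\<^bsub>M\<^esub> y) = \<psi> x \<ominus> \<psi> y"
 using mod_hom_closed[OF assms[unfolded functional_def]] mod_hom_add[OF assms[unfolded functional_def]]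
  mod_hom_smult[OF assms[unfolded functional_def]]
  mod_hom_zero[OF _ module_self assms[unfolded functional_def]]
  mod_hom_minus[OF _ module_self assms[unfolded functional_def]] by auto

lemma functional_comp: "f \<in> mod_hom R M N ==> functional N \<psi> ==> functional M (\<lambda>x. \<psi> (f x))"
 unfolding functional_def by (rule mod_hom_comp)

lemma functional_add: "functional M \<psi> ==> functional M \<chi> ==> functional M (\<lambda>x. \<psi> x \<oplus> \<chi> x)"
 unfolding functional_def using Self.mod_hom_addf by fastforce

lemma functional_smult: "functional M \<psi> ==> s \<in> carrier R ==> functional M (\<lambda>x. s \<otimes> \<psi> x)"
 unfolding functional_def using Self.mod_hom_smultf by fastforce

lemma functional_minus: "module R M ==> functional M \<psi> ==> functional M \<chi> ==> functional M (\<lambda>x. \<psi> x \<ominus> \<chi> x)"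
 unfolding functional_def using Self.mod_hom_subf by fastforce

lemma functional_zero: "functional M (\<lambda>x. \<zero>)" unfolding functional_def using Self.mod_hom_zerof by simp

lemma functional_cong: "module R M ==> functional M \<psi> ==> (\<And>x. x \<in> carrier M ==> \<chi> x = \<psi> x) ==> functional M \<chi>"
 unfolding functional_def by (rule mod_hom_cong)

lemma coboundary_cong:
 assumes "coboundary P d i \<psi>" "\<And>x. x \<in> carrier (P i) ==> \<chi> x = \<psi> x"
 shows "coboundary P d i \<chi>"
 using assms by (cases i) (auto simp: coboundary_def)

lemma coboundary_add:
 assumes "coboundary P d i \<psi>" "coboundary P d i \<chi>"
 shows "coboundary P d i (\<lambda>x. \<psi> x \<oplus> \<chi> x)"
proof (cases i)
 case (Suc j)
 then obtain h h' where "functional (P j) h" "functional (P j) h'"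
  "\<forall>x\<in>carrier (P (Suc j)). \<psi> x = h (d j x)" "\<forall>x\<in>carrier (P (Suc j)). \<chi> x = h' (d j x)"
  using assms by (auto simp: coboundary_def)
 then show ?thesis using Suc functional_add by (auto simp: coboundary_def intro!: exI[of _ "\<lambda>x. h x \<oplus> h' x"])
qed (use assms in \<open>auto simp: coboundary_def\<close>)

lemma coboundary_smult:
 assumes "coboundary P d i \<psi>" "s \<in> carrier R"
 shows "coboundary P d i (\<lambda>x. s \<otimes> \<psi> x)"
proof (cases i)
 case (Suc j)
 then obtain h where "functional (P j) h" "\<forall>x\<in>carrier (P (Suc j)). \<psi> x = h (d j x)"
  using assms by (auto simp: coboundary_def)
 then show ?thesis using Suc functional_smult assms(2) by (auto simp: coboundary_def intro!: exI[of _ "\<lambda>x. s \<otimes> h x"])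
qed (use assms in \<open>auto simp: coboundary_def\<close>)

lemma coboundary_pullback:
 assumes "chain_map_over R P dP \<epsilon>P Q dQ \<epsilon>Q f \<theta>" "coboundary Q dQ i \<psi>"
 shows "coboundary P dP i (\<lambda>x. \<psi> (\<theta> i x))"
proof -
 note th = chain_map_overD[OF assms(1)]
 show ?thesis
 proof (cases i)
  case 0
  then show ?thesis using assms(2) mod_hom_closed[OF th(1)[of 0]] by (auto simp: coboundary_def)
 next
  case (Suc j)
  then obtain h where h: "functional (Q j) h" "\<forall>x\<in>carrier (Q (Suc j)). \<psi> x = h (dQ j x)"
   using assms(2) by (auto simp: coboundary_def)
  have "\<psi> (\<theta> (Suc j) x) = h (\<theta> j (dP j x))" if "x \<in> carrier (P (Suc j))" for x
   using h(2) mod_hom_closed[OF th(1)[of "Suc j"] that] th(3)[OF that] by simp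
  then show ?thesis
   using Suc functional_comp[OF th(1) h(1)] by (auto simp: coboundary_def intro!: exI[of _ "\<lambda>x. h (\<theta> j x)"])
 qed
qed

lemma cocycle_pullback:
 assumes "chain_map_over R P dP \<epsilon>P Q dQ \<epsilon>Q f \<theta>" "cocycle Q dQ i \<psi>"
 shows "cocycle P dP i (\<lambda>x. \<psi> (\<theta> i x))"
proof -
 note th = chain_map_overD[OF assms(1)]
 have "\<psi> (\<theta> i (dP i x)) = \<zero>" if "x \<in> carrier (P (Suc i))" for x
  using th(3)[OF that, symmetric] assms(2) mod_hom_closed[OF th(1) that] by (simp add: cocycle_def)
 then show ?thesis using assms(2) functional_comp[OF th(1)] by (auto simp: cocycle_def)
qed

text \<open>A cocycle kills boundaries, so of the homotopy formula only the term
  \<open>\<psi> s d\<close> survives.\<close>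

lemma coboundary_homotopic:
 fixes M :: "('a, 'y) module" and N :: "('a, 'z) module"
  and P :: "nat => ('a, 'u) module" and Q :: "nat => ('a, 'v) module" and i :: nat
 assumes P: "resolution R M P dP \<epsilon>P" and proj: "\<And>i. fg_projective R (P i)"
  and Q: "resolution R N Q dQ \<epsilon>Q" and N: "module R N"
  and t: "chain_map_over R P dP \<epsilon>P Q dQ \<epsilon>Q f t" and t': "chain_map_over R P dP \<epsilon>P Q dQ \<epsilon>Q f t'"
  and \<psi>: "cocycle Q dQ i \<psi>"
 shows "coboundary P dP i (\<lambda>x. \<psi> (t i x) \<ominus> \<psi> (t' i x))"
proof -
 note p = resolutionD[OF P] and q = resolutionD[OF Q]
 interpret Qm: lmodule R "Q k" for k by (rule lmodule.intro) (rule q(1))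
 note th = chain_map_overD(1)[OF t] and th' = chain_map_overD(1)[OF t']
 note thc = mod_hom_closed[OF th] and thc' = mod_hom_closed[OF th']
 have f: "functional (Q i) \<psi>" and z: "\<And>x. x \<in> carrier (Q (Suc i)) ==> \<psi> (dQ i x) = \<zero>"
  using \<psi> by (auto simp: cocycle_def)
 note fD = functionalD[OF f]
 obtain s where s: "\<And>i. s i \<in> mod_hom R (P i) (Q (Suc i))"
  "\<And>x. x \<in> carrier (P 0) ==> t 0 x \<ominus>\<^bsub>Q 0\<^esub> t' 0 x = dQ 0 (s 0 x)"
  "\<And>i x. x \<in> carrier (P (Suc i)) ==>
    t (Suc i) x \<ominus>\<^bsub>Q (Suc i)\<^esub> t' (Suc i) x \<ominus>\<^bsub>Q (Suc i)\<^esub> s i (dP i x) = dQ (Suc i) (s (Suc i) x)"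
  using chain_homotopy_ex[OF P proj Q N t t'] by metis
 show ?thesis
 proof (cases i)
  case 0
  have "\<psi> (t 0 x) \<ominus> \<psi> (t' 0 x) = \<zero>" if x: "x \<in> carrier (P 0)" for x
   using fD(5)[OF q(1), of "t 0 x" "t' 0 x"] thc[OF x] thc'[OF x] s(2)[OF x] z[of "s 0 x"] mod_hom_closed[OF s(1) x] 0 by simp
  then show ?thesis using 0 by (simp add: coboundary_def)
 next
  case (Suc j)
  have "\<psi> (t i x) \<ominus> \<psi> (t' i x) = \<psi> (s j (dP j x))" if x: "x \<in> carrier (P (Suc j))" for x
  proof -
   have c: "t i x \<in> carrier (Q i)" "t' i x \<in> carrier (Q i)" "s j (dP j x) \<in> carrier (Q i)"
    using thc[of x i] thc'[of x i] mod_hom_closed[OF s(1) mod_hom_closed[OF p(3) x]] x Suc by auto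
   have "\<psi> (t i x \<ominus>\<^bsub>Q i\<^esub> t' i x \<ominus>\<^bsub>Q i\<^esub> s j (dP j x)) = \<zero>"
    using s(3)[OF x] z[OF mod_hom_closed[OF s(1)], of x] x Suc by simp
   then have "(\<psi> (t i x) \<ominus> \<psi> (t' i x)) \<ominus> \<psi> (s j (dP j x)) = \<zero>"
    using fD(5)[OF q(1) Qm.M.minus_closed[OF c(1,2)] c(3)] fD(5)[OF q(1) c(1,2)] by simp
   then show ?thesis using Self.eq_of_minus_zero[of "\<psi> (t i x) \<ominus> \<psi> (t' i x)" "\<psi> (s j (dP j x))"] c fD(1) by simp
  qed
  then show ?thesis
   using Suc functional_comp[OF s(1)[of j]] f by (auto simp: coboundary_def intro!: exI[of _ "\<lambda>x. \<psi> (s j x)"])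
 qed
qed

lemma chain_map_comp:
 assumes "chain_map_over R P dP \<epsilon>P Q dQ \<epsilon>Q f \<theta>" "chain_map_over R Q dQ \<epsilon>Q L dL \<epsilon>L g \<eta>"
  "\<And>i. dP i \<in> mod_hom R (P (Suc i)) (P i)"
 shows "chain_map_over R P dP \<epsilon>P L dL \<epsilon>L (\<lambda>x. g (f x)) (\<lambda>i x. \<eta> i (\<theta> i x))"
proof -
 note t = chain_map_overD[OF assms(1)] and e = chain_map_overD[OF assms(2)]
 note tc = mod_hom_closed[OF t(1)]
 show ?thesis unfolding chain_map_over_def using mod_hom_comp[OF t(1) e(1)] e(2)[OF tc] t(2) e(3)[OF tc] t(3) by auto
qed

lemma chain_map_id: "chain_map_over R P dP \<epsilon>P P dP \<epsilon>P (\<lambda>x. x) (\<lambda>i x. x)"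
 by (simp add: chain_map_over_def mod_hom_id)

end

section \<open>Cosets, dual modules and Ext as classes of cocycles\<close>

context lmodule
begin

lemma coset_iff:
 assumes B: "submodule B R M" and x: "x \<in> carrier M" and y: "y \<in> carrier M"
 shows "y \<in> B +>\<^bsub>M\<^esub> x \<longleftrightarrow> y \<ominus>\<^sub>M x \<in> B"
proof
 assume "y \<in> B +>\<^bsub>M\<^esub> x"
 then obtain b where b: "b \<in> B" "y = b \<oplus>\<^sub>M x" by (auto simp: a_r_coset_def')
 have "b \<in> carrier M" using submod_carrier[OF B b(1)] .
 then have "y \<ominus>\<^sub>M x = b" unfolding b(2) using x by algebra
 then show "y \<ominus>\<^sub>M x \<in> B" using b(1) by simp
next
 assume a: "y \<ominus>\<^sub>M x \<in> B"
 have "y = (y \<ominus>\<^sub>M x) \<oplus>\<^sub>M x" using x y by algebra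
 then show "y \<in> B +>\<^bsub>M\<^esub> x" using a unfolding a_r_coset_def' by blast
qed

lemma coset_carrier:
 assumes "submodule B R M" "x \<in> carrier M"
 shows "B +>\<^bsub>M\<^esub> x \<subseteq> carrier M"
 using submod_carrier[OF assms(1)] assms(2) by (auto simp: a_r_coset_def')

lemma coset_self:
 assumes "submodule B R M" "x \<in> carrier M"
 shows "x \<in> B +>\<^bsub>M\<^esub> x"
 using coset_iff[OF assms(1,2,2)] minus_self[OF assms(2)] submod_zero[OF assms(1)] by simp

lemma coset_eq_iff:
 assumes B: "submodule B R M" and x: "x \<in> carrier M" and y: "y \<in> carrier M"
 shows "B +>\<^bsub>M\<^esub> x = B +>\<^bsub>M\<^esub> y \<longleftrightarrow> x \<ominus>\<^sub>M y \<in> B"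
proof
 assume "B +>\<^bsub>M\<^esub> x = B +>\<^bsub>M\<^esub> y"
 then have "x \<in> B +>\<^bsub>M\<^esub> y" using coset_self[OF B x] by simp
 then show "x \<ominus>\<^sub>M y \<in> B" using coset_iff[OF B y x] by simp
next
 assume xy: "x \<ominus>\<^sub>M y \<in> B"
 have "z \<ominus>\<^sub>M x \<in> B \<longleftrightarrow> z \<ominus>\<^sub>M y \<in> B" if z: "z \<in> carrier M" for z
 proof -
  have e1: "z \<ominus>\<^sub>M y = (z \<ominus>\<^sub>M x) \<oplus>\<^sub>M (x \<ominus>\<^sub>M y)" using x y z by algebra
  have e2: "z \<ominus>\<^sub>M x = (z \<ominus>\<^sub>M y) \<ominus>\<^sub>M (x \<ominus>\<^sub>M y)" using x y z by algebra
  show ?thesis using submod_add[OF B _ xy] submod_minus[OF B _ xy] e1 e2 by metis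
 qed
 then show "B +>\<^bsub>M\<^esub> x = B +>\<^bsub>M\<^esub> y"
  using coset_iff[OF B x] coset_iff[OF B y] coset_carrier[OF B x] coset_carrier[OF B y] by blast
qed

lemma coset_set_add:
 assumes B: "submodule B R M" and x: "x \<in> carrier M" and y: "y \<in> carrier M"
 shows "set_add M (B +>\<^bsub>M\<^esub> x) (B +>\<^bsub>M\<^esub> y) = B +>\<^bsub>M\<^esub> (x \<oplus>\<^sub>M y)"
proof
 note Bc = submod_carrier[OF B]
 show "set_add M (B +>\<^bsub>M\<^esub> x) (B +>\<^bsub>M\<^esub> y) \<subseteq> B +>\<^bsub>M\<^esub> (x \<oplus>\<^sub>M y)"
 proof
  fix z assume "z \<in> set_add M (B +>\<^bsub>M\<^esub> x) (B +>\<^bsub>M\<^esub> y)"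
  then obtain b b' where b: "b \<in> B" "b' \<in> B" "z = (b \<oplus>\<^sub>M x) \<oplus>\<^sub>M (b' \<oplus>\<^sub>M y)"
   by (auto simp: set_add_def' a_r_coset_def')
  have "z = (b \<oplus>\<^sub>M b') \<oplus>\<^sub>M (x \<oplus>\<^sub>M y)" unfolding b(3) using Bc b x y by (simp add: M.a_ac)
  then show "z \<in> B +>\<^bsub>M\<^esub> (x \<oplus>\<^sub>M y)" using submod_add[OF B b(1,2)] unfolding a_r_coset_def' by blast
 qed
 show "B +>\<^bsub>M\<^esub> (x \<oplus>\<^sub>M y) \<subseteq> set_add M (B +>\<^bsub>M\<^esub> x) (B +>\<^bsub>M\<^esub> y)"
 proof
  fix z assume "z \<in> B +>\<^bsub>M\<^esub> (x \<oplus>\<^sub>M y)"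
  then obtain b where b: "b \<in> B" "z = b \<oplus>\<^sub>M (x \<oplus>\<^sub>M y)" by (auto simp: a_r_coset_def')
  have "z = (b \<oplus>\<^sub>M x) \<oplus>\<^sub>M (\<zero>\<^sub>M \<oplus>\<^sub>M y)" unfolding b(2) using Bc b x y by (simp add: M.a_assoc)
  then show "z \<in> set_add M (B +>\<^bsub>M\<^esub> x) (B +>\<^bsub>M\<^esub> y)"
   using b(1) submod_zero[OF B] unfolding set_add_def' a_r_coset_def' by blast
 qed
qed

end

context cring
begin

lemma dual_simps:
 "\<zero>\<^bsub>dual R L\<^esub> = (\<lambda>x\<in>carrier L. \<zero>)"
 "\<psi> \<oplus>\<^bsub>dual R L\<^esub> \<chi> = (\<lambda>x\<in>carrier L. \<psi> x \<oplus> \<chi> x)"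
 "s \<odot>\<^bsub>dual R L\<^esub> \<psi> = (\<lambda>x\<in>carrier L. s \<otimes> \<psi> x)" by (simp_all add: hom_mod_def)

lemma dual_carrier: "\<psi> \<in> carrier (dual R L) \<longleftrightarrow> functional L \<psi> \<and> \<psi> \<in> extensional (carrier L)"
 by (simp add: hom_mod_def functional_def)

lemma dual_restrict: "module R L ==> functional L \<psi> ==> restrict \<psi> (carrier L) \<in> carrier (dual R L)"
 by (simp add: dual_carrier functional_cong[of L \<psi>])

lemma dual_apply_closed: "\<psi> \<in> carrier (dual R L) ==> x \<in> carrier L ==> \<psi> x \<in> carrier R"
 unfolding dual_carrier by (elim conjE) (rule functionalD(1))

lemma dual_eqI:
 "\<psi> \<in> carrier (dual R L) ==> \<chi> \<in> carrier (dual R L) ==> (\<And>x. x \<in> carrier L ==> \<psi> x = \<chi> x) ==> \<psi> = \<chi>"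
 by (rule extensionalityI[of _ "carrier L"]) (auto simp: dual_carrier)

lemma module_dual:
 assumes L: "module R L"
 shows "module R (dual R L)"
proof -
 note fD = functionalD(1)
 have cl: "\<psi> \<oplus>\<^bsub>dual R L\<^esub> \<chi> \<in> carrier (dual R L)" if "\<psi> \<in> carrier (dual R L)" "\<chi> \<in> carrier (dual R L)" for \<psi> \<chi>
  using that dual_restrict[OF L functional_add] by (simp add: dual_carrier dual_simps)
 have zc: "\<zero>\<^bsub>dual R L\<^esub> \<in> carrier (dual R L)" using dual_restrict[OF L functional_zero] by (simp add: dual_simps)
 have sc: "s \<odot>\<^bsub>dual R L\<^esub> \<psi> \<in> carrier (dual R L)" if "s \<in> carrier R" "\<psi> \<in> carrier (dual R L)" for s \<psi>
  using that dual_restrict[OF L functional_smult] by (simp add: dual_carrier dual_simps)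
 note c = cl zc sc
 note ap = dual_apply_closed
 show ?thesis
 proof (intro moduleI abelian_groupI)
  show "\<exists>\<chi>\<in>carrier (dual R L). \<chi> \<oplus>\<^bsub>dual R L\<^esub> \<psi> = \<zero>\<^bsub>dual R L\<^esub>" if p: "\<psi> \<in> carrier (dual R L)" for \<psi>
  proof (rule bexI[of _ "(\<ominus> \<one>) \<odot>\<^bsub>dual R L\<^esub> \<psi>"])
   show "(\<ominus> \<one>) \<odot>\<^bsub>dual R L\<^esub> \<psi> \<oplus>\<^bsub>dual R L\<^esub> \<psi> = \<zero>\<^bsub>dual R L\<^esub>"
    by (rule dual_eqI[OF cl[OF sc[OF _ p] p] zc]) (use ap[OF p] in \<open>simp_all add: dual_simps l_minus l_neg\<close>)
  qed (use sc p in simp)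
  fix \<psi> \<chi> \<xi> assume p: "\<psi> \<in> carrier (dual R L)" "\<chi> \<in> carrier (dual R L)"
  show "\<psi> \<oplus>\<^bsub>dual R L\<^esub> \<chi> = \<chi> \<oplus>\<^bsub>dual R L\<^esub> \<psi>"
   by (rule dual_eqI[OF cl[OF p] cl[OF p(2,1)]]) (use ap[OF p(1)] ap[OF p(2)] in \<open>simp add: dual_simps a_comm\<close>)
  show "\<psi> \<oplus>\<^bsub>dual R L\<^esub> \<chi> \<oplus>\<^bsub>dual R L\<^esub> \<xi> = \<psi> \<oplus>\<^bsub>dual R L\<^esub> (\<chi> \<oplus>\<^bsub>dual R L\<^esub> \<xi>)" if q: "\<xi> \<in> carrier (dual R L)"
   by (rule dual_eqI[OF cl[OF cl[OF p] q] cl[OF p(1) cl[OF p(2) q]]])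
    (use ap[OF p(1)] ap[OF p(2)] ap[OF q] in \<open>simp add: dual_simps a_assoc\<close>)
 next
  fix \<psi> assume p: "\<psi> \<in> carrier (dual R L)"
  show "\<zero>\<^bsub>dual R L\<^esub> \<oplus>\<^bsub>dual R L\<^esub> \<psi> = \<psi>"
   by (rule dual_eqI[OF cl[OF zc p] p]) (use ap[OF p] in \<open>simp add: dual_simps\<close>)
  show "\<one> \<odot>\<^bsub>dual R L\<^esub> \<psi> = \<psi>"
   by (rule dual_eqI[OF sc[OF one_closed p] p]) (use ap[OF p] in \<open>simp add: dual_simps\<close>)
 next
  fix a b \<psi> assume s: "a \<in> carrier R" "b \<in> carrier R" and p: "\<psi> \<in> carrier (dual R L)"
  have ab: "a \<oplus> b \<in> carrier R" "a \<otimes> b \<in> carrier R" using s by auto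
  show "(a \<oplus> b) \<odot>\<^bsub>dual R L\<^esub> \<psi> = a \<odot>\<^bsub>dual R L\<^esub> \<psi> \<oplus>\<^bsub>dual R L\<^esub> b \<odot>\<^bsub>dual R L\<^esub> \<psi>"
   by (rule dual_eqI[OF sc[OF ab(1) p] cl[OF sc[OF s(1) p] sc[OF s(2) p]]])
    (use ap[OF p] s in \<open>simp add: dual_simps l_distr\<close>)
  show "(a \<otimes> b) \<odot>\<^bsub>dual R L\<^esub> \<psi> = a \<odot>\<^bsub>dual R L\<^esub> (b \<odot>\<^bsub>dual R L\<^esub> \<psi>)"
   by (rule dual_eqI[OF sc[OF ab(2) p] sc[OF s(1) sc[OF s(2) p]]])
    (use ap[OF p] s in \<open>simp add: dual_simps m_assoc\<close>)
 next
  fix a \<psi> \<chi> assume s: "a \<in> carrier R" and p: "\<psi> \<in> carrier (dual R L)" "\<chi> \<in> carrier (dual R L)"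
  show "a \<odot>\<^bsub>dual R L\<^esub> (\<psi> \<oplus>\<^bsub>dual R L\<^esub> \<chi>) = a \<odot>\<^bsub>dual R L\<^esub> \<psi> \<oplus>\<^bsub>dual R L\<^esub> a \<odot>\<^bsub>dual R L\<^esub> \<chi>"
   by (rule dual_eqI[OF sc[OF s cl[OF p]] cl[OF sc[OF s p(1)] sc[OF s p(2)]]])
    (use ap[OF p(1)] ap[OF p(2)] s in \<open>simp add: dual_simps r_distr\<close>)
 qed (use c is_cring in auto)
qed

lemma dual_minus_apply:
 assumes L: "module R L" and p: "\<psi> \<in> carrier (dual R L)" "\<chi> \<in> carrier (dual R L)" and x: "x \<in> carrier L"
 shows "(\<psi> \<ominus>\<^bsub>dual R L\<^esub> \<chi>) x = \<psi> x \<ominus> \<chi> x"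
proof -
 interpret D: lmodule R "dual R L" by (rule lmodule.intro) (rule module_dual[OF L])
 have "((\<psi> \<ominus>\<^bsub>dual R L\<^esub> \<chi>) \<oplus>\<^bsub>dual R L\<^esub> \<chi>) x = \<psi> x"
  using p by (metis D.M.a_assoc D.M.a_inv_closed D.M.l_neg D.M.minus_eq D.M.r_zero)
 then have e: "(\<psi> \<ominus>\<^bsub>dual R L\<^esub> \<chi>) x \<oplus> \<chi> x = \<psi> x" using x by (simp add: dual_simps)
 have c: "(\<psi> \<ominus>\<^bsub>dual R L\<^esub> \<chi>) x \<in> carrier R" "\<chi> x \<in> carrier R"
  using dual_apply_closed[OF D.M.minus_closed[OF p] x] dual_apply_closed[OF p(2) x] by auto
 have "(\<psi> \<ominus>\<^bsub>dual R L\<^esub> \<chi>) x = ((\<psi> \<ominus>\<^bsub>dual R L\<^esub> \<chi>) x \<oplus> \<chi> x) \<ominus> \<chi> x"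
  using c by (simp add: minus_eq a_assoc r_neg)
 then show ?thesis using e by simp
qed

lemma coboundary_cong_iff:
 "(\<And>x. x \<in> carrier (P i) ==> \<chi> x = \<psi> x) ==> coboundary P d i \<chi> \<longleftrightarrow> coboundary P d i \<psi>"
 using coboundary_cong[of P d i \<psi> \<chi>] coboundary_cong[of P d i \<chi> \<psi>] by auto

text \<open>\<open>G F\<close> and the identity both lift the identity of \<open>M\<close>, so they
  agree on cohomology. The second part lets one decide in any resolution whether a class is
  zero.\<close>

lemma coboundary_transfer:
 fixes M :: "('a, 'y) module" and P :: "nat => ('a, 'u) module" and Q :: "nat => ('a, 'v) module" and i :: nat
 assumes P: "resolution R M P dP \<epsilon>P" "\<And>i. fg_projective R (P i)" and Q: "resolution R M Q dQ \<epsilon>Q" and M: "module R M"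
  and F: "chain_map_over R P dP \<epsilon>P Q dQ \<epsilon>Q (\<lambda>x. x) F" and G: "chain_map_over R Q dQ \<epsilon>Q P dP \<epsilon>P (\<lambda>x. x) G"
  and \<psi>: "cocycle P dP i \<psi>"
 shows "coboundary P dP i (\<lambda>x. \<psi> (G i (F i x)) \<ominus> \<psi> x)"
  and "coboundary Q dQ i (\<lambda>x. \<psi> (G i x)) \<longleftrightarrow> coboundary P dP i \<psi>"
proof -
 note p = resolutionD[OF P(1)]
 note FD = mod_hom_closed[OF chain_map_overD(1)[OF F]] and GD = mod_hom_closed[OF chain_map_overD(1)[OF G]]
 show c: "coboundary P dP i (\<lambda>x. \<psi> (G i (F i x)) \<ominus> \<psi> x)"
  by (rule coboundary_homotopic[OF P P(1) M chain_map_comp[OF F G p(3)] chain_map_id \<psi>])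
 have fD: "\<psi> x \<in> carrier R" if "x \<in> carrier (P i)" for x
  using functionalD(1)[of "P i" \<psi>] \<psi> that by (simp add: cocycle_def)
 show "coboundary Q dQ i (\<lambda>x. \<psi> (G i x)) \<longleftrightarrow> coboundary P dP i \<psi>"
 proof
  assume "coboundary Q dQ i (\<lambda>x. \<psi> (G i x))"
  then have "coboundary P dP i (\<lambda>x. \<psi> (G i (F i x)))" by (rule coboundary_pullback[OF F])
  then have "coboundary P dP i (\<lambda>x. \<psi> (G i (F i x)) \<oplus> (\<ominus> \<one>) \<otimes> (\<psi> (G i (F i x)) \<ominus> \<psi> x))"
   by (rule coboundary_add[OF _ coboundary_smult[OF c]]) simp
  then show "coboundary P dP i \<psi>"
  proof (rule coboundary_cong)
   fix x assume x: "x \<in> carrier (P i)"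
   have "\<psi> (G i (F i x)) \<in> carrier R" "\<psi> x \<in> carrier R" using fD[OF GD[OF FD[OF x]]] fD[OF x] by auto
   then show "\<psi> x = \<psi> (G i (F i x)) \<oplus> (\<ominus> \<one>) \<otimes> (\<psi> (G i (F i x)) \<ominus> \<psi> x)" by algebra
  qed
 next
  assume "coboundary P dP i \<psi>"
  then show "coboundary Q dQ i (\<lambda>x. \<psi> (G i x))" by (rule coboundary_pullback[OF G])
 qed
qed

text \<open>When \<open>P\<close> is a projective resolution of M this says Ext^i(M, R) = 0, with no
  reference to a chosen resolution.\<close>

definition acyclic_dual :: "(nat => ('a, 'x) module) => (nat => 'x => 'x) => nat => bool" where
 "acyclic_dual P d i \<longleftrightarrow> (\<forall>\<psi>. cocycle P d i \<psi> --> coboundary P d i \<psi>)"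

lemma acyclic_dual_transfer:
 fixes M :: "('a, 'y) module" and P :: "nat => ('a, 'u) module" and Q :: "nat => ('a, 'v) module" and i :: nat
 assumes P: "resolution R M P dP \<epsilon>P" "\<And>i. fg_projective R (P i)"
  and Q: "resolution R M Q dQ \<epsilon>Q" "\<And>i. fg_projective R (Q i)" and M: "module R M" and a: "acyclic_dual Q dQ i"
 shows "acyclic_dual P dP i"
proof -
 obtain F where F: "chain_map_over R P dP \<epsilon>P Q dQ \<epsilon>Q (\<lambda>x. x) F"
  using chain_map_ex[OF P Q(1) M M mod_hom_id] by blast
 obtain G where G: "chain_map_over R Q dQ \<epsilon>Q P dP \<epsilon>P (\<lambda>x. x) G"
  using chain_map_ex[OF Q P(1) M M mod_hom_id] by blast
 show ?thesis unfolding acyclic_dual_def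
 proof (intro allI impI)
  fix \<psi> assume \<psi>: "cocycle P dP i \<psi>"
  have "coboundary Q dQ i (\<lambda>x. \<psi> (G i x))" using a cocycle_pullback[OF G \<psi>] unfolding acyclic_dual_def by blast
  then show "coboundary P dP i \<psi>" using coboundary_transfer(2)[OF P Q(1) M F G \<psi>] by blast
 qed
qed

text \<open>A choice by \<open>SOME\<close> has its property as soon as one resolution by modules
  R^n is known; here a concrete one is always at hand.\<close>

lemma chosen_resolution_res:
 assumes "resolution R M (Frees b) d \<epsilon>"
 shows "resolution R M (res_mod R M) (res_diff R M) (res_aug R M)"
proof -
 have "\<exists>p. case p of (b, d, \<epsilon>) => resolution R M (Frees b) d \<epsilon>"
  using assms by (intro exI[of _ "(b, d, \<epsilon>)"]) simp
 then have "case chosen_resolution R M of (b, d, \<epsilon>) => resolution R M (Frees b) d \<epsilon>"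
  unfolding chosen_resolution_def by (rule someI_ex)
 moreover have "res_mod R M = (\<lambda>i. Free (fst (chosen_resolution R M) i))" by (simp add: fun_eq_iff res_mod_def)
 ultimately show ?thesis by (simp add: res_diff_def res_aug_def split: prod.splits)
qed

lemma res_mod_projective: "fg_projective R (res_mod R M i)" by (simp add: res_mod_def fg_projective_free)

text \<open>Restriction turns any function into the extensional representative that
  \<open>Ext\<close> requires, so classes can be named by ordinary functions.\<close>

definition Ext_class :: "('a, 'y) module => nat => ((nat => 'a) => 'a) => ((nat => 'a) => 'a) set" where
 "Ext_class M i \<psi> = coboundaries R i M (self_module R) +>\<^bsub>dual R (res_mod R M i)\<^esub> restrict \<psi> (carrier (res_mod R M i))"

context
 fixes M :: "('a, 'y) module" and E :: "nat => ('a, ((nat => 'a) => 'a) set) module"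
 assumes M: "module R M" and res: "resolution R M (res_mod R M) (res_diff R M) (res_aug R M)"
 defines "E \<equiv> \<lambda>i. Ext R i M (self_module R)"
begin

abbreviation (input) "resC \<equiv> res_mod R M"
abbreviation (input) "resd \<equiv> res_diff R M"
abbreviation (input) "resa \<equiv> res_aug R M"

lemma cocycles_iff:
 "\<psi> \<in> cocycles R i M (self_module R) \<longleftrightarrow> \<psi> \<in> extensional (carrier (resC i)) \<and> cocycle resC resd i \<psi>"
proof -
 have "hom_map (resC (Suc i)) (resd i) \<psi> = \<zero>\<^bsub>dual R (resC (Suc i))\<^esub> \<longleftrightarrow> (\<forall>x\<in>carrier (resC (Suc i)). \<psi> (resd i x) = \<zero>)"
  unfolding hom_map_def compose_def dual_simps by (auto simp: restrict_def fun_eq_iff)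
 then show ?thesis by (auto simp: cocycles_def mod_ker_def dual_carrier cocycle_def)
qed

lemma coboundaries_iff:
 "\<psi> \<in> coboundaries R i M (self_module R) \<longleftrightarrow> \<psi> \<in> carrier (dual R (resC i)) \<and> coboundary resC resd i \<psi>"
proof (cases i)
 case 0
 have "\<psi> = \<zero>\<^bsub>dual R (resC 0)\<^esub> \<longleftrightarrow> \<psi> \<in> carrier (dual R (resC 0)) \<and> (\<forall>x\<in>carrier (resC 0). \<psi> x = \<zero>)"
  using dual_restrict[OF resolutionD(1)[OF res] functional_zero, of 0]
  by (auto simp: dual_simps dual_carrier intro!: extensionalityI[of \<psi> "carrier (resC 0)"])
 then show ?thesis using 0 by (simp add: coboundaries_def coboundary_def)
next
 case (Suc j)
 note d = resolutionD(3)[OF res, of j]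
 show ?thesis
 proof
  assume "\<psi> \<in> coboundaries R i M (self_module R)"
  then obtain h where h: "h \<in> carrier (dual R (resC j))" "\<psi> = compose (carrier (resC i)) h (resd j)"
   by (auto simp: coboundaries_def hom_map_def Suc)
  have \<psi>: "\<psi> x = h (resd j x)" if "x \<in> carrier (resC i)" for x using that by (simp add: h(2) compose_def)
  have "functional (resC i) (\<lambda>x. h (resd j x))" using functional_comp[OF d] h(1) Suc by (simp add: dual_carrier)
  then have "functional (resC i) \<psi>" by (rule functional_cong[OF resolutionD(1)[OF res]]) (rule \<psi>)
  then show "\<psi> \<in> carrier (dual R (resC i)) \<and> coboundary resC resd i \<psi>"
   using h(1) \<psi> Suc by (auto simp: dual_carrier coboundary_def h(2) intro!: exI[of _ h])
 next
  assume a: "\<psi> \<in> carrier (dual R (resC i)) \<and> coboundary resC resd i \<psi>"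
  then obtain h where h: "functional (resC j) h" "\<forall>x\<in>carrier (resC (Suc j)). \<psi> x = h (resd j x)"
   by (auto simp: coboundary_def Suc)
  have "restrict h (carrier (resC j)) \<in> carrier (dual R (resC j))" by (rule dual_restrict[OF resolutionD(1)[OF res] h(1)])
  moreover have "\<psi> = hom_map (resC i) (resd j) (restrict h (carrier (resC j)))" using a h(2) mod_hom_closed[OF d] Suc
   by (intro extensionalityI[of \<psi> "carrier (resC i)"]) (auto simp: hom_map_def compose_def dual_carrier)
  ultimately show "\<psi> \<in> coboundaries R i M (self_module R)" by (auto simp: coboundaries_def Suc)
 qed
qed

lemma dual_C: "lmodule R (dual R (resC i))" by (rule lmodule.intro module_dual resolutionD(1)[OF res])+

lemma coboundaries_submod: "submodule (coboundaries R i M (self_module R)) R (dual R (resC i))"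
proof -
 interpret D: lmodule R "dual R (resC i)" by (rule dual_C)
 show ?thesis
 proof (rule D.submodI)
  show "coboundaries R i M (self_module R) \<subseteq> carrier (dual R (resC i))" using coboundaries_iff by auto
  have "coboundary resC resd i (\<lambda>x. \<zero>)"
   by (cases i) (auto simp: coboundary_def intro!: exI[of _ "\<lambda>x. \<zero>"] functional_zero)
  then show "\<zero>\<^bsub>dual R (resC i)\<^esub> \<in> coboundaries R i M (self_module R)"
   unfolding coboundaries_iff using D.M.zero_closed by (auto simp: dual_simps intro: coboundary_cong)
  show "a \<oplus>\<^bsub>dual R (resC i)\<^esub> b \<in> coboundaries R i M (self_module R)" if "a \<in> coboundaries R i M (self_module R)" "b \<in> coboundaries R i M (self_module R)" for a b
   using that coboundary_cong[OF coboundary_add, of "resC" "resd" i a b "a \<oplus>\<^bsub>dual R (resC i)\<^esub> b"] D.M.a_closed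
   by (simp add: coboundaries_iff) (simp add: dual_simps)
  show "s \<odot>\<^bsub>dual R (resC i)\<^esub> a \<in> coboundaries R i M (self_module R)" if "s \<in> carrier R" "a \<in> coboundaries R i M (self_module R)" for s a
   using that coboundary_cong[OF coboundary_smult, of "resC" "resd" i a s "s \<odot>\<^bsub>dual R (resC i)\<^esub> a"] D.smult_closed
   by (simp add: coboundaries_iff) (simp add: dual_simps)
 qed
qed

lemma restrict_C: "functional (resC i) \<psi> ==> restrict \<psi> (carrier (resC i)) \<in> carrier (dual R (resC i))"
 by (rule dual_restrict[OF resolutionD(1)[OF res]])

lemma Ext_class_eq_iff:
 assumes "functional (resC i) \<psi>" "functional (resC i) \<chi>"
 shows "Ext_class M i \<psi> = Ext_class M i \<chi> \<longleftrightarrow> coboundary resC resd i (\<lambda>x. \<psi> x \<ominus> \<chi> x)"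
proof -
 interpret D: lmodule R "dual R (resC i)" by (rule dual_C)
 note r = restrict_C[OF assms(1)] restrict_C[OF assms(2)]
 have e: "(restrict \<psi> (carrier (resC i)) \<ominus>\<^bsub>dual R (resC i)\<^esub> restrict \<chi> (carrier (resC i))) x = \<psi> x \<ominus> \<chi> x"
  if "x \<in> carrier (resC i)" for x using dual_minus_apply[OF resolutionD(1)[OF res] r that] that by simp
 show ?thesis unfolding Ext_class_def D.coset_eq_iff[OF coboundaries_submod r] coboundaries_iff
  using D.M.minus_closed[OF r] coboundary_cong_iff[of "resC" i _ _ "resd", OF e] by simp
qed

lemma Ext_carrier: "carrier (E i) = {Ext_class M i \<psi> | \<psi>. cocycle resC resd i \<psi>}"
proof -
 have r1: "restrict \<psi> (carrier (resC i)) \<in> cocycles R i M (self_module R)" if "cocycle resC resd i \<psi>" for \<psi>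
  using that restrict_C[of i \<psi>] mod_hom_closed[OF resolutionD(3)[OF res]] by (auto simp: cocycles_iff cocycle_def dual_carrier)
 have r2: "restrict \<psi> (carrier (resC i)) = \<psi>" "cocycle resC resd i \<psi>" if "\<psi> \<in> cocycles R i M (self_module R)" for \<psi>
  using that by (simp_all add: cocycles_iff extensional_restrict)
 have E: "carrier (E i) = {coboundaries R i M (self_module R) +>\<^bsub>dual R (resC i)\<^esub> \<psi> | \<psi>. \<psi> \<in> cocycles R i M (self_module R)}"
  by (auto simp: E_def Ext_def quot_mod_def A_RCOSETS_def' a_r_coset_def')
 show ?thesis
 proof (intro equalityI subsetI)
  fix Z assume "Z \<in> carrier (E i)"
  then obtain \<psi> where \<psi>: "\<psi> \<in> cocycles R i M (self_module R)" "Z = coboundaries R i M (self_module R) +>\<^bsub>dual R (resC i)\<^esub> \<psi>"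
   unfolding E by blast
  then have "Z = Ext_class M i \<psi>" using r2(1) by (simp add: Ext_class_def)
  then show "Z \<in> {Ext_class M i \<psi> | \<psi>. cocycle resC resd i \<psi>}" using r2(2)[OF \<psi>(1)] by blast
 next
  fix Z assume "Z \<in> {Ext_class M i \<psi> | \<psi>. cocycle resC resd i \<psi>}"
  then obtain \<psi> where \<psi>: "cocycle resC resd i \<psi>" "Z = Ext_class M i \<psi>" by blast
  show "Z \<in> carrier (E i)" unfolding E \<psi>(2) Ext_class_def using r1[OF \<psi>(1)] by blast
 qed
qed

lemma Ext_add:
 assumes "functional (resC i) \<psi>" "functional (resC i) \<chi>"
 shows "Ext_class M i \<psi> \<oplus>\<^bsub>E i\<^esub> Ext_class M i \<chi> = Ext_class M i (\<lambda>x. \<psi> x \<oplus> \<chi> x)"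
proof -
 interpret D: lmodule R "dual R (resC i)" by (rule dual_C)
 have "restrict \<psi> (carrier (resC i)) \<oplus>\<^bsub>dual R (resC i)\<^esub> restrict \<chi> (carrier (resC i)) = restrict (\<lambda>x. \<psi> x \<oplus> \<chi> x) (carrier (resC i))"
  by (auto simp: dual_simps restrict_def)
 then have "set_add (dual R (resC i)) (Ext_class M i \<psi>) (Ext_class M i \<chi>) = Ext_class M i (\<lambda>x. \<psi> x \<oplus> \<chi> x)"
  unfolding Ext_class_def using D.coset_set_add[OF coboundaries_submod restrict_C[OF assms(1)] restrict_C[OF assms(2)]] by simp
 then show ?thesis by (simp add: E_def Ext_def quot_mod_def set_add_def')
qed

lemma Ext_zero: "\<zero>\<^bsub>E i\<^esub> = Ext_class M i (\<lambda>x. \<zero>)"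
proof -
 interpret D: lmodule R "dual R (resC i)" by (rule dual_C)
 have "coboundaries R i M (self_module R) +>\<^bsub>dual R (resC i)\<^esub> \<zero>\<^bsub>dual R (resC i)\<^esub> = coboundaries R i M (self_module R)"
  using D.submod_carrier[OF coboundaries_submod] by (auto simp: a_r_coset_def')
 then show ?thesis by (simp add: E_def Ext_def quot_mod_def Ext_class_def dual_simps)
qed

lemma Ext_trivial_iff: "carrier (E i) = {\<zero>\<^bsub>E i\<^esub>} \<longleftrightarrow> acyclic_dual resC resd i"
proof -
 have m: "\<psi> x \<ominus> \<zero> = \<psi> x" if "functional (resC i) \<psi>" "x \<in> carrier (resC i)" for \<psi> x
  using functionalD(1)[OF that] by (simp add: minus_eq)
 have z: "Ext_class M i \<psi> = Ext_class M i (\<lambda>x. \<zero>) \<longleftrightarrow> coboundary resC resd i \<psi>" if "cocycle resC resd i \<psi>" for \<psi>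
 proof -
  have f: "functional (resC i) \<psi>" using that by (simp add: cocycle_def)
  show ?thesis unfolding Ext_class_eq_iff[OF f functional_zero] by (rule coboundary_cong_iff) (rule m[OF f])
 qed
 have c0: "cocycle resC resd i (\<lambda>x. \<zero>)" by (simp add: cocycle_def functional_zero)
 show ?thesis
 proof
  assume a: "carrier (E i) = {\<zero>\<^bsub>E i\<^esub>}"
  have "coboundary resC resd i \<psi>" if "cocycle resC resd i \<psi>" for \<psi>
  proof -
   have "Ext_class M i \<psi> \<in> carrier (E i)" unfolding Ext_carrier using that by blast
   then show ?thesis using z[OF that] by (simp add: a Ext_zero)
  qed
  then show "acyclic_dual resC resd i" by (simp add: acyclic_dual_def)
 next
  assume "acyclic_dual resC resd i"
  then have "Ext_class M i \<psi> = \<zero>\<^bsub>E i\<^esub>" if "cocycle resC resd i \<psi>" for \<psi>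
   using z[OF that] that by (simp add: acyclic_dual_def Ext_zero)
  moreover have "\<zero>\<^bsub>E i\<^esub> \<in> carrier (E i)" unfolding Ext_zero Ext_carrier using c0 by blast
  ultimately show "carrier (E i) = {\<zero>\<^bsub>E i\<^esub>}" unfolding Ext_carrier by auto
 qed
qed

lemma chain_lift_map:
 assumes "f \<in> mod_hom R M M"
 shows "chain_map_over R resC resd resa resC resd resa f (chain_lift R M M f)"
proof -
 have "\<exists>\<theta>. chain_map_over R resC resd resa resC resd resa f \<theta>"
  by (rule chain_map_ex[OF res res_mod_projective res M M assms])
 then show ?thesis unfolding chain_map_over_def chain_lift_def by (rule someI_ex)
qed

text \<open>\<open>Ext_map\<close> is a union over all representatives of a class. Each of them
  contributes the same coset, as coboundaries pull back to coboundaries.\<close>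

lemma Ext_map_class:
 assumes f: "f \<in> mod_hom R M M" and \<psi>: "cocycle resC resd i \<psi>"
 shows "Ext_map R i M M (self_module R) f (Ext_class M i \<psi>) = Ext_class M i (\<lambda>x. \<psi> (chain_lift R M M f i x))"
proof -
 interpret D: lmodule R "dual R (resC i)" by (rule dual_C)
 let ?\<chi> = "chain_lift R M M f"
 note \<chi> = chain_lift_map[OF f]
 note \<chi>c = mod_hom_closed[OF chain_map_overD(1)[OF \<chi>]]
 have f\<psi>: "functional (resC i) \<psi>" using \<psi> by (simp add: cocycle_def)
 have each: "coboundaries R i M (self_module R) +>\<^bsub>dual R (resC i)\<^esub> hom_map (resC i) (?\<chi> i) g = Ext_class M i (\<lambda>x. \<psi> (?\<chi> i x))"
  if g: "g \<in> Ext_class M i \<psi>" for g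
 proof -
  obtain b where b: "b \<in> coboundaries R i M (self_module R)" "g = b \<oplus>\<^bsub>dual R (resC i)\<^esub> restrict \<psi> (carrier (resC i))"
   using g unfolding Ext_class_def a_r_coset_def' by blast
  have bc: "b \<in> carrier (dual R (resC i))" "coboundary resC resd i b" using b(1) coboundaries_iff by auto
  have bx: "b x \<in> carrier R" if "x \<in> carrier (resC i)" for x using dual_apply_closed[OF bc(1) that] .
  have gx: "g x = b x \<oplus> \<psi> x" if "x \<in> carrier (resC i)" for x using that by (simp add: b(2) dual_simps)
  have gf: "functional (resC i) g" using D.M.a_closed[OF bc(1) restrict_C[OF f\<psi>]] by (simp add: b(2) dual_carrier)
  have "hom_map (resC i) (?\<chi> i) g = restrict (\<lambda>x. g (?\<chi> i x)) (carrier (resC i))" by (simp add: hom_map_def compose_def)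
  then have "coboundaries R i M (self_module R) +>\<^bsub>dual R (resC i)\<^esub> hom_map (resC i) (?\<chi> i) g = Ext_class M i (\<lambda>x. g (?\<chi> i x))"
   by (simp add: Ext_class_def)
  also have "\<dots> = Ext_class M i (\<lambda>x. \<psi> (?\<chi> i x))"
  proof (subst Ext_class_eq_iff)
   show "functional (resC i) (\<lambda>x. g (?\<chi> i x))" "functional (resC i) (\<lambda>x. \<psi> (?\<chi> i x))"
    using functional_comp[OF chain_map_overD(1)[OF \<chi>]] gf f\<psi> by auto
   show "coboundary resC resd i (\<lambda>x. g (?\<chi> i x) \<ominus> \<psi> (?\<chi> i x))"
   proof (rule coboundary_cong[OF coboundary_pullback[OF \<chi> bc(2)]])
    fix x assume x: "x \<in> carrier (resC i)"
    show "g (?\<chi> i x) \<ominus> \<psi> (?\<chi> i x) = b (?\<chi> i x)"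
     using gx[OF \<chi>c[OF x]] bx[OF \<chi>c[OF x]] functionalD(1)[OF f\<psi> \<chi>c[OF x]] by (simp add: minus_eq a_assoc r_neg)
   qed
  qed
  finally show ?thesis .
 qed
 have "Ext_class M i \<psi> \<noteq> {}" unfolding Ext_class_def using D.coset_self[OF coboundaries_submod restrict_C[OF f\<psi>]] by blast
 then show ?thesis unfolding Ext_map_def using each by simp
qed

text \<open>The arbitrary choice in \<open>chain_lift\<close> may be replaced by any lift
  \<open>t\<close>, since two lifts are homotopic.\<close>

lemma Ext_class_smult_map:
 assumes \<psi>: "cocycle resC resd i \<psi>" and f: "f \<in> mod_hom R M M" and t: "chain_map_over R resC resd resa resC resd resa f t"
 shows "Ext_map R i M M (self_module R) f (Ext_class M i \<psi>) = Ext_class M i (\<lambda>x. \<psi> (t i x))"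
proof -
 note \<chi> = chain_lift_map[OF f]
 have f\<psi>: "functional (resC i) \<psi>" using \<psi> by (simp add: cocycle_def)
 have "Ext_class M i (\<lambda>x. \<psi> (chain_lift R M M f i x)) = Ext_class M i (\<lambda>x. \<psi> (t i x))"
  using functional_comp[OF chain_map_overD(1)[OF \<chi>] f\<psi>] functional_comp[OF chain_map_overD(1)[OF t] f\<psi>]
   coboundary_homotopic[OF res res_mod_projective res M \<chi> t \<psi>] by (simp add: Ext_class_eq_iff)
 then show ?thesis by (simp add: Ext_map_class[OF f \<psi>])
qed

end

end

section \<open>Self-dual resolutions\<close>

context cring
begin

text \<open>The pairing that identifies R^n with its dual, so that adjoint maps are again maps
  between modules \<open>Free n\<close>.\<close>

definition dot :: "nat => (nat => 'a) => (nat => 'a) => 'a" where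
 "dot n u v = lincomb (self_module R) n u v"

lemma dot_closed: "u \<in> Vec n ==> v \<in> Vec n ==> dot n u v \<in> carrier R"
 unfolding dot_def using Self.lincomb_closed[of n u v] Vec_closed by auto

lemma dot_comm:
 assumes "u \<in> Vec n" "v \<in> Vec n"
 shows "dot n u v = dot n v u"
proof -
 note uv = Vec_closed[OF assms(1)] Vec_closed[OF assms(2)]
 have "lincomb (self_module R) p u v = lincomb (self_module R) p v u" for p
  by (induction p) (use uv in \<open>simp_all add: Self.lincomb_Suc m_comm\<close>)
 then show ?thesis by (simp add: dot_def)
qed

lemma dot_functional: "u \<in> Vec n ==> functional (Free n) (dot n u)"
proof -
 assume u: "u \<in> Vec n"
 have "functional (Free n) (\<lambda>v. lincomb (self_module R) n v u)"
  unfolding functional_def using Vec_closed[OF u] by (intro Self.lincomb_hom) simp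
 then show ?thesis by (rule functional_cong[OF free_module]) (metis dot_comm dot_def u)
qed

lemma functional_dot:
 assumes "functional (Free n) \<psi>"
 shows "\<exists>u\<in>Vec n. \<forall>v\<in>Vec n. \<psi> v = dot n u v"
proof -
 let ?u = "\<lambda>k. if k < n then \<psi> (unitvec k) else \<zero>"
 have uc: "\<psi> (unitvec k) \<in> carrier R" if "k < n" for k using functionalD(1)[OF assms unitvec_closed[OF that]] .
 have u: "?u \<in> Vec n" using uc by (auto intro!: free_modI)
 have "\<psi> v = dot n ?u v" if v: "v \<in> Vec n" for v
 proof -
  have "\<psi> v = lincomb (self_module R) n v (\<lambda>k. \<psi> (unitvec k))"
   by (rule Self.free_hom_lincomb[OF assms[unfolded functional_def] v])
  also have "\<dots> = dot n v ?u" unfolding dot_def using uc Vec_closed[OF v] by (intro Self.lincomb_cong) auto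
  finally show ?thesis using dot_comm[OF u v] by simp
 qed
 then show ?thesis using u by blast
qed

lemma dot_unitvec: "u \<in> Vec n ==> k < n ==> dot n u (unitvec k) = u k"
 using dot_comm[of u n "unitvec k"] Self.lincomb_unit[of k n u] Vec_closed by (simp add: dot_def)

lemma dot_eqI:
 assumes "u \<in> Vec n" "v \<in> Vec n" and "\<And>w. w \<in> Vec n ==> dot n u w = dot n v w"
 shows "u = v"
proof
 fix k
 show "u k = v k"
 proof (cases "k < n")
  case True
  then show ?thesis using assms dot_unitvec unitvec_closed by metis
 next
  case False
  then show ?thesis using free_mod_beyond[OF assms(1)] free_mod_beyond[OF assms(2)] by simp
 qed
qed

lemma dot_smult:
 assumes "s \<in> carrier R" "u \<in> Vec n" "v \<in> Vec n"
 shows "dot n (s \<odot>[n] u) v = s \<otimes> dot n u v"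
 using functionalD(3)[OF dot_functional[OF assms(3)] assms(1,2)] dot_comm[OF assms(3) Free.smult_closed[OF assms(1,2)]]
  dot_comm[OF assms(3,2)] by simp

lemma dot_add:
 assumes "u \<in> Vec n" "u' \<in> Vec n" "v \<in> Vec n"
 shows "dot n (u \<oplus>[n] u') v = dot n u v \<oplus> dot n u' v"
 using functionalD(2)[OF dot_functional[OF assms(3)] assms(1,2)] dot_comm[OF assms(3) Free.M.a_closed[OF assms(1,2)]]
  dot_comm[OF assms(3,2)] dot_comm[OF assms(3,1)] by simp

lemma dot_minus:
 assumes "u \<in> Vec n" "u' \<in> Vec n" "v \<in> Vec n"
 shows "dot n (u \<ominus>[n] u') v = dot n u v \<ominus> dot n u' v"
 using functionalD(5)[OF dot_functional[OF assms(3)] free_module assms(1,2)] dot_comm[OF assms(3) Free.M.minus_closed[OF assms(1,2)]]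
  dot_comm[OF assms(3,2)] dot_comm[OF assms(3,1)] by simp

lemma dot_zero: "v \<in> Vec n ==> dot n \<zero>[n] v = \<zero>"
 using functionalD(4)[OF dot_functional free_module, of v n] dot_comm[OF Free.M.zero_closed, of v n] by simp

definition transpose_map :: "nat => nat => ((nat => 'a) => nat => 'a) => (nat => 'a) => nat => 'a" where
 "transpose_map p q f u = (\<lambda>k. if k < p then dot q u (f (unitvec k)) else \<zero>)"

lemma transpose_closed:
 assumes "f \<in> Lin p q" "u \<in> Vec q"
 shows "transpose_map p q f u \<in> Vec p"
 using dot_closed[OF assms(2) mod_hom_closed[OF assms(1) unitvec_closed]] by (auto simp: transpose_map_def intro!: free_modI)

lemma dot_transpose:
 assumes f: "f \<in> Lin p q" and u: "u \<in> Vec q" and v: "v \<in> Vec p"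
 shows "dot p (transpose_map p q f u) v = dot q u (f v)"
proof (rule Self.free_hom_eqI[OF _ _ _ v])
 show "dot p (transpose_map p q f u) \<in> mod_hom R (Free p) (self_module R)"
  using dot_functional[OF transpose_closed[OF f u]] by (simp add: functional_def)
 show "(\<lambda>v. dot q u (f v)) \<in> mod_hom R (Free p) (self_module R)"
  using functional_comp[OF f dot_functional[OF u]] by (simp add: functional_def)
 show "dot p (transpose_map p q f u) (unitvec k) = dot q u (f (unitvec k))" if "k < p" for k
  using dot_unitvec[OF transpose_closed[OF f u] that] that by (simp add: transpose_map_def)
qed

lemma transpose_hom:
 assumes f: "f \<in> Lin p q"
 shows "transpose_map p q f \<in> Lin q p"
proof (rule mod_homI)
 note c = transpose_closed[OF f] and t = dot_transpose[OF f] and fc = mod_hom_closed[OF f]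
 show "transpose_map p q f u \<in> Vec p" if "u \<in> Vec q" for u using c[OF that] .
 show "transpose_map p q f (u \<oplus>[q] u') = transpose_map p q f u \<oplus>[p] transpose_map p q f u'"
  if u: "u \<in> Vec q" "u' \<in> Vec q" for u u'
  by (rule dot_eqI[OF c[OF Free.M.a_closed[OF u]] Free.M.a_closed[OF c[OF u(1)] c[OF u(2)]]])
   (simp only: t[OF Free.M.a_closed[OF u]] dot_add[OF u fc] dot_add[OF c[OF u(1)] c[OF u(2)]] t[OF u(1)] t[OF u(2)])
 show "transpose_map p q f (s \<odot>[q] u) = s \<odot>[p] transpose_map p q f u"
  if s: "s \<in> carrier R" and u: "u \<in> Vec q" for s u
  by (rule dot_eqI[OF c[OF Free.smult_closed[OF s u]] Free.smult_closed[OF s c[OF u]]])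
   (simp only: t[OF Free.smult_closed[OF s u]] dot_smult[OF s u fc] dot_smult[OF s c[OF u]] t[OF u])
qed

text \<open>A complex of length l + 1 in which \<open>D (l - i)\<close> is the adjoint of
  \<open>D i\<close> up to a factor of square one. The factor may vary with the degree: in the
  intended complex it is 1 outside the middle and (-1)^m there.\<close>

definition self_dual_complex :: "nat => (nat => nat) => (nat => (nat => 'a) => nat => 'a) => bool" where
 "self_dual_complex l b D \<longleftrightarrow> (\<forall>i\<le>Suc l. b (Suc l - i) = b i) \<and> (\<forall>i>Suc l. b i = 0) \<and>
   (\<forall>i\<le>l. \<exists>\<sigma>\<in>carrier R. \<sigma> \<otimes> \<sigma> = \<one> \<and> (\<forall>u\<in>Vec (b i). \<forall>v\<in>Vec (b (Suc i)).
    dot (b i) u (D i v) = \<sigma> \<otimes> dot (b (Suc i)) (D (l - i) u) v))"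

context
 fixes M :: "('a, 'y) module" and b D \<epsilon> l
 assumes res: "resolution R M (Frees b) D \<epsilon>" and sd: "self_dual_complex l b D"
begin

lemma self_dual_rank: "i \<le> Suc l ==> b (Suc l - i) = b i" "Suc l < i ==> b i = 0"
 using sd by (auto simp: self_dual_complex_def)

lemma self_dual_adjoint:
 assumes "i \<le> l"
 obtains \<sigma> where "\<sigma> \<in> carrier R" "\<sigma> \<otimes> \<sigma> = \<one>"
  "\<And>u v. u \<in> Vec (b i) ==> v \<in> Vec (b (Suc i)) ==>
    dot (b i) u (D i v) = \<sigma> \<otimes> dot (b (Suc i)) (D (l - i) u) v" using sd assms unfolding self_dual_complex_def by metis

lemma self_dual_diff_closed:
 assumes "i \<le> l" "u \<in> Vec (b i)"
 shows "D (l - i) u \<in> Vec (b (Suc i))"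
proof -
 have e: "b (Suc (l - i)) = b i" "b (l - i) = b (Suc i)"
  using self_dual_rank(1)[of i, unfolded Suc_diff_le[OF assms(1)]] self_dual_rank(1)[of "Suc i", unfolded diff_Suc_Suc]
   assms(1) by linarith+
 then show ?thesis using mod_hom_closed[OF resolutionD(3)[OF res, of "l - i"], of u, unfolded e] assms(2) by simp
qed

text \<open>A functional is \<open>dot u\<close>. Being a cocycle means that the adjoint
  differential \<open>D (l - i)\<close> kills \<open>u\<close>; exactness of the complex itself
  writes \<open>u\<close> as a boundary, and this makes the functional a coboundary.\<close>

lemma self_dual_acyclic:
 assumes i: "i \<le> l"
 shows "acyclic_dual (Frees b) D i" unfolding acyclic_dual_def
proof (intro allI impI)
 note r = resolutionD[OF res]
 fix \<psi> assume \<psi>: "cocycle (Frees b) D i \<psi>"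
 then obtain u where u: "u \<in> Vec (b i)" "\<And>v. v \<in> Vec (b i) ==> \<psi> v = dot (b i) u v"
  using functional_dot[of "b i" \<psi>] by (auto simp: cocycle_def)
 obtain \<sigma> where \<sigma>: "\<sigma> \<in> carrier R" "\<sigma> \<otimes> \<sigma> = \<one>"
  "\<And>u v. u \<in> Vec (b i) ==> v \<in> Vec (b (Suc i)) ==>
    dot (b i) u (D i v) = \<sigma> \<otimes> dot (b (Suc i)) (D (l - i) u) v" using self_dual_adjoint[OF i] by blast
 have Du: "D (l - i) u \<in> Vec (b (Suc i))" by (rule self_dual_diff_closed[OF i u(1)])
 have "D (l - i) u = \<zero>[b (Suc i)]"
 proof (rule dot_eqI[OF Du Free.M.zero_closed])
  fix v assume v: "v \<in> Vec (b (Suc i))"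
  have Dv: "D i v \<in> Vec (b i)" using mod_hom_closed[OF r(3)] v .
  have "\<sigma> \<otimes> dot (b (Suc i)) (D (l - i) u) v = \<zero>"
   using \<sigma>(3)[OF u(1) v] u(2)[OF Dv] \<psi> v by (simp add: cocycle_def)
  then have "\<sigma> \<otimes> (\<sigma> \<otimes> dot (b (Suc i)) (D (l - i) u) v) = \<zero>" using \<sigma>(1) by simp
  then have "dot (b (Suc i)) (D (l - i) u) v = \<zero>" using \<sigma>(1,2) dot_closed[OF Du v] by (simp add: m_assoc[symmetric])
  then show "dot (b (Suc i)) (D (l - i) u) v = dot (b (Suc i)) \<zero>[b (Suc i)] v" using dot_zero[OF v] by simp
 qed
 moreover have e: "b (Suc (l - i)) = b i" using self_dual_rank(1)[of i, unfolded Suc_diff_le[OF i]] i by linarith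
 ultimately have "\<exists>w\<in>carrier (Free (b (Suc (Suc (l - i))))). u = D (Suc (l - i)) w" using u(1) by (intro r(7)) auto
 then obtain w where w: "w \<in> carrier (Free (b (Suc (Suc (l - i)))))" "u = D (Suc (l - i)) w" by blast
 show "coboundary (Frees b) D i \<psi>"
 proof (cases i)
  case 0
  \<comment> \<open>Here \<open>w\<close> has degree l + 2, beyond the end of the complex, so
    \<open>u\<close> vanishes.\<close>
  then have "w = \<zero>[b (Suc (Suc l))]" using w(1) self_dual_rank(2)[of "Suc (Suc l)"] by (auto simp: free_mod_carrier)
  then have "u = \<zero>[b (Suc l)]" using w(2) mod_hom_zero[OF r(1) r(1) r(3), of "Suc l"] 0 by simp
  then have "u = \<zero>[b 0]" by simp
  then show ?thesis using u(2) dot_zero 0 by (simp add: coboundary_def)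
 next
  case (Suc j)
  have j: "j \<le> l" "Suc (l - i) = l - j" "Suc (Suc (l - i)) = Suc l - j" using i Suc by auto
  have "b (Suc (Suc (l - i))) = b j" unfolding j(3) using self_dual_rank(1)[of j] j(1) by linarith
  then have wj: "w \<in> Vec (b j)" "u = D (l - j) w" using w unfolding j(2) by (simp_all only:)
  obtain \<tau> where \<tau>: "\<tau> \<in> carrier R" "\<tau> \<otimes> \<tau> = \<one>"
   "\<And>u v. u \<in> Vec (b j) ==> v \<in> Vec (b (Suc j)) ==>
     dot (b j) u (D j v) = \<tau> \<otimes> dot (b (Suc j)) (D (l - j) u) v" using self_dual_adjoint[OF j(1)] by blast
  have "\<psi> v = \<tau> \<otimes> dot (b j) w (D j v)" if v: "v \<in> Vec (b (Suc j))" for v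
  proof -
   have "\<psi> v = dot (b (Suc j)) (D (l - j) w) v" using u(2)[of v] v Suc wj(2) by simp
   moreover have "dot (b (Suc j)) (D (l - j) w) v \<in> carrier R" using dot_closed[OF self_dual_diff_closed[OF j(1) wj(1)] v] .
   ultimately show ?thesis using \<tau>(3)[OF wj(1) v] \<tau>(1,2) by (simp add: m_assoc[symmetric])
  qed
  then show ?thesis using Suc functional_smult[OF dot_functional[OF wj(1)] \<tau>(1)]
   by (auto simp: coboundary_def intro!: exI[of _ "\<lambda>v. \<tau> \<otimes> dot (b j) w v"])
 qed
qed

text \<open>The coboundaries in top degree correspond under \<open>dot\<close> to the image of
  \<open>D 0\<close>. So the top Ext is the quotient of R^(b 0) by that image, which is
  \<open>M\<close>.\<close>

lemma self_dual_top_coboundary: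
 assumes x: "x \<in> Vec (b 0)"
 shows "coboundary (Frees b) D (Suc l) (dot (b 0) x) \<longleftrightarrow> \<epsilon> x = \<zero>\<^bsub>M\<^esub>"
proof -
 note r = resolutionD[OF res]
 have b0: "b (Suc l) = b 0" "b l = b (Suc 0)"
  using self_dual_rank(1)[of 0, unfolded diff_zero] self_dual_rank(1)[of "Suc 0", unfolded diff_Suc_Suc diff_zero] by linarith+
 obtain \<sigma> where \<sigma>: "\<sigma> \<in> carrier R" "\<sigma> \<otimes> \<sigma> = \<one>"
  "\<And>u v. u \<in> Vec (b l) ==> v \<in> Vec (b (Suc l)) ==>
    dot (b l) u (D l v) = \<sigma> \<otimes> dot (b (Suc l)) (D (l - l) u) v" using self_dual_adjoint[OF le_refl] by blast
 have D0: "D 0 w \<in> Vec (b 0)" if "w \<in> Vec (b (Suc 0))" for w using mod_hom_closed[OF r(3)] that .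
 have adj: "dot (b l) w (D l v) = dot (b 0) (\<sigma> \<odot>[b 0] D 0 w) v"
  if "w \<in> Vec (b l)" "v \<in> Vec (b 0)" for w v using \<sigma>(3)[of w v] that b0 dot_smult[OF \<sigma>(1) D0, of w v] by simp
 show ?thesis
 proof
  assume "coboundary (Frees b) D (Suc l) (dot (b 0) x)"
  then obtain h where h: "functional (Free (b l)) h" "\<And>v. v \<in> Vec (b (Suc l)) ==> dot (b 0) x v = h (D l v)"
   by (auto simp: coboundary_def)
  obtain w where w: "w \<in> Vec (b l)" "\<And>v. v \<in> Vec (b l) ==> h v = dot (b l) w v"
   using functional_dot[OF h(1)] by blast
  have w': "w \<in> Vec (b (Suc 0))" using w(1) b0 by simp
  have "x = \<sigma> \<odot>[b 0] D 0 w"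
  proof (rule dot_eqI[OF x Free.smult_closed[OF \<sigma>(1) D0[OF w']]])
   fix v assume v: "v \<in> Vec (b 0)"
   then have v': "v \<in> Vec (b (Suc l))" using b0 by simp
   have "D l v \<in> Vec (b l)" using mod_hom_closed[OF r(3)] v' .
   then show "dot (b 0) x v = dot (b 0) (\<sigma> \<odot>[b 0] D 0 w) v" using h(2)[OF v'] w(2) adj[OF w(1) v] by simp
  qed
  then have "x = D 0 (\<sigma> \<odot>[b (Suc 0)] w)" using mod_hom_smult[OF r(3) \<sigma>(1) w'] by simp
  then show "\<epsilon> x = \<zero>\<^bsub>M\<^esub>" using r(6)[OF Free.smult_closed[OF \<sigma>(1) w']] by simp
 next
  assume "\<epsilon> x = \<zero>\<^bsub>M\<^esub>"
  then obtain w where w: "w \<in> Vec (b (Suc 0))" "x = D 0 w" using r(5)[OF x] by blast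
  let ?w = "\<sigma> \<odot>[b (Suc 0)] w"
  have w': "?w \<in> Vec (b (Suc 0))" using \<sigma>(1) w(1) by (rule Free.smult_closed)
  have "\<sigma> \<odot>[b 0] D 0 ?w = \<sigma> \<odot>[b 0] (\<sigma> \<odot>[b 0] D 0 w)"
   using mod_hom_smult[OF r(3) \<sigma>(1) w(1)] by (simp only:)
  also have "\<dots> = (\<sigma> \<otimes> \<sigma>) \<odot>[b 0] D 0 w" using Free.smult_assoc1[OF \<sigma>(1,1) D0[OF w(1)]] by metis
  also have "\<dots> = x" using \<sigma>(2) w(2) Free.smult_one[OF x] by (simp only:)
  finally have e: "\<sigma> \<odot>[b 0] D 0 ?w = x" .
  have "dot (b 0) x v = dot (b l) ?w (D l v)" if "v \<in> Vec (b (Suc l))" for v using adj[of ?w v] w' that b0 e by (simp only:)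
  then show "coboundary (Frees b) D (Suc l) (dot (b 0) x)"
   using dot_functional[of ?w "b l"] w' b0 by (simp only: coboundary_def nat.case) blast
 qed
qed

end

end

section \<open>Grade, projective dimension and the Gorenstein property\<close>

lemma Inf_enat_eq:
 assumes "Q c" "\<And>i. Q i ==> c \<le> i"
 shows "Inf {enat i | i. Q i} = enat c"
proof (rule antisym)
 show "Inf {enat i | i. Q i} \<le> enat c" by (rule Inf_lower) (use assms in auto)
 show "enat c \<le> Inf {enat i | i. Q i}" by (rule Inf_greatest) (use assms in auto)
qed

text \<open>Ext vanishes above the length of any projective resolution \<open>P\<close>; the
  vanishing is carried over to the resolution \<open>C\<close> that computes it.\<close>

lemma (in cring) proj_dim_acyclic:
 fixes P :: "nat => ('a, nat => 'a) module" and C :: "nat => ('a, 'v) module"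
 assumes P: "resolution R M P d \<epsilon>" "\<And>i. fg_projective R (P i)" "\<And>i. l < i ==> carrier (P i) = {\<zero>\<^bsub>P i\<^esub>}"
  and C: "resolution R M C dC \<epsilon>C" "\<And>i. fg_projective R (C i)" and M: "module R M" and "l < i"
 shows "acyclic_dual C dC i"
proof (rule acyclic_dual_transfer[OF C P(1,2) M])
 show "acyclic_dual P d i" unfolding acyclic_dual_def
 proof (intro allI impI)
  fix \<psi> assume "cocycle P d i \<psi>"
  then have f: "functional (P i) \<psi>" by (simp add: cocycle_def)
  obtain j where j: "i = Suc j" using assms(7) by (cases i) auto
  have "\<psi> x = \<zero>" if "x \<in> carrier (P i)" for x
   using P(3)[OF assms(7)] functionalD(4)[OF f resolutionD(1)[OF P(1)]] that by auto
  then show "coboundary P d i \<psi>" using j functional_zero by (auto simp: coboundary_def intro!: exI[of _ "\<lambda>x. \<zero>"])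
 qed
qed

text \<open>The annihilator of the zero module is everything and the zero ring has dimension
  \<open>- \<infinity>\<close>, so the codimension would not be a number.\<close>

lemma algebra_nonzero:
 assumes "cring R" "krull_dim S = ereal (real n)" "codimension S (restrict_scalars \<phi> R) = ereal (real c)" "cring S" "\<phi> \<in> ring_hom S R"
 shows "\<one>\<^bsub>R\<^esub> \<noteq> \<zero>\<^bsub>R\<^esub>"
proof
 interpret R: cring R by fact
 interpret S: cring S by fact
 assume "\<one>\<^bsub>R\<^esub> = \<zero>\<^bsub>R\<^esub>"
 then have z: "x = \<zero>\<^bsub>R\<^esub>" if "x \<in> carrier R" for x using R.one_zeroD that by blast
 have ann: "annihilator S (restrict_scalars \<phi> R) = carrier S"
  using z[OF R.m_closed[OF ring_hom_closed[OF assms(5)]]] by (auto simp: annihilator_def)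
 have "\<not> primeideal q (S Quot carrier S)" for q
 proof
  assume "primeideal q (S Quot carrier S)"
  then interpret q: primeideal q "S Quot carrier S" .
  have eq: "a = b" if ab: "a \<in> carrier (S Quot carrier S)" "b \<in> carrier (S Quot carrier S)" for a b
  proof -
   obtain a' where a': "a' \<in> carrier S" "a = carrier S +>\<^bsub>S\<^esub> a'" using S.quot_carrier_ex[OF ab(1)] by (rule bexE)
   obtain b' where b': "b' \<in> carrier S" "b = carrier S +>\<^bsub>S\<^esub> b'" using S.quot_carrier_ex[OF ab(2)] by (rule bexE)
   have "a' \<ominus>\<^bsub>S\<^esub> b' \<in> carrier S" using a'(1) b'(1) by simp
   then show ?thesis unfolding a'(2) b'(2) S.quotient_eq_iff_same_a_r_cos[OF S.oneideal a'(1) b'(1)] .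
  qed
  have z: "\<zero>\<^bsub>S Quot carrier S\<^esub> \<in> q" by (rule additive_subgroup.zero_closed[OF ideal.axioms(1)[OF q.is_ideal]])
  have "carrier (S Quot carrier S) \<subseteq> q"
  proof
   fix a assume "a \<in> carrier (S Quot carrier S)"
   from eq[OF this, of "\<zero>\<^bsub>S Quot carrier S\<^esub>"] show "a \<in> q" using z q.a_subset by (simp add: subset_iff)
  qed
  then have "carrier (S Quot carrier S) = q" using q.a_subset by (rule equalityI)
  then show False using q.I_notcarr by simp
 qed
 then have e: "{n. \<exists>p. (\<forall>i\<le>n. primeideal (p i) (S Quot carrier S)) \<and> (\<forall>i<n. p i \<subset> p (Suc i))} = {}" by auto
 have "krull_dim (S Quot carrier S) = - \<infinity>" unfolding krull_dim_def e by (simp add: bot_ereal_def)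
 then show False using assms(2,3) by (simp add: codimension_def module_dim_def ann)
qed

text \<open>The isomorphism sends \<open>\<epsilon> x\<close> to the top class of
  \<open>dot x\<close>. That it is well defined and bijective is duality; its linearity over
  \<open>R\<close> is where the birationality is used.\<close>

theorem gorenstein_of_self_dual:
 fixes S :: "('a, 'r) ring_scheme" and R :: "('b, 'q) ring_scheme" and \<phi> :: "'a => 'b"
 defines "RS \<equiv> restrict_scalars \<phi> R"
 defines "S' \<equiv> S Quot annihilator S RS"
 defines "\<phi>' \<equiv> \<lambda>P. the_elem (\<phi> ` P)"
 assumes reg: "regular_local_ring S \<mm>" and R: "cring R" and \<phi>: "\<phi> \<in> ring_hom S R" and fg: "fin_gen S RS"
  and loc_iso: "\<And>p. minimal_prime S' p ==>
      localization_map R (carrier S' - p) \<phi>'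
       \<in> ring_iso (localization S' (carrier S' - p)) (localization R (\<phi>' ` (carrier S' - p)))"
  and codim: "codimension S RS = ereal (real (Suc l))"
  and res: "resolution S RS (\<lambda>i. free_mod S (b i)) D \<epsilon>" and sd: "cring.self_dual_complex S l b D"
 shows "gorenstein_algebra S R \<phi> (Suc l)"
proof -
 have locS: "local_ring S \<mm>" using reg by (simp add: regular_local_ring_def)
 then interpret S: cring S by (simp add: local_ring_def)
 interpret R: cring R by fact
 interpret \<phi>: ring_hom_cring S R \<phi> using \<phi> by unfold_locales
 let ?c = "Suc l"
 have M: "module S RS" unfolding RS_def by (rule module_restrict_scalars[OF S.is_cring R \<phi>])
 interpret M: lmodule S RS by (rule lmodule.intro) (rule M)
 note r = resolutionD[OF res]
 note chosen = S.chosen_resolution_res[OF res]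
 define C dC \<epsilon>C where "C = res_mod S RS" and "dC = res_diff S RS" and "\<epsilon>C = res_aug S RS"
 have C: "resolution S RS C dC \<epsilon>C" using chosen by (simp add: C_def dC_def \<epsilon>C_def)
 have Cp: "fg_projective S (C i)" for i unfolding C_def by (rule S.res_mod_projective)
 have Qp: "fg_projective S (S.Free (b i))" for i by (rule S.fg_projective_free)
 obtain F where F: "chain_map_over S C dC \<epsilon>C (S.Frees b) D \<epsilon> (\<lambda>x. x) F"
  using S.chain_map_ex[OF C Cp res M M mod_hom_id] by blast
 obtain G where G: "chain_map_over S (S.Frees b) D \<epsilon> C dC \<epsilon>C (\<lambda>x. x) G"
  using S.chain_map_ex[OF res Qp C M M mod_hom_id] by blast
 note Fh = chain_map_overD(1)[OF F] and Gh = chain_map_overD(1)[OF G]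
 note Fc = mod_hom_closed[OF Fh]
 define E where "E i = Ext S i RS (self_module S)" for i
 note E_carrier = S.Ext_carrier[OF M chosen, folded E_def C_def dC_def] and E_add = S.Ext_add[OF M chosen, folded E_def C_def dC_def]
  and E_eq = S.Ext_class_eq_iff[OF M chosen, folded E_def C_def dC_def] and E_zero = S.Ext_zero[OF M chosen, folded E_def C_def dC_def]
  and E_trivial = S.Ext_trivial_iff[OF M chosen, folded E_def C_def dC_def]
  and E_map = S.Ext_class_smult_map[OF M chosen, folded E_def C_def dC_def \<epsilon>C_def]
  and lift_map = S.chain_lift_map[OF M chosen, folded E_def C_def dC_def \<epsilon>C_def]
 have bc: "b ?c = b 0" and bz: "\<And>i. ?c < i ==> b i = 0"
  using S.self_dual_rank(1)[OF res sd, of 0] S.self_dual_rank(2)[OF res sd] by auto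
 have ex: "exact_free S b D" using res by (simp add: resolution_def exact_free_def)
 have R1: "\<one>\<^bsub>R\<^esub> \<noteq> \<zero>\<^bsub>R\<^esub>"
 proof -
  obtain n x where "krull_dim S = ereal (real n)" "S.regular_seq n x" "\<And>i. i < n ==> x i \<in> \<mm>"
   by (rule S.regular_local_regular_seq[OF reg]) (rule that)
  then show ?thesis using algebra_nonzero[OF R _ codim[unfolded RS_def] S.is_cring \<phi>] by blast
 qed
 \<comment> \<open>The class of the functional \<open>dot x\<close> on the last module, pulled back
   by \<open>F\<close> to the chosen resolution that defines \<open>Ext\<close>.\<close>
 define K where "K x = S.Ext_class RS ?c (\<lambda>v. S.dot (b 0) x (F ?c v))" for x
 have coc_top: "S.cocycle (S.Frees b) D ?c (S.dot (b 0) x)" if x: "x \<in> S.Vec (b 0)" for x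
 proof -
  have "S.functional (S.Free (b ?c)) (S.dot (b 0) x)" using S.dot_functional[OF x] bc by simp
  moreover have "S.dot (b 0) x (D ?c v) = \<zero>\<^bsub>S\<^esub>" if v: "v \<in> S.Vec (b (Suc ?c))" for v
  proof -
   have "v = \<zero>\<^bsub>S.Free (b (Suc ?c))\<^esub>" using v bz[of "Suc ?c"] by (auto simp: free_mod_carrier)
   then have "D ?c v = \<zero>\<^bsub>S.Free (b ?c)\<^esub>" using mod_hom_zero[OF r(1) r(1) r(3), of ?c] by simp
   then show ?thesis using S.functionalD(4)[OF S.dot_functional[OF x] S.free_module] bc by simp
  qed
  ultimately show ?thesis by (simp add: S.cocycle_def)
 qed
 have coc: "S.cocycle C dC ?c (\<lambda>v. S.dot (b 0) x (F ?c v))" if "x \<in> S.Vec (b 0)" for x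
  by (rule S.cocycle_pullback[OF F coc_top[OF that]])
 have fnl: "S.functional (C ?c) (\<lambda>v. S.dot (b 0) x (F ?c v))" if "x \<in> S.Vec (b 0)" for x
  using coc[OF that] by (simp add: S.cocycle_def)
 have Fc0: "F ?c v \<in> S.Vec (b 0)" if "v \<in> carrier (C ?c)" for v using Fc[OF that] bc by simp
 have K_carrier: "K x \<in> carrier (E ?c)" if "x \<in> S.Vec (b 0)" for x unfolding K_def E_carrier using coc[OF that] by blast
 \<comment> \<open>So \<open>K\<close> factors through \<open>\<epsilon>\<close> and is injective on
   \<open>R\<close>. The question is moved to the self-dual resolution, where the top coboundaries
   are known.\<close>
 have K_eq: "K x = K y \<longleftrightarrow> \<epsilon> x = \<epsilon> y"
  if x: "x \<in> S.Vec (b 0)" and y: "y \<in> S.Vec (b 0)" for x y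
 proof -
  have xy: "x \<ominus>\<^bsub>S.Free (b 0)\<^esub> y \<in> S.Vec (b 0)" using x y by (rule S.Free.M.minus_closed)
  have "K x = K y \<longleftrightarrow> S.coboundary C dC ?c (\<lambda>v. S.dot (b 0) x (F ?c v) \<ominus>\<^bsub>S\<^esub> S.dot (b 0) y (F ?c v))"
   unfolding K_def by (rule E_eq[OF fnl[OF x] fnl[OF y]])
  also have "\<dots> \<longleftrightarrow> S.coboundary C dC ?c (\<lambda>v. S.dot (b 0) (x \<ominus>\<^bsub>S.Free (b 0)\<^esub> y) (F ?c v))"
   by (rule S.coboundary_cong_iff) (simp only: S.dot_minus[OF x y Fc0])
  also have "\<dots> \<longleftrightarrow> S.coboundary (S.Frees b) D ?c (S.dot (b 0) (x \<ominus>\<^bsub>S.Free (b 0)\<^esub> y))"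
   by (rule S.coboundary_transfer(2)[OF res Qp C M G F coc_top[OF xy]])
  also have "\<dots> \<longleftrightarrow> \<epsilon> (x \<ominus>\<^bsub>S.Free (b 0)\<^esub> y) = \<zero>\<^bsub>RS\<^esub>"
   by (rule S.self_dual_top_coboundary[OF res sd xy])
  also have "\<dots> \<longleftrightarrow> \<epsilon> x = \<epsilon> y" unfolding mod_hom_minus[OF r(1) M r(2) x y]
   using M.eq_of_minus_zero[of "\<epsilon> x" "\<epsilon> y"] M.minus_self[of "\<epsilon> y"] mod_hom_closed[OF r(2) x] mod_hom_closed[OF r(2) y] by auto
  finally show ?thesis .
 qed
 have K_surj: "\<exists>x\<in>S.Vec (b 0). Z = K x" if Z: "Z \<in> carrier (E ?c)" for Z
 proof -
  obtain \<psi> where \<psi>: "S.cocycle C dC ?c \<psi>" "Z = S.Ext_class RS ?c \<psi>" using Z unfolding E_carrier by blast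
  have f\<psi>: "S.functional (C ?c) \<psi>" using \<psi>(1) by (simp add: S.cocycle_def)
  obtain x where x: "x \<in> S.Vec (b ?c)" "\<And>v. v \<in> S.Vec (b ?c) ==> \<psi> (G ?c v) = S.dot (b ?c) x v"
   using S.functional_dot[OF S.functional_comp[OF Gh f\<psi>]] by blast
  have x0: "x \<in> S.Vec (b 0)" using x bc by simp
  have "K x = Z" unfolding K_def \<psi>(2) E_eq[OF fnl[OF x0] f\<psi>]
  proof (rule S.coboundary_cong[OF S.coboundary_transfer(1)[OF C Cp res M F G \<psi>(1)]])
   fix v assume v: "v \<in> carrier (C ?c)"
   show "S.dot (b 0) x (F ?c v) \<ominus>\<^bsub>S\<^esub> \<psi> v = \<psi> (G ?c (F ?c v)) \<ominus>\<^bsub>S\<^esub> \<psi> v"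
    using x(2)[OF Fc[OF v]] bc by simp
  qed
  then show ?thesis using x0 by blast
 qed
 have K_add: "K (x \<oplus>\<^bsub>S.Free (b 0)\<^esub> y) = K x \<oplus>\<^bsub>E ?c\<^esub> K y"
  if x: "x \<in> S.Vec (b 0)" and y: "y \<in> S.Vec (b 0)" for x y
 proof -
  have xy: "x \<oplus>\<^bsub>S.Free (b 0)\<^esub> y \<in> S.Vec (b 0)" using x y by (rule S.Free.M.a_closed)
  have "K x \<oplus>\<^bsub>E ?c\<^esub> K y = S.Ext_class RS ?c (\<lambda>v. S.dot (b 0) x (F ?c v) \<oplus>\<^bsub>S\<^esub> S.dot (b 0) y (F ?c v))"
   unfolding K_def by (rule E_add[OF fnl[OF x] fnl[OF y]])
  also have "\<dots> = K (x \<oplus>\<^bsub>S.Free (b 0)\<^esub> y)" unfolding K_def S.Ext_class_def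
   by (rule arg_cong[where f = "\<lambda>h. _ +>\<^bsub>_\<^esub> h"]) (rule restrict_ext, simp only: S.dot_add[OF x y Fc0] flip: C_def)
  finally show ?thesis by simp
 qed
 have noethS: "noetherian_ring S" using locS by (simp add: local_ring_def)
 \<comment> \<open>A defect of linearity is a torsion element, and nonzero elements of \<open>R\<close> are not torsion.\<close>
 have K_map: "Ext_map S ?c RS RS (self_module S) (\<lambda>x. s \<otimes>\<^bsub>R\<^esub> x) (K x) = K z"
  if s: "s \<in> carrier R" and x: "x \<in> S.Vec (b 0)" and z: "z \<in> S.Vec (b 0)" "\<epsilon> z = s \<otimes>\<^bsub>R\<^esub> \<epsilon> x"
  for s x z
 proof -
  have mult: "(\<lambda>x. s \<otimes>\<^bsub>R\<^esub> x) \<in> mod_hom S RS RS"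
   unfolding RS_def using s by (intro mod_homI) (auto simp: R.r_distr R.m_lcomm)
  define t where "t = chain_lift S RS RS (\<lambda>x. s \<otimes>\<^bsub>R\<^esub> x)"
  have t: "chain_map_over S C dC \<epsilon>C C dC \<epsilon>C (\<lambda>x. s \<otimes>\<^bsub>R\<^esub> x) t" unfolding t_def by (rule lift_map[OF mult])
  note th = chain_map_overD(1)[OF t]
  define \<psi> where "\<psi> = (\<lambda>v. S.dot (b 0) x (F ?c v))"
  have c\<psi>: "S.cocycle C dC ?c \<psi>" and f\<psi>: "S.functional (C ?c) \<psi>" unfolding \<psi>_def using coc fnl x by auto
  have f\<psi>t: "S.functional (C ?c) (\<lambda>v. \<psi> (t ?c v))" by (rule S.functional_comp[OF th f\<psi>])
  have map: "Ext_map S ?c RS RS (self_module S) (\<lambda>x. s \<otimes>\<^bsub>R\<^esub> x) (K x) = S.Ext_class RS ?c (\<lambda>v. \<psi> (t ?c v))"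
   unfolding K_def \<psi>_def[symmetric] by (rule E_map[OF c\<psi> mult t])
  have "S.Ext_class RS ?c (\<lambda>v. \<psi> (t ?c v)) \<in> carrier (E ?c)"
   unfolding E_carrier using S.cocycle_pullback[OF t c\<psi>] by blast
  then obtain w where w: "w \<in> S.Vec (b 0)" "S.Ext_class RS ?c (\<lambda>v. \<psi> (t ?c v)) = K w" using K_surj by blast
  have \<epsilon>c: "\<epsilon> w \<in> carrier R" "\<epsilon> x \<in> carrier R" "\<epsilon> z \<in> carrier R"
   using mod_hom_closed[OF r(2) w(1)] mod_hom_closed[OF r(2) x] mod_hom_closed[OF r(2) z(1)] unfolding RS_def by auto
  \<comment> \<open>\<open>K w\<close> is \<open>s\<close> acting on \<open>K x\<close>, so
    \<open>\<delta>\<close> measures the failure of linearity.\<close>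
  define \<delta> where "\<delta> = \<epsilon> w \<ominus>\<^bsub>R\<^esub> s \<otimes>\<^bsub>R\<^esub> \<epsilon> x"
  have \<delta>c: "\<delta> \<in> carrier R" unfolding \<delta>_def using \<epsilon>c s by simp
  \<comment> \<open>If \<open>\<phi> u\<close> times \<open>s\<close> is \<open>\<phi> a\<close>,
    then \<open>u\<close> times the lift of multiplication by \<open>s\<close>, and plain
    multiplication by the scalar \<open>a\<close>, lift the same map and are homotopic. Hence
    \<open>K (u w) = K (a x)\<close>.\<close>
  have kill: "\<phi> u \<otimes>\<^bsub>R\<^esub> \<delta> = \<zero>\<^bsub>R\<^esub>" if u: "u \<in> carrier S" "a \<in> carrier S" "\<phi> u \<otimes>\<^bsub>R\<^esub> s = \<phi> a" for u a
  proof -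
   interpret Cm: lmodule S "C k" for k by (rule lmodule.intro) (rule resolutionD(1)[OF C])
   note tc = mod_hom_closed[OF th]
   have t1: "chain_map_over S C dC \<epsilon>C C dC \<epsilon>C (\<lambda>x. \<phi> a \<otimes>\<^bsub>R\<^esub> x) (\<lambda>i v. a \<odot>\<^bsub>C i\<^esub> v)"
    unfolding chain_map_over_def
    using Cm.mod_hom_smultf[OF mod_hom_id u(2)] mod_hom_smult[OF resolutionD(2)[OF C] u(2)] mod_hom_smult[OF resolutionD(3)[OF C] u(2)]
    by (simp add: RS_def)
   have t2: "chain_map_over S C dC \<epsilon>C C dC \<epsilon>C (\<lambda>x. \<phi> a \<otimes>\<^bsub>R\<^esub> x) (\<lambda>i v. u \<odot>\<^bsub>C i\<^esub> t i v)"
    unfolding chain_map_over_def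
   proof (intro conjI allI ballI)
    show "(\<lambda>v. u \<odot>\<^bsub>C i\<^esub> t i v) \<in> mod_hom S (C i) (C i)" for i by (rule Cm.mod_hom_smultf[OF th u(1)])
    show "\<epsilon>C (u \<odot>\<^bsub>C 0\<^esub> t 0 v) = \<phi> a \<otimes>\<^bsub>R\<^esub> \<epsilon>C v" if v: "v \<in> carrier (C 0)" for v
    proof -
     have "\<epsilon>C v \<in> carrier R" using mod_hom_closed[OF resolutionD(2)[OF C] v] by (simp add: RS_def)
     then show ?thesis using mod_hom_smult[OF resolutionD(2)[OF C] u(1) tc[OF v]] chain_map_overD(2)[OF t v] u s
      by (simp add: RS_def R.m_assoc[symmetric])
    qed
    show "dC i (u \<odot>\<^bsub>C (Suc i)\<^esub> t (Suc i) v) = u \<odot>\<^bsub>C i\<^esub> t i (dC i v)" if v: "v \<in> carrier (C (Suc i))" for i v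
     using mod_hom_smult[OF resolutionD(3)[OF C] u(1) tc[OF v]] chain_map_overD(3)[OF t v] by simp
   qed
   have uw: "u \<odot>\<^bsub>S.Free (b 0)\<^esub> w \<in> S.Vec (b 0)" and ax: "a \<odot>\<^bsub>S.Free (b 0)\<^esub> x \<in> S.Vec (b 0)"
    using S.Free.smult_closed[OF u(1) w(1)] S.Free.smult_closed[OF u(2) x] .
   have c1: "S.coboundary C dC ?c (\<lambda>v. u \<otimes>\<^bsub>S\<^esub> (\<psi> (t ?c v) \<ominus>\<^bsub>S\<^esub> S.dot (b 0) w (F ?c v)))"
    using w(2) unfolding K_def E_eq[OF f\<psi>t fnl[OF w(1)]] by (rule S.coboundary_smult[OF _ u(1)])
   have c2: "S.coboundary C dC ?c (\<lambda>v. \<psi> (u \<odot>\<^bsub>C ?c\<^esub> t ?c v) \<ominus>\<^bsub>S\<^esub> \<psi> (a \<odot>\<^bsub>C ?c\<^esub> v))"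
    by (rule S.coboundary_homotopic[OF C Cp C M t2 t1 c\<psi>])
   have "K (u \<odot>\<^bsub>S.Free (b 0)\<^esub> w) = K (a \<odot>\<^bsub>S.Free (b 0)\<^esub> x)"
    unfolding K_def E_eq[OF fnl[OF uw] fnl[OF ax]]
   proof (rule S.coboundary_cong[OF S.coboundary_add[OF c2 S.coboundary_smult[OF c1, of "\<ominus>\<^bsub>S\<^esub> \<one>\<^bsub>S\<^esub>"]]])
    fix v assume v: "v \<in> carrier (C ?c)"
    have 1: "S.dot (b 0) (u \<odot>\<^bsub>S.Free (b 0)\<^esub> w) (F ?c v) = u \<otimes>\<^bsub>S\<^esub> S.dot (b 0) w (F ?c v)"
     by (rule S.dot_smult[OF u(1) w(1) Fc0[OF v]])
    have 2: "S.dot (b 0) (a \<odot>\<^bsub>S.Free (b 0)\<^esub> x) (F ?c v) = a \<otimes>\<^bsub>S\<^esub> \<psi> v"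
     unfolding \<psi>_def by (rule S.dot_smult[OF u(2) x Fc0[OF v]])
    have 3: "\<psi> (u \<odot>\<^bsub>C ?c\<^esub> t ?c v) = u \<otimes>\<^bsub>S\<^esub> \<psi> (t ?c v)" by (rule S.functionalD(3)[OF f\<psi> u(1) tc[OF v]])
    have 4: "\<psi> (a \<odot>\<^bsub>C ?c\<^esub> v) = a \<otimes>\<^bsub>S\<^esub> \<psi> v" by (rule S.functionalD(3)[OF f\<psi> u(2) v])
    have cc: "\<psi> (t ?c v) \<in> carrier S" "\<psi> v \<in> carrier S" "S.dot (b 0) w (F ?c v) \<in> carrier S"
     using S.functionalD(1)[OF f\<psi> tc[OF v]] S.functionalD(1)[OF f\<psi> v] S.dot_closed[OF w(1) Fc0[OF v]] by auto
    show "S.dot (b 0) (u \<odot>\<^bsub>S.Free (b 0)\<^esub> w) (F ?c v) \<ominus>\<^bsub>S\<^esub> S.dot (b 0) (a \<odot>\<^bsub>S.Free (b 0)\<^esub> x) (F ?c v) =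
     (\<psi> (u \<odot>\<^bsub>C ?c\<^esub> t ?c v) \<ominus>\<^bsub>S\<^esub> \<psi> (a \<odot>\<^bsub>C ?c\<^esub> v)) \<oplus>\<^bsub>S\<^esub>
      (\<ominus>\<^bsub>S\<^esub> \<one>\<^bsub>S\<^esub>) \<otimes>\<^bsub>S\<^esub> (u \<otimes>\<^bsub>S\<^esub> (\<psi> (t ?c v) \<ominus>\<^bsub>S\<^esub> S.dot (b 0) w (F ?c v)))"
     unfolding 1 2 3 4 using cc u(1,2) by algebra
   qed simp
   then have "\<epsilon> (u \<odot>\<^bsub>S.Free (b 0)\<^esub> w) = \<epsilon> (a \<odot>\<^bsub>S.Free (b 0)\<^esub> x)" using K_eq[OF uw ax] by blast
   then have "\<phi> u \<otimes>\<^bsub>R\<^esub> \<epsilon> w = \<phi> a \<otimes>\<^bsub>R\<^esub> \<epsilon> x"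
    using mod_hom_smult[OF r(2) u(1) w(1)] mod_hom_smult[OF r(2) u(2) x] by (simp only: RS_def restrict_scalars_simps)
   then have "\<phi> u \<otimes>\<^bsub>R\<^esub> \<epsilon> w = (\<phi> u \<otimes>\<^bsub>R\<^esub> s) \<otimes>\<^bsub>R\<^esub> \<epsilon> x" using u(3) by simp
   moreover have "\<phi> u \<in> carrier R" using u by simp
   ultimately show ?thesis unfolding \<delta>_def using \<epsilon>c s R.minus_eq by (simp add: R.r_distr R.m_assoc R.r_minus R.r_neg)
  qed
  have "\<delta> = \<zero>\<^bsub>R\<^esub>"
  proof (rule ccontr)
   assume "\<delta> \<noteq> \<zero>\<^bsub>R\<^esub>"
   have zsub: "submodule {\<zero>\<^bsub>RS\<^esub>} S RS" by (rule M.submodI) auto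
   have "\<delta> \<in> carrier RS" "\<delta> \<notin> {\<zero>\<^bsub>RS\<^esub>}" using \<delta>c \<open>\<delta> \<noteq> \<zero>\<^bsub>R\<^esub>\<close> by (simp_all add: RS_def)
   from M.assoc_prime_ex[OF noethS zsub this]
   obtain s0 where s0: "s0 \<in> carrier S" "s0 \<odot>\<^bsub>RS\<^esub> \<delta> \<notin> {\<zero>\<^bsub>RS\<^esub>}"
    "primeideal {r \<in> carrier S. r \<odot>\<^bsub>RS\<^esub> (s0 \<odot>\<^bsub>RS\<^esub> \<delta>) \<in> {\<zero>\<^bsub>RS\<^esub>}} S"
    by (elim bexE conjE)
   define y where "y = \<phi> s0 \<otimes>\<^bsub>R\<^esub> \<delta>"
   define P where "P = {r \<in> carrier S. \<phi> r \<otimes>\<^bsub>R\<^esub> y = \<zero>\<^bsub>R\<^esub>}"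
   have y: "y \<in> carrier R" "y \<noteq> \<zero>\<^bsub>R\<^esub>" and P: "primeideal P S"
    using s0 \<delta>c by (simp_all add: y_def P_def RS_def)
   \<comment> \<open>\<open>P\<close> is the annihilator of a multiple \<open>y\<close> of
     \<open>\<delta>\<close>. A denominator \<open>u\<close> of \<open>s\<close> outside
     \<open>P\<close> kills \<open>\<delta>\<close>, hence \<open>y\<close>, and so lies in
     \<open>P\<close>.\<close>
   have "\<exists>u\<in>carrier S - P. \<exists>a\<in>carrier S. \<phi> u \<otimes>\<^bsub>R\<^esub> s = \<phi> a"
   proof (rule birational_denominator[OF reg R \<phi> _ _ ex _ _ _ _ y P_def P s])
    show "codimension S (restrict_scalars \<phi> R) = ereal (real (Suc l))" using codim by (simp add: RS_def)
    show "b i = 0" if "Suc l < i" for i using bz[OF that] .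
    show "\<epsilon> \<in> mod_hom S (S.Free (b 0)) (restrict_scalars \<phi> R)" using r(2) by (simp add: RS_def)
    show "\<epsilon> ` S.Vec (b 0) = carrier (restrict_scalars \<phi> R)"
     "D 0 ` S.Vec (b 1) = mod_ker (S.Free (b 0)) (restrict_scalars \<phi> R) \<epsilon>"
     using res by (simp_all add: resolution_def RS_def)
   qed (use loc_iso in \<open>simp add: S'_def RS_def \<phi>'_def\<close>)
   then obtain u a where u: "u \<in> carrier S - P" "a \<in> carrier S" "\<phi> u \<otimes>\<^bsub>R\<^esub> s = \<phi> a" by blast
   have uS: "u \<in> carrier S" using u by blast
   have "\<phi> u \<otimes>\<^bsub>R\<^esub> y = \<phi> s0 \<otimes>\<^bsub>R\<^esub> (\<phi> u \<otimes>\<^bsub>R\<^esub> \<delta>)"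
    unfolding y_def using uS s0(1) \<delta>c by (simp add: R.m_lcomm)
   also have "\<dots> = \<zero>\<^bsub>R\<^esub>" using kill[OF uS u(2,3)] s0(1) by simp
   finally have "u \<in> P" using uS by (simp add: P_def)
   then show False using u(1) by blast
  qed
  then have "\<epsilon> w = \<epsilon> z"
   using R.r_right_minus_eq[of "\<epsilon> w" "s \<otimes>\<^bsub>R\<^esub> \<epsilon> x"] \<epsilon>c s z(2) by (simp add: \<delta>_def)
  then have "K w = K z" using K_eq[OF w(1) z(1)] by simp
  then show ?thesis using map w(2) by simp
 qed
 have nontriv: "carrier (E i) \<noteq> {\<zero>\<^bsub>E i\<^esub>} \<longleftrightarrow> \<not> S.acyclic_dual C dC i" for i using E_trivial by simp
 have low: "S.acyclic_dual C dC i" if "i < ?c" for i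
  using that by (intro S.acyclic_dual_transfer[OF C Cp res Qp M S.self_dual_acyclic[OF res sd]]) simp
 have top: "\<not> S.acyclic_dual C dC ?c"
 proof
  assume a: "S.acyclic_dual C dC ?c"
  obtain x where x: "x \<in> S.Vec (b 0)" "\<one>\<^bsub>R\<^esub> = \<epsilon> x"
   using r(4)[of "\<one>\<^bsub>R\<^esub>"] by (auto simp: RS_def)
  have z: "\<zero>\<^bsub>S.Free (b 0)\<^esub> \<in> S.Vec (b 0)" by (rule S.Free.M.zero_closed)
  have "carrier (E ?c) = {\<zero>\<^bsub>E ?c\<^esub>}" using E_trivial a by simp
  then have "K x = K \<zero>\<^bsub>S.Free (b 0)\<^esub>" using K_carrier[OF x(1)] K_carrier[OF z] by simp
  then have "\<epsilon> x = \<epsilon> \<zero>\<^bsub>S.Free (b 0)\<^esub>" using K_eq[OF x(1) z] by simp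
  also have "\<dots> = \<zero>\<^bsub>R\<^esub>" using mod_hom_zero[OF r(1) M r(2)] by (simp add: RS_def)
  finally show False using x(2) R1 by simp
 qed
 have grade: "grade S RS = enat ?c" unfolding grade_def E_def[symmetric] nontriv
 proof (rule Inf_enat_eq[where Q = "\<lambda>i. \<not> S.acyclic_dual C dC i", OF top])
  fix i assume "\<not> S.acyclic_dual C dC i"
  then show "?c \<le> i" using low[of i] by (cases "i < ?c") auto
 qed
 have pd: "proj_dim S RS = enat ?c" unfolding proj_dim_def
 proof (rule Inf_enat_eq)
  show "\<exists>(P :: nat => ('a, nat => 'a) module) d \<epsilon>. resolution S RS P d \<epsilon> \<and> (\<forall>i. fg_projective S (P i)) \<and>
    (\<forall>i>?c. carrier (P i) = {\<zero>\<^bsub>P i\<^esub>})"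
  proof (intro exI conjI allI impI)
   show "resolution S RS (S.Frees b) D \<epsilon>" by (rule res)
   show "fg_projective S (S.Free (b i))" for i by (rule Qp)
   show "S.Vec (b i) = {\<zero>\<^bsub>S.Free (b i)\<^esub>}" if "i > ?c" for i using bz[OF that] by (auto simp: free_mod_carrier)
  qed
  fix k assume "\<exists>(P :: nat => ('a, nat => 'a) module) d \<epsilon>. resolution S RS P d \<epsilon> \<and> (\<forall>i. fg_projective S (P i)) \<and>
    (\<forall>i>k. carrier (P i) = {\<zero>\<^bsub>P i\<^esub>})"
  then obtain P :: "nat => ('a, nat => 'a) module" and d \<epsilon>P where
   P: "resolution S RS P d \<epsilon>P" "\<And>i. fg_projective S (P i)" "\<And>i. k < i ==> carrier (P i) = {\<zero>\<^bsub>P i\<^esub>}" by blast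
  \<comment> \<open>A projective resolution of length below \<open>?c\<close> would make the top Ext
    vanish, although it is isomorphic to \<open>R\<close>, which is not zero.\<close>
  show "?c \<le> k"
  proof (rule ccontr)
   assume "\<not> ?c \<le> k"
   then have "S.acyclic_dual C dC ?c" by (intro S.proj_dim_acyclic[OF P C Cp M]) auto
   then show False using top by simp
  qed
 qed
 \<comment> \<open>Any choice of preimages will do, since \<open>K\<close> only depends on the image
   under \<open>\<epsilon>\<close>.\<close>
 define pre where "pre y = (SOME x. x \<in> S.Vec (b 0) \<and> \<epsilon> x = y)" for y
 have pre: "pre y \<in> S.Vec (b 0)" "\<epsilon> (pre y) = y" if "y \<in> carrier R" for y
 proof -
  have "\<exists>x. x \<in> S.Vec (b 0) \<and> \<epsilon> x = y" using r(4)[of y] that by (auto simp: RS_def)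
  then have "pre y \<in> S.Vec (b 0) \<and> \<epsilon> (pre y) = y" unfolding pre_def by (rule someI_ex)
  then show "pre y \<in> S.Vec (b 0)" "\<epsilon> (pre y) = y" by blast+
 qed
 let ?f = "\<lambda>y. K (pre y)"
 let ?E = "Ext_over_algebra S R \<phi> ?c"
 have EE: "carrier ?E = carrier (E ?c)" "add ?E = add (E ?c)"
  "smult ?E = (\<lambda>s. Ext_map S ?c RS RS (self_module S) (\<lambda>x. s \<otimes>\<^bsub>R\<^esub> x))"
  by (simp_all add: Ext_over_algebra_def Let_def E_def RS_def)
 have "?f \<in> mod_iso R (self_module R) ?E"
 proof (rule mod_isoI)
  show "?f \<in> mod_hom R (self_module R) ?E"
  proof (rule mod_homI)
   fix x assume x: "x \<in> carrier (self_module R)"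
   then show "?f x \<in> carrier ?E" unfolding EE using K_carrier pre by simp
   fix y assume y: "y \<in> carrier (self_module R)"
   have xy: "x \<in> carrier R" "y \<in> carrier R" "x \<oplus>\<^bsub>R\<^esub> y \<in> carrier R" using x y by auto
   have s: "pre x \<oplus>\<^bsub>S.Free (b 0)\<^esub> pre y \<in> S.Vec (b 0)"
    using pre(1)[OF xy(1)] pre(1)[OF xy(2)] by (rule S.Free.M.a_closed)
   have "\<epsilon> (pre x \<oplus>\<^bsub>S.Free (b 0)\<^esub> pre y) = x \<oplus>\<^bsub>R\<^esub> y"
    using mod_hom_add[OF r(2) pre(1)[OF xy(1)] pre(1)[OF xy(2)]] pre(2) xy by (simp add: RS_def)
   then have "?f (x \<oplus>\<^bsub>R\<^esub> y) = K (pre x \<oplus>\<^bsub>S.Free (b 0)\<^esub> pre y)"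
    using K_eq[OF pre(1)[OF xy(3)] s] pre(2)[OF xy(3)] by simp
   then show "?f (x \<oplus>\<^bsub>self_module R\<^esub> y) = ?f x \<oplus>\<^bsub>?E\<^esub> ?f y"
    unfolding EE using K_add[OF pre(1)[OF xy(1)] pre(1)[OF xy(2)]] by simp
  next
   fix s x assume "s \<in> carrier R" "x \<in> carrier (self_module R)"
   then have sx: "s \<in> carrier R" "x \<in> carrier R" "s \<otimes>\<^bsub>R\<^esub> x \<in> carrier R" by auto
   show "?f (s \<odot>\<^bsub>self_module R\<^esub> x) = s \<odot>\<^bsub>?E\<^esub> ?f x"
    unfolding EE using K_map[OF sx(1) pre(1)[OF sx(2)] pre(1)[OF sx(3)]] pre(2)[OF sx(2)] pre(2)[OF sx(3)] by simp
  qed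
  show "bij_betw ?f (carrier (self_module R)) (carrier ?E)" unfolding bij_betw_def EE
  proof (intro conjI inj_onI equalityI subsetI)
   fix x y assume "x \<in> carrier (self_module R)" "y \<in> carrier (self_module R)" "?f x = ?f y"
   then show "x = y" using K_eq[OF pre(1) pre(1), of x y] pre(2)[of x] pre(2)[of y] by simp
  next
   fix Z assume "Z \<in> ?f ` carrier (self_module R)"
   then show "Z \<in> carrier (E ?c)" using K_carrier pre(1) by auto
  next
   fix Z assume "Z \<in> carrier (E ?c)"
   then obtain x where x: "x \<in> S.Vec (b 0)" "Z = K x" using K_surj by blast
   have ex: "\<epsilon> x \<in> carrier R" using mod_hom_closed[OF r(2) x(1)] by (simp add: RS_def)
   have "Z = ?f (\<epsilon> x)" unfolding x(2) using K_eq[OF x(1) pre(1)[OF ex]] pre(2)[OF ex] by simp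
   then show "Z \<in> ?f ` carrier (self_module R)" using ex by simp
  qed
 qed
 then show ?thesis unfolding gorenstein_algebra_def perfect_module_def using codim fg grade pd by (auto simp: RS_def)
qed

section \<open>Minimal free resolutions\<close>

context lmodule
begin

lemma lincomb_in_submod:
 assumes K: "submodule K R M" and "\<And>k. k < n ==> a k \<in> carrier R" "\<And>k. k < n ==> g k \<in> carrier M"
  and "\<And>k. k < n ==> a k \<odot>\<^sub>M g k \<in> K"
 shows "lincomb M n a g \<in> K" using assms(2-)
 by (induction n) (auto simp: lincomb_Suc submod_zero[OF K] intro!: submod_add[OF K])

lemma prime_mult_mem:
 assumes P: "ideal P R" and A: "A \<subseteq> carrier M" and p: "p \<in> P" and x: "x \<in> mspan R M A"
 shows "p \<odot>\<^sub>M x \<in> prime_mult P A"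
proof -
 have pc: "p \<in> carrier R" using ideal_carrier[OF P p] .
 have "mspan R M A \<subseteq> {x \<in> carrier M. p \<odot>\<^sub>M x \<in> prime_mult P A}"
 proof (rule mspan_min)
  show "submodule {x \<in> carrier M. p \<odot>\<^sub>M x \<in> prime_mult P A} R M"
   by (rule submod_vimage_smult[OF prime_mult_submod[OF P A] pc])
  show "A \<subseteq> {x \<in> carrier M. p \<odot>\<^sub>M x \<in> prime_mult P A}"
   using A p by (auto simp: prime_mult_def intro!: mspan_self)
 qed
 then show ?thesis using x by blast
qed

lemma hom_image_submod:
 assumes "module R L" "f \<in> mod_hom R L M"
 shows "submodule (f ` carrier L) R M"
proof -
 interpret L: module R L by fact
 show ?thesis
 proof (rule submodI)
  show "f ` carrier L \<subseteq> carrier M" using mod_hom_closed[OF assms(2)] by blast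
  show "\<zero>\<^sub>M \<in> f ` carrier L" using mod_hom_zero[OF assms(1) module_axioms assms(2)] L.M.zero_closed by (metis imageI)
  show "a \<oplus>\<^sub>M b \<in> f ` carrier L" if ab: "a \<in> f ` carrier L" "b \<in> f ` carrier L" for a b
  proof -
   obtain u v where uv: "u \<in> carrier L" "v \<in> carrier L" and e: "a = f u" "b = f v" using ab by blast
   show ?thesis unfolding e mod_hom_add[OF assms(2) uv, symmetric] using uv by (intro imageI L.M.a_closed)
  qed
  show "s \<odot>\<^sub>M a \<in> f ` carrier L" if s: "s \<in> carrier R" and a: "a \<in> f ` carrier L" for s a
  proof -
   obtain u where u: "u \<in> carrier L" and e: "a = f u" using a by blast
   show ?thesis unfolding e mod_hom_smult[OF assms(2) s u, symmetric] using s u by (intro imageI L.smult_closed)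
  qed
 qed
qed

lemma nakayama_surj:
 assumes loc: "local_ring R \<mm>" and A: "finite A" "A \<subseteq> carrier M" "mspan R M A = carrier M" and L: "submodule L R M"
  and ex: "\<And>a. a \<in> A ==> \<exists>l\<in>L. \<exists>h\<in>prime_mult \<mm> A. a = l \<oplus>\<^sub>M h"
 shows "L = carrier M"
proof -
 note mp = local_ring_prime[OF loc]
 have "\<exists>u\<in>carrier R - \<mm>. \<forall>x\<in>mspan R M A. u \<odot>\<^sub>M x \<in> L"
 proof (rule nakayama[OF mp A(1,2) L])
  fix a assume a: "a \<in> A"
  then have "\<one> \<odot>\<^sub>M a = a" using A(2) by auto
  then show "\<exists>u\<in>carrier R - \<mm>. \<exists>l\<in>L. \<exists>h\<in>prime_mult \<mm> A. u \<odot>\<^sub>M a = l \<oplus>\<^sub>M h"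
   using ex[OF a] prime_one[OF mp] by (intro bexI[of _ \<one>]) auto
 qed
 then obtain u where u: "u \<in> carrier R - \<mm>" "\<And>x. x \<in> carrier M ==> u \<odot>\<^sub>M x \<in> L" unfolding A(3) by blast
 obtain v where v: "v \<in> carrier R" "v \<otimes> u = \<one>" using local_ring_unit[OF loc u(1)] .
 have "x \<in> L" if x: "x \<in> carrier M" for x
 proof -
  have "x = v \<odot>\<^sub>M (u \<odot>\<^sub>M x)" using v u(1) x by (simp add: smult_assoc1[symmetric])
  then show ?thesis using submod_smult[OF L v(1) u(2)[OF x]] by simp
 qed
 then show ?thesis using submod_carrier[OF L] by blast
qed

end

context cring
begin

text \<open>Inserts a zero at position \<open>j\<close>; composing a map with it removes the
  \<open>j\<close>-th generator from the list of its images.\<close>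

definition drop_coord :: "nat => (nat => 'a) => nat => 'a" where
 "drop_coord j x = (\<lambda>i. if i < j then x i else if i = j then \<zero> else x (i - 1))"

lemma drop_coord_hom:
 assumes "j \<le> q"
 shows "drop_coord j \<in> Lin q (Suc q)"
proof (rule mod_homI)
 show "drop_coord j x \<in> Vec (Suc q)" if "x \<in> Vec q" for x
  using that assms by (auto simp: drop_coord_def Vec_closed free_mod_beyond intro!: free_modI)
qed (auto simp: drop_coord_def fun_eq_iff)

text \<open>A relation whose \<open>j\<close>-th coefficient is a unit expresses the
  \<open>j\<close>-th generator by the others: subtracting a multiple of \<open>x\<close> clears the
  \<open>j\<close>-th coordinate.\<close>

lemma drop_generator:
 assumes loc: "local_ring R \<mm>" and M: "module R M" and f: "f \<in> mod_hom R (Free (Suc q)) M"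
  and x: "x \<in> Vec (Suc q)" "f x = \<zero>\<^bsub>M\<^esub>" and j: "j \<le> q" "x j \<notin> \<mm>"
 shows "(\<lambda>y. f (drop_coord j y)) ` Vec q = f ` Vec (Suc q)"
proof
 interpret M: lmodule R M by (rule lmodule.intro) (rule M)
 note dc = mod_hom_closed[OF drop_coord_hom[OF j(1)]]
 show "(\<lambda>y. f (drop_coord j y)) ` Vec q \<subseteq> f ` Vec (Suc q)" using dc by blast
 show "f ` Vec (Suc q) \<subseteq> (\<lambda>y. f (drop_coord j y)) ` Vec q"
 proof
  fix w assume "w \<in> f ` Vec (Suc q)"
  then obtain z where z: "z \<in> Vec (Suc q)" "w = f z" by blast
  have xj: "x j \<in> carrier R - \<mm>" using Vec_closed[OF x(1)] j by blast
  obtain v where v: "v \<in> carrier R" "v \<otimes> x j = \<one>" using local_ring_unit[OF loc xj] .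
  have zj: "z j \<in> carrier R" "z j \<otimes> v \<in> carrier R" using Vec_closed[OF z(1)] v by auto
  define z' where "z' = z \<ominus>[Suc q] (z j \<otimes> v) \<odot>[Suc q] x"
  have vx: "(z j \<otimes> v) \<odot>[Suc q] x \<in> Vec (Suc q)" using zj(2) x(1) by (rule Free.smult_closed)
  have z'c: "z' \<in> Vec (Suc q)" unfolding z'_def using z(1) vx by (rule Free.M.minus_closed)
  have "f z' = f z \<ominus>\<^bsub>M\<^esub> (z j \<otimes> v) \<odot>\<^bsub>M\<^esub> f x"
   unfolding z'_def mod_hom_minus[OF free_module M f z(1) vx] mod_hom_smult[OF f zj(2) x(1)] ..
  then have fz': "f z' = w" unfolding x(2) z(2) using M.minus_zero_right[OF mod_hom_closed[OF f z(1)]] M.smult_r_null[OF zj(2)] by simp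
  have "z' j = z j \<ominus> (z j \<otimes> v) \<otimes> x j" using free_mod_minus[OF z(1) vx] by (simp add: z'_def)
  also have "\<dots> = z j \<ominus> z j \<otimes> (v \<otimes> x j)" using zj(1) v(1) xj by (simp add: m_assoc)
  also have "\<dots> = \<zero>" using zj(1) v(2) by (simp add: minus_eq r_neg)
  finally have z'j: "z' j = \<zero>" .
  define y where "y = (\<lambda>i. if i < j then z' i else z' (Suc i))"
  have "y \<in> Vec q" using z'c j(1) by (auto simp: y_def Vec_closed free_mod_beyond intro!: free_modI)
  moreover have "drop_coord j y = z'" using z'j by (auto simp: drop_coord_def y_def fun_eq_iff)
  ultimately show "w \<in> (\<lambda>y. f (drop_coord j y)) ` Vec q" using fz' by (intro image_eqI[of _ _ y]) auto
 qed
qed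

lemma free_span: "mspan R (Free n) (unitvec ` {..<n}) = Vec n"
proof
 have A: "unitvec ` {..<n} \<subseteq> Vec n" by auto
 show "mspan R (Free n) (unitvec ` {..<n}) \<subseteq> Vec n" using Free.submod_carrier[OF Free.mspan_submod[OF A]] by blast
 show "Vec n \<subseteq> mspan R (Free n) (unitvec ` {..<n})"
 proof
  fix x assume x: "x \<in> Vec n"
  have "lincomb (Free n) n x unitvec \<in> mspan R (Free n) (unitvec ` {..<n})" using Vec_closed[OF x] A
   by (intro Free.lincomb_in_submod[OF Free.mspan_submod[OF A]] Free.submod_smult[OF Free.mspan_submod[OF A]] Free.mspan_self) auto
  then show "x \<in> mspan R (Free n) (unitvec ` {..<n})" by (simp only: lincomb_unitvec[OF x])
 qed
qed

lemma vecs_prime_mult: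
 assumes P: "ideal P R" and x: "x \<in> vecs P n"
 shows "x \<in> Free.prime_mult n P (unitvec ` {..<n})"
proof -
 have xc: "x \<in> Vec n" and xP: "\<And>i. x i \<in> P" using x by (auto simp: vecs_def)
 have A: "unitvec ` {..<n} \<subseteq> Vec n" by auto
 note S = Free.prime_mult_submod[OF P A]
 have "lincomb (Free n) n x unitvec \<in> Free.prime_mult n P (unitvec ` {..<n})" using Vec_closed[OF xc] xP
  by (intro Free.lincomb_in_submod[OF S] Free.prime_mult_mem[OF P A] Free.mspan_self) auto
 then show ?thesis by (simp only: lincomb_unitvec[OF xc])
qed

lemma free_nakayama_surj:
 assumes loc: "local_ring R \<mm>" and L: "submodule L R (Free n)"
  and ex: "\<And>x. x \<in> Vec n ==> \<exists>l\<in>L. \<exists>h\<in>vecs \<mm> n. x = l \<oplus>[n] h"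
 shows "L = Vec n"
proof (rule Free.nakayama_surj[OF loc _ _ free_span L])
 fix a assume "a \<in> unitvec ` {..<n}"
 then have "a \<in> Vec n" by auto
 from ex[OF this] show "\<exists>l\<in>L. \<exists>h\<in>Free.prime_mult n \<mm> (unitvec ` {..<n}). a = l \<oplus>[n] h"
  using vecs_prime_mult[OF prime_ideal[OF local_ring_prime[OF loc]]] by blast
qed auto

text \<open>With the least number of generators, every relation has its coefficients in the maximal
  ideal, since otherwise a generator could be dropped.\<close>

lemma minimal_cover:
 assumes loc: "local_ring R \<mm>" and K: "submodule K R (Free p)"
 shows "\<exists>q f. f \<in> Lin q p \<and> f ` Vec q = K \<and>
  (\<forall>x\<in>Vec q. f x = \<zero>[p] --> x \<in> vecs \<mm> q)"
proof -
 have nr: "noetherian_ring R" using loc by (simp add: local_ring_def)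
 note mi = prime_ideal[OF local_ring_prime[OF loc]]
 define cov where "cov q f \<longleftrightarrow> f \<in> Lin q p \<and> f ` Vec q = K" for q f
 have "\<exists>q f. cov q f"
 proof -
  obtain A where A: "finite A" "A \<subseteq> Vec p" "K = mspan R (Free p) A" by (rule noeth_mod_obtain[OF noeth_free[OF nr] K])
  obtain g where g: "bij_betw g {0..<card A} A" using ex_bij_betw_nat_finite[OF A(1)] by blast
  let ?n = "card A"
  have gA: "g k \<in> A" "g k \<in> Vec p" if "k < ?n" for k using g that A(2) by (auto simp: bij_betw_def)
  let ?f = "\<lambda>x. lincomb (Free p) ?n x g"
  have f: "?f \<in> Lin ?n p" using gA by (intro Free.lincomb_hom) auto
  have "?f ` Vec ?n = K"
  proof
   have "?f x \<in> K" if x: "x \<in> Vec ?n" for x using gA Vec_closed[OF x] Free.mspan_self[of _ A p] A(3)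
    by (intro Free.lincomb_in_submod[OF K] Free.submod_smult[OF K]) auto
   then show "?f ` Vec ?n \<subseteq> K" by blast
   have "A \<subseteq> ?f ` Vec ?n"
   proof
    fix a assume "a \<in> A"
    then have "a \<in> g ` {0..<?n}" using bij_betw_imp_surj_on[OF g] by simp
    then obtain k where k: "k < ?n" "a = g k" by auto
    have "?f (unitvec k) = a" unfolding k(2) by (rule Free.lincomb_unit[OF k(1)]) (rule gA)
    then show "a \<in> ?f ` Vec ?n" using unitvec_closed[OF k(1)] by (intro image_eqI[of _ _ "unitvec k"]) auto
   qed
   then show "K \<subseteq> ?f ` Vec ?n" unfolding A(3) by (intro Free.mspan_min Free.hom_image_submod[OF free_module f])
  qed
  then show ?thesis using f unfolding cov_def by blast
 qed
 then have "\<exists>q. \<exists>f. cov q f" .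
 then obtain q where q: "\<exists>f. cov q f" and least: "\<And>k. k < q ==> \<nexists>f. cov k f"
  using exists_least_iff[of "\<lambda>q. \<exists>f. cov q f"] by blast
 obtain f where f: "cov q f" using q by blast
 have "x \<in> vecs \<mm> q" if x: "x \<in> Vec q" "f x = \<zero>[p]" for x
 proof (rule ccontr)
  assume "x \<notin> vecs \<mm> q"
  then obtain j where j: "x j \<notin> \<mm>" using x(1) by (auto simp: vecs_def)
  then have "j < q" using free_mod_beyond[OF x(1), of j] ideal_zero[OF mi] by (metis not_le)
  then obtain q' where q': "q = Suc q'" "j \<le> q'" by (cases q) auto
  have fh: "f \<in> Lin (Suc q') p" "f ` Vec (Suc q') = K" using f q' by (auto simp: cov_def)
  have xc: "x \<in> Vec (Suc q')" using x(1) q' by simp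
  have "cov q' (\<lambda>y. f (drop_coord j y))" unfolding cov_def using mod_hom_comp[OF drop_coord_hom[OF q'(2)] fh(1)]
    drop_generator[OF loc free_module fh(1) xc x(2) q'(2) j] fh(2) by simp
  then show False using least[of q'] q' by blast
 qed
 then show ?thesis using f unfolding cov_def by blast
qed

lemma kernel_submod:
 assumes M: "module R M" and f: "f \<in> mod_hom R (Free n) M"
 shows "submodule {x \<in> Vec n. f x = \<zero>\<^bsub>M\<^esub>} R (Free n)"
proof (rule Free.submodI)
 interpret M: lmodule R M by (rule lmodule.intro) (rule M)
 show "\<zero>[n] \<in> {x \<in> Vec n. f x = \<zero>\<^bsub>M\<^esub>}" using mod_hom_zero[OF free_module M f] Free.M.zero_closed by blast
 show "a \<oplus>[n] b \<in> {x \<in> Vec n. f x = \<zero>\<^bsub>M\<^esub>}"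
  if "a \<in> {x \<in> Vec n. f x = \<zero>\<^bsub>M\<^esub>}" "b \<in> {x \<in> Vec n. f x = \<zero>\<^bsub>M\<^esub>}" for a b
  using that mod_hom_add[OF f, of a b] Free.M.a_closed[of a n b] by simp
 show "s \<odot>[n] a \<in> {x \<in> Vec n. f x = \<zero>\<^bsub>M\<^esub>}"
  if "s \<in> carrier R" "a \<in> {x \<in> Vec n. f x = \<zero>\<^bsub>M\<^esub>}" for s a
  using that mod_hom_smult[OF f, of s a] Free.smult_closed[of s a n] by simp
qed auto

text \<open>The first map \<open>\<epsilon>\<close> is prescribed, so that a basis vector of
  \<open>F_0\<close> can be made to map to 1.\<close>

lemma minimal_resolution_extend:
 assumes loc: "local_ring R \<mm>" and M: "module R M" and \<epsilon>: "\<epsilon> \<in> mod_hom R (Free p) M"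
  and surj: "\<epsilon> ` Vec p = carrier M"
  and min: "\<And>x. x \<in> Vec p ==> \<epsilon> x = \<zero>\<^bsub>M\<^esub> ==> x \<in> vecs \<mm> p"
 shows "\<exists>b d. b 0 = p \<and> resolution R M (Frees b) d \<epsilon> \<and>
  (\<forall>i. \<forall>x\<in>Vec (b (Suc i)). d i x \<in> vecs \<mm> (b i))"
proof -
 \<comment> \<open>A state is a triple: target rank, source rank and map. \<open>nxt\<close> glues
   consecutive maps along a rank and makes the sequence exact there.\<close>
 define good where "good n s \<longleftrightarrow> (case s of (p', q, f) => f \<in> Lin q p' \<and>
   (\<forall>x\<in>Vec q. f x = \<zero>[p'] --> x \<in> vecs \<mm> q) \<and>
   (n = (0::nat) --> p' = p \<and> f ` Vec q = {x \<in> Vec p. \<epsilon> x = \<zero>\<^bsub>M\<^esub>}))" for n s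
 define nxt where "nxt s s' \<longleftrightarrow> (case s of (p', q, f) => case s' of (p'', q', f') =>
   p'' = q \<and> f' ` Vec q' = {x \<in> Vec q. f x = \<zero>[p']})"
  for s s' :: "nat \<times> nat \<times> ((nat => 'a) => nat => 'a)"
 have "\<exists>s. \<forall>n. good n (s n) \<and> nxt (s n) (s (Suc n))"
 proof (rule dependent_nat_choice)
  obtain q f where "f \<in> Lin q p" "f ` Vec q = {x \<in> Vec p. \<epsilon> x = \<zero>\<^bsub>M\<^esub>}"
   "\<forall>x\<in>Vec q. f x = \<zero>[p] --> x \<in> vecs \<mm> q"
   using minimal_cover[OF loc kernel_submod[OF M \<epsilon>]] by blast
  then show "\<exists>s. good 0 s" unfolding good_def by (intro exI[of _ "(p, q, f)"]) simp
  fix s n assume s: "good n s"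
  obtain p' q f where sf: "s = (p', q, f)" by (cases s)
  have f: "f \<in> Lin q p'" using s by (simp add: good_def sf)
  obtain q' f' where "f' \<in> Lin q' q" "f' ` Vec q' = {x \<in> Vec q. f x = \<zero>[p']}"
   "\<forall>x\<in>Vec q'. f' x = \<zero>[q] --> x \<in> vecs \<mm> q'"
   using minimal_cover[OF loc kernel_submod[OF free_module f]] by blast
  then show "\<exists>s'. good (Suc n) s' \<and> nxt s s'" unfolding good_def nxt_def sf by (intro exI[of _ "(q, q', f')"]) simp
 qed
 then obtain s where s: "\<And>n. good n (s n)" "\<And>n. nxt (s n) (s (Suc n))" by blast
 define b where "b i = fst (s i)" for i
 define d where "d i = snd (snd (s i))" for i
 have sd: "s i = (b i, b (Suc i), d i)" for i using s(2)[of i] by (auto simp: nxt_def b_def d_def split: prod.splits)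
 have dh: "d i \<in> Lin (b (Suc i)) (b i)"
  and dm: "\<And>x. x \<in> Vec (b (Suc i)) ==> d i x = \<zero>[b i] ==> x \<in> vecs \<mm> (b (Suc i))" for i
  using s(1)[of i] unfolding sd good_def by auto
 have b0: "b 0 = p" and d0: "d 0 ` Vec (b (Suc 0)) = {x \<in> Vec p. \<epsilon> x = \<zero>\<^bsub>M\<^esub>}"
  using s(1)[of 0] unfolding sd good_def by auto
 have dS: "d (Suc i) ` Vec (b (Suc (Suc i))) = {x \<in> Vec (b (Suc i)). d i x = \<zero>[b i]}" for i
  using s(2)[of i] unfolding sd nxt_def by auto
 have "resolution R M (Frees b) d \<epsilon>"
  unfolding resolution_def mod_ker_def One_nat_def using free_module \<epsilon> surj dh d0 dS b0 by auto
 moreover have "d i x \<in> vecs \<mm> (b i)" if x: "x \<in> Vec (b (Suc i))" for i x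
 proof (cases i)
  case 0
  then have "d 0 x \<in> {x \<in> Vec p. \<epsilon> x = \<zero>\<^bsub>M\<^esub>}" using d0 x by blast
  then show ?thesis using min 0 b0 by simp
 next
  case (Suc j)
  then have "d (Suc j) x \<in> {x \<in> Vec (b (Suc j)). d j x = \<zero>[b j]}" using dS x by blast
  then show ?thesis using dm Suc by simp
 qed
 ultimately show ?thesis using b0 by blast
qed

end

text \<open>The element 1 belongs to a minimal system of generators of \<open>R\<close>. The rank is
  minimised only among covers that send the first basis vector to 1, and minimality is then proved
  for relations involving that vector as well.\<close>

lemma algebra_minimal_resolution:
 fixes S :: "('a, 'r) ring_scheme" and R :: "('b, 'q) ring_scheme" and \<phi> :: "'a => 'b"
 defines "RS \<equiv> restrict_scalars \<phi> R"
 assumes loc: "local_ring S \<mm>" and R: "cring R" and \<phi>: "\<phi> \<in> ring_hom S R" and fg: "fin_gen S RS"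
  and R1: "\<one>\<^bsub>R\<^esub> \<noteq> \<zero>\<^bsub>R\<^esub>"
 shows "\<exists>b d \<epsilon> k. b 0 = Suc k \<and> resolution S RS (\<lambda>i. free_mod S (b i)) d \<epsilon> \<and>
  (\<forall>i. \<forall>x\<in>carrier (free_mod S (b (Suc i))). d i x \<in> cring.vecs S \<mm> (b i)) \<and>
  \<epsilon> (cring.unitvec S 0) = \<one>\<^bsub>R\<^esub>"
proof -
 interpret S: cring S using loc by (simp add: local_ring_def)
 interpret R: cring R by fact
 have M: "module S RS" unfolding RS_def by (rule module_restrict_scalars[OF S.is_cring R \<phi>])
 interpret M: lmodule S RS by (rule lmodule.intro) (rule M)
 note mi = S.prime_ideal[OF S.local_ring_prime[OF loc]]
 have one: "\<one>\<^bsub>R\<^esub> \<in> carrier RS" by (simp add: RS_def)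
 define cov where "cov k f \<longleftrightarrow> f \<in> mod_hom S (S.Free (Suc k)) RS \<and> f ` S.Vec (Suc k) = carrier RS \<and>
   f (S.unitvec 0) = \<one>\<^bsub>R\<^esub>" for k f
 have "\<exists>k f. cov k f"
 proof -
  obtain A where A: "finite A" "A \<subseteq> carrier RS" "\<forall>x\<in>carrier RS. \<exists>c\<in>A \<rightarrow> carrier S. x = (\<Oplus>\<^bsub>RS\<^esub>a\<in>A. c a \<odot>\<^bsub>RS\<^esub> a)"
   using fg unfolding fin_gen_def by blast
  obtain h where h: "bij_betw h {0..<card A} A" using ex_bij_betw_nat_finite[OF A(1)] by blast
  let ?k = "card A"
  define g where "g i = (case i of 0 => \<one>\<^bsub>R\<^esub> | Suc i => h i)" for i
  have gc: "g i \<in> carrier RS" if "i < Suc ?k" for i using that one h A(2) by (cases i) (auto simp: g_def bij_betw_def)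
  let ?f = "\<lambda>x. lincomb RS (Suc ?k) x g"
  have f: "?f \<in> mod_hom S (S.Free (Suc ?k)) RS" using gc by (intro M.lincomb_hom)
  have f0: "?f (S.unitvec 0) = \<one>\<^bsub>R\<^esub>" using M.lincomb_unit[of 0 "Suc ?k" g] gc by (simp add: g_def)
  have Im: "submodule (?f ` S.Vec (Suc ?k)) S RS" by (rule M.hom_image_submod[OF S.free_module f])
  have gen: "a \<in> ?f ` S.Vec (Suc ?k)" if "a \<in> A" for a
  proof -
   have "a \<in> h ` {0..<?k}" using bij_betw_imp_surj_on[OF h] that by simp
   then obtain i where i: "i < ?k" "a = h i" by auto
   have "?f (S.unitvec (Suc i)) = a" using M.lincomb_unit[of "Suc i" "Suc ?k" g] gc i by (simp add: g_def)
   moreover have "S.unitvec (Suc i) \<in> S.Vec (Suc ?k)" using i by (intro S.unitvec_closed) simp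
   ultimately show ?thesis by blast
  qed
  have fin: "(\<Oplus>\<^bsub>RS\<^esub>a\<in>B. c a \<odot>\<^bsub>RS\<^esub> a) \<in> ?f ` S.Vec (Suc ?k)"
   if "finite B" "B \<subseteq> A" and c: "c \<in> A \<rightarrow> carrier S" for B c using that(1,2)
  proof (induction B rule: finite_induct)
   case empty
   show ?case using M.submod_zero[OF Im] by simp
  next
   case (insert a B)
   have "c b \<odot>\<^bsub>RS\<^esub> b \<in> carrier RS" if "b \<in> insert a B" for b
    using insert.prems c A(2) that by (intro M.smult_closed) auto
   then have "(\<Oplus>\<^bsub>RS\<^esub>a\<in>insert a B. c a \<odot>\<^bsub>RS\<^esub> a) = c a \<odot>\<^bsub>RS\<^esub> a \<oplus>\<^bsub>RS\<^esub> (\<Oplus>\<^bsub>RS\<^esub>a\<in>B. c a \<odot>\<^bsub>RS\<^esub> a)"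
    using insert.hyps by (intro M.M.finsum_insert) auto
   also have "\<dots> \<in> ?f ` S.Vec (Suc ?k)"
   proof (rule M.submod_add[OF Im])
    show "c a \<odot>\<^bsub>RS\<^esub> a \<in> ?f ` S.Vec (Suc ?k)" using insert.prems c by (intro M.submod_smult[OF Im] gen) auto
    show "(\<Oplus>\<^bsub>RS\<^esub>a\<in>B. c a \<odot>\<^bsub>RS\<^esub> a) \<in> ?f ` S.Vec (Suc ?k)"
     using insert.prems by (intro insert.IH) auto
   qed
   finally show ?case .
  qed
  have "carrier RS \<subseteq> ?f ` S.Vec (Suc ?k)"
  proof
   fix x assume "x \<in> carrier RS"
   then obtain c where "c \<in> A \<rightarrow> carrier S" "x = (\<Oplus>\<^bsub>RS\<^esub>a\<in>A. c a \<odot>\<^bsub>RS\<^esub> a)" using A(3) by blast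
   then show "x \<in> ?f ` S.Vec (Suc ?k)" using fin[of A c] A(1) by simp
  qed
  then have "?f ` S.Vec (Suc ?k) = carrier RS" using M.submod_carrier[OF Im] by blast
  then show ?thesis using f f0 unfolding cov_def by blast
 qed
 then obtain k where k: "\<exists>f. cov k f" and least: "\<And>k'. k' < k ==> \<nexists>f. cov k' f"
  using exists_least_iff[of "\<lambda>k. \<exists>f. cov k f"] by blast
 obtain f where f: "f \<in> mod_hom S (S.Free (Suc k)) RS" "f ` S.Vec (Suc k) = carrier RS" "f (S.unitvec 0) = \<one>\<^bsub>R\<^esub>"
  using k unfolding cov_def by blast
 have min: "x \<in> S.vecs \<mm> (Suc k)" if x: "x \<in> S.Vec (Suc k)" "f x = \<zero>\<^bsub>RS\<^esub>" for x
 proof (rule ccontr)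
  assume "x \<notin> S.vecs \<mm> (Suc k)"
  then have ex: "\<exists>j. x j \<notin> \<mm>" using x(1) by (auto simp: S.vecs_def)
  \<comment> \<open>Dropping a generator of positive index does not move \<open>unitvec 0\<close>,
    so the cover stays of the required kind.\<close>
  have pos: "x j \<in> \<mm>" if j0: "j > 0" for j
  proof (rule ccontr)
   assume j: "x j \<notin> \<mm>"
   then have "j < Suc k" using S.free_mod_beyond[OF x(1), of j] S.ideal_zero[OF mi] by (metis not_le)
   then obtain k' where k': "k = Suc k'" "j \<le> k" using j0 by (cases k) auto
   note dh = S.drop_coord_hom[OF k'(2)]
   have "S.drop_coord j (S.unitvec 0) = S.unitvec 0" using j0 by (auto simp: S.drop_coord_def S.unitvec_def)
   then have "cov k' (\<lambda>y. f (S.drop_coord j y))"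
    unfolding cov_def using mod_hom_comp[OF dh f(1)] S.drop_generator[OF loc M f(1) x k'(2) j] f(2,3) k'(1) by simp
   then show False using least[of k'] k' by blast
  qed
  have x0: "x 0 \<in> carrier S - \<mm>" using ex pos S.Vec_closed[OF x(1)] by (metis DiffI neq0_conv)
  obtain v where v: "v \<in> carrier S" "v \<otimes>\<^bsub>S\<^esub> x 0 = \<one>\<^bsub>S\<^esub>" by (rule S.local_ring_unit[OF loc x0])
  \<comment> \<open>If the coefficient of 1 is a unit, eliminating it leaves a vector over the
    maximal ideal that still maps to 1.\<close>
  define w where "w = S.unitvec 0 \<ominus>\<^bsub>S.Free (Suc k)\<^esub> v \<odot>\<^bsub>S.Free (Suc k)\<^esub> x"
  have e0: "S.unitvec 0 \<in> S.Vec (Suc k)" by (rule S.unitvec_closed) simp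
  have vx: "v \<odot>\<^bsub>S.Free (Suc k)\<^esub> x \<in> S.Vec (Suc k)" using v(1) x(1) by (rule S.Free.smult_closed)
  have wc: "w \<in> S.Vec (Suc k)" unfolding w_def using e0 vx by (rule S.Free.M.minus_closed)
  have wi: "w i = S.unitvec 0 i \<ominus>\<^bsub>S\<^esub> v \<otimes>\<^bsub>S\<^esub> x i" for i
   using S.free_mod_minus[OF e0 vx] by (simp add: w_def)
  have wm: "w i \<in> \<mm>" for i
  proof (cases i)
   case 0
   then show ?thesis using v(2) S.ideal_zero[OF mi] by (simp add: wi S.unitvec_def S.minus_eq S.r_neg)
  next
   case (Suc j)
   have "v \<otimes>\<^bsub>S\<^esub> x i \<in> \<mm>" using S.ideal_mult[OF mi v(1) pos[of i]] Suc by simp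
   then have "\<zero>\<^bsub>S\<^esub> \<ominus>\<^bsub>S\<^esub> v \<otimes>\<^bsub>S\<^esub> x i \<in> \<mm>" using S.ideal_minus[OF mi S.ideal_zero[OF mi]] by blast
   then show ?thesis using Suc by (simp add: wi S.unitvec_def)
  qed
  have "f w = f (S.unitvec 0) \<ominus>\<^bsub>RS\<^esub> v \<odot>\<^bsub>RS\<^esub> f x"
   unfolding w_def mod_hom_minus[OF S.free_module M f(1) e0 vx] mod_hom_smult[OF f(1) v(1) x(1)] ..
  then have fw: "f w = \<one>\<^bsub>R\<^esub>" unfolding x(2) f(3) M.smult_r_null[OF v(1)] using M.minus_zero_right[OF one] by simp
  define A where "A = (\<lambda>i. f (S.unitvec i)) ` {..<Suc k}"
  have uc: "f (S.unitvec i) \<in> carrier RS" if "i < Suc k" for i using mod_hom_closed[OF f(1) S.unitvec_closed[OF that]] .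
  have A: "finite A" "A \<subseteq> carrier RS" using uc unfolding A_def by auto
  have span: "mspan S RS A = carrier RS"
  proof
   show "mspan S RS A \<subseteq> carrier RS" using M.submod_carrier[OF M.mspan_submod[OF A(2)]] by blast
   show "carrier RS \<subseteq> mspan S RS A"
   proof
    fix y assume "y \<in> carrier RS"
    then obtain z where z: "z \<in> S.Vec (Suc k)" "y = f z" using f(2) by (metis imageE)
    have "f z \<in> mspan S RS A" unfolding M.free_hom_lincomb[OF f(1) z(1)] using S.Vec_closed[OF z(1)] uc
     by (intro M.lincomb_in_submod[OF M.mspan_submod[OF A(2)]] M.submod_smult[OF M.mspan_submod[OF A(2)]] M.mspan_self) (auto simp: A_def)
    then show "y \<in> mspan S RS A" using z(2) by simp
   qed
  qed
  have zsub: "submodule {\<zero>\<^bsub>RS\<^esub>} S RS" by (rule M.submodI) auto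
  have "{\<zero>\<^bsub>RS\<^esub>} = carrier RS"
  proof (rule M.nakayama_surj[OF loc A span zsub])
   fix a assume "a \<in> A"
   then have a: "a \<in> carrier RS" using A by blast
   have mult: "(\<lambda>y. a \<otimes>\<^bsub>R\<^esub> y) \<in> mod_hom S RS RS"
    using a ring_hom_closed[OF \<phi>] unfolding RS_def by (intro mod_homI) (auto simp: R.r_distr R.m_lcomm)
   \<comment> \<open>From \<open>1 = f w\<close> with coefficients in \<mm>, multiplication by
     \<open>a\<close> puts every generator, and hence \<open>R\<close>, into \<mm> R; Nakayama makes
     \<open>R\<close> zero.\<close>
   have "a = a \<otimes>\<^bsub>R\<^esub> f w" using a by (simp add: fw RS_def)
   also have "\<dots> = a \<otimes>\<^bsub>R\<^esub> lincomb RS (Suc k) w (\<lambda>i. f (S.unitvec i))"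
    by (subst M.free_hom_lincomb[OF f(1) wc]) simp
   also have "\<dots> = lincomb RS (Suc k) w (\<lambda>i. a \<otimes>\<^bsub>R\<^esub> f (S.unitvec i))"
    using S.Vec_closed[OF wc] uc by (intro M.lincomb_mod_hom[OF M mult]) auto
   also have "\<dots> \<in> M.prime_mult \<mm> A" using S.Vec_closed[OF wc] mod_hom_closed[OF mult uc] wm span
    by (intro M.lincomb_in_submod[OF M.prime_mult_submod[OF mi A(2)]] M.prime_mult_mem[OF mi A(2)]) auto
   finally have "a \<in> M.prime_mult \<mm> A" .
   then show "\<exists>l\<in>{\<zero>\<^bsub>RS\<^esub>}. \<exists>h\<in>M.prime_mult \<mm> A. a = l \<oplus>\<^bsub>RS\<^esub> h"
    using a by (intro bexI[of _ "\<zero>\<^bsub>RS\<^esub>"] bexI[of _ a]) auto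
  qed
  then show False using one R1 by (auto simp: RS_def)
 qed
 obtain b d where "b 0 = Suc k" "resolution S RS (S.Frees b) d f"
  "\<forall>i. \<forall>x\<in>S.Vec (b (Suc i)). d i x \<in> S.vecs \<mm> (b i)"
  using S.minimal_resolution_extend[OF loc M f(1,2) min] by blast
 then show ?thesis using f(3) by blast
qed

section \<open>Graded commutative products on resolutions\<close>

definition bilin :: "('a, 'r) ring_scheme => ('a, 'x) module => ('a, 'y) module => ('a, 'z) module => ('x => 'y => 'z) => bool" where
 "bilin S M N L \<beta> \<longleftrightarrow> (\<forall>y\<in>carrier N. (\<lambda>x. \<beta> x y) \<in> mod_hom S M L) \<and> (\<forall>x\<in>carrier M. \<beta> x \<in> mod_hom S N L)"

lemma bilinD:
 assumes "bilin S M N L \<beta>"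
 shows "y \<in> carrier N ==> (\<lambda>x. \<beta> x y) \<in> mod_hom S M L" and "x \<in> carrier M ==> \<beta> x \<in> mod_hom S N L"
  and "x \<in> carrier M ==> y \<in> carrier N ==> \<beta> x y \<in> carrier L"
 using assms mod_hom_closed unfolding bilin_def by blast+

lemma bilin_swap: "bilin S M N L \<beta> ==> bilin S N M L (\<lambda>y x. \<beta> x y)" by (simp add: bilin_def)

lemma bilin_comp:
 assumes "bilin S M N L \<beta>" "f \<in> mod_hom S M' M" "g \<in> mod_hom S N' N"
 shows "bilin S M' N' L (\<lambda>x y. \<beta> (f x) (g y))" unfolding bilin_def
proof (intro conjI ballI)
 fix y assume "y \<in> carrier N'"
 then have "g y \<in> carrier N" by (rule mod_hom_closed[OF assms(3)])
 then show "(\<lambda>x. \<beta> (f x) (g y)) \<in> mod_hom S M' L" by (rule mod_hom_comp[OF assms(2) bilinD(1)[OF assms(1)]])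
next
 fix x assume "x \<in> carrier M'"
 then have "f x \<in> carrier M" by (rule mod_hom_closed[OF assms(2)])
 then show "(\<lambda>y. \<beta> (f x) (g y)) \<in> mod_hom S N' L" by (rule mod_hom_comp[OF assms(3) bilinD(2)[OF assms(1)]])
qed

lemma bilin_post: "bilin S M N L \<beta> ==> f \<in> mod_hom S L K ==> bilin S M N K (\<lambda>x y. f (\<beta> x y))"
 unfolding bilin_def by (auto intro: mod_hom_comp)

context lmodule
begin

lemma bilin_add: "bilin R P Q M \<beta> ==> bilin R P Q M \<gamma> ==> bilin R P Q M (\<lambda>x y. \<beta> x y \<oplus>\<^sub>M \<gamma> x y)"
 unfolding bilin_def by (intro conjI ballI mod_hom_addf) auto

lemma bilin_smult: "bilin R P Q M \<beta> ==> s \<in> carrier R ==> bilin R P Q M (\<lambda>x y. s \<odot>\<^sub>M \<beta> x y)"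
 unfolding bilin_def by (intro conjI ballI mod_hom_smultf) auto

lemma bilin_zero: "bilin R P Q M (\<lambda>x y. \<zero>\<^sub>M)" unfolding bilin_def by (intro conjI ballI mod_hom_zerof)

lemma bilin_zero_left: "module R P ==> bilin R P Q M \<beta> ==> y \<in> carrier Q ==> \<beta> \<zero>\<^bsub>P\<^esub> y = \<zero>\<^sub>M"
 using mod_hom_zero[OF _ module_axioms bilinD(1)] by fast

lemma bilin_zero_right: "module R Q ==> bilin R P Q M \<beta> ==> x \<in> carrier P ==> \<beta> x \<zero>\<^bsub>Q\<^esub> = \<zero>\<^sub>M"
 using mod_hom_zero[OF _ module_axioms bilinD(2)] by fast

lemma bilin_eqI:
 assumes "bilin R (Free p) (Free q) M \<beta>" "bilin R (Free p) (Free q) M \<gamma>"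
  and "\<And>k l. k < p ==> l < q ==> \<beta> (unitvec k) (unitvec l) = \<gamma> (unitvec k) (unitvec l)"
  and x: "x \<in> Vec p" and y: "y \<in> Vec q"
 shows "\<beta> x y = \<gamma> x y"
proof (rule free_hom_eqI[OF bilinD(1)[OF assms(1) y] bilinD(1)[OF assms(2) y] _ x])
 fix k assume k: "k < p"
 show "\<beta> (unitvec k) y = \<gamma> (unitvec k) y"
  by (rule free_hom_eqI[OF bilinD(2)[OF assms(1) unitvec_closed[OF k]] bilinD(2)[OF assms(2) unitvec_closed[OF k]] _ y])
   (rule assms(3)[OF k])
qed

lemma lincomb_of_homs:
 assumes "module R P" "\<And>k. k < n ==> a k \<in> carrier R" "\<And>k. k < n ==> f k \<in> mod_hom R P M"
 shows "(\<lambda>y. lincomb M n a (\<lambda>k. f k y)) \<in> mod_hom R P M" using assms(2,3)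
proof (induction n)
 case 0
 then show ?case by (simp add: mod_hom_zerof)
next
 case (Suc n)
 have "(\<lambda>y. lincomb M n a (\<lambda>k. f k y) \<oplus>\<^sub>M a n \<odot>\<^sub>M f n y) \<in> mod_hom R P M"
  using Suc by (intro mod_hom_addf mod_hom_smultf) auto
 then show ?case
 proof (rule mod_hom_cong[OF assms(1)])
  fix y assume y: "y \<in> carrier P"
  have "f k y \<in> carrier M" if "k \<le> n" for k using mod_hom_closed[OF Suc.prems(2) y] that by simp
  then show "lincomb M (Suc n) a (\<lambda>k. f k y) = lincomb M n a (\<lambda>k. f k y) \<oplus>\<^sub>M a n \<odot>\<^sub>M f n y"
   using Suc.prems(1) by (intro lincomb_Suc) auto
 qed
qed

lemma bilin_of_basis:
 assumes v: "\<And>k l. k < p ==> l < q ==> v k l \<in> carrier M"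
 shows "\<exists>\<beta>. bilin R (Free p) (Free q) M \<beta> \<and> (\<forall>k<p. \<forall>l<q. \<beta> (unitvec k) (unitvec l) = v k l)"
proof -
 let ?g = "\<lambda>k y. lincomb M q y (v k)"
 let ?\<beta> = "\<lambda>x y. lincomb M p x (\<lambda>k. ?g k y)"
 have g: "?g k \<in> mod_hom R (Free q) M" if "k < p" for k using v that by (intro lincomb_hom)
 have gc: "?g k y \<in> carrier M" if "k < p" "y \<in> Vec q" for k y using mod_hom_closed[OF g[OF that(1)] that(2)] .
 have "bilin R (Free p) (Free q) M ?\<beta>" unfolding bilin_def
 proof (intro conjI ballI)
  show "(\<lambda>x. ?\<beta> x y) \<in> mod_hom R (Free p) M" if "y \<in> Vec q" for y using gc that by (intro lincomb_hom)
  show "?\<beta> x \<in> mod_hom R (Free q) M" if "x \<in> Vec p" for x using Vec_closed[OF that] g by (intro lincomb_of_homs free_module)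
 qed
 moreover have "?\<beta> (unitvec k) (unitvec l) = v k l" if kl: "k < p" "l < q" for k l
 proof -
  have "?\<beta> (unitvec k) (unitvec l) = ?g k (unitvec l)"
   using lincomb_unit[OF kl(1), of "\<lambda>k. ?g k (unitvec l)"] gc[OF _ unitvec_closed[OF kl(2)]] by simp
  also have "\<dots> = v k l" using lincomb_unit[OF kl(2), of "v k"] v kl by simp
  finally show ?thesis .
 qed
 ultimately show ?thesis by blast
qed

lemma bilin_lift:
 assumes T: "module R T" and D: "D \<in> mod_hom R M T" and W: "bilin R (Free p) (Free q) T W"
  and im: "\<And>x y. x \<in> Vec p ==> y \<in> Vec q ==> W x y \<in> D ` carrier M"
 shows "\<exists>\<beta>. bilin R (Free p) (Free q) M \<beta> \<and>
  (\<forall>x\<in>Vec p. \<forall>y\<in>Vec q. D (\<beta> x y) = W x y)"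
proof -
 interpret T: lmodule R T by (rule lmodule.intro) (rule T)
 have "\<forall>k l. \<exists>h. k < p --> l < q --> h \<in> carrier M \<and> D h = W (unitvec k) (unitvec l)"
  using im[OF unitvec_closed unitvec_closed] by (metis imageE)
 then obtain h where h: "\<And>k l. k < p ==> l < q ==> h k l \<in> carrier M"
  "\<And>k l. k < p ==> l < q ==> D (h k l) = W (unitvec k) (unitvec l)" by metis
 obtain \<beta> where \<beta>: "bilin R (Free p) (Free q) M \<beta>" "\<And>k l. k < p ==> l < q ==> \<beta> (unitvec k) (unitvec l) = h k l"
  using bilin_of_basis[of p q h, OF h(1)] by blast
 have "D (\<beta> x y) = W x y" if "x \<in> Vec p" "y \<in> Vec q" for x y
  by (rule T.bilin_eqI[OF bilin_post[OF \<beta>(1) D] W _ that]) (simp add: \<beta>(2) h(2))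
 then show ?thesis using \<beta>(1) by blast
qed

text \<open>For \<open>s = - 1\<close> the form vanishes on the diagonal, so zero is a lift there; this is why the product
 is graded commutative on the nose even if \<open>2\<close> is not invertible.\<close>

lemma bilin_sym_lift:
 assumes T: "module R T" and D: "D \<in> mod_hom R M T" and W: "bilin R (Free p) (Free p) T W"
  and im: "\<And>x y. x \<in> Vec p ==> y \<in> Vec p ==> W x y \<in> D ` carrier M"
  and s: "s \<in> carrier R" "s \<otimes> s = \<one>"
  and sym: "\<And>x y. x \<in> Vec p ==> y \<in> Vec p ==> W y x = s \<odot>\<^bsub>T\<^esub> W x y"
  and diag: "s = \<one> \<or> (\<forall>x\<in>Vec p. W x x = \<zero>\<^bsub>T\<^esub>)"
 shows "\<exists>\<beta>. bilin R (Free p) (Free p) M \<beta> \<and>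
  (\<forall>x\<in>Vec p. \<forall>y\<in>Vec p. D (\<beta> x y) = W x y \<and> \<beta> y x = s \<odot>\<^sub>M \<beta> x y)"
proof -
 interpret T: lmodule R T by (rule lmodule.intro) (rule T)
 have "\<forall>k l. \<exists>h. k < p --> l < p --> h \<in> carrier M \<and> D h = W (unitvec k) (unitvec l)"
  using im[OF unitvec_closed unitvec_closed] by (metis imageE)
 then obtain h where h: "\<And>k l. k < p ==> l < p ==> h k l \<in> carrier M"
  "\<And>k l. k < p ==> l < p ==> D (h k l) = W (unitvec k) (unitvec l)" by metis
 \<comment> \<open>Values above the diagonal are lifted, those below are forced by the symmetry, and
   on the diagonal only the case \<open>s = 1\<close> leaves room for a lift.\<close>
 define v where "v k l = (if k < l then h k l else if l < k then s \<odot>\<^sub>M h l k else if s = \<one> then h k k else \<zero>\<^sub>M)" for k l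
 have vc: "v k l \<in> carrier M" if "k < p" "l < p" for k l using h(1) s that by (simp add: v_def)
 have Dv: "D (v k l) = W (unitvec k) (unitvec l)" if kl: "k < p" "l < p" for k l
 proof -
  consider "k < l" | "l < k" | "k = l" by linarith
  then show ?thesis
  proof cases
   case 2
   have "D (v k l) = s \<odot>\<^bsub>T\<^esub> W (unitvec l) (unitvec k)"
    using 2 mod_hom_smult[OF D s(1) h(1)[OF kl(2,1)]] h(2)[OF kl(2,1)] by (simp add: v_def)
   then show ?thesis using sym[OF unitvec_closed[OF kl(2)] unitvec_closed[OF kl(1)]] by simp
  next
   case 3
   then show ?thesis using h(2)[OF kl] mod_hom_zero[OF module_axioms T D] diag unitvec_closed[OF kl(1)] by (auto simp: v_def)
  qed (use h(2)[OF kl] in \<open>simp add: v_def\<close>)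
 qed
 have vs: "v l k = s \<odot>\<^sub>M v k l" if kl: "k < p" "l < p" for k l
 proof -
  have "s \<odot>\<^sub>M (s \<odot>\<^sub>M z) = z" if "z \<in> carrier M" for z using s that by (simp add: smult_assoc1[symmetric])
  then show ?thesis using h(1) kl s by (auto simp: v_def)
 qed
 obtain \<beta> where \<beta>: "bilin R (Free p) (Free p) M \<beta>" "\<And>k l. k < p ==> l < p ==> \<beta> (unitvec k) (unitvec l) = v k l"
  using bilin_of_basis[of p p v, OF vc] by blast
 have "D (\<beta> x y) = W x y" if "x \<in> Vec p" "y \<in> Vec p" for x y
  by (rule T.bilin_eqI[OF bilin_post[OF \<beta>(1) D] W _ that]) (simp only: \<beta>(2) Dv)
 moreover have "\<beta> y x = s \<odot>\<^sub>M \<beta> x y" if "x \<in> Vec p" "y \<in> Vec p" for x y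
 proof (rule bilin_eqI[OF bilin_swap[OF \<beta>(1)] bilin_smult[OF \<beta>(1) s(1)] _ that])
  fix k l assume kl: "k < p" "l < p"
  show "\<beta> (unitvec l) (unitvec k) = s \<odot>\<^sub>M \<beta> (unitvec k) (unitvec l)"
   unfolding \<beta>(2)[OF kl] \<beta>(2)[OF kl(2,1)] by (rule vs[OF kl])
 qed
 ultimately show ?thesis using \<beta>(1) by blast
qed

end

section \<open>The product on a resolution, built by total degree\<close>

context cring
begin

definition sg :: "nat => 'a" where
 "sg i = (if even i then \<one> else \<ominus> \<one>)"

lemma sg_closed [simp]: "sg i \<in> carrier R" by (simp add: sg_def)

lemma sg_add: "sg (i + j) = sg i \<otimes> sg j" by (simp add: sg_def l_minus)

lemma sg_sq: "sg i \<otimes> sg i = \<one>" by (simp add: sg_def l_minus)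

lemma sg_pow: "(\<ominus> \<one>) [^] (i::nat) = sg i" by (induction i) (simp_all add: sg_def l_minus)

lemma sg_smult_cancel: "lmodule R M ==> x \<in> carrier M ==> sg i \<odot>\<^bsub>M\<^esub> (sg i \<odot>\<^bsub>M\<^esub> x) = x"
 using module.smult_assoc1[OF lmodule.axioms, of R M "sg i" "sg i" x] module.smult_one[OF lmodule.axioms, of R M x] by (simp add: sg_sq)

text \<open>The expression d x y + (-1)^i x d y of degree k = i + j - 1. A term is zero when its
  factor has degree 0, as the augmentation is not counted as a differential.\<close>

definition leibniz :: "(nat => nat) => (nat => (nat => 'a) => nat => 'a) =>
  (nat => nat => (nat => 'a) => (nat => 'a) => nat => 'a) => nat => nat => nat => (nat => 'a) => (nat => 'a) => nat => 'a" where
 "leibniz b d \<beta> k i j x y =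
   (case i of 0 => \<zero>[b k] | Suc i' => \<beta> i' j (d i' x) y) \<oplus>[b k]
   sg i \<odot>[b k] (case j of 0 => \<zero>[b k] | Suc j' => \<beta> i j' x (d j' y))"

context
 fixes M :: "('a, 'y) module" and b d \<epsilon> mul
 assumes res: "resolution R M (Frees b) d \<epsilon>" and M: "module R M"
  and mul: "bilin R M M M mul" and mul_comm: "\<forall>x\<in>carrier M. \<forall>y\<in>carrier M. mul x y = mul y x"
begin

text \<open>The conditions bind only up to total degree \<open>n\<close>, which permits induction on
  \<open>n\<close>; a finite stage, one beyond the length of the resolution, is all that the pairing
  takes, so there is no limit to form.\<close>

definition product_upto :: "nat => (nat => nat => (nat => 'a) => (nat => 'a) => nat => 'a) => bool" where
 "product_upto n \<beta> \<longleftrightarrow>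
   (\<forall>i j. i + j \<le> n --> bilin R (Free (b i)) (Free (b j)) (Free (b (i + j))) (\<beta> i j)) \<and>
   (\<forall>x\<in>Vec (b 0). \<forall>y\<in>Vec (b 0). \<epsilon> (\<beta> 0 0 x y) = mul (\<epsilon> x) (\<epsilon> y)) \<and>
   (\<forall>i j. i + j \<le> n --> (\<forall>x\<in>Vec (b i). \<forall>y\<in>Vec (b j).
    \<beta> j i y x = sg (i * j) \<odot>[b (i + j)] \<beta> i j x y)) \<and>
   (\<forall>k i j. i + j = Suc k --> Suc k \<le> n --> (\<forall>x\<in>Vec (b i). \<forall>y\<in>Vec (b j).
    d k (\<beta> i j x y) = leibniz b d \<beta> k i j x y))"

lemma productD:
 assumes "product_upto n \<beta>"
 shows "i + j = k ==> k \<le> n ==> bilin R (Free (b i)) (Free (b j)) (Free (b k)) (\<beta> i j)"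
  and "x \<in> Vec (b 0) ==> y \<in> Vec (b 0) ==> \<epsilon> (\<beta> 0 0 x y) = mul (\<epsilon> x) (\<epsilon> y)"
  and "i + j = k ==> k \<le> n ==> x \<in> Vec (b i) ==> y \<in> Vec (b j) ==>
    \<beta> j i y x = sg (i * j) \<odot>[b k] \<beta> i j x y"
  and "i + j = Suc k ==> Suc k \<le> n ==> x \<in> Vec (b i) ==> y \<in> Vec (b j) ==>
    d k (\<beta> i j x y) = leibniz b d \<beta> k i j x y" using assms unfolding product_upto_def by blast+

lemma leibniz_bilin:
 assumes "product_upto n \<beta>" "i + j = Suc k" "k \<le> n"
 shows "bilin R (Free (b i)) (Free (b j)) (Free (b k)) (leibniz b d \<beta> k i j)"
proof -
 note dh = resolutionD(3)[OF res]
 have 1: "bilin R (Free (b i)) (Free (b j)) (Free (b k)) (\<lambda>x y. case i of 0 => \<zero>[b k] | Suc i' => \<beta> i' j (d i' x) y)"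
 proof (cases i)
  case 0
  then show ?thesis using Free.bilin_zero by simp
 next
  case (Suc i')
  show ?thesis unfolding Suc nat.case by (rule bilin_comp[OF productD(1)[OF assms(1)] dh mod_hom_id]) (use assms Suc in auto)
 qed
 have 2: "bilin R (Free (b i)) (Free (b j)) (Free (b k)) (\<lambda>x y. case j of 0 => \<zero>[b k] | Suc j' => \<beta> i j' x (d j' y))"
 proof (cases j)
  case 0
  then show ?thesis using Free.bilin_zero by simp
 next
  case (Suc j')
  show ?thesis unfolding Suc nat.case by (rule bilin_comp[OF productD(1)[OF assms(1)] mod_hom_id dh]) (use assms Suc in auto)
 qed
 have "bilin R (Free (b i)) (Free (b j)) (Free (b k)) (\<lambda>x y. leibniz b d \<beta> k i j x y)"
  unfolding leibniz_def by (intro Free.bilin_add[OF 1] Free.bilin_smult[OF 2] sg_closed)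
 then show ?thesis .
qed

text \<open>Exchanging the factors exchanges the two terms. The exponents (i - 1) j and i (j - 1)
  differ from i j by j and by i, which the signs in front of the terms make up for. A graded
  commutative lift needs this symmetry.\<close>

lemma leibniz_sym:
 assumes p: "product_upto n \<beta>" and k: "i + j = Suc k" "k \<le> n" and x: "x \<in> Vec (b i)" and y: "y \<in> Vec (b j)"
 shows "leibniz b d \<beta> k j i y x = sg (i * j) \<odot>[b k] leibniz b d \<beta> k i j x y"
proof -
 note dc = mod_hom_closed[OF resolutionD(3)[OF res]]
 define u where "u = (case i of 0 => \<zero>[b k] | Suc i' => \<beta> i' j (d i' x) y)"
 define v where "v = (case j of 0 => \<zero>[b k] | Suc j' => \<beta> i j' x (d j' y))"
 have u: "u \<in> Vec (b k)"
 proof (cases i)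
  case (Suc i')
  have "bilin R (Free (b i')) (Free (b j)) (Free (b k)) (\<beta> i' j)" by (rule productD(1)[OF p]) (use k Suc in auto)
  moreover have "d i' x \<in> Vec (b i')" by (rule dc) (use x Suc in simp)
  ultimately show ?thesis unfolding u_def Suc nat.case using y by (rule bilinD(3))
 next
  case 0
  show ?thesis unfolding u_def 0 nat.case by (rule Free.M.zero_closed)
 qed
 have v: "v \<in> Vec (b k)"
 proof (cases j)
  case (Suc j')
  have "bilin R (Free (b i)) (Free (b j')) (Free (b k)) (\<beta> i j')" by (rule productD(1)[OF p]) (use k Suc in auto)
  moreover have "d j' y \<in> Vec (b j')" by (rule dc) (use y Suc in simp)
  ultimately show ?thesis unfolding v_def Suc nat.case using x by (metis bilinD(3))
 next
  case 0
  show ?thesis unfolding v_def 0 nat.case by (rule Free.M.zero_closed)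
 qed
 have 1: "(case j of 0 => \<zero>[b k] | Suc j' => \<beta> j' i (d j' y) x) = (sg (i * j) \<otimes> sg i) \<odot>[b k] v"
 proof (cases j)
  case 0
  show ?thesis unfolding v_def 0 nat.case using Free.smult_r_null[of "sg (i * 0) \<otimes> sg i" "b k"] by simp
 next
  case (Suc j')
  have y': "y \<in> Vec (b (Suc j'))" using y Suc by simp
  have "\<beta> j' i (d j' y) x = sg (i * j') \<odot>[b k] \<beta> i j' x (d j' y)"
   using k Suc by (intro productD(3)[OF p _ _ x dc[OF y']]) auto
  moreover have "sg (i * j) \<otimes> sg i = sg (i * j')" using Suc by (simp add: sg_def l_minus)
  ultimately show ?thesis unfolding v_def Suc nat.case by simp
 qed
 have 2: "(case i of 0 => \<zero>[b k] | Suc i' => \<beta> j i' y (d i' x)) = (sg (i * j) \<otimes> sg j) \<odot>[b k] u"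
 proof (cases i)
  case 0
  show ?thesis unfolding u_def 0 nat.case using Free.smult_r_null[of "sg (0 * j) \<otimes> sg j" "b k"] by simp
 next
  case (Suc i')
  have x': "x \<in> Vec (b (Suc i'))" using x Suc by simp
  have "\<beta> j i' y (d i' x) = sg (i' * j) \<odot>[b k] \<beta> i' j (d i' x) y"
   using k Suc by (intro productD(3)[OF p _ _ dc[OF x'] y]) auto
  moreover have "sg (i * j) \<otimes> sg j = sg (i' * j)" using Suc by (simp add: sg_def l_minus)
  ultimately show ?thesis unfolding u_def Suc nat.case by simp
 qed
 have s: "sg (i * j) \<in> carrier R" "sg i \<in> carrier R" "sg j \<in> carrier R" by simp_all
 have "leibniz b d \<beta> k j i y x = (sg (i * j) \<otimes> sg i) \<odot>[b k] v \<oplus>[b k]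
   sg j \<odot>[b k] ((sg (i * j) \<otimes> sg j) \<odot>[b k] u)" unfolding leibniz_def 1 2 ..
 also have "\<dots> = (sg j \<otimes> sg j) \<odot>[b k] (sg (i * j) \<odot>[b k] u) \<oplus>[b k] sg (i * j) \<odot>[b k] (sg i \<odot>[b k] v)"
  using s u v by algebra
 also have "\<dots> = sg (i * j) \<odot>[b k] u \<oplus>[b k] sg (i * j) \<odot>[b k] (sg i \<odot>[b k] v)"
  unfolding sg_sq using Free.smult_one[OF Free.smult_closed[OF s(1) u]] by (simp only:)
 also have "\<dots> = sg (i * j) \<odot>[b k] leibniz b d \<beta> k i j x y"
  unfolding leibniz_def u_def[symmetric] v_def[symmetric] using s u v by algebra
 finally show ?thesis .
qed

text \<open>For odd i the factors d x and x commute, since (i - 1) i is even, and they enter with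
  opposite signs. This is the diagonal condition of \<open>bilin_sym_lift\<close>.\<close>

lemma leibniz_diag:
 assumes p: "product_upto n \<beta>" and k: "i + i = Suc k" "k \<le> n" and i: "odd i" and x: "x \<in> Vec (b i)"
 shows "leibniz b d \<beta> k i i x x = \<zero>[b k]"
proof -
 note dc = mod_hom_closed[OF resolutionD(3)[OF res]]
 obtain i' where i': "i = Suc i'" using i by (cases i) auto
 have x': "x \<in> Vec (b (Suc i'))" using x i' by simp
 have c: "\<beta> i' i (d i' x) x \<in> Vec (b k)" using k i' by (intro bilinD(3)[OF productD(1)[OF p] dc[OF x'] x]) auto
 have "\<beta> i i' x (d i' x) = sg (i' * i) \<odot>[b k] \<beta> i' i (d i' x) x"
  using k i' by (intro productD(3)[OF p _ _ dc[OF x'] x]) auto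
 moreover have "sg (i' * i) = \<one>" "sg i = \<ominus> \<one>" using i i' by (auto simp: sg_def)
 ultimately have "leibniz b d \<beta> k i i x x = \<beta> i' i (d i' x) x \<oplus>[b k] (\<ominus> \<one>) \<odot>[b k] (\<one> \<odot>[b k] \<beta> i' i (d i' x) x)"
  unfolding leibniz_def i' nat.case by simp
 also have "\<dots> = \<zero>[b k]" using c by algebra
 finally show ?thesis .
qed

text \<open>The obstruction to lifting vanishes: in d of the expression the two mixed terms d x d y
  cancel. In degree 0 the augmentation takes the place of d.\<close>

lemma leibniz_cycle:
 assumes p: "product_upto n \<beta>" and k: "i + j = Suc k" "k \<le> n" and x: "x \<in> Vec (b i)" and y: "y \<in> Vec (b j)"
 shows "leibniz b d \<beta> k i j x y \<in> (d k) ` Vec (b (Suc k))"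
proof -
 note r = resolutionD[OF res]
 note dc = mod_hom_closed[OF r(3)]
 interpret M: lmodule R M by (rule lmodule.intro) (rule M)
 have Wc: "leibniz b d \<beta> k i j x y \<in> Vec (b k)" by (rule bilinD(3)[OF leibniz_bilin[OF p k] x y])
 show ?thesis
 proof (cases k)
  case 0
  note \<epsilon>c = mod_hom_closed[OF r(2)]
  have "\<epsilon> (leibniz b d \<beta> k i j x y) = \<zero>\<^bsub>M\<^esub>"
  proof (cases i)
   case i0: 0
   then have j: "j = Suc 0" using k 0 by simp
   have yc: "y \<in> Vec (b (Suc 0))" "x \<in> Vec (b 0)" using y x j i0 by auto
   have c: "\<beta> 0 0 x (d 0 y) \<in> Vec (b 0)" by (rule bilinD(3)[OF productD(1)[OF p] yc(2) dc[OF yc(1)]]) auto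
   have "leibniz b d \<beta> k i j x y = \<beta> 0 0 x (d 0 y)"
    unfolding leibniz_def 0 i0 j nat.case using c Free.smult_one[OF c] Free.M.l_zero[OF c] by (simp only: sg_def even_zero if_True)
   moreover have "\<epsilon> (\<beta> 0 0 x (d 0 y)) = mul (\<epsilon> x) \<zero>\<^bsub>M\<^esub>"
    using productD(2)[OF p yc(2) dc[OF yc(1)]] r(6)[OF yc(1)] by simp
   ultimately show ?thesis using M.bilin_zero_right[OF M mul \<epsilon>c[OF yc(2)]] by simp
  next
   case (Suc i')
   then have ij: "i = Suc 0" "j = 0" using k 0 by auto
   have xc: "x \<in> Vec (b (Suc 0))" "y \<in> Vec (b 0)" using y x ij by auto
   have c: "\<beta> 0 0 (d 0 x) y \<in> Vec (b 0)" by (rule bilinD(3)[OF productD(1)[OF p] dc[OF xc(1)] xc(2)]) auto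
   have "leibniz b d \<beta> k i j x y = \<beta> 0 0 (d 0 x) y"
    unfolding leibniz_def 0 ij nat.case using Free.smult_r_null[OF sg_closed] Free.M.r_zero[OF c] by (simp only:)
   moreover have "\<epsilon> (\<beta> 0 0 (d 0 x) y) = mul \<zero>\<^bsub>M\<^esub> (\<epsilon> y)"
    using productD(2)[OF p dc[OF xc(1)] xc(2)] r(6)[OF xc(1)] by simp
   ultimately show ?thesis using M.bilin_zero_left[OF M mul \<epsilon>c[OF xc(2)]] by simp
  qed
  then show ?thesis using r(5)[of "leibniz b d \<beta> k i j x y"] Wc unfolding 0 by blast
 next
  case (Suc k')
  have k': "i + j = Suc (Suc k')" "Suc k' \<le> n" using k Suc by auto
  \<comment> \<open>The product of d x and d y. The first Leibniz term contributes (-1)^(i-1) times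
    it, the second (-1)^i times it.\<close>
  define B where "B = (case i of 0 => \<zero>[b k'] | Suc i' => (case j of 0 => \<zero>[b k'] | Suc j' => \<beta> i' j' (d i' x) (d j' y)))"
  have Bc: "B \<in> Vec (b k')"
  proof (cases "i = 0 \<or> j = 0")
   case True
   then show ?thesis unfolding B_def using Free.M.zero_closed[of "b k'"] by (auto split: nat.split simp del: free_mod_simps)
  next
   case False
   then obtain i' j' where ij: "i = Suc i'" "j = Suc j'" by (cases i; cases j) auto
   have "bilin R (Free (b i')) (Free (b j')) (Free (b k')) (\<beta> i' j')" by (rule productD(1)[OF p]) (use k' ij in auto)
   moreover have "d i' x \<in> Vec (b i')" by (rule dc) (use x ij in simp)
   moreover have "d j' y \<in> Vec (b j')" by (rule dc) (use y ij in simp)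
   ultimately show ?thesis unfolding B_def ij nat.case by (rule bilinD(3))
  qed
  have U: "(case i of 0 => \<zero>[b k] | Suc i' => \<beta> i' j (d i' x) y) \<in> Vec (b k) \<and>
    d k' (case i of 0 => \<zero>[b k] | Suc i' => \<beta> i' j (d i' x) y) = (\<ominus> (sg i)) \<odot>[b k'] B"
  proof (cases i)
   case 0
   show ?thesis unfolding B_def 0 nat.case
    using Free.M.zero_closed[of "b k"] mod_hom_zero[OF r(1) r(1) r(3), of k'] Free.smult_r_null[of "\<ominus> (sg 0)" "b k'"] Suc
    by (simp del: free_mod_simps)
  next
   case i: (Suc i')
   have x': "x \<in> Vec (b (Suc i'))" using x i by simp
   have c: "\<beta> i' j (d i' x) y \<in> Vec (b k)" using k i by (intro bilinD(3)[OF productD(1)[OF p] dc[OF x'] y]) auto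
   have "d k' (\<beta> i' j (d i' x) y) = leibniz b d \<beta> k' i' j (d i' x) y"
    using k' i by (intro productD(4)[OF p _ _ dc[OF x'] y]) auto
   also have "\<dots> = \<zero>[b k'] \<oplus>[b k'] sg i' \<odot>[b k'] B"
   proof -
    have "(case i' of 0 => \<zero>[b k'] | Suc i'' => \<beta> i'' j (d i'' (d i' x)) y) = \<zero>[b k']"
    proof (cases i')
     case (Suc i'')
     have "d i'' (d i' x) = \<zero>[b i'']" using r(8)[of x i''] x' Suc by simp
     moreover have "bilin R (Free (b i'')) (Free (b j)) (Free (b k')) (\<beta> i'' j)" using k' i Suc by (intro productD(1)[OF p]) auto
     ultimately show ?thesis using Free.bilin_zero_left[OF free_module _ y] Suc by simp
    qed simp
    moreover have "B = (case j of 0 => \<zero>[b k'] | Suc j' => \<beta> i' j' (d i' x) (d j' y))"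
     unfolding B_def i nat.case ..
    ultimately show ?thesis unfolding leibniz_def by (simp only:)
   qed
   also have "\<dots> = sg i' \<odot>[b k'] B" by (rule Free.M.l_zero[OF Free.smult_closed[OF sg_closed Bc]])
   also have "sg i' = \<ominus> (sg i)" unfolding i by (simp add: sg_def)
   finally show ?thesis using c unfolding i nat.case by simp
  qed
  have V: "(case j of 0 => \<zero>[b k] | Suc j' => \<beta> i j' x (d j' y)) \<in> Vec (b k) \<and>
    d k' (case j of 0 => \<zero>[b k] | Suc j' => \<beta> i j' x (d j' y)) = B"
  proof (cases j)
   case 0
   have "B = \<zero>[b k']" unfolding B_def 0 nat.case by (simp split: nat.split)
   then show ?thesis unfolding 0 nat.case
    using Free.M.zero_closed[of "b k"] mod_hom_zero[OF r(1) r(1) r(3), of k'] Suc by (simp del: free_mod_simps)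
  next
   case j: (Suc j')
   have y': "y \<in> Vec (b (Suc j'))" using y j by simp
   have c: "\<beta> i j' x (d j' y) \<in> Vec (b k)" using k j by (intro bilinD(3)[OF productD(1)[OF p] x dc[OF y']]) auto
   have "d k' (\<beta> i j' x (d j' y)) = leibniz b d \<beta> k' i j' x (d j' y)"
    using k' j by (intro productD(4)[OF p _ _ x dc[OF y']]) auto
   also have "\<dots> = B \<oplus>[b k'] sg i \<odot>[b k'] \<zero>[b k']"
   proof -
    have "(case j' of 0 => \<zero>[b k'] | Suc j'' => \<beta> i j'' x (d j'' (d j' y))) = \<zero>[b k']"
    proof (cases j')
     case (Suc j'')
     have "d j'' (d j' y) = \<zero>[b j'']" using r(8)[of y j''] y' Suc by simp
     moreover have "bilin R (Free (b i)) (Free (b j'')) (Free (b k')) (\<beta> i j'')" using k' j Suc by (intro productD(1)[OF p]) auto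
     ultimately show ?thesis using Free.bilin_zero_right[OF free_module _ x] Suc by simp
    qed simp
    moreover have "B = (case i of 0 => \<zero>[b k'] | Suc i' => \<beta> i' j' (d i' x) (d j' y))"
     unfolding B_def j nat.case ..
    ultimately show ?thesis unfolding leibniz_def by (simp only:)
   qed
   also have "\<dots> = B" unfolding Free.smult_r_null[OF sg_closed] by (rule Free.M.r_zero[OF Bc])
   finally show ?thesis using c unfolding j nat.case by simp
  qed
  have dk: "d k' \<in> Lin (b k) (b k')" using r(3)[of k'] Suc by simp
  have "d k' (leibniz b d \<beta> k i j x y) = (\<ominus> (sg i)) \<odot>[b k'] B \<oplus>[b k'] sg i \<odot>[b k'] B"
   unfolding leibniz_def by (simp only: mod_hom_add[OF dk conjunct1[OF U] Free.smult_closed[OF sg_closed conjunct1[OF V]]]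
     mod_hom_smult[OF dk sg_closed conjunct1[OF V]] conjunct2[OF U] conjunct2[OF V])
  also have "\<dots> = \<zero>[b k']" using Bc sg_closed[of i] by algebra
  finally show ?thesis using r(7)[of "leibniz b d \<beta> k i j x y" k'] Wc unfolding Suc by blast
 qed
qed

lemma product_base: "\<exists>\<beta>. product_upto 0 \<beta>"
proof -
 note r = resolutionD[OF res]
 interpret M: lmodule R M by (rule lmodule.intro) (rule M)
 have "\<exists>\<beta>. bilin R (Free (b 0)) (Free (b 0)) (Free (b 0)) \<beta> \<and>
  (\<forall>x\<in>Vec (b 0). \<forall>y\<in>Vec (b 0). \<epsilon> (\<beta> x y) = mul (\<epsilon> x) (\<epsilon> y) \<and> \<beta> y x = \<one> \<odot>[b 0] \<beta> x y)"
 proof (rule Free.bilin_sym_lift[OF M r(2) bilin_comp[OF mul r(2) r(2)]])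
  fix x y assume xy: "x \<in> Vec (b 0)" "y \<in> Vec (b 0)"
  note c = mod_hom_closed[OF r(2) xy(1)] mod_hom_closed[OF r(2) xy(2)]
  show "mul (\<epsilon> x) (\<epsilon> y) \<in> \<epsilon> ` Vec (b 0)" using r(4)[OF bilinD(3)[OF mul c]] by blast
  show "mul (\<epsilon> y) (\<epsilon> x) = \<one> \<odot>\<^bsub>M\<^esub> mul (\<epsilon> x) (\<epsilon> y)" using mul_comm[rule_format, OF c] bilinD(3)[OF mul c] by simp
 qed auto
 then obtain \<beta> where \<beta>: "bilin R (Free (b 0)) (Free (b 0)) (Free (b 0)) \<beta>"
  "\<And>x y. x \<in> Vec (b 0) ==> y \<in> Vec (b 0) ==> \<epsilon> (\<beta> x y) = mul (\<epsilon> x) (\<epsilon> y)"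
  "\<And>x y. x \<in> Vec (b 0) ==> y \<in> Vec (b 0) ==> \<beta> y x = \<one> \<odot>[b 0] \<beta> x y" by blast
 have "product_upto 0 (\<lambda>i j. \<beta>)" unfolding product_upto_def
 proof (intro conjI allI impI ballI)
  fix x y assume xy: "x \<in> Vec (b 0)" "y \<in> Vec (b 0)"
  show "\<epsilon> (\<beta> x y) = mul (\<epsilon> x) (\<epsilon> y)" by (rule \<beta>(2)[OF xy])
 next
  fix i j x y assume ij: "i + j \<le> (0::nat)" and xy: "x \<in> Vec (b i)" "y \<in> Vec (b j)"
  have i0: "i = 0" "j = 0" "sg (0 * 0) = \<one>" using ij by (simp_all add: sg_def)
  show "\<beta> y x = sg (i * j) \<odot>[b (i + j)] \<beta> x y" using \<beta>(3)[of x y] xy unfolding i0 by (simp only: add_0 i0(3))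
 qed (use \<beta>(1) in simp_all)
 then show ?thesis by blast
qed

lemma product_step:
 assumes p: "product_upto n \<beta>"
 shows "\<exists>\<gamma>. product_upto (Suc n) \<gamma>"
proof -
 note r = resolutionD[OF res]
 have "\<exists>g. i + j = Suc n --> bilin R (Free (b i)) (Free (b j)) (Free (b (Suc n))) g \<and>
   (\<forall>x\<in>Vec (b i). \<forall>y\<in>Vec (b j). d n (g x y) = leibniz b d \<beta> n i j x y) \<and>
   (i = j --> (\<forall>x\<in>Vec (b i). \<forall>y\<in>Vec (b i). g y x = sg (i * i) \<odot>[b (Suc n)] g x y))" for i j
 proof (cases "i + j = Suc n")
  case True
  note Wb = leibniz_bilin[OF p True order_refl] and Wc = leibniz_cycle[OF p True order_refl]
  show ?thesis
  proof (cases "i = j")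
   case ij: True
   \<comment> \<open>In equal degrees commutativity constrains a single form, so the lift has to be
     chosen symmetric up to sign.\<close>
   have "\<exists>g. bilin R (Free (b i)) (Free (b i)) (Free (b (Suc n))) g \<and>
    (\<forall>x\<in>Vec (b i). \<forall>y\<in>Vec (b i).
     d n (g x y) = leibniz b d \<beta> n i i x y \<and> g y x = sg (i * i) \<odot>[b (Suc n)] g x y)"
   proof (rule Free.bilin_sym_lift[OF free_module r(3) _ _ sg_closed sg_sq])
    show "bilin R (Free (b i)) (Free (b i)) (Free (b n)) (leibniz b d \<beta> n i i)" using Wb ij by simp
    show "leibniz b d \<beta> n i i x y \<in> d n ` Vec (b (Suc n))"
     if "x \<in> Vec (b i)" "y \<in> Vec (b i)" for x y using Wc[of x y] that ij by simp
    show "leibniz b d \<beta> n i i y x = sg (i * i) \<odot>[b n] leibniz b d \<beta> n i i x y"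
     if "x \<in> Vec (b i)" "y \<in> Vec (b i)" for x y using True ij that by (intro leibniz_sym[OF p]) auto
    show "sg (i * i) = \<one> \<or> (\<forall>x\<in>Vec (b i). leibniz b d \<beta> n i i x x = \<zero>[b n])"
     using leibniz_diag[OF p, of i n] True ij by (cases "even i") (auto simp: sg_def simp del: free_mod_simps)
   qed
   then show ?thesis using ij by auto
  next
   case False
   have "\<exists>g. bilin R (Free (b i)) (Free (b j)) (Free (b (Suc n))) g \<and>
    (\<forall>x\<in>Vec (b i). \<forall>y\<in>Vec (b j). d n (g x y) = leibniz b d \<beta> n i j x y)"
    by (rule Free.bilin_lift[OF free_module r(3) Wb Wc])
   then show ?thesis using False by auto
  qed
 qed simp
 then have "\<exists>g. \<forall>i j. i + j = Suc n --> bilin R (Free (b i)) (Free (b j)) (Free (b (Suc n))) (g i j) \<and>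
   (\<forall>x\<in>Vec (b i). \<forall>y\<in>Vec (b j). d n (g i j x y) = leibniz b d \<beta> n i j x y) \<and>
   (i = j --> (\<forall>x\<in>Vec (b i). \<forall>y\<in>Vec (b i). g i j y x = sg (i * i) \<odot>[b (Suc n)] g i j x y))"
  by (intro choice allI)
 then obtain g where g: "\<forall>i j. i + j = Suc n --> bilin R (Free (b i)) (Free (b j)) (Free (b (Suc n))) (g i j) \<and>
   (\<forall>x\<in>Vec (b i). \<forall>y\<in>Vec (b j). d n (g i j x y) = leibniz b d \<beta> n i j x y) \<and>
   (i = j --> (\<forall>x\<in>Vec (b i). \<forall>y\<in>Vec (b i). g i j y x = sg (i * i) \<odot>[b (Suc n)] g i j x y))"
  by (rule exE)
 have g1: "bilin R (Free (b i)) (Free (b j)) (Free (b (Suc n))) (g i j)"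
  and g2: "\<And>x y. x \<in> Vec (b i) ==> y \<in> Vec (b j) ==> d n (g i j x y) = leibniz b d \<beta> n i j x y"
  if "i + j = Suc n" for i j using g that by blast+
 have g3: "g i i y x = sg (i * i) \<odot>[b (Suc n)] g i i x y"
  if "i + i = Suc n" "x \<in> Vec (b i)" "y \<in> Vec (b i)" for i x y using g that by blast
 \<comment> \<open>Of each pair of bidegrees only the one with \<open>i \<le> j\<close> is lifted;
   the other is defined from it by graded commutativity.\<close>
 define \<gamma> where "\<gamma> i j = (if i + j \<noteq> Suc n then \<beta> i j else if i \<le> j then g i j
   else (\<lambda>x y. sg (i * j) \<odot>[b (Suc n)] g j i y x))" for i j
 have low: "\<gamma> i j = \<beta> i j" if "i + j \<le> n" for i j using that by (auto simp: \<gamma>_def)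
 have lb: "leibniz b d \<gamma> k i j x y = leibniz b d \<beta> k i j x y" if "i + j = Suc k" "k \<le> n" for k i j x y
  unfolding leibniz_def using that low by (auto split: nat.splits simp del: free_mod_simps)
 have top_bilin: "bilin R (Free (b i)) (Free (b j)) (Free (b (Suc n))) (\<gamma> i j)" if ij: "i + j = Suc n" for i j
 proof (cases "i \<le> j")
  case True
  then show ?thesis using g1[OF ij] ij by (simp add: \<gamma>_def)
 next
  case False
  have "j + i = Suc n" using ij by simp
  then have "bilin R (Free (b i)) (Free (b j)) (Free (b (Suc n))) (\<lambda>x y. sg (i * j) \<odot>[b (Suc n)] g j i y x)"
   by (rule Free.bilin_smult[OF bilin_swap[OF g1] sg_closed])
  moreover have "\<gamma> i j = (\<lambda>x y. sg (i * j) \<odot>[b (Suc n)] g j i y x)"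
   using False ij unfolding \<gamma>_def by (simp only: if_False simp_thms)
  ultimately show ?thesis by (simp only:)
 qed
 have top_leibniz: "d n (\<gamma> i j x y) = leibniz b d \<beta> n i j x y"
  if ij: "i + j = Suc n" and x: "x \<in> Vec (b i)" and y: "y \<in> Vec (b j)" for i j x y
 proof (cases "i \<le> j")
  case True
  then show ?thesis using g2[OF ij x y] ij by (simp add: \<gamma>_def)
 next
  case False
  have ji: "j + i = Suc n" using ij by simp
  have "\<gamma> i j x y = sg (i * j) \<odot>[b (Suc n)] g j i y x"
   using False ij unfolding \<gamma>_def by (simp only: if_False simp_thms)
  then have "d n (\<gamma> i j x y) = sg (i * j) \<odot>[b n] leibniz b d \<beta> n j i y x"
   using mod_hom_smult[OF r(3) sg_closed bilinD(3)[OF g1[OF ji] y x], of "i * j"] g2[OF ji y x] by (simp only:)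
  also have "\<dots> = sg (i * j) \<odot>[b n] (sg (i * j) \<odot>[b n] leibniz b d \<beta> n i j x y)"
   using leibniz_sym[OF p ij order_refl x y] by (simp only:)
  also have "\<dots> = leibniz b d \<beta> n i j x y"
   by (rule sg_smult_cancel[OF Free.lmodule_axioms bilinD(3)[OF leibniz_bilin[OF p ij order_refl] x y]])
  finally show ?thesis .
 qed
 have top_comm: "\<gamma> j i y x = sg (i * j) \<odot>[b (Suc n)] \<gamma> i j x y"
  if ij: "i + j = Suc n" and x: "x \<in> Vec (b i)" and y: "y \<in> Vec (b j)" for i j x y
 proof -
  have ji: "j + i = Suc n" using ij by simp
  consider "i < j" | "i = j" | "j < i" by linarith
  then show ?thesis
  proof cases
   case 1
   then have "\<gamma> j i y x = sg (j * i) \<odot>[b (Suc n)] g i j x y" "\<gamma> i j x y = g i j x y"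
    using ij ji unfolding \<gamma>_def by (simp_all del: free_mod_simps)
   then show ?thesis by (simp only: mult.commute)
  next
   case 2
   then have "\<gamma> j i = g i i" "\<gamma> i j = g i i" using ij unfolding \<gamma>_def by simp_all
   then show ?thesis using g3[of i x y] ij x y 2 by simp
  next
   case 3
   then have "\<gamma> i j x y = sg (i * j) \<odot>[b (Suc n)] g j i y x" "\<gamma> j i y x = g j i y x"
    using ij ji unfolding \<gamma>_def by (simp_all del: free_mod_simps)
   then show ?thesis using sg_smult_cancel[OF Free.lmodule_axioms bilinD(3)[OF g1[OF ji] y x], of "i * j"] by (simp only:)
  qed
 qed
 have "product_upto (Suc n) \<gamma>" unfolding product_upto_def
 proof (intro conjI allI impI ballI)
  fix i j assume ij: "i + j \<le> Suc n"
  show "bilin R (Free (b i)) (Free (b j)) (Free (b (i + j))) (\<gamma> i j)"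
   using top_bilin[of i j] productD(1)[OF p, of i j] low[of i j] ij by (cases "i + j = Suc n") auto
  fix x y assume "x \<in> Vec (b i)" "y \<in> Vec (b j)"
  then show "\<gamma> j i y x = sg (i * j) \<odot>[b (i + j)] \<gamma> i j x y"
   using top_comm[of i j x y] productD(3)[OF p, of i j "i + j" x y] low[of i j] low[of j i] ij
   by (cases "i + j = Suc n") (auto simp: add.commute simp del: free_mod_simps)
 next
  fix x y assume "x \<in> Vec (b 0)" "y \<in> Vec (b 0)"
  then show "\<epsilon> (\<gamma> 0 0 x y) = mul (\<epsilon> x) (\<epsilon> y)" using productD(2)[OF p] low[of 0 0] by simp
 next
  fix k i j x y assume k: "i + j = Suc k" "Suc k \<le> Suc n" and xy: "x \<in> Vec (b i)" "y \<in> Vec (b j)"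
  then show "d k (\<gamma> i j x y) = leibniz b d \<gamma> k i j x y"
   using top_leibniz[of i j x y] productD(4)[OF p, of i j k x y] lb[of i j k x y] low[of i j] by (cases "k = n") auto
 qed
 then show ?thesis by blast
qed

lemma product_ex: "\<exists>\<beta>. product_upto n \<beta>" by (induction n) (use product_base product_step in auto)

end

end

section \<open>Perfect pairings and self-dual resolutions\<close>

lemma mod_iso_inv:
 assumes "module S M" "f \<in> mod_hom S M N" "bij_betw f (carrier M) (carrier N)"
 shows "inv_into (carrier M) f \<in> mod_hom S N M"
proof -
 interpret M: lmodule S M by (rule lmodule.intro) fact
 let ?g = "inv_into (carrier M) f"
 have g: "?g y \<in> carrier M" "f (?g y) = y" if "y \<in> carrier N" for y
  using that assms(3) by (auto simp: bij_betw_def inv_into_into f_inv_into_f)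
 have eqI: "?g y = x" if "x \<in> carrier M" "f x = y" for x y using that assms(3) by (auto simp: bij_betw_def)
 show ?thesis
 proof (rule mod_homI)
  show "?g y \<in> carrier M" if "y \<in> carrier N" for y by (rule g(1)[OF that])
  show "?g (x \<oplus>\<^bsub>N\<^esub> y) = ?g x \<oplus>\<^bsub>M\<^esub> ?g y" if "x \<in> carrier N" "y \<in> carrier N" for x y
   using mod_hom_add[OF assms(2) g(1)[OF that(1)] g(1)[OF that(2)]] g that by (intro eqI) auto
  show "?g (s \<odot>\<^bsub>N\<^esub> y) = s \<odot>\<^bsub>M\<^esub> ?g y" if "s \<in> carrier S" "y \<in> carrier N" for s y
   using mod_hom_smult[OF assms(2) that(1) g(1)[OF that(2)]] g that by (intro eqI) auto
 qed
qed

text \<open>Exactness passes along an isomorphism of complexes, also between different types of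
  elements. It serves to replace half of a resolution by duals and to move between coordinates and
  the sum type.\<close>

lemma resolution_transport:
 assumes res: "resolution S M C d \<epsilon>" and N: "\<And>i. module S (N i)"
  and \<iota>: "\<And>i. \<iota> i \<in> mod_hom S (C i) (N i)" "\<And>i. bij_betw (\<iota> i) (carrier (C i)) (carrier (N i))"
  and D: "\<And>i. D i \<in> mod_hom S (N (Suc i)) (N i)" "\<And>i x. x \<in> carrier (C (Suc i)) ==> D i (\<iota> (Suc i) x) = \<iota> i (d i x)"
  and \<eta>: "\<eta> \<in> mod_hom S (N 0) M" "\<And>x. x \<in> carrier (C 0) ==> \<eta> (\<iota> 0 x) = \<epsilon> x"
 shows "resolution S M N D \<eta>"
proof -
 note r = resolutionD[OF res]
 have im: "carrier (N i) = \<iota> i ` carrier (C i)" for i using \<iota>(2)[of i] by (simp add: bij_betw_def)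
 have zero: "\<iota> i x = \<zero>\<^bsub>N i\<^esub> \<longleftrightarrow> x = \<zero>\<^bsub>C i\<^esub>" if "x \<in> carrier (C i)" for i x
 proof -
  have "\<iota> i \<zero>\<^bsub>C i\<^esub> = \<zero>\<^bsub>N i\<^esub>" by (rule mod_hom_zero[OF r(1) N \<iota>(1)])
  moreover have "\<zero>\<^bsub>C i\<^esub> \<in> carrier (C i)" by (rule abelian_monoid.zero_closed[OF abelian_group.axioms(1)[OF module.axioms(2)[OF r(1)]]])
  ultimately show ?thesis using \<iota>(2)[of i] that by (metis bij_betw_def inj_on_eq_iff)
 qed
 have Dim: "D i ` carrier (N (Suc i)) = \<iota> i ` d i ` carrier (C (Suc i))" for i unfolding im image_image using D(2) by simp
 have ker0: "mod_ker (N 0) M \<eta> = \<iota> 0 ` mod_ker (C 0) M \<epsilon>" unfolding mod_ker_def im using \<eta>(2) by auto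
 have ker: "mod_ker (N (Suc i)) (N i) (D i) = \<iota> (Suc i) ` mod_ker (C (Suc i)) (C i) (d i)" for i
 proof -
  have "D i (\<iota> (Suc i) x) = \<zero>\<^bsub>N i\<^esub> \<longleftrightarrow> d i x = \<zero>\<^bsub>C i\<^esub>" if "x \<in> carrier (C (Suc i))" for x
   using D(2)[OF that] zero[OF mod_hom_closed[OF r(3) that]] by simp
  then show ?thesis unfolding mod_ker_def im by blast
 qed
 show ?thesis unfolding resolution_def One_nat_def ker0 ker Dim
 proof (intro conjI allI)
  show "\<eta> ` carrier (N 0) = carrier M" unfolding im image_image using res \<eta>(2) by (simp add: resolution_def)
 qed (use res N D(1) \<eta>(1) in \<open>simp_all add: resolution_def\<close>)
qed

lemma (in lmodule) hom_vecs:
 assumes f: "f \<in> mod_hom R (Free n) M" and K: "submodule K R M"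
  and J: "\<And>p y. p \<in> J ==> y \<in> carrier M ==> p \<odot>\<^sub>M y \<in> K" and x: "x \<in> vecs J n"
 shows "f x \<in> K"
proof -
 have xc: "x \<in> Vec n" and xJ: "\<And>i. x i \<in> J" using x by (auto simp: vecs_def)
 have fc: "f (unitvec k) \<in> carrier M" if "k < n" for k by (rule mod_hom_closed[OF f unitvec_closed[OF that]])
 show ?thesis unfolding free_hom_lincomb[OF f xc] by (rule lincomb_in_submod[OF K]) (use fc J xJ Vec_closed[OF xc] in auto)
qed

context cring
begin

lemma free_hom_vecs:
 assumes "ideal J R" "f \<in> Lin p q" "x \<in> vecs J p"
 shows "f x \<in> vecs J q"
proof (rule Free.hom_vecs[OF assms(2) vecs_submod[OF assms(1)] _ assms(3)])
 fix s y assume sy: "s \<in> J" "y \<in> Vec q"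
 have sc: "s \<in> carrier R" by (rule ideal_carrier[OF assms(1) sy(1)])
 have "s \<otimes> y i \<in> J" for i using ideal_mult[OF assms(1) Vec_closed[OF sy(2)] sy(1)] m_comm[OF sc Vec_closed[OF sy(2)]] by simp
 then show "s \<odot>[q] y \<in> vecs J q" using Free.smult_closed[OF sc sy(2)] by (simp add: vecs_def)
qed

lemma functional_vecs:
 assumes "ideal J R" "functional (Free n) \<psi>" "x \<in> vecs J n"
 shows "\<psi> x \<in> J"
proof (rule Self.hom_vecs[OF assms(2)[unfolded functional_def] _ _ assms(3)])
 show "submodule J R (self_module R)" using assms(1) by (simp only: ideal_iff_submod)
 fix s y assume sy: "s \<in> J" "y \<in> carrier (self_module R)"
 have sc: "s \<in> carrier R" by (rule ideal_carrier[OF assms(1) sy(1)])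
 show "s \<odot>\<^bsub>self_module R\<^esub> y \<in> J" using ideal_mult[OF assms(1) _ sy(1), of y] m_comm[OF sc, of y] sy(2) by simp
qed

lemma local_ideal: "local_ring R \<mm> ==> ideal \<mm> R" by (rule prime_ideal[OF local_ring_prime])

text \<open>\<open>f\<close> is onto by Nakayama and has a section \<open>\<rho>\<close>. As the
  kernel lies in \<mm> R^p, the section is onto by Nakayama as well, and then \<open>f\<close> is
  injective; no determinants and no comparison of ranks.\<close>

lemma free_bij:
 assumes loc: "local_ring R \<mm>" and f: "f \<in> Lin p q"
  and ker: "\<And>x. x \<in> Vec p ==> f x = \<zero>[q] ==> x \<in> vecs \<mm> p"
  and surj: "\<And>z. z \<in> Vec q ==> \<exists>x\<in>Vec p. \<exists>h\<in>vecs \<mm> q. z = f x \<oplus>[q] h"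
 shows "bij_betw f (Vec p) (Vec q)"
proof -
 have im: "f ` Vec p = Vec q" by (rule free_nakayama_surj[OF loc Free.hom_image_submod[OF free_module f]]) (use surj in blast)
 have "\<exists>\<rho>\<in>Lin q p. \<forall>z\<in>Vec q. f (\<rho> z) = z"
  by (rule projective_lift[OF fg_projective_free free_module free_module f mod_hom_id]) (simp only: im)
 then obtain \<rho> where \<rho>: "\<rho> \<in> Lin q p" "\<And>z. z \<in> Vec q ==> f (\<rho> z) = z" by blast
 note fc = mod_hom_closed[OF f] and \<rho>c = mod_hom_closed[OF \<rho>(1)]
 have im\<rho>: "\<rho> ` Vec q = Vec p"
 proof (rule free_nakayama_surj[OF loc Free.hom_image_submod[OF free_module \<rho>(1)]])
  fix x assume x: "x \<in> Vec p"
  have r: "\<rho> (f x) \<in> Vec p" by (rule \<rho>c[OF fc[OF x]])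
  have "f (x \<ominus>[p] \<rho> (f x)) = \<zero>[q]"
   unfolding mod_hom_minus[OF free_module free_module f x r] \<rho>(2)[OF fc[OF x]] by (rule Free.minus_self[OF fc[OF x]])
  then have "x \<ominus>[p] \<rho> (f x) \<in> vecs \<mm> p" by (rule ker[OF Free.M.minus_closed[OF x r]])
  moreover have "x = \<rho> (f x) \<oplus>[p] (x \<ominus>[p] \<rho> (f x))" using x r by algebra
  ultimately show "\<exists>l\<in>\<rho> ` Vec q. \<exists>h\<in>vecs \<mm> p. x = l \<oplus>[p] h" using fc[OF x] by blast
 qed
 have "inj_on f (Vec p)"
 proof (rule inj_onI)
  fix x y assume "x \<in> Vec p" "y \<in> Vec p" and eq: "f x = f y"
  then obtain z w where "z \<in> Vec q" "x = \<rho> z" "w \<in> Vec q" "y = \<rho> w" using im\<rho> by blast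
  then show "x = y" using eq \<rho>(2) by simp
 qed
 then show ?thesis using im by (simp add: bij_betw_def)
qed

lemma bilin_dot:
 assumes \<beta>: "bilin R (Free p) (Free q) (self_module R) \<beta>"
 shows "\<exists>B\<in>Lin p q. \<forall>x\<in>Vec p. \<forall>y\<in>Vec q. dot q (B x) y = \<beta> x y"
proof -
 have "\<forall>x\<in>Vec p. \<exists>u. u \<in> Vec q \<and> (\<forall>y\<in>Vec q. dot q u y = \<beta> x y)"
 proof
  fix x assume x: "x \<in> Vec p"
  have "functional (Free q) (\<beta> x)" unfolding functional_def by (rule bilinD(2)[OF \<beta> x])
  from functional_dot[OF this] show "\<exists>u. u \<in> Vec q \<and> (\<forall>y\<in>Vec q. dot q u y = \<beta> x y)"
   by (elim bexE) (rule exI, auto)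
 qed
 from bchoice[OF this] obtain B where B: "\<And>x. x \<in> Vec p ==> B x \<in> Vec q"
  "\<And>x y. x \<in> Vec p ==> y \<in> Vec q ==> dot q (B x) y = \<beta> x y" by blast
 have "B \<in> Lin p q"
 proof (rule mod_homI)
  fix x assume x: "x \<in> Vec p"
  show "B x \<in> Vec q" by (rule B(1)[OF x])
  fix y assume y: "y \<in> Vec p"
  have xy: "x \<oplus>[p] y \<in> Vec p" by (rule Free.M.a_closed[OF x y])
  show "B (x \<oplus>[p] y) = B x \<oplus>[q] B y"
  proof (rule dot_eqI[OF B(1)[OF xy] Free.M.a_closed[OF B(1)[OF x] B(1)[OF y]]])
   fix w assume w: "w \<in> Vec q"
   show "dot q (B (x \<oplus>[p] y)) w = dot q (B x \<oplus>[q] B y) w"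
    unfolding dot_add[OF B(1)[OF x] B(1)[OF y] w] B(2)[OF xy w] B(2)[OF x w] B(2)[OF y w]
    using mod_hom_add[OF bilinD(1)[OF \<beta> w] x y] by (simp only: self_module_simps)
  qed
 next
  fix s x assume s: "s \<in> carrier R" and x: "x \<in> Vec p"
  have sx: "s \<odot>[p] x \<in> Vec p" by (rule Free.smult_closed[OF s x])
  show "B (s \<odot>[p] x) = s \<odot>[q] B x"
  proof (rule dot_eqI[OF B(1)[OF sx] Free.smult_closed[OF s B(1)[OF x]]])
   fix w assume w: "w \<in> Vec q"
   show "dot q (B (s \<odot>[p] x)) w = dot q (s \<odot>[q] B x) w" unfolding dot_smult[OF s B(1)[OF x] w] B(2)[OF sx w] B(2)[OF x w]
    using mod_hom_smult[OF bilinD(1)[OF \<beta> w] s x] by (simp only: self_module_simps)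
  qed
 qed
 then show ?thesis using B(2) by blast
qed

lemma coboundary_zero: "coboundary P d i (\<lambda>x. \<zero>)" unfolding coboundary_def using functional_zero by (cases i) auto

text \<open>\<open>sd_ranks\<close> and \<open>sd_maps\<close> are \<open>self_dual_mod\<close> and
  \<open>self_dual_diff\<close> in coordinates, with transposes for duals. Differentials are counted
  from 0 here and from 1 there.\<close>

definition sd_ranks :: "nat => (nat => nat) => nat => nat" where
 "sd_ranks m n i = (if i \<le> m then n i else if i \<le> 2 * m + 1 then n (2 * m + 1 - i) else 0)"

definition sd_maps :: "nat => (nat => nat) => (nat => (nat => 'a) => nat => 'a) => ((nat => 'a) => nat => 'a) =>
  nat => (nat => 'a) => nat => 'a" where
 "sd_maps m n d E i = (if i < m then d i else if i = m then E
   else if i \<le> 2 * m then transpose_map (n (Suc (2 * m - i))) (n (2 * m - i)) (d (2 * m - i)) else (\<lambda>x i. \<zero>))"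

lemma sd_maps_hom:
 assumes d: "\<And>i. i < m ==> d i \<in> Lin (n (Suc i)) (n i)" and E: "E \<in> Lin (n m) (n m)"
 shows "sd_maps m n d E i \<in> Lin (sd_ranks m n (Suc i)) (sd_ranks m n i)"
proof -
 consider "i < m" | "i = m" | "m < i" "i \<le> 2 * m" | "2 * m < i" by linarith
 then show ?thesis
 proof cases
  case 3
  then have "2 * m - i < m" "2 * m + 1 - i = Suc (2 * m - i)" "2 * m + 1 - Suc i = 2 * m - i" by auto
  then show ?thesis using transpose_hom[OF d[of "2 * m - i"]] 3 by (simp add: sd_maps_def sd_ranks_def)
 next
  case 4
  then show ?thesis using Free.mod_hom_zerof by (simp add: sd_maps_def)
 qed (use d E in \<open>auto simp: sd_maps_def sd_ranks_def\<close>)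
qed

section \<open>Perfect pairings on a minimal resolution\<close>

context
 fixes M :: "('a, 'y) module" and b d \<epsilon> \<mm> c and P :: "nat => nat => (nat => 'a) => (nat => 'a) => 'a"
 assumes loc: "local_ring R \<mm>" and res: "resolution R M (Frees b) d \<epsilon>"
  and min: "\<And>i x. x \<in> Vec (b (Suc i)) ==> d i x \<in> vecs \<mm> (b i)"
  and acyc: "\<And>i. i < c ==> acyclic_dual (Frees b) d i"
  and P: "\<And>i j. i + j = c ==> bilin R (Free (b i)) (Free (b j)) (self_module R) (P i j)"
  and leib: "\<And>i j x y. Suc (i + j) = c ==> x \<in> Vec (b (Suc i)) ==> y \<in> Vec (b (Suc j)) ==>
   P i (Suc j) (d i x) y = sg i \<otimes> P (Suc i) j x (d j y)"
  and inj: "\<And>x. x \<in> Vec (b 0) ==> coboundary (Frees b) d c (P 0 c x) ==> \<exists>w\<in>Vec (b (Suc 0)). x = d 0 w"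
  and surj: "\<And>\<psi>. functional (Free (b c)) \<psi> ==> \<exists>x\<in>Vec (b 0). coboundary (Frees b) d c (\<lambda>y. \<psi> y \<ominus> P 0 c x y)"
begin

text \<open>Minimality: a functional of the form \<open>h d\<close> takes values in the maximal
  ideal, and the coordinates of \<open>w\<close> are such values.\<close>

lemma coboundary_vecs:
 assumes w: "w \<in> Vec (b j)" and c: "coboundary (Frees b) d j (dot (b j) w)"
 shows "w \<in> vecs \<mm> (b j)"
proof -
 have "w k \<in> \<mm>" for k
 proof (cases "k < b j")
  case True
  show ?thesis
  proof (cases j)
   case 0
   then have "w k = \<zero>" using c dot_unitvec[OF w True] unitvec_closed[OF True] by (simp add: coboundary_def)
   then show ?thesis using ideal_zero[OF local_ideal[OF loc]] by simp
  next
   case (Suc i)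
   have uc: "unitvec k \<in> Vec (b (Suc i))" using unitvec_closed[OF True] Suc by simp
   obtain h where h: "functional (Free (b i)) h" "\<forall>x\<in>Vec (b (Suc i)). dot (b j) w x = h (d i x)"
    using c unfolding coboundary_def Suc nat.case by blast
   have "w k = h (d i (unitvec k))" using bspec[OF h(2) uc] dot_unitvec[OF w True] by simp
   then show ?thesis using functional_vecs[OF local_ideal[OF loc] h(1) min[OF uc]] by simp
  qed
 next
  case False
  then show ?thesis using free_mod_beyond[OF w] ideal_zero[OF local_ideal[OF loc]] by simp
 qed
 then show ?thesis using w by (simp add: vecs_def)
qed

lemma coboundary_cocycle:
 assumes "coboundary (Frees b) d j \<psi>" "y \<in> Vec (b (Suc j))"
 shows "\<psi> (d j y) = \<zero>"
proof (cases j)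
 case 0
 then show ?thesis using assms mod_hom_closed[OF resolutionD(3)[OF res], of y 0] by (simp add: coboundary_def)
next
 case (Suc i)
 obtain h where h: "functional (Free (b i)) h" "\<forall>x\<in>Vec (b (Suc i)). \<psi> x = h (d i x)"
  using assms(1) unfolding coboundary_def Suc nat.case by blast
 have y: "y \<in> Vec (b (Suc (Suc i)))" using assms(2) Suc by simp
 have "\<psi> (d j y) = h (d i (d (Suc i) y))" using bspec[OF h(2) mod_hom_closed[OF resolutionD(3)[OF res] y]] Suc by simp
 also have "\<dots> = h \<zero>[b i]" using resolutionD(8)[OF res y] by simp
 also have "\<dots> = \<zero>" by (rule functionalD(4)[OF h(1) free_module])
 finally show ?thesis .
qed

lemma pairing_functional: "i + j = c ==> x \<in> Vec (b i) ==> functional (Free (b j)) (P i j x)"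
 unfolding functional_def by (rule bilinD(2)[OF P])

text \<open>\<open>H\<close> and \<open>T\<close> express nondegeneracy only up to boundaries and
  coboundaries. On a minimal resolution both are zero modulo the maximal ideal, so Nakayama, through
  \<open>free_bij\<close>, makes the pairing perfect.\<close>

lemma pairing_bij:
 assumes ij: "i + j = c" and B: "B \<in> Lin (b i) (b j)"
  and BP: "\<And>x y. x \<in> Vec (b i) ==> y \<in> Vec (b j) ==> dot (b j) (B x) y = P i j x y"
  and H: "\<And>x. x \<in> Vec (b i) ==> coboundary (Frees b) d j (P i j x) ==> \<exists>w\<in>Vec (b (Suc i)). x = d i w"
  and T: "\<And>\<psi>. functional (Free (b j)) \<psi> ==> \<exists>x\<in>Vec (b i). coboundary (Frees b) d j (\<lambda>y. \<psi> y \<ominus> P i j x y)"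
 shows "bij_betw B (Vec (b i)) (Vec (b j))"
proof (rule free_bij[OF loc B])
 note Bc = mod_hom_closed[OF B]
 fix x assume x: "x \<in> Vec (b i)" and 0: "B x = \<zero>[b j]"
 have "coboundary (Frees b) d j (P i j x)"
  by (rule coboundary_cong[OF coboundary_zero]) (use BP[OF x] dot_zero 0 in \<open>simp del: free_mod_simps\<close>)
 from H[OF x this] show "x \<in> vecs \<mm> (b i)" using min by blast
next
 note Bc = mod_hom_closed[OF B]
 fix z assume z: "z \<in> Vec (b j)"
 obtain x where x: "x \<in> Vec (b i)" "coboundary (Frees b) d j (\<lambda>y. dot (b j) z y \<ominus> P i j x y)"
  using T[OF dot_functional[OF z]] by blast
 have zx: "z \<ominus>[b j] B x \<in> Vec (b j)" by (rule Free.M.minus_closed[OF z Bc[OF x(1)]])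
 have "coboundary (Frees b) d j (dot (b j) (z \<ominus>[b j] B x))"
  by (rule coboundary_cong[OF x(2)]) (simp only: dot_minus[OF z Bc[OF x(1)]] BP[OF x(1)])
 then have "z \<ominus>[b j] B x \<in> vecs \<mm> (b j)" by (rule coboundary_vecs[OF zx])
 moreover have "z = B x \<oplus>[b j] (z \<ominus>[b j] B x)" using z Bc[OF x(1)] by algebra
 ultimately show "\<exists>x\<in>Vec (b i). \<exists>h\<in>vecs \<mm> (b j). z = B x \<oplus>[b j] h" using x(1) by blast
qed

text \<open>Induction along the resolution; \<open>inj\<close> and \<open>surj\<close>, the
  isomorphism of \<open>M\<close> with Ext^c, start it. The pairing in bidegree (i, j + 1) is
  already perfect, so \<open>\<psi> d\<close> is represented by some \<open>u\<close>; it is a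
  coboundary, hence \<open>u = d v\<close>, and \<open>v\<close> represents \<open>\<psi>\<close> up
  to a cocycle of degree below c, which is a coboundary by acyclicity.\<close>

lemma pairing_nondegenerate:
 "i + j = c ==>
  (\<forall>x\<in>Vec (b i). coboundary (Frees b) d j (P i j x) --> (\<exists>w\<in>Vec (b (Suc i)). x = d i w)) \<and>
  (\<forall>\<psi>. functional (Free (b j)) \<psi> --> (\<exists>x\<in>Vec (b i). coboundary (Frees b) d j (\<lambda>y. \<psi> y \<ominus> P i j x y)))"
proof (induction i arbitrary: j)
 case 0
 then show ?case using inj surj by simp
next
 case (Suc i)
 note r = resolutionD[OF res]
 have ij: "i + Suc j = c" "Suc (i + j) = c" "j < c" using Suc.prems by simp_all
 obtain B where B: "B \<in> Lin (b i) (b (Suc j))"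
  "\<And>x y. x \<in> Vec (b i) ==> y \<in> Vec (b (Suc j)) ==> dot (b (Suc j)) (B x) y = P i (Suc j) x y"
  using bilin_dot[OF P[OF ij(1)]] by blast
 note IH1 = conjunct1[OF Suc.IH[OF ij(1)], rule_format] and IH2 = conjunct2[OF Suc.IH[OF ij(1)], rule_format]
 have bij: "bij_betw B (Vec (b i)) (Vec (b (Suc j)))" by (rule pairing_bij[OF ij(1) B IH1 IH2])
 note Bc = mod_hom_closed[OF B(1)] and dc = mod_hom_closed[OF r(3)]
 show ?case
 proof (intro conjI ballI allI impI)
  fix x assume x: "x \<in> Vec (b (Suc i))" and cb: "coboundary (Frees b) d j (P (Suc i) j x)"
  have "B (d i x) = \<zero>[b (Suc j)]"
  proof (rule dot_eqI[OF Bc[OF dc[OF x]] Free.M.zero_closed])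
   fix y assume y: "y \<in> Vec (b (Suc j))"
   show "dot (b (Suc j)) (B (d i x)) y = dot (b (Suc j)) \<zero>[b (Suc j)] y"
    unfolding B(2)[OF dc[OF x] y] dot_zero[OF y] leib[OF ij(2) x y] coboundary_cocycle[OF cb y] by simp
  qed
  moreover have "B \<zero>[b i] = \<zero>[b (Suc j)]" by (rule mod_hom_zero[OF free_module free_module B(1)])
  ultimately have "d i x = \<zero>[b i]" using bij dc[OF x] Free.M.zero_closed[of "b i"] unfolding bij_betw_def by (metis inj_on_eq_iff)
  then show "\<exists>w\<in>Vec (b (Suc (Suc i))). x = d (Suc i) w" by (rule r(7)[OF x])
 next
  fix \<psi> assume \<psi>: "functional (Free (b j)) \<psi>"
  obtain w where w: "w \<in> Vec (b (Suc j))" "\<And>y. y \<in> Vec (b (Suc j)) ==> \<psi> (d j y) = dot (b (Suc j)) w y"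
   using functional_dot[OF functional_comp[OF r(3) \<psi>]] by blast
  obtain u where u: "u \<in> Vec (b i)" "w = B u" using bij w(1) unfolding bij_betw_def by blast
  have Pu: "P i (Suc j) u y = \<psi> (d j y)" if "y \<in> Vec (b (Suc j))" for y using w(2)[OF that] B(2)[OF u(1) that] u(2) by simp
  have "coboundary (Frees b) d (Suc j) (P i (Suc j) u)" unfolding coboundary_def nat.case using \<psi> Pu by blast
  from IH1[OF u(1) this] obtain v where v: "v \<in> Vec (b (Suc i))" "u = d i v" by blast
  \<comment> \<open>The sign undoes the one produced by \<open>leib\<close> when \<open>d\<close> is
    moved to the other factor.\<close>
  define v' where "v' = sg i \<odot>[b (Suc i)] v"
  have v': "v' \<in> Vec (b (Suc i))" unfolding v'_def by (rule Free.smult_closed[OF sg_closed v(1)])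
  have Pv: "P (Suc i) j v' y = sg i \<otimes> P (Suc i) j v y" if "y \<in> Vec (b j)" for y
   unfolding v'_def using mod_hom_smult[OF bilinD(1)[OF P[OF Suc.prems] that] sg_closed v(1)] by (simp only: self_module_simps)
  have "cocycle (Frees b) d j (\<lambda>y. \<psi> y \<ominus> P (Suc i) j v' y)" unfolding cocycle_def
  proof (intro conjI ballI)
   show "functional (Free (b j)) (\<lambda>y. \<psi> y \<ominus> P (Suc i) j v' y)"
    by (rule functional_minus[OF free_module \<psi> pairing_functional[OF Suc.prems v']])
   fix y assume y: "y \<in> Vec (b (Suc j))"
   have "P (Suc i) j v' (d j y) = \<psi> (d j y)" using Pv[OF dc[OF y]] leib[OF ij(2) v(1) y] Pu[OF y] v(2) by simp
   then show "\<psi> (d j y) \<ominus> P (Suc i) j v' (d j y) = \<zero>" using functionalD(1)[OF \<psi> dc[OF y]] by simp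
  qed
  then have "coboundary (Frees b) d j (\<lambda>y. \<psi> y \<ominus> P (Suc i) j v' y)"
   using acyc[OF ij(3)] by (simp add: acyclic_dual_def)
  then show "\<exists>x\<in>Vec (b (Suc i)). coboundary (Frees b) d j (\<lambda>y. \<psi> y \<ominus> P (Suc i) j x y)" using v' by blast
 qed
qed

lemma pairing_iso:
 assumes ij: "i + j = c"
 shows "\<exists>B. B \<in> Lin (b i) (b j) \<and> bij_betw B (Vec (b i)) (Vec (b j)) \<and>
  (\<forall>x\<in>Vec (b i). \<forall>y\<in>Vec (b j). dot (b j) (B x) y = P i j x y)"
proof -
 obtain B where B: "B \<in> Lin (b i) (b j)"
  "\<And>x y. x \<in> Vec (b i) ==> y \<in> Vec (b j) ==> dot (b j) (B x) y = P i j x y"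
  using bilin_dot[OF P[OF ij]] by blast
 have "bij_betw B (Vec (b i)) (Vec (b j))"
  by (rule pairing_bij[OF ij B conjunct1[OF pairing_nondegenerate[OF ij], rule_format] conjunct2[OF pairing_nondegenerate[OF ij], rule_format]])
 then show ?thesis using B by blast
qed

text \<open>The pairing maps \<open>B i\<close> for i > m turn the right half of the resolution into
  the dual of the left half. The middle map becomes \<open>d m\<close> after the inverse of
  \<open>B (Suc m)\<close>, and its symmetry is the commutativity of the pairing combined with the
  Leibniz rule.\<close>

lemma self_dual_resolution:
 assumes cm: "c = 2 * m + 1" and bz: "\<And>i. c < i ==> b i = 0"
  and comm: "\<And>x y. x \<in> Vec (b m) ==> y \<in> Vec (b (Suc m)) ==> P (Suc m) m y x = P m (Suc m) x y"
 shows "\<exists>E. E \<in> Lin (b m) (b m) \<and> (\<forall>x\<in>Vec (b m). E x \<in> vecs \<mm> (b m)) \<and>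
  (\<forall>x\<in>Vec (b m). \<forall>y\<in>Vec (b m). dot (b m) x (E y) = sg m \<otimes> dot (b m) y (E x)) \<and>
  resolution R M (\<lambda>i. Free (sd_ranks m b i)) (sd_maps m b d E) \<epsilon>"
proof -
 note r = resolutionD[OF res]
 note dc = mod_hom_closed[OF r(3)]
 have "\<forall>i. \<exists>B. i \<le> c --> B \<in> Lin (b i) (b (c - i)) \<and> bij_betw B (Vec (b i)) (Vec (b (c - i))) \<and>
  (\<forall>x\<in>Vec (b i). \<forall>y\<in>Vec (b (c - i)). dot (b (c - i)) (B x) y = P i (c - i) x y)"
  using pairing_iso[of _ "c - _"] by (metis le_add_diff_inverse)
 then obtain B where B: "\<And>i. i \<le> c ==> B i \<in> Lin (b i) (b (c - i))"
  "\<And>i. i \<le> c ==> bij_betw (B i) (Vec (b i)) (Vec (b (c - i)))"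
  "\<And>i x y. i \<le> c ==> x \<in> Vec (b i) ==> y \<in> Vec (b (c - i)) ==> dot (b (c - i)) (B i x) y = P i (c - i) x y"
  by metis
 have cm1: "c - Suc m = m" "Suc m \<le> c" "m + Suc m = c" "Suc (m + m) = c" using cm by auto
 note B1 = B(1)[OF cm1(2), unfolded cm1(1)] and B2 = B(2)[OF cm1(2), unfolded cm1(1)] and B3 = B(3)[OF cm1(2), unfolded cm1(1)]
 define E where "E y = d m (inv_into (Vec (b (Suc m))) (B (Suc m)) y)" for y
 have inv: "inv_into (Vec (b (Suc m))) (B (Suc m)) \<in> Lin (b m) (b (Suc m))" by (rule mod_iso_inv[OF free_module B1 B2])
 have Eh: "E \<in> Lin (b m) (b m)" unfolding E_def by (rule mod_hom_comp[OF inv r(3)])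
 have EB: "E (B (Suc m) y) = d m y" if "y \<in> Vec (b (Suc m))" for y using B2 that by (simp add: E_def bij_betw_def)
 have Emin: "E x \<in> vecs \<mm> (b m)" if "x \<in> Vec (b m)" for x unfolding E_def by (rule min[OF mod_hom_closed[OF inv that]])
 \<comment> \<open>With \<open>x = B u\<close> and \<open>y = B v\<close> both sides are pairings of
   \<open>u\<close> and \<open>v\<close> with one differential; moving it across costs (-1)^m,
   commuting degrees m and m + 1 costs nothing.\<close>
 have sym: "dot (b m) x (E y) = sg m \<otimes> dot (b m) y (E x)" if xy: "x \<in> Vec (b m)" "y \<in> Vec (b m)" for x y
 proof -
  obtain u v where u: "u \<in> Vec (b (Suc m))" "x = B (Suc m) u" and v: "v \<in> Vec (b (Suc m))" "y = B (Suc m) v"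
   using B2 xy unfolding bij_betw_def by blast
  have "dot (b m) x (E y) = P (Suc m) m u (d m v)" using B3[OF u(1) dc[OF v(1)]] EB[OF v(1)] u(2) v(2) by simp
  moreover have "dot (b m) y (E x) = P (Suc m) m v (d m u)" using B3[OF v(1) dc[OF u(1)]] EB[OF u(1)] u(2) v(2) by simp
  moreover have "P (Suc m) m v (d m u) = P m (Suc m) (d m u) v" by (rule comm[OF dc[OF u(1)] v(1)])
  moreover have "\<dots> = sg m \<otimes> P (Suc m) m u (d m v)" by (rule leib[OF cm1(4) u(1) v(1)])
  moreover have "P (Suc m) m u (d m v) \<in> carrier R"
   using functionalD(1)[OF pairing_functional[of "Suc m" m, OF _ u(1)] dc[OF v(1)]] cm1 by simp
  ultimately show ?thesis by (simp add: m_assoc[symmetric] sg_sq)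
 qed
 \<comment> \<open>The Leibniz sign (-1)^i in the square at i has to be absorbed by the
   isomorphisms, so their signs accumulate. The sum starts at m + 1, leaving the middle map without
   an extra sign.\<close>
 define t where "t i = (\<Sum>k=Suc m..<i. k)" for i
 have t: "t (Suc m) = 0" "\<And>i. m < i ==> t (Suc i) = t i + i" by (simp_all add: t_def)
 \<comment> \<open>Above \<open>c\<close> the modules vanish on both sides and the identity serves
   as isomorphism.\<close>
 define \<iota> where "\<iota> i = (if i \<le> m \<or> c < i then (\<lambda>x. x) else (\<lambda>x. sg (t i) \<odot>[b (c - i)] B i x))" for i
 have rank: "sd_ranks m b i = (if i \<le> m \<or> c < i then b i else b (c - i))" for i using bz cm by (auto simp: sd_ranks_def)
 have \<iota>h: "\<iota> i \<in> Lin (b i) (sd_ranks m b i)" and \<iota>b: "bij_betw (\<iota> i) (Vec (b i)) (Vec (sd_ranks m b i))" for i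
 proof -
  have "\<iota> i \<in> Lin (b i) (sd_ranks m b i) \<and> bij_betw (\<iota> i) (Vec (b i)) (Vec (sd_ranks m b i))"
  proof (cases "i \<le> m \<or> c < i")
   case True
   then show ?thesis using mod_hom_id[of R "Free (b i)"] bij_betw_id[of "Vec (b i)"] rank[of i] by (simp add: \<iota>_def id_def)
  next
   case False
   then have i: "i \<le> c" by simp
   have e: "\<iota> i = (\<lambda>x. sg (t i) \<odot>[b (c - i)] B i x)" "sd_ranks m b i = b (c - i)"
    using False rank[of i] unfolding \<iota>_def by (simp_all only: if_False)
   have "bij_betw (\<lambda>y. sg (t i) \<odot>[b (c - i)] y) (Vec (b (c - i))) (Vec (b (c - i)))"
   proof (rule bij_betw_byWitness[where f' = "\<lambda>y. sg (t i) \<odot>[b (c - i)] y"])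
    show "\<forall>a\<in>Vec (b (c - i)). sg (t i) \<odot>[b (c - i)] (sg (t i) \<odot>[b (c - i)] a) = a"
     by (intro ballI sg_smult_cancel[OF Free.lmodule_axioms])
    then show "\<forall>a\<in>Vec (b (c - i)). sg (t i) \<odot>[b (c - i)] (sg (t i) \<odot>[b (c - i)] a) = a" .
   qed (use Free.smult_closed[OF sg_closed] in blast)+
   from bij_betw_trans[OF B(2)[OF i] this] show ?thesis
    unfolding e using Free.mod_hom_smultf[OF B(1)[OF i] sg_closed] by (simp only: o_def)
  qed
  then show "\<iota> i \<in> Lin (b i) (sd_ranks m b i)" and "bij_betw (\<iota> i) (Vec (b i)) (Vec (sd_ranks m b i))" by blast+
 qed
 have comm: "sd_maps m b d E i (\<iota> (Suc i) x) = \<iota> i (d i x)" if x: "x \<in> Vec (b (Suc i))" for i x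
 proof -
  consider "i < m" | "i = m" | "m < i" "i \<le> 2 * m" | "2 * m < i" by linarith
  then show ?thesis
  proof cases
   case 1
   then show ?thesis by (simp add: sd_maps_def \<iota>_def)
  next
   case 2
   have x': "x \<in> Vec (b (Suc m))" using x 2 by simp
   have "\<iota> (Suc m) x = sg 0 \<odot>[b m] B (Suc m) x" using cm1 t(1) by (simp add: \<iota>_def del: free_mod_simps)
   also have "\<dots> = B (Suc m) x" using Free.smult_one[OF mod_hom_closed[OF B1 x']] by (simp only: sg_def even_zero if_True)
   finally show ?thesis using EB[OF x'] 2 by (simp add: sd_maps_def \<iota>_def)
  next
   case 3
   define j where "j = 2 * m - i"
   have j: "Suc (i + j) = c" "c - i = Suc j" "c - Suc i = j" "i \<le> c" "Suc i \<le> c" "i + Suc j = c" "Suc i + j = c" using 3 cm by (auto simp: j_def)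
   have D: "sd_maps m b d E i = transpose_map (b (Suc j)) (b j) (d j)" using 3 by (simp add: sd_maps_def j_def)
   have \<iota>1: "\<iota> (Suc i) x = sg (t i + i) \<odot>[b j] B (Suc i) x" and \<iota>0: "\<iota> i (d i x) = sg (t i) \<odot>[b (Suc j)] B i (d i x)"
    unfolding \<iota>_def using 3 j t(2) by (simp_all del: free_mod_simps)
   have c1: "B (Suc i) x \<in> Vec (b j)" using mod_hom_closed[OF B(1)[OF j(5)] x] j by simp
   have c0: "B i (d i x) \<in> Vec (b (Suc j))" using mod_hom_closed[OF B(1)[OF j(4)] dc[OF x]] j by simp
   have s1: "\<iota> (Suc i) x \<in> Vec (b j)" unfolding \<iota>1 by (rule Free.smult_closed[OF sg_closed c1])
   show ?thesis unfolding D
   proof (rule dot_eqI)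
    show "transpose_map (b (Suc j)) (b j) (d j) (\<iota> (Suc i) x) \<in> Vec (b (Suc j))" by (rule transpose_closed[OF r(3) s1])
    show "\<iota> i (d i x) \<in> Vec (b (Suc j))" unfolding \<iota>0 by (rule Free.smult_closed[OF sg_closed c0])
    fix y assume y: "y \<in> Vec (b (Suc j))"
    have 1: "dot (b j) (B (Suc i) x) (d j y) = P (Suc i) j x (d j y)" using B(3)[OF j(5) x, of "d j y"] dc[OF y] j by simp
    have 0: "dot (b (Suc j)) (B i (d i x)) y = P i (Suc j) (d i x) y" using B(3)[OF j(4) dc[OF x], of y] y j by simp
    have Pc: "P (Suc i) j x (d j y) \<in> carrier R" by (rule functionalD(1)[OF pairing_functional[OF j(7) x] dc[OF y]])
    show "dot (b (Suc j)) (transpose_map (b (Suc j)) (b j) (d j) (\<iota> (Suc i) x)) y = dot (b (Suc j)) (\<iota> i (d i x)) y"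
     unfolding dot_transpose[OF r(3) s1 y] unfolding \<iota>1 \<iota>0 dot_smult[OF sg_closed c1 dc[OF y]] dot_smult[OF sg_closed c0 y] 0 1
     unfolding leib[OF j(1) x y] sg_add using Pc by (simp add: m_assoc)
   qed
  next
   case 4
   have "b (Suc i) = 0" using bz[of "Suc i"] 4 cm by simp
   then have "x = \<zero>[b (Suc i)]" using x by (auto simp: free_mod_carrier)
   then have "d i x = \<zero>[b i]" using mod_hom_zero[OF r(1) r(1) r(3)] by simp
   then have "\<iota> i (d i x) = \<zero>[sd_ranks m b i]" using mod_hom_zero[OF r(1) free_module \<iota>h, of i] by simp
   then show ?thesis using 4 by (simp add: sd_maps_def)
  qed
 qed
 have "resolution R M (\<lambda>i. Free (sd_ranks m b i)) (sd_maps m b d E) \<epsilon>"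
 proof (rule resolution_transport[where N = "\<lambda>i. Free (sd_ranks m b i)" and \<iota> = \<iota>, OF res free_module \<iota>h \<iota>b _ comm])
  show "sd_maps m b d E i \<in> Lin (sd_ranks m b (Suc i)) (sd_ranks m b i)" for i by (rule sd_maps_hom[OF r(3) Eh])
  show "\<epsilon> \<in> mod_hom R (Free (sd_ranks m b 0)) M" using r(2) by (simp add: sd_ranks_def)
  show "\<epsilon> (\<iota> 0 x) = \<epsilon> x" if "x \<in> Vec (b 0)" for x by (simp add: \<iota>_def)
 qed
 then show ?thesis using Eh Emin sym by blast
qed

end

end

section \<open>From a generator of Ext to a pairing\<close>

lemma Inf_enat_attained:
 assumes "Inf {enat i | i. Q i} = enat g"
 shows "Q g" and "\<And>i. Q i ==> g \<le> i"
proof -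
 let ?A = "{enat i | i. Q i}"
 have "?A \<noteq> {}"
 proof
  assume "?A = {}"
  then have "Inf ?A = \<infinity>" by (simp only: Inf_empty top_enat_def)
  then show False using assms by simp
 qed
 then obtain a where "a \<in> ?A" by (rule ex_in_conv[THEN iffD2, THEN exE])
 then have "Inf ?A \<in> ?A" by (rule wellorder_InfI)
 then show "Q g" using assms by auto
 show "g \<le> i" if "Q i" for i
 proof -
  have "Inf ?A \<le> enat i" by (rule Inf_lower) (use that in blast)
  then show ?thesis using assms by simp
 qed
qed

text \<open>Through the zero module \<open>P (Suc i)\<close> the identity of the minimal resolution
  is homotopic to 0 in that degree. But \<open>d s + s d\<close> has values in \<mm> times the
  module, which contain no basis vector.\<close>

lemma (in cring) minimal_resolution_vanishes:
 fixes P :: "nat => ('a, 'v) module"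
 assumes loc: "local_ring R \<mm>" and M: "module R M" and res: "resolution R M (Frees b) d \<epsilon>"
  and min: "\<And>i x. x \<in> Vec (b (Suc i)) ==> d i x \<in> vecs \<mm> (b i)"
  and P: "resolution R M P dP \<epsilon>P" "\<And>i. fg_projective R (P i)" "carrier (P (Suc i)) = {\<zero>\<^bsub>P (Suc i)\<^esub>}"
 shows "b (Suc i) = 0"
proof (rule ccontr)
 assume b: "b (Suc i) \<noteq> 0"
 note r = resolutionD[OF res] and J = local_ideal[OF loc]
 obtain \<theta> where \<theta>: "chain_map_over R (Frees b) d \<epsilon> P dP \<epsilon>P (\<lambda>x. x) \<theta>"
  using chain_map_ex[OF res fg_projective_free P(1) M M mod_hom_id] by blast
 obtain \<eta> where \<eta>: "chain_map_over R P dP \<epsilon>P (Frees b) d \<epsilon> (\<lambda>x. x) \<eta>"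
  using chain_map_ex[OF P(1,2) res M M mod_hom_id] by blast
 from chain_homotopy_ex[OF res fg_projective_free res M chain_map_comp[OF \<theta> \<eta> r(3)] chain_map_id]
 obtain s where s: "\<And>i. s i \<in> Lin (b i) (b (Suc i))"
  "\<And>i x. x \<in> Vec (b (Suc i)) ==>
   \<eta> (Suc i) (\<theta> (Suc i) x) \<ominus>[b (Suc i)] x \<ominus>[b (Suc i)] s i (d i x) = d (Suc i) (s (Suc i) x)" by blast
 define x where "x = unitvec 0"
 have x: "x \<in> Vec (b (Suc i))" unfolding x_def using b by simp
 have "\<theta> (Suc i) x = \<zero>\<^bsub>P (Suc i)\<^esub>" using mod_hom_closed[OF chain_map_overD(1)[OF \<theta>] x] P(3) by simp
 then have 0: "\<eta> (Suc i) (\<theta> (Suc i) x) = \<zero>[b (Suc i)]"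
  using mod_hom_zero[OF resolutionD(1)[OF P(1)] free_module chain_map_overD(1)[OF \<eta>]] by simp
 define a e where "a = s i (d i x)" and "e = d (Suc i) (s (Suc i) x)"
 have a: "a \<in> vecs \<mm> (b (Suc i))" unfolding a_def by (rule free_hom_vecs[OF J s(1) min[OF x]])
 have e: "e \<in> vecs \<mm> (b (Suc i))" unfolding e_def by (rule min[OF mod_hom_closed[OF s(1) x]])
 have ac: "a \<in> Vec (b (Suc i))" using a by (simp add: vecs_def)
 have eq: "e = \<zero>[b (Suc i)] \<ominus>[b (Suc i)] x \<ominus>[b (Suc i)] a" using s(2)[OF x] unfolding 0 a_def e_def by simp
 have "x = \<ominus>[b (Suc i)] (e \<oplus>[b (Suc i)] a)" unfolding eq using x ac by algebra
 then have "x \<in> vecs \<mm> (b (Suc i))"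
  using Free.submod_uminus[OF vecs_submod[OF J] Free.submod_add[OF vecs_submod[OF J] e a]] by (simp only:)
 then have "x 0 \<in> \<mm>" by (simp add: vecs_def)
 then show False using prime_one[OF local_ring_prime[OF loc]] by (simp add: x_def unitvec_def)
qed

theorem self_dual_of_gorenstein:
 fixes S :: "('a, 'r) ring_scheme" and R :: "('b, 'q) ring_scheme" and \<phi> :: "'a => 'b"
 defines "RS \<equiv> restrict_scalars \<phi> R"
 assumes loc: "local_ring S \<mm>" and R: "cring R" and \<phi>: "\<phi> \<in> ring_hom S R" and fg: "fin_gen S RS"
  and R1: "\<one>\<^bsub>R\<^esub> \<noteq> \<zero>\<^bsub>R\<^esub>" and gor: "gorenstein_algebra S R \<phi> c" and c: "c = 2 * m + 1"
 shows "\<exists>b d E \<epsilon> k. b 0 = Suc k \<and> \<epsilon> (cring.unitvec S 0) = \<one>\<^bsub>R\<^esub> \<and>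
  (\<forall>i. d i \<in> mod_hom S (free_mod S (b (Suc i))) (free_mod S (b i))) \<and>
  (\<forall>i. \<forall>x\<in>carrier (free_mod S (b (Suc i))). d i x \<in> cring.vecs S \<mm> (b i)) \<and>
  E \<in> mod_hom S (free_mod S (b m)) (free_mod S (b m)) \<and> (\<forall>x\<in>carrier (free_mod S (b m)). E x \<in> cring.vecs S \<mm> (b m)) \<and>
  (\<forall>x\<in>carrier (free_mod S (b m)). \<forall>y\<in>carrier (free_mod S (b m)).
    cring.dot S (b m) x (E y) = cring.sg S m \<otimes>\<^bsub>S\<^esub> cring.dot S (b m) y (E x)) \<and>
  resolution S RS (\<lambda>i. free_mod S (cring.sd_ranks m b i)) (cring.sd_maps S m b d E) \<epsilon>"
proof -
 from loc interpret S: cring S by (simp add: local_ring_def)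
 interpret R: cring R by fact
 interpret \<phi>: ring_hom_cring S R \<phi> using \<phi> by unfold_locales
 have M: "module S RS" unfolding RS_def by (rule module_restrict_scalars[OF S.is_cring R \<phi>])
 interpret M: lmodule S RS by (rule lmodule.intro) (rule M)
 obtain b d \<epsilon> k where bk: "b 0 = Suc k" and res: "resolution S RS (S.Frees b) d \<epsilon>"
  and min: "\<And>i x. x \<in> S.Vec (b (Suc i)) ==> d i x \<in> S.vecs \<mm> (b i)"
  and \<epsilon>1: "\<epsilon> (S.unitvec 0) = \<one>\<^bsub>R\<^esub>"
  using algebra_minimal_resolution[OF loc R \<phi> fg[unfolded RS_def] R1, folded RS_def] by blast
 note r = resolutionD[OF res]
 note dc = mod_hom_closed[OF r(3)]
 note chosen = S.chosen_resolution_res[OF res]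
 define C dC \<epsilon>C where "C = res_mod S RS" and "dC = res_diff S RS" and "\<epsilon>C = res_aug S RS"
 have C: "resolution S RS C dC \<epsilon>C" using chosen by (simp add: C_def dC_def \<epsilon>C_def)
 have Cp: "fg_projective S (C i)" for i unfolding C_def by (rule S.res_mod_projective)
 have Qp: "fg_projective S (S.Free (b i))" for i by (rule S.fg_projective_free)
 obtain F where F: "chain_map_over S C dC \<epsilon>C (S.Frees b) d \<epsilon> (\<lambda>x. x) F"
  using S.chain_map_ex[OF C Cp res M M mod_hom_id] by blast
 obtain H where H: "chain_map_over S (S.Frees b) d \<epsilon> C dC \<epsilon>C (\<lambda>x. x) H"
  using S.chain_map_ex[OF res Qp C M M mod_hom_id] by blast
 note Fh = chain_map_overD(1)[OF F] and Hh = chain_map_overD(1)[OF H]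
 note Fc = mod_hom_closed[OF Fh] and Hc = mod_hom_closed[OF Hh]
 define E where "E i = Ext S i RS (self_module S)" for i
 note E_carrier = S.Ext_carrier[OF M chosen, folded E_def C_def dC_def]
  and E_eq = S.Ext_class_eq_iff[OF M chosen, folded E_def C_def dC_def]
  and E_trivial = S.Ext_trivial_iff[OF M chosen, folded E_def C_def dC_def]
  and E_map = S.Ext_class_smult_map[OF M chosen, folded E_def C_def dC_def \<epsilon>C_def]
  and lift_map = S.chain_lift_map[OF M chosen, folded E_def C_def dC_def \<epsilon>C_def]
 let ?E = "Ext_over_algebra S R \<phi> c"
 have EE: "carrier ?E = carrier (E c)" "smult ?E = (\<lambda>s. Ext_map S c RS RS (self_module S) (\<lambda>x. s \<otimes>\<^bsub>R\<^esub> x))"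
  by (simp_all add: Ext_over_algebra_def Let_def E_def RS_def)
 obtain h where hh: "h \<in> mod_hom R (self_module R) ?E" and hb: "bij_betw h (carrier R) (carrier (E c))"
  using gor by (auto simp: gorenstein_algebra_def mod_iso_def EE)
 have hc: "h x \<in> carrier (E c)" if "x \<in> carrier R" for x using hb that by (auto simp: bij_betw_def)
 have hinj: "x = y" if "h x = h y" "x \<in> carrier R" "y \<in> carrier R" for x y using hb that unfolding bij_betw_def by (meson inj_onD)

 have top: "\<not> S.acyclic_dual C dC c"
 proof
  assume "S.acyclic_dual C dC c"
  then have "carrier (E c) = {\<zero>\<^bsub>E c\<^esub>}" using E_trivial by simp
  then have "h \<one>\<^bsub>R\<^esub> = h \<zero>\<^bsub>R\<^esub>" using hc[OF R.one_closed] hc[OF R.zero_closed] by simp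
  then show False using hinj[OF _ R.one_closed R.zero_closed] R1 by blast
 qed
 have gr: "grade S RS = Inf {enat i | i. \<not> S.acyclic_dual C dC i}" unfolding grade_def E_def[symmetric] using E_trivial by simp
 have "grade S RS \<le> enat c" unfolding gr using top by (intro Inf_lower) blast
 then obtain g where g: "grade S RS = enat g" by (cases "grade S RS") auto
 note g1 = Inf_enat_attained[OF g[unfolded gr]]
 have "proj_dim S RS = enat g" using gor g by (simp add: gorenstein_algebra_def perfect_module_def RS_def)
 from Inf_enat_attained(1)[OF this[unfolded proj_dim_def]]
 obtain P :: "nat => ('a, nat => 'a) module" and dP \<epsilon>P where
  P: "resolution S RS P dP \<epsilon>P" "\<And>i. fg_projective S (P i)" "\<And>i. g < i ==> carrier (P i) = {\<zero>\<^bsub>P i\<^esub>}" by blast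
 \<comment> \<open>Perfection gives one number for grade and projective dimension. Ext^c is
   isomorphic to the nonzero \<open>R\<close>, so \<open>c\<close> is at least the grade and at most
   the projective dimension.\<close>
 have gc: "g = c"
 proof (rule antisym)
  show "g \<le> c" by (rule g1(2)[OF top])
  show "c \<le> g" using S.proj_dim_acyclic[where l = g and i = c, OF P C Cp M] top by (meson not_le)
 qed
 have low: "S.acyclic_dual (S.Frees b) d i" if "i < c" for i
 proof -
  have "S.acyclic_dual C dC i" using g1(2)[of i] that gc by (meson not_le)
  then show ?thesis by (rule S.acyclic_dual_transfer[OF res Qp C Cp M])
 qed
 have bz: "b i = 0" if "c < i" for i
 proof -
  have "i \<noteq> 0" using that by simp
  then obtain i' where "i = Suc i'" by (rule not0_implies_Suc[THEN exE])
  then show ?thesis using S.minimal_resolution_vanishes[OF loc M res min P(1,2), of i'] P(3)[of i] that gc by simp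
 qed
 have zero_beyond: "y = \<zero>\<^bsub>S.Free (b i)\<^esub>" if "c < i" "y \<in> S.Vec (b i)" for i y
  using bz[OF that(1)] that(2) by (auto simp: free_mod_carrier)

 \<comment> \<open>A representative of the class that generates Ext^c over \<open>R\<close>;
   \<open>l\<close> is its transport to the minimal resolution and will turn products of total
   degree \<open>c\<close> into scalars.\<close>
 obtain l0 where l0: "S.cocycle C dC c l0" "h \<one>\<^bsub>R\<^esub> = S.Ext_class RS c l0"
  using hc[OF R.one_closed] unfolding E_carrier by blast
 have l0f: "S.functional (C c) l0" using l0(1) by (simp add: S.cocycle_def)
 define l where "l y = l0 (H c y)" for y
 have lf: "S.functional (S.Free (b c)) l" unfolding l_def by (rule S.functional_comp[OF Hh l0f])
 have mult: "(\<lambda>x. s \<otimes>\<^bsub>R\<^esub> x) \<in> mod_hom S RS RS" if "s \<in> carrier R" for s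
  unfolding RS_def using that by (intro mod_homI) (auto simp: R.r_distr R.m_lcomm)
 \<comment> \<open>Linearity of \<open>h\<close> over \<open>R\<close>, translated: the class of
   \<open>s\<close> is \<open>l0\<close> composed with any lift of multiplication by
   \<open>s\<close>.\<close>
 have h_class: "h s = S.Ext_class RS c (\<lambda>y. l0 (t c y))"
  if s: "s \<in> carrier R" and t: "chain_map_over S C dC \<epsilon>C C dC \<epsilon>C (\<lambda>x. s \<otimes>\<^bsub>R\<^esub> x) t" for s t
 proof -
  have "h s = h (s \<odot>\<^bsub>self_module R\<^esub> \<one>\<^bsub>R\<^esub>)" using s by simp
  also have "\<dots> = s \<odot>\<^bsub>?E\<^esub> h \<one>\<^bsub>R\<^esub>" by (rule mod_hom_smult[OF hh s]) simp
  also have "\<dots> = Ext_map S c RS RS (self_module S) (\<lambda>x. s \<otimes>\<^bsub>R\<^esub> x) (S.Ext_class RS c l0)" unfolding EE l0(2) ..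
  also have "\<dots> = S.Ext_class RS c (\<lambda>y. l0 (t c y))" by (rule E_map[OF l0(1) mult[OF s] t])
  finally show ?thesis .
 qed
 interpret Cm: lmodule S "C k" for k by (rule lmodule.intro) (rule resolutionD(1)[OF C])
 have h0: "h \<zero>\<^bsub>R\<^esub> = S.Ext_class RS c (\<lambda>y. \<zero>\<^bsub>S\<^esub>)"
 proof -
  have "chain_map_over S C dC \<epsilon>C C dC \<epsilon>C (\<lambda>x. \<zero>\<^bsub>R\<^esub> \<otimes>\<^bsub>R\<^esub> x) (\<lambda>i y. \<zero>\<^bsub>C i\<^esub>)"
   unfolding chain_map_over_def
  proof (intro conjI allI ballI)
   show "(\<lambda>y. \<zero>\<^bsub>C i\<^esub>) \<in> mod_hom S (C i) (C i)" for i by (rule Cm.mod_hom_zerof)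
   show "\<epsilon>C \<zero>\<^bsub>C 0\<^esub> = \<zero>\<^bsub>R\<^esub> \<otimes>\<^bsub>R\<^esub> \<epsilon>C x" if "x \<in> carrier (C 0)" for x
    using mod_hom_zero[OF resolutionD(1)[OF C] M resolutionD(2)[OF C]] mod_hom_closed[OF resolutionD(2)[OF C] that]
    by (simp add: RS_def)
   show "dC i \<zero>\<^bsub>C (Suc i)\<^esub> = \<zero>\<^bsub>C i\<^esub>" for i
    by (rule mod_hom_zero[OF resolutionD(1)[OF C] resolutionD(1)[OF C] resolutionD(3)[OF C]])
  qed
  from h_class[OF R.zero_closed this] show ?thesis using S.functionalD(4)[OF l0f resolutionD(1)[OF C]] by simp
 qed

 have mul: "bilin S RS RS RS (\<lambda>x y. x \<otimes>\<^bsub>R\<^esub> y)" unfolding bilin_def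
 proof (intro conjI ballI)
  show "(\<lambda>y. x \<otimes>\<^bsub>R\<^esub> y) \<in> mod_hom S RS RS" if "x \<in> carrier RS" for x using that by (intro mult) (simp add: RS_def)
  show "(\<lambda>x. x \<otimes>\<^bsub>R\<^esub> y) \<in> mod_hom S RS RS" if "y \<in> carrier RS" for y
   using that unfolding RS_def by (intro mod_homI) (auto simp: R.l_distr R.m_assoc)
 qed
 have mul_comm: "\<forall>x\<in>carrier RS. \<forall>y\<in>carrier RS. x \<otimes>\<^bsub>R\<^esub> y = y \<otimes>\<^bsub>R\<^esub> x"
  by (simp add: RS_def R.m_comm)
 \<comment> \<open>Total degree \<open>c + 1\<close> is included: there the product is zero because
   the module is, and the Leibniz rule becomes the adjointness of the differentials.\<close>
 obtain \<beta> where \<beta>: "S.product_upto TYPE(_) b d \<epsilon> (\<lambda>x y. x \<otimes>\<^bsub>R\<^esub> y) (Suc c) \<beta>"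
  using S.product_ex[OF res M mul mul_comm] by blast
 note pD = S.productD[OF res M mul mul_comm \<beta>]
 \<comment> \<open>Left multiplication by \<open>x\<close> of degree 0, which lifts multiplication
   by \<open>\<epsilon> x\<close> on \<open>R\<close>. Above \<open>c\<close>, where the modules
   vanish, it is set to zero to be a chain map in all degrees.\<close>
 define T where "T x i y = (if i \<le> c then \<beta> 0 i x y else \<zero>\<^bsub>S.Free (b i)\<^esub>)" for x i y
 have T: "chain_map_over S (S.Frees b) d \<epsilon> (S.Frees b) d \<epsilon> (\<lambda>z. \<epsilon> x \<otimes>\<^bsub>R\<^esub> z) (T x)"
  if x: "x \<in> S.Vec (b 0)" for x unfolding chain_map_over_def
 proof (intro conjI allI ballI)
  show Th: "T x i \<in> S.Lin (b i) (b i)" for i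
  proof (cases "i \<le> c")
   case True
   then show ?thesis unfolding T_def using bilinD(2)[OF pD(1)[of 0 i i] x] by simp
  next
   case False
   then show ?thesis unfolding T_def using S.Free.mod_hom_zerof by simp
  qed
  show "\<epsilon> (T x 0 y) = \<epsilon> x \<otimes>\<^bsub>R\<^esub> \<epsilon> y" if "y \<in> S.Vec (b 0)" for y
   using pD(2)[OF x that] by (simp add: T_def)
  show "d i (T x (Suc i) y) = T x i (d i y)" if y: "y \<in> S.Vec (b (Suc i))" for i y
  proof (cases "i < c")
   case True
   have bc: "\<beta> 0 i x (d i y) \<in> S.Vec (b i)" using bilinD(3)[OF pD(1)[of 0 i i] x dc[OF y]] True by simp
   have "d i (\<beta> 0 (Suc i) x y) = S.leibniz b d \<beta> i 0 (Suc i) x y" using True by (intro pD(4)[OF _ _ x y]) auto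
   also have "\<dots> = \<beta> 0 i x (d i y)" unfolding S.leibniz_def nat.case using S.Free.smult_one[OF bc] S.Free.M.l_zero[OF bc]
    by (simp only: S.sg_def even_zero if_True)
   finally show ?thesis using True by (simp add: T_def)
  next
   case False
   have "y = \<zero>\<^bsub>S.Free (b (Suc i))\<^esub>" using zero_beyond[OF _ y] False by simp
   then have "d i y = \<zero>\<^bsub>S.Free (b i)\<^esub>" using mod_hom_zero[OF r(1) r(1) r(3)] by simp
   then have "T x i (d i y) = \<zero>\<^bsub>S.Free (b i)\<^esub>" using mod_hom_zero[OF r(1) r(1) Th] by simp
   moreover have "d i (T x (Suc i) y) = \<zero>\<^bsub>S.Free (b i)\<^esub>"
    using False mod_hom_zero[OF r(1) r(1) r(3), of i] by (simp add: T_def)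
   ultimately show ?thesis by simp
  qed
 qed
 \<comment> \<open>\<open>T x\<close> followed by \<open>H\<close>, and \<open>H\<close> followed by
   \<open>t\<close>, both lift multiplication by \<open>\<epsilon> x\<close>. So pairing with
   \<open>x\<close> represents the class \<open>h (\<epsilon> x)\<close>.\<close>
 have compare: "S.coboundary (S.Frees b) d c (\<lambda>y. l (\<beta> 0 c x y) \<ominus>\<^bsub>S\<^esub> l0 (t c (H c y)))"
  if x: "x \<in> S.Vec (b 0)" and t: "chain_map_over S C dC \<epsilon>C C dC \<epsilon>C (\<lambda>z. \<epsilon> x \<otimes>\<^bsub>R\<^esub> z) t" for x t
 proof -
  have "S.coboundary (S.Frees b) d c (\<lambda>y. l0 (H c (T x c y)) \<ominus>\<^bsub>S\<^esub> l0 (t c (H c y)))"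
   by (rule S.coboundary_homotopic[OF res Qp C M S.chain_map_comp[OF T[OF x] H r(3)] S.chain_map_comp[OF H t r(3)] l0(1)])
  then show ?thesis by (simp add: T_def l_def)
 qed

 define P' where "P' i j x y = l (\<beta> i j x y)" for i j x y
 have "\<exists>E. E \<in> S.Lin (b m) (b m) \<and> (\<forall>x\<in>S.Vec (b m). E x \<in> S.vecs \<mm> (b m)) \<and>
  (\<forall>x\<in>S.Vec (b m). \<forall>y\<in>S.Vec (b m). S.dot (b m) x (E y) = S.sg m \<otimes>\<^bsub>S\<^esub> S.dot (b m) y (E x)) \<and>
  resolution S RS (\<lambda>i. S.Free (S.sd_ranks m b i)) (S.sd_maps m b d E) \<epsilon>"
 proof (rule S.self_dual_resolution[where P = P', OF loc res min low _ _ _ _ c bz])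
  show "bilin S (S.Free (b i)) (S.Free (b j)) (self_module S) (P' i j)" if "i + j = c" for i j
   unfolding P'_def by (rule bilin_post[OF pD(1)[OF that] lf[unfolded S.functional_def]]) simp
  show "P' i (Suc j) (d i x) y = S.sg i \<otimes>\<^bsub>S\<^esub> P' (Suc i) j x (d j y)"
   if ij: "Suc (i + j) = c" and x: "x \<in> S.Vec (b (Suc i))" and y: "y \<in> S.Vec (b (Suc j))" for i j x y
  proof -
   have c1: "\<beta> i (Suc j) (d i x) y \<in> S.Vec (b c)" using ij by (intro bilinD(3)[OF pD(1) dc[OF x] y]) auto
   have c2: "\<beta> (Suc i) j x (d j y) \<in> S.Vec (b c)" using ij by (intro bilinD(3)[OF pD(1) x dc[OF y]]) auto
   \<comment> \<open>A product of degree \<open>c + 1\<close> is zero; applying \<open>d\<close> and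
     then \<open>l\<close> to it yields the relation between the two pairings.\<close>
   have "\<beta> (Suc i) (Suc j) x y \<in> S.Vec (b (Suc c))" using ij by (intro bilinD(3)[OF pD(1) x y]) auto
   then have "\<beta> (Suc i) (Suc j) x y = \<zero>\<^bsub>S.Free (b (Suc c))\<^esub>" by (intro zero_beyond) auto
   then have "\<zero>\<^bsub>S.Free (b c)\<^esub> = d c (\<beta> (Suc i) (Suc j) x y)" using mod_hom_zero[OF r(1) r(1) r(3), of c] by simp
   also have "\<dots> = S.leibniz b d \<beta> c (Suc i) (Suc j) x y" using ij by (intro pD(4)[OF _ _ x y]) auto
   also have "\<dots> = \<beta> i (Suc j) (d i x) y \<oplus>\<^bsub>S.Free (b c)\<^esub> S.sg (Suc i) \<odot>\<^bsub>S.Free (b c)\<^esub> \<beta> (Suc i) j x (d j y)"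
    unfolding S.leibniz_def nat.case ..
   finally have "l \<zero>\<^bsub>S.Free (b c)\<^esub> = l (\<beta> i (Suc j) (d i x) y \<oplus>\<^bsub>S.Free (b c)\<^esub> S.sg (Suc i) \<odot>\<^bsub>S.Free (b c)\<^esub> \<beta> (Suc i) j x (d j y))"
    by (rule arg_cong)
   then have e: "\<zero>\<^bsub>S\<^esub> = P' i (Suc j) (d i x) y \<oplus>\<^bsub>S\<^esub> S.sg (Suc i) \<otimes>\<^bsub>S\<^esub> P' (Suc i) j x (d j y)"
    unfolding P'_def S.functionalD(4)[OF lf S.free_module] S.functionalD(2)[OF lf c1 S.Free.smult_closed[OF S.sg_closed c2]]
     S.functionalD(3)[OF lf S.sg_closed c2] .
   have pc: "P' i (Suc j) (d i x) y \<in> carrier S" "P' (Suc i) j x (d j y) \<in> carrier S"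
    unfolding P'_def by (rule S.functionalD(1)[OF lf c1], rule S.functionalD(1)[OF lf c2])
   have s: "S.sg (Suc i) = \<ominus>\<^bsub>S\<^esub> (S.sg i)" by (simp add: S.sg_def)
   have "P' i (Suc j) (d i x) y = (P' i (Suc j) (d i x) y \<oplus>\<^bsub>S\<^esub> \<ominus>\<^bsub>S\<^esub> (S.sg i) \<otimes>\<^bsub>S\<^esub> P' (Suc i) j x (d j y)) \<oplus>\<^bsub>S\<^esub> S.sg i \<otimes>\<^bsub>S\<^esub> P' (Suc i) j x (d j y)"
    using pc S.sg_closed[of i] by algebra
   also have "\<dots> = \<zero>\<^bsub>S\<^esub> \<oplus>\<^bsub>S\<^esub> S.sg i \<otimes>\<^bsub>S\<^esub> P' (Suc i) j x (d j y)" using e s by simp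
   also have "\<dots> = S.sg i \<otimes>\<^bsub>S\<^esub> P' (Suc i) j x (d j y)" using pc by simp
   finally show ?thesis .
  qed
  show "\<exists>w\<in>S.Vec (b (Suc 0)). x = d 0 w"
   if x: "x \<in> S.Vec (b 0)" and cb: "S.coboundary (S.Frees b) d c (P' 0 c x)" for x
  proof -
   have ex: "\<epsilon> x \<in> carrier R" using mod_hom_closed[OF r(2) x] by (simp add: RS_def)
   define t where "t = chain_lift S RS RS (\<lambda>z. \<epsilon> x \<otimes>\<^bsub>R\<^esub> z)"
   have t: "chain_map_over S C dC \<epsilon>C C dC \<epsilon>C (\<lambda>z. \<epsilon> x \<otimes>\<^bsub>R\<^esub> z) t" unfolding t_def by (rule lift_map[OF mult[OF ex]])
   have ct: "S.cocycle C dC c (\<lambda>y. l0 (t c y))" by (rule S.cocycle_pullback[OF t l0(1)])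
   then have ft: "S.functional (C c) (\<lambda>y. l0 (t c y))" by (simp add: S.cocycle_def)
   have "S.coboundary (S.Frees b) d c (\<lambda>y. l0 (t c (H c y)))"
   proof (rule S.coboundary_cong[OF S.coboundary_add[OF cb S.coboundary_smult[OF compare[OF x t], of "\<ominus>\<^bsub>S\<^esub> \<one>\<^bsub>S\<^esub>"]]])
    fix y assume y: "y \<in> S.Vec (b c)"
    have "\<beta> 0 c x y \<in> S.Vec (b c)" using bilinD(3)[OF pD(1)[of 0 c c] x y] by simp
    then have "l (\<beta> 0 c x y) \<in> carrier S" "l0 (t c (H c y)) \<in> carrier S"
     using S.functionalD(1)[OF lf] S.functionalD(1)[OF ft Hc[OF y]] by auto
    then show "l0 (t c (H c y)) = P' 0 c x y \<oplus>\<^bsub>S\<^esub> (\<ominus>\<^bsub>S\<^esub> \<one>\<^bsub>S\<^esub>) \<otimes>\<^bsub>S\<^esub> (l (\<beta> 0 c x y) \<ominus>\<^bsub>S\<^esub> l0 (t c (H c y)))"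
     unfolding P'_def by algebra
   qed simp
   then have "S.coboundary C dC c (\<lambda>y. l0 (t c y))" using S.coboundary_transfer(2)[OF C Cp res M F H ct] by simp
   then have "S.coboundary C dC c (\<lambda>y. l0 (t c y) \<ominus>\<^bsub>S\<^esub> \<zero>\<^bsub>S\<^esub>)"
    using S.functionalD(1)[OF ft] by (elim S.coboundary_cong) (simp add: a_minus_def)
   then have "h (\<epsilon> x) = h \<zero>\<^bsub>R\<^esub>" unfolding h_class[OF ex t] h0 E_eq[OF ft S.functional_zero] .
   then have "\<epsilon> x = \<zero>\<^bsub>RS\<^esub>" using hinj[OF _ ex R.zero_closed] by (simp add: RS_def)
   then show ?thesis by (rule r(5)[OF x])
  qed
  show "\<exists>x\<in>S.Vec (b 0). S.coboundary (S.Frees b) d c (\<lambda>y. \<psi> y \<ominus>\<^bsub>S\<^esub> P' 0 c x y)"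
   if \<psi>: "S.functional (S.Free (b c)) \<psi>" for \<psi>
  proof -
   have c\<psi>: "S.cocycle (S.Frees b) d c \<psi>" unfolding S.cocycle_def
   proof (intro conjI ballI \<psi>)
    fix y assume "y \<in> S.Vec (b (Suc c))"
    then have "y = \<zero>\<^bsub>S.Free (b (Suc c))\<^esub>" by (intro zero_beyond) auto
    then show "\<psi> (d c y) = \<zero>\<^bsub>S\<^esub>"
     using mod_hom_zero[OF r(1) r(1) r(3), of c] S.functionalD(4)[OF \<psi> S.free_module] by simp
   qed
   have cF: "S.cocycle C dC c (\<lambda>y. \<psi> (F c y))" by (rule S.cocycle_pullback[OF F c\<psi>])
   have "S.Ext_class RS c (\<lambda>y. \<psi> (F c y)) \<in> carrier (E c)" unfolding E_carrier using cF by blast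
   then obtain s where s: "s \<in> carrier R" "h s = S.Ext_class RS c (\<lambda>y. \<psi> (F c y))"
    using hb unfolding bij_betw_def by (metis imageE)
   obtain x where x: "x \<in> S.Vec (b 0)" "s = \<epsilon> x" using r(4)[of s] s(1) by (auto simp: RS_def)
   define t where "t = chain_lift S RS RS (\<lambda>z. \<epsilon> x \<otimes>\<^bsub>R\<^esub> z)"
   have t: "chain_map_over S C dC \<epsilon>C C dC \<epsilon>C (\<lambda>z. \<epsilon> x \<otimes>\<^bsub>R\<^esub> z) t" unfolding t_def using mult s x by (intro lift_map) simp
   have ft: "S.functional (C c) (\<lambda>y. l0 (t c y))" by (rule S.functional_comp[OF chain_map_overD(1)[OF t] l0f])
   have fF: "S.functional (C c) (\<lambda>y. \<psi> (F c y))" by (rule S.functional_comp[OF Fh \<psi>])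
   have eq: "S.Ext_class RS c (\<lambda>y. l0 (t c y)) = S.Ext_class RS c (\<lambda>y. \<psi> (F c y))"
    using h_class[OF s(1)[unfolded x(2)] t] s(2) x(2) by simp
   have cb1: "S.coboundary (S.Frees b) d c (\<lambda>y. l0 (t c (H c y)) \<ominus>\<^bsub>S\<^esub> \<psi> (F c (H c y)))"
    by (rule S.coboundary_pullback[OF H eq[unfolded E_eq[OF ft fF]]])
   have cb2: "S.coboundary (S.Frees b) d c (\<lambda>y. \<psi> (F c (H c y)) \<ominus>\<^bsub>S\<^esub> \<psi> y)"
    by (rule S.coboundary_transfer(1)[OF res Qp C M H F c\<psi>])
   \<comment> \<open>The three differences telescope to \<open>P' 0 c x - \<psi>\<close>, and the
     factor -1 reverses the order.\<close>
   have "S.coboundary (S.Frees b) d c (\<lambda>y. \<psi> y \<ominus>\<^bsub>S\<^esub> P' 0 c x y)"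
   proof (rule S.coboundary_cong[OF S.coboundary_smult[OF S.coboundary_add[OF compare[OF x(1) t] S.coboundary_add[OF cb1 cb2]], of "\<ominus>\<^bsub>S\<^esub> \<one>\<^bsub>S\<^esub>"]])
    fix y assume y: "y \<in> S.Vec (b c)"
    have "\<beta> 0 c x y \<in> S.Vec (b c)" using bilinD(3)[OF pD(1)[of 0 c c] x(1) y] by simp
    then have "l (\<beta> 0 c x y) \<in> carrier S" "l0 (t c (H c y)) \<in> carrier S" "\<psi> (F c (H c y)) \<in> carrier S" "\<psi> y \<in> carrier S"
     using S.functionalD(1)[OF lf] S.functionalD(1)[OF ft Hc[OF y]] S.functionalD(1)[OF fF Hc[OF y]] S.functionalD(1)[OF \<psi> y] by auto
    then show "\<psi> y \<ominus>\<^bsub>S\<^esub> P' 0 c x y = (\<ominus>\<^bsub>S\<^esub> \<one>\<^bsub>S\<^esub>) \<otimes>\<^bsub>S\<^esub> ((l (\<beta> 0 c x y) \<ominus>\<^bsub>S\<^esub> l0 (t c (H c y))) \<oplus>\<^bsub>S\<^esub>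
      ((l0 (t c (H c y)) \<ominus>\<^bsub>S\<^esub> \<psi> (F c (H c y))) \<oplus>\<^bsub>S\<^esub> (\<psi> (F c (H c y)) \<ominus>\<^bsub>S\<^esub> \<psi> y)))"
     unfolding P'_def by algebra
   qed simp
   then show ?thesis using x(1) by blast
  qed
  show "P' (Suc m) m y x = P' m (Suc m) x y"
   if x: "x \<in> S.Vec (b m)" and y: "y \<in> S.Vec (b (Suc m))" for x y
  proof -
   have bc: "\<beta> m (Suc m) x y \<in> S.Vec (b c)" using c by (intro bilinD(3)[OF pD(1) x y]) auto
   have "\<beta> (Suc m) m y x = S.sg (m * Suc m) \<odot>\<^bsub>S.Free (b c)\<^esub> \<beta> m (Suc m) x y"
    using c by (intro pD(3)[OF _ _ x y]) auto
   \<comment> \<open>One of two consecutive numbers is even.\<close>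
   moreover have "S.sg (m * Suc m) = \<one>\<^bsub>S\<^esub>" by (simp add: S.sg_def)
   ultimately show ?thesis unfolding P'_def using S.Free.smult_one[OF bc] by (simp only:)
  qed
 qed
 then show ?thesis using bk \<epsilon>1 r(3) min by blast
qed

section \<open>Coordinates on the self-dual complex\<close>

lemma mod_hom_via_iso:
 assumes M: "module S M" and N: "module S N" and f: "f \<in> mod_hom S M N" "bij_betw f (carrier M) (carrier N)"
  and gf: "(\<lambda>x. g (f x)) \<in> mod_hom S M L"
 shows "g \<in> mod_hom S N L"
proof (rule mod_hom_cong[OF N mod_hom_comp[OF mod_iso_inv[OF M f] gf]])
 show "g y = g (f (inv_into (carrier M) f y))" if "y \<in> carrier N" for y using f(2) that by (simp add: bij_betw_def f_inv_into_f)
qed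

lemma image_mod_iso:
 assumes M: "module S M" and j: "inj_on j (carrier M)"
 shows "module S (image_mod j M)" and "j \<in> mod_hom S M (image_mod j M)" and "bij_betw j (carrier M) (carrier (image_mod j M))"
proof -
 show b: "bij_betw j (carrier M) (carrier (image_mod j M))" using j by (simp add: bij_betw_def image_mod_def Let_def)
 have a: "j (x \<oplus>\<^bsub>M\<^esub> y) = j x \<oplus>\<^bsub>image_mod j M\<^esub> j y" if "x \<in> carrier M" "y \<in> carrier M" for x y
  using j that by (simp add: image_mod_def Let_def)
 have s: "j (r \<odot>\<^bsub>M\<^esub> x) = r \<odot>\<^bsub>image_mod j M\<^esub> j x" if "r \<in> carrier S" "x \<in> carrier M" for r x
  using j that by (simp add: image_mod_def Let_def)
 show "module S (image_mod j M)" by (rule module_transport[OF M b _ a s]) (simp_all add: image_mod_def Let_def)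
 show "j \<in> mod_hom S M (image_mod j M)" by (rule mod_homI[OF _ a s]) (use b in \<open>auto simp: bij_betw_def\<close>)
qed

lemma (in lmodule) hom_vecs_ideal_smult:
 assumes f: "f \<in> mod_hom R (Free n) M" and x: "x \<in> vecs J n"
 shows "f x \<in> ideal_smult J M"
proof -
 have xc: "x \<in> Vec n" and xJ: "\<And>i. x i \<in> J" using x by (auto simp: vecs_def)
 have 1: "f x = (\<Oplus>\<^bsub>M\<^esub>k\<in>{..<n}. x k \<odot>\<^sub>M f (unitvec k))"
  using free_hom_lincomb[OF f xc] by (simp only: lincomb_def)
 have 2: "x \<in> {..<n} \<rightarrow> J" using xJ by blast
 have 3: "(\<lambda>k. f (unitvec k)) \<in> {..<n} \<rightarrow> carrier M" using mod_hom_closed[OF f unitvec_closed] by simp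
 show ?thesis unfolding ideal_smult_def by (intro CollectI exI conjI) (rule 1 2 3)+
qed

context cring
begin

text \<open>The functional \<open>dot n u\<close>, restricted so that it is an element of the
  extensional dual.\<close>

definition covector :: "nat => (nat => 'a) => (nat => 'a) => 'a" where
 "covector n u = (\<lambda>v\<in>Vec n. dot n u v)"

lemma covector_apply: "v \<in> Vec n ==> covector n u v = dot n u v" by (simp add: covector_def)

lemma covector_closed: "u \<in> Vec n ==> covector n u \<in> carrier (dual R (Free n))"
 unfolding covector_def by (rule dual_restrict[OF free_module dot_functional])

lemma covector_hom: "covector n \<in> mod_hom R (Free n) (dual R (Free n))"
proof (rule mod_homI)
 show "covector n (u \<oplus>[n] v) = covector n u \<oplus>\<^bsub>dual R (Free n)\<^esub> covector n v"
  if "u \<in> Vec n" "v \<in> Vec n" for u v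
  unfolding dual_simps unfolding covector_def by (rule restrict_ext) (simp add: dot_add[OF that] del: free_mod_simps)
 show "covector n (s \<odot>[n] u) = s \<odot>\<^bsub>dual R (Free n)\<^esub> covector n u"
  if "s \<in> carrier R" "u \<in> Vec n" for s u
  unfolding dual_simps unfolding covector_def by (rule restrict_ext) (simp add: dot_smult[OF that] del: free_mod_simps)
qed (rule covector_closed)

lemma covector_bij: "bij_betw (covector n) (Vec n) (carrier (dual R (Free n)))" unfolding bij_betw_def
proof (intro conjI equalityI subsetI inj_onI)
 fix u v assume uv: "u \<in> Vec n" "v \<in> Vec n" and e: "covector n u = covector n v"
 show "u = v" by (rule dot_eqI[OF uv]) (use e in \<open>simp flip: covector_apply\<close>)
next
 fix \<psi> assume "\<psi> \<in> covector n ` Vec n"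
 then show "\<psi> \<in> carrier (dual R (Free n))" using covector_closed by blast
next
 fix \<psi> assume \<psi>: "\<psi> \<in> carrier (dual R (Free n))"
 obtain u where u: "u \<in> Vec n" "\<And>v. v \<in> Vec n ==> \<psi> v = dot n u v"
  using functional_dot[of n \<psi>] \<psi> by (auto simp: dual_carrier)
 have "\<psi> = covector n u" by (rule dual_eqI[OF \<psi> covector_closed[OF u(1)]]) (simp add: u(2) covector_apply)
 then show "\<psi> \<in> covector n ` Vec n" using u(1) by blast
qed

context
 fixes m :: nat and n :: "nat => nat"
begin

text \<open>The isomorphism of complexes from coordinates to the sum type: the left half is injected
  by \<open>Inl\<close>, the right half is first turned into functionals.\<close>

definition coord :: "nat => (nat => 'a) => (nat => 'a) + ((nat => 'a) => 'a)" where
 "coord i = (if i \<le> m then Inl else if i \<le> 2 * m + 1 then (\<lambda>u. Inr (covector (n (2 * m + 1 - i)) u)) else (\<lambda>u. Inl (\<lambda>i. \<zero>)))"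

lemma coord_iso:
 "module R (self_dual_mod R m (Frees n) i) \<and>
  coord i \<in> mod_hom R (Free (sd_ranks m n i)) (self_dual_mod R m (Frees n) i) \<and>
  bij_betw (coord i) (Vec (sd_ranks m n i)) (carrier (self_dual_mod R m (Frees n) i))"
proof -
 consider "i \<le> m" | "m < i" "i \<le> 2 * m + 1" | "2 * m + 1 < i" by linarith
 then show ?thesis
 proof cases
  case 1
  have "inj_on Inl (Vec (n i))" by simp
  from image_mod_iso[OF free_module this] show ?thesis using 1 by (simp add: self_dual_mod_def coord_def sd_ranks_def)
 next
  case 2
  define j where "j = 2 * m + 1 - i"
  have "inj_on Inr (carrier (dual R (Free (n j))))" by simp
  note im = image_mod_iso[OF module_dual[OF free_module] this]
  have e: "self_dual_mod R m (Frees n) i = image_mod Inr (dual R (Free (n j)))"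
   "coord i = (\<lambda>u. Inr (covector (n j) u))" "sd_ranks m n i = n j"
   using 2 by (simp_all add: self_dual_mod_def coord_def sd_ranks_def j_def)
  show ?thesis unfolding e using im(1) mod_hom_comp[OF covector_hom im(2)] bij_betw_trans[OF covector_bij im(3)] by (simp add: o_def)
 next
  \<comment> \<open>Beyond the end the module keeps the operations of the image of
    \<open>F 0\<close> with its carrier cut down to zero, so the axioms need the value of
    \<open>inv_into\<close> at that zero.\<close>
  case 3
  let ?N = "self_dual_mod R m (Frees n) i"
  have e: "coord i = (\<lambda>u. Inl (\<lambda>i. \<zero>))" "sd_ranks m n i = 0"
   and N: "?N = (image_mod Inl (Free (n 0)))\<lparr>carrier := {Inl (\<lambda>i. \<zero>)}\<rparr>"
   using 3 by (simp_all add: self_dual_mod_def coord_def sd_ranks_def)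
  have z: "(\<lambda>i. \<zero>) \<in> Vec (n 0)" by (simp add: free_mod_carrier)
  have k: "inv_into (Vec (n 0)) Inl (Inl (\<lambda>i. \<zero>)) = (\<lambda>i. \<zero>)" using z by (intro inv_into_f_f) auto
  have b: "bij_betw (coord i) (Vec (sd_ranks m n i)) (carrier ?N)" unfolding e N by (auto simp: bij_betw_def inj_on_def free_mod_carrier)
  have a: "coord i (x \<oplus>[sd_ranks m n i] y) = coord i x \<oplus>\<^bsub>?N\<^esub> coord i y"
   if "x \<in> Vec (sd_ranks m n i)" "y \<in> Vec (sd_ranks m n i)" for x y unfolding e N by (simp add: image_mod_def Let_def k)
  have s: "coord i (r \<odot>[sd_ranks m n i] x) = r \<odot>\<^bsub>?N\<^esub> coord i x"
   if "r \<in> carrier R" "x \<in> Vec (sd_ranks m n i)" for r x unfolding e N using that by (simp add: image_mod_def Let_def k)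
  have "module R ?N" by (rule module_transport[where f = "coord i", OF free_module b _ a s]) (simp_all add: e N image_mod_def Let_def)
  moreover have "coord i \<in> mod_hom R (Free (sd_ranks m n i)) ?N" by (rule mod_homI[where f = "coord i", OF _ a s]) (simp_all add: e N)
  ultimately show ?thesis using b by blast
 qed
qed

lemmas coord_module = coord_iso[THEN conjunct1] and coord_hom = coord_iso[THEN conjunct2, THEN conjunct1]
 and coord_bij = coord_iso[THEN conjunct2, THEN conjunct2]

text \<open>In the right half this is the identity that turns composition with \<open>d\<close> into
  the transpose; the argument \<open>d (Suc i)\<close> bridges the two ways of counting.\<close>

lemma coord_diff:
 assumes d: "\<And>i. i < m ==> d (Suc i) \<in> Lin (n (Suc i)) (n i)" and x: "x \<in> Vec (sd_ranks m n (Suc i))"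
 shows "self_dual_diff R m (Frees n) d e i (coord (Suc i) x) =
  coord i (sd_maps m n (\<lambda>i. d (Suc i)) (\<lambda>u. e (covector (n m) u)) i x)"
proof -
 consider "i < m" | "i = m" | "m < i" "i \<le> 2 * m" | "2 * m < i" by linarith
 then show ?thesis
 proof cases
  case 3
  define j where "j = 2 * m - i"
  have j: "j < m" "2 * m + 1 - i = Suc j" "2 * m + 1 - Suc i = j" "2 * m - i = j" using 3 by (auto simp: j_def)
  have xj: "x \<in> Vec (n j)" using x 3 j by (simp add: sd_ranks_def)
  have "compose (Vec (n (Suc j))) (covector (n j) x) (d (Suc j)) = covector (n (Suc j)) (transpose_map (n (Suc j)) (n j) (d (Suc j)) x)"
   unfolding compose_def covector_def[of "n (Suc j)"]
  proof (rule restrict_ext)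
   fix y assume y: "y \<in> Vec (n (Suc j))"
   show "covector (n j) x (d (Suc j) y) = dot (n (Suc j)) (transpose_map (n (Suc j)) (n j) (d (Suc j)) x) y"
    unfolding dot_transpose[OF d[OF j(1)] xj y] by (rule covector_apply[OF mod_hom_closed[OF d[OF j(1)] y]])
  qed
  then show ?thesis using 3 j by (simp add: self_dual_diff_def coord_def sd_maps_def hom_map_def)
 next
  case 4
  have "coord i (\<lambda>i. \<zero>) = \<zero>\<^bsub>self_dual_mod R m (Frees n) i\<^esub>"
   using mod_hom_zero[OF free_module coord_module coord_hom] by simp
  then show ?thesis using 4 by (simp add: self_dual_diff_def sd_maps_def)
 qed (simp_all add: self_dual_diff_def coord_def sd_maps_def)
qed

text \<open>The factor is 1 off the middle, where a map faces its own transpose, and (-1)^m at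
  \<open>i = m\<close>, where \<open>E\<close> faces itself.\<close>

lemma self_dual_complex_maps:
 assumes d: "\<And>i. i < m ==> d i \<in> Lin (n (Suc i)) (n i)" and E: "E \<in> Lin (n m) (n m)"
  and sym: "\<And>x y. x \<in> Vec (n m) ==> y \<in> Vec (n m) ==> dot (n m) x (E y) = sg m \<otimes> dot (n m) y (E x)"
 shows "self_dual_complex (2 * m) (sd_ranks m n) (sd_maps m n d E)"
proof -
 have "\<exists>\<sigma>\<in>carrier R. \<sigma> \<otimes> \<sigma> = \<one> \<and> (\<forall>u\<in>Vec (sd_ranks m n i). \<forall>v\<in>Vec (sd_ranks m n (Suc i)).
   dot (sd_ranks m n i) u (sd_maps m n d E i v) =
   \<sigma> \<otimes> dot (sd_ranks m n (Suc i)) (sd_maps m n d E (2 * m - i) u) v)" if i: "i \<le> 2 * m" for i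
 proof -
  consider "i < m" | "i = m" | "m < i" by linarith
  then show ?thesis
  proof cases
   case 1
   have e: "sd_ranks m n i = n i" "sd_ranks m n (Suc i) = n (Suc i)" "sd_maps m n d E i = d i"
    "sd_maps m n d E (2 * m - i) = transpose_map (n (Suc i)) (n i) (d i)" using 1 by (auto simp: sd_ranks_def sd_maps_def)
   show ?thesis unfolding e
   proof (intro bexI conjI ballI)
    fix u v assume u: "u \<in> Vec (n i)" and v: "v \<in> Vec (n (Suc i))"
    show "dot (n i) u (d i v) = \<one> \<otimes> dot (n (Suc i)) (transpose_map (n (Suc i)) (n i) (d i) u) v"
     unfolding dot_transpose[OF d[OF 1] u v] using dot_closed[OF u mod_hom_closed[OF d[OF 1] v]] by simp
   qed auto
  next
   case 2
   have e: "sd_ranks m n i = n m" "sd_ranks m n (Suc i) = n m" "sd_maps m n d E i = E" "sd_maps m n d E (2 * m - i) = E"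
    using 2 by (auto simp: sd_ranks_def sd_maps_def)
   show ?thesis unfolding e
   proof (intro bexI conjI ballI)
    fix u v assume u: "u \<in> Vec (n m)" and v: "v \<in> Vec (n m)"
    show "dot (n m) u (E v) = sg m \<otimes> dot (n m) (E u) v" using sym[OF u v] dot_comm[OF v mod_hom_closed[OF E u]] by simp
   qed (simp_all add: sg_sq)
  next
   case 3
   define j where "j = 2 * m - i"
   have j: "j < m" "2 * m + 1 - i = Suc j" "2 * m + 1 - Suc i = j" "2 * m - i = j" using 3 i by (auto simp: j_def)
   have e: "sd_ranks m n i = n (Suc j)" "sd_ranks m n (Suc i) = n j"
    "sd_maps m n d E i = transpose_map (n (Suc j)) (n j) (d j)" "sd_maps m n d E (2 * m - i) = d j"
    using 3 i j by (auto simp: sd_ranks_def sd_maps_def)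
   show ?thesis unfolding e
   proof (intro bexI conjI ballI)
    fix u v assume u: "u \<in> Vec (n (Suc j))" and v: "v \<in> Vec (n j)"
    have "dot (n (Suc j)) u (transpose_map (n (Suc j)) (n j) (d j) v) = dot (n j) v (d j u)"
     using dot_comm[OF u transpose_closed[OF d[OF j(1)] v]] dot_transpose[OF d[OF j(1)] v u] by simp
    then show "dot (n (Suc j)) u (transpose_map (n (Suc j)) (n j) (d j) v) = \<one> \<otimes> dot (n j) (d j u) v"
     using dot_comm[OF v mod_hom_closed[OF d[OF j(1)] u]] dot_closed[OF v mod_hom_closed[OF d[OF j(1)] u]] by simp
   qed auto
  qed
 qed
 then show ?thesis unfolding self_dual_complex_def by (auto simp: sd_ranks_def)
qed

text \<open>A matrix and its transpose have the same entries, so minimality of the left half and of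
  the middle map carries over to the right half.\<close>

lemma sd_maps_vecs:
 assumes J: "ideal J R" and d: "\<And>i. i < m ==> d i \<in> Lin (n (Suc i)) (n i)"
  and dJ: "\<And>i x. i < m ==> x \<in> Vec (n (Suc i)) ==> d i x \<in> vecs J (n i)"
  and EJ: "\<And>x. x \<in> Vec (n m) ==> E x \<in> vecs J (n m)" and x: "x \<in> Vec (sd_ranks m n (Suc i))"
 shows "sd_maps m n d E i x \<in> vecs J (sd_ranks m n i)"
proof -
 consider "i < m" | "i = m" | "m < i" "i \<le> 2 * m" | "2 * m < i" by linarith
 then show ?thesis
 proof cases
  case 1
  then show ?thesis using dJ x by (simp add: sd_maps_def sd_ranks_def)
 next
  case 2
  then show ?thesis using EJ x by (simp add: sd_maps_def sd_ranks_def)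
 next
  case 3
  define j where "j = 2 * m - i"
  have j: "j < m" "2 * m + 1 - i = Suc j" "2 * m + 1 - Suc i = j" "2 * m - i = j" using 3 by (auto simp: j_def)
  have xj: "x \<in> Vec (n j)" using x 3 j by (simp add: sd_ranks_def)
  have "transpose_map (n (Suc j)) (n j) (d j) x k \<in> J" for k unfolding transpose_map_def
   using functional_vecs[OF J dot_functional[OF xj] dJ[OF j(1) unitvec_closed]] ideal_zero[OF J] by simp
  then show ?thesis using transpose_closed[OF d[OF j(1)] xj] 3 j by (simp add: sd_maps_def sd_ranks_def vecs_def)
 next
  case 4
  have "(\<lambda>i. \<zero>) \<in> vecs J (sd_ranks m n i)" using ideal_zero[OF J] by (simp add: vecs_def free_mod_carrier)
  then show ?thesis using 4 by (simp add: sd_maps_def)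
 qed
qed

end

text \<open>The middle condition equates two maps from the dual into the bidual; evaluated on
  functionals \<open>covector n v\<close> it becomes symmetry up to sign of a bilinear form on
  R^n.\<close>

lemma symmetric_coord:
 assumes E: "\<And>u. u \<in> Vec n ==> e (covector n u) \<in> Vec n"
 shows "(\<forall>\<alpha>\<in>carrier (dual R (Free n)). hom_map (dual R (Free n)) e \<alpha> = bidual_map R (Free n) (((\<ominus> \<one>) [^] m) \<odot>[n] e \<alpha>)) \<longleftrightarrow>
  (\<forall>u\<in>Vec n. \<forall>v\<in>Vec n. dot n u (e (covector n v)) = sg m \<otimes> dot n v (e (covector n u)))"
proof -
 have im: "carrier (dual R (Free n)) = covector n ` Vec n" using covector_bij[of n] by (simp add: bij_betw_def)
 have r: "restrict f A = restrict g A \<longleftrightarrow> (\<forall>x\<in>A. f x = g x)" for f g :: "((nat => 'a) => 'a) => 'a" and A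
  by (auto simp: restrict_def fun_eq_iff)
 have "hom_map (dual R (Free n)) e \<alpha> = bidual_map R (Free n) (((\<ominus> \<one>) [^] m) \<odot>[n] e \<alpha>) \<longleftrightarrow>
   (\<forall>\<beta>\<in>carrier (dual R (Free n)). \<alpha> (e \<beta>) = \<beta> (sg m \<odot>[n] e \<alpha>))" for \<alpha>
  unfolding hom_map_def bidual_map_def compose_def sg_pow by (rule r)
 then show ?thesis unfolding im using covector_apply[OF E] covector_apply[OF Free.smult_closed[OF sg_closed E]]
   functionalD(3)[OF dot_functional sg_closed E] by (simp del: free_mod_simps)
qed

end

section \<open>Passage between coordinates and the complex in a sum type\<close>

theorem theorem1p5:
  fixes S :: "('a, 'r) ring_scheme" and \<mm> :: "'a set" and R :: "('b, 'q) ring_scheme"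
    and \<phi> :: "'a \<Rightarrow> 'b" and c m :: nat
  defines "R\<^sub>S \<equiv> restrict_scalars \<phi> R"
  defines "S' \<equiv> S Quot annihilator S R\<^sub>S"
  defines "\<phi>' \<equiv> \<lambda>P. the_elem (\<phi> ` P)"
  assumes "regular_local_ring S \<mm>"
    and "cring R" and "noetherian_ring R"
    and "\<phi> \<in> ring_hom S R"
    and "fin_gen S R\<^sub>S"
    and "\<And>p. minimal_prime S' p \<Longrightarrow>
           localization_map R (carrier S' - p) \<phi>'
             \<in> ring_iso (localization S' (carrier S' - p)) (localization R (\<phi>' ` (carrier S' - p)))"
    and "codimension S R\<^sub>S = ereal (real c)" and "c = 2 * m + 1"
  shows "gorenstein_algebra S R \<phi> c \<longleftrightarrow>
    (\<exists>(n :: nat \<Rightarrow> nat) k d\<^sub>0 d\<^sub>0' d e.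
       let F = (\<lambda>i. free_mod S (n i)) in
       minimal_free_resolution S \<mm> R\<^sub>S
         (self_dual_mod S m F) (self_dual_diff S m F d e) (\<lambda>x. d\<^sub>0 (projl x)) \<and>
       n 0 = Suc k \<and> d\<^sub>0' \<in> mod_hom S (free_mod S k) R\<^sub>S \<and>
       (\<forall>x\<in>carrier (F 0). d\<^sub>0 x = \<phi> (x 0) \<oplus>\<^bsub>R\<^esub> d\<^sub>0' (\<lambda>i. x (Suc i))) \<and>
       (\<forall>\<alpha>\<in>carrier (dual S (F m)).
          hom_map (dual S (F m)) e \<alpha>
            = bidual_map S (F m) (((\<ominus>\<^bsub>S\<^esub> \<one>\<^bsub>S\<^esub>) [^]\<^bsub>S\<^esub> m) \<odot>\<^bsub>F m\<^esub> e \<alpha>)))"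
proof
 have locS: "local_ring S \<mm>" using assms(4) by (simp add: regular_local_ring_def)
 then interpret S: cring S by (simp add: local_ring_def)
 interpret R: cring R by fact
 interpret \<phi>: ring_hom_cring S R \<phi> using assms(7) by unfold_locales
 note RS = assms(1)
 have M: "module S R\<^sub>S" unfolding RS by (rule module_restrict_scalars[OF S.is_cring assms(5,7)])
 {
  assume gor: "gorenstein_algebra S R \<phi> c"
  obtain l x where "krull_dim S = ereal (real l)" "S.regular_seq l x" "\<And>i. i < l ==> x i \<in> \<mm>"
   by (rule S.regular_local_regular_seq[OF assms(4)]) (rule that)
  then have R1: "\<one>\<^bsub>R\<^esub> \<noteq> \<zero>\<^bsub>R\<^esub>" using algebra_nonzero[OF assms(5) _ assms(10)[unfolded RS] S.is_cring assms(7)] by blast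
  obtain b d E \<epsilon> k where bk: "b 0 = Suc k" and \<epsilon>1: "\<epsilon> (S.unitvec 0) = \<one>\<^bsub>R\<^esub>"
   and d: "\<And>i. d i \<in> S.Lin (b (Suc i)) (b i)"
   and dmin: "\<And>i x. x \<in> S.Vec (b (Suc i)) ==> d i x \<in> S.vecs \<mm> (b i)"
   and E: "E \<in> S.Lin (b m) (b m)" "\<And>x. x \<in> S.Vec (b m) ==> E x \<in> S.vecs \<mm> (b m)"
    "\<And>x y. x \<in> S.Vec (b m) ==> y \<in> S.Vec (b m) ==> S.dot (b m) x (E y) = S.sg m \<otimes>\<^bsub>S\<^esub> S.dot (b m) y (E x)"
   and res: "resolution S R\<^sub>S (\<lambda>i. S.Free (S.sd_ranks m b i)) (S.sd_maps m b d E) \<epsilon>"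
   using self_dual_of_gorenstein[OF locS assms(5,7) assms(8)[unfolded RS] R1 gor assms(11), folded RS] by blast
  let ?F = "\<lambda>i. S.Free (b i)"
  let ?N = "self_dual_mod S m ?F"
  \<comment> \<open>\<open>self_dual_diff\<close> counts the differentials from 1.\<close>
  define d' where "d' i = d (i - 1)" for i
  \<comment> \<open>The middle map is \<open>E\<close> applied to the coordinate vector of a
    functional.\<close>
  define e where "e \<alpha> = E (inv_into (carrier (?F m)) (S.covector (b m)) \<alpha>)" for \<alpha>
  have ecov: "e (S.covector (b m) u) = E u" if "u \<in> carrier (?F m)" for u
   unfolding e_def using S.covector_bij[of "b m"] that by (simp add: bij_betw_def)
  have d'S: "d' (Suc i) = d i" for i by (simp add: d'_def)
  let ?D = "self_dual_diff S m ?F d' e"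
  have maps: "S.sd_maps m b (\<lambda>i. d' (Suc i)) (\<lambda>u. e (S.covector (b m) u)) i x = S.sd_maps m b d E i x"
   if "x \<in> S.Vec (S.sd_ranks m b (Suc i))" for i x
   by (cases "i = m") (use that ecov in \<open>simp_all add: S.sd_maps_def d'S S.sd_ranks_def\<close>)
  have D\<iota>: "?D i (S.coord m b (Suc i) x) = S.coord m b i (S.sd_maps m b d E i x)"
   if "x \<in> S.Vec (S.sd_ranks m b (Suc i))" for i x
   unfolding S.coord_diff[where d = d' and e = e, OF d[folded d'S] that] maps[OF that] ..
  have maps_hom: "S.sd_maps m b d E i \<in> S.Lin (S.sd_ranks m b (Suc i)) (S.sd_ranks m b i)" for i by (rule S.sd_maps_hom[OF d E(1)])
  have Dh: "?D i \<in> mod_hom S (?N (Suc i)) (?N i)" for i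
  proof (rule mod_hom_via_iso[OF S.free_module S.coord_module S.coord_hom S.coord_bij])
   show "(\<lambda>x. ?D i (S.coord m b (Suc i) x)) \<in> mod_hom S (S.Free (S.sd_ranks m b (Suc i))) (?N i)"
    by (rule mod_hom_cong[OF S.free_module mod_hom_comp[OF maps_hom S.coord_hom] D\<iota>])
  qed
  have \<epsilon>h: "(\<lambda>x. \<epsilon> (projl x)) \<in> mod_hom S (?N 0) R\<^sub>S"
  proof (rule mod_hom_via_iso[OF S.free_module S.coord_module S.coord_hom S.coord_bij])
   show "(\<lambda>x. \<epsilon> (projl (S.coord m b 0 x))) \<in> mod_hom S (S.Free (S.sd_ranks m b 0)) R\<^sub>S"
    using resolutionD(2)[OF res] by (simp add: S.coord_def)
  qed
  have resN: "resolution S R\<^sub>S ?N ?D (\<lambda>x. \<epsilon> (projl x))"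
  proof (rule resolution_transport[where N = ?N and \<iota> = "S.coord m b", OF res S.coord_module S.coord_hom S.coord_bij Dh D\<iota> \<epsilon>h])
   show "\<epsilon> (projl (S.coord m b 0 x)) = \<epsilon> x" for x by (simp add: S.coord_def)
  qed
  have minN: "?D i ` carrier (?N (Suc i)) \<subseteq> ideal_smult \<mm> (?N i)" for i
  proof
   interpret N: lmodule S "?N i" by (rule lmodule.intro) (rule S.coord_module)
   fix z assume "z \<in> ?D i ` carrier (?N (Suc i))"
   then have "z \<in> (\<lambda>x. ?D i (S.coord m b (Suc i) x)) ` S.Vec (S.sd_ranks m b (Suc i))"
    unfolding bij_betw_imp_surj_on[OF S.coord_bij, symmetric] image_image .
   then obtain x where x: "z = ?D i (S.coord m b (Suc i) x)" "x \<in> S.Vec (S.sd_ranks m b (Suc i))" by (rule imageE)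
   have "S.sd_maps m b d E i x \<in> S.vecs \<mm> (S.sd_ranks m b i)"
    by (rule S.sd_maps_vecs[OF S.local_ideal[OF locS] d dmin E(2) x(2)])
   then show "z \<in> ideal_smult \<mm> (?N i)" unfolding x(1) D\<iota>[OF x(2)] by (rule N.hom_vecs_ideal_smult[OF S.coord_hom])
  qed
  have freeN: "fg_free S (?N i)" for i
   unfolding fg_free_def using S.coord_module[of m b i] mod_isoI[OF S.coord_hom S.coord_bij, of m b i] by blast
  \<comment> \<open>Embeds S^k as the last k coordinates, so that \<open>d\<^sub>0'\<close> can be
    taken as \<open>\<epsilon>\<close> after it; the first basis vector maps to 1 and accounts for
    \<open>\<phi>\<close>.\<close>
  define shift where "shift y = (\<lambda>i. case i of 0 => \<zero>\<^bsub>S\<^esub> | Suc j => y j)" for y :: "nat => 'a"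
  have shift: "shift \<in> mod_hom S (S.Free k) (?F 0)"
   unfolding bk by (rule mod_homI) (auto simp: shift_def free_mod_carrier fun_eq_iff split: nat.split)
  have \<epsilon>F: "\<epsilon> \<in> mod_hom S (?F 0) R\<^sub>S" using resolutionD(2)[OF res] by (simp add: S.sd_ranks_def)
  have aug: "\<epsilon> x = \<phi> (x 0) \<oplus>\<^bsub>R\<^esub> \<epsilon> (shift (\<lambda>i. x (Suc i)))" if x: "x \<in> carrier (?F 0)" for x
  proof -
   have x0: "x 0 \<in> carrier S" by (rule S.Vec_closed[OF x])
   have t: "(\<lambda>i. x (Suc i)) \<in> S.Vec k" using x by (auto simp: free_mod_carrier bk)
   have u: "S.unitvec 0 \<in> carrier (?F 0)" using bk by simp
   have "x = x 0 \<odot>\<^bsub>?F 0\<^esub> S.unitvec 0 \<oplus>\<^bsub>?F 0\<^esub> shift (\<lambda>i. x (Suc i))"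
    using S.Vec_closed[OF x] by (auto simp: shift_def S.unitvec_def fun_eq_iff split: nat.split)
   then have "\<epsilon> x = \<epsilon> (x 0 \<odot>\<^bsub>?F 0\<^esub> S.unitvec 0 \<oplus>\<^bsub>?F 0\<^esub> shift (\<lambda>i. x (Suc i)))" by (rule arg_cong)
   also have "\<dots> = x 0 \<odot>\<^bsub>R\<^sub>S\<^esub> \<epsilon> (S.unitvec 0) \<oplus>\<^bsub>R\<^sub>S\<^esub> \<epsilon> (shift (\<lambda>i. x (Suc i)))"
    unfolding mod_hom_add[OF \<epsilon>F S.Free.smult_closed[OF x0 u] mod_hom_closed[OF shift t]] mod_hom_smult[OF \<epsilon>F x0 u] ..
   finally show ?thesis unfolding \<epsilon>1 using x0 by (simp add: RS)
  qed
  have sym: "\<forall>\<alpha>\<in>carrier (dual S (?F m)). hom_map (dual S (?F m)) e \<alpha> = bidual_map S (?F m) (((\<ominus>\<^bsub>S\<^esub> \<one>\<^bsub>S\<^esub>) [^]\<^bsub>S\<^esub> m) \<odot>\<^bsub>?F m\<^esub> e \<alpha>)"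
  proof (rule iffD2[OF S.symmetric_coord])
   show "e (S.covector (b m) u) \<in> carrier (?F m)" if "u \<in> carrier (?F m)" for u
    unfolding ecov[OF that] by (rule mod_hom_closed[OF E(1) that])
   show "\<forall>u\<in>carrier (?F m). \<forall>v\<in>carrier (?F m). S.dot (b m) u (e (S.covector (b m) v)) = S.sg m \<otimes>\<^bsub>S\<^esub> S.dot (b m) v (e (S.covector (b m) u))"
   proof (intro ballI)
    fix u v assume u: "u \<in> carrier (?F m)" and v: "v \<in> carrier (?F m)"
    show "S.dot (b m) u (e (S.covector (b m) v)) = S.sg m \<otimes>\<^bsub>S\<^esub> S.dot (b m) v (e (S.covector (b m) u))"
     unfolding ecov[OF u] ecov[OF v] by (rule E(3)[OF u v])
   qed
  qed
  show "\<exists>(n :: nat => nat) k d\<^sub>0 d\<^sub>0' d e.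
    let F = (S.Frees n) in
    minimal_free_resolution S \<mm> R\<^sub>S
     (self_dual_mod S m F) (self_dual_diff S m F d e) (\<lambda>x. d\<^sub>0 (projl x)) \<and>
    n 0 = Suc k \<and> d\<^sub>0' \<in> mod_hom S (S.Free k) R\<^sub>S \<and>
    (\<forall>x\<in>carrier (F 0). d\<^sub>0 x = \<phi> (x 0) \<oplus>\<^bsub>R\<^esub> d\<^sub>0' (\<lambda>i. x (Suc i))) \<and>
    (\<forall>\<alpha>\<in>carrier (dual S (F m)).
     hom_map (dual S (F m)) e \<alpha>
      = bidual_map S (F m) (((\<ominus>\<^bsub>S\<^esub> \<one>\<^bsub>S\<^esub>) [^]\<^bsub>S\<^esub> m) \<odot>\<^bsub>F m\<^esub> e \<alpha>))"
   unfolding Let_def minimal_free_resolution_def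
   by (intro exI[of _ b] exI[of _ k] exI[of _ \<epsilon>] exI[of _ "\<lambda>y. \<epsilon> (shift y)"] exI[of _ d'] exI[of _ e] conjI allI ballI
     resN freeN minN bk mod_hom_comp[OF shift \<epsilon>F] aug sym[rule_format])
 }
 {
  assume "\<exists>(n :: nat => nat) k d\<^sub>0 d\<^sub>0' d e.
    let F = (S.Frees n) in
    minimal_free_resolution S \<mm> R\<^sub>S
     (self_dual_mod S m F) (self_dual_diff S m F d e) (\<lambda>x. d\<^sub>0 (projl x)) \<and>
    n 0 = Suc k \<and> d\<^sub>0' \<in> mod_hom S (S.Free k) R\<^sub>S \<and>
    (\<forall>x\<in>carrier (F 0). d\<^sub>0 x = \<phi> (x 0) \<oplus>\<^bsub>R\<^esub> d\<^sub>0' (\<lambda>i. x (Suc i))) \<and>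
    (\<forall>\<alpha>\<in>carrier (dual S (F m)).
     hom_map (dual S (F m)) e \<alpha>
      = bidual_map S (F m) (((\<ominus>\<^bsub>S\<^esub> \<one>\<^bsub>S\<^esub>) [^]\<^bsub>S\<^esub> m) \<odot>\<^bsub>F m\<^esub> e \<alpha>))"
  then obtain n :: "nat => nat" and d\<^sub>0 d e where
   res: "resolution S R\<^sub>S (self_dual_mod S m (S.Frees n)) (self_dual_diff S m (S.Frees n) d e) (\<lambda>x. d\<^sub>0 (projl x))"
   and sym: "\<forall>\<alpha>\<in>carrier (dual S (S.Free (n m))). hom_map (dual S (S.Free (n m))) e \<alpha>
      = bidual_map S (S.Free (n m)) (((\<ominus>\<^bsub>S\<^esub> \<one>\<^bsub>S\<^esub>) [^]\<^bsub>S\<^esub> m) \<odot>\<^bsub>S.Free (n m)\<^esub> e \<alpha>)"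
   unfolding Let_def minimal_free_resolution_def by blast
  let ?F = "\<lambda>i. S.Free (n i)"
  let ?N = "self_dual_mod S m ?F" and ?D = "self_dual_diff S m ?F d e"
  let ?G = "\<lambda>i. S.Free (S.sd_ranks m n i)"
  \<comment> \<open>The complex is pulled back to coordinates, where the theory of self-dual
    complexes applies.\<close>
  define \<kappa> where "\<kappa> i = inv_into (carrier (?G i)) (S.coord m n i)" for i
  have \<kappa>h: "\<kappa> i \<in> mod_hom S (?N i) (?G i)" for i
   unfolding \<kappa>_def by (rule mod_iso_inv[OF S.free_module S.coord_hom S.coord_bij])
  have \<kappa>b: "bij_betw (\<kappa> i) (carrier (?N i)) (carrier (?G i))" for i
   unfolding \<kappa>_def by (rule bij_betw_inv_into[OF S.coord_bij])
  have \<kappa>1: "\<kappa> i (S.coord m n i x) = x" if "x \<in> carrier (?G i)" for i x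
   unfolding \<kappa>_def using S.coord_bij[of m n i] that by (simp add: bij_betw_def)
  have \<kappa>2: "S.coord m n i (\<kappa> i y) = y" if "y \<in> carrier (?N i)" for i y
   unfolding \<kappa>_def using S.coord_bij[of m n i] that by (simp add: bij_betw_def f_inv_into_f)
  have gh: "(\<lambda>x. \<kappa> i (?D i (S.coord m n (Suc i) x))) \<in> mod_hom S (?G (Suc i)) (?G i)" for i
   by (rule mod_hom_comp[OF mod_hom_comp[OF S.coord_hom resolutionD(3)[OF res]] \<kappa>h])
  have G: "?G i = ?F i" if "i \<le> m" for i using that by (simp add: S.sd_ranks_def)
  have \<kappa>Inl: "\<kappa> i (Inl x) = x" if "i \<le> m" "Inl x \<in> carrier (?N i)" for i x
   using \<kappa>2[OF that(2)] that(1) by (simp add: S.coord_def)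
  have Dc: "?D i (S.coord m n (Suc i) x) \<in> carrier (?N i)" if "x \<in> carrier (?G (Suc i))" for i x
   by (rule mod_hom_closed[OF resolutionD(3)[OF res] mod_hom_closed[OF S.coord_hom that]])
  \<comment> \<open>The hypothesis speaks only of the glued differentials, so linearity of each
    \<open>d (Suc i)\<close> is read off through the isomorphism.\<close>
  have dh: "d (Suc i) \<in> mod_hom S (?F (Suc i)) (?F i)" if i: "i < m" for i
  proof (rule mod_hom_cong[OF S.free_module])
   show "(\<lambda>x. \<kappa> i (?D i (S.coord m n (Suc i) x))) \<in> mod_hom S (?F (Suc i)) (?F i)" using gh[of i] G[of i] G[of "Suc i"] i by simp
   fix x assume x: "x \<in> carrier (?F (Suc i))"
   have "?D i (S.coord m n (Suc i) x) = Inl (d (Suc i) x)" using i by (simp add: self_dual_diff_def S.coord_def)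
   then show "d (Suc i) x = \<kappa> i (?D i (S.coord m n (Suc i) x))" using \<kappa>Inl[of i "d (Suc i) x"] Dc[of x i] x G[of "Suc i"] i by simp
  qed
  \<comment> \<open>The middle map on coordinate vectors. Its linearity and its symmetry also come
    from the glued complex and from \<open>symmetric_coord\<close>.\<close>
  define E where "E u = e (S.covector (n m) u)" for u
  have Gm: "?G (Suc m) = ?F m" by (simp add: S.sd_ranks_def)
  have Eh: "E \<in> mod_hom S (?F m) (?F m)"
  proof (rule mod_hom_cong[OF S.free_module])
   show "(\<lambda>x. \<kappa> m (?D m (S.coord m n (Suc m) x))) \<in> mod_hom S (?F m) (?F m)" using gh[of m] G[of m] Gm by simp
   fix x assume x: "x \<in> carrier (?F m)"
   have "?D m (S.coord m n (Suc m) x) = Inl (E x)" by (simp add: self_dual_diff_def S.coord_def E_def)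
   then show "E x = \<kappa> m (?D m (S.coord m n (Suc m) x))" using \<kappa>Inl[of m "E x"] Dc[of x m] x Gm by simp
  qed
  let ?H = "S.sd_maps m n (\<lambda>i. d (Suc i)) E"
  have comm: "?H i (\<kappa> (Suc i) y) = \<kappa> i (?D i y)" if y: "y \<in> carrier (?N (Suc i))" for i y
  proof -
   define x where "x = \<kappa> (Suc i) y"
   have x: "x \<in> carrier (?G (Suc i))" unfolding x_def by (rule mod_hom_closed[OF \<kappa>h y])
   have "?D i y = S.coord m n i (?H i x)"
    using S.coord_diff[where d = d and e = e, OF dh x] \<kappa>2[OF y] by (simp add: x_def E_def[abs_def])
   then show ?thesis
    using \<kappa>1[OF mod_hom_closed[OF S.sd_maps_hom[where d = "\<lambda>i. d (Suc i)", OF dh Eh] x]] by (simp add: x_def)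
  qed
  have res': "resolution S R\<^sub>S ?G ?H d\<^sub>0"
  proof (rule resolution_transport[where N = ?G and \<iota> = \<kappa>, OF res S.free_module \<kappa>h \<kappa>b _ comm])
   show "?H i \<in> mod_hom S (?G (Suc i)) (?G i)" for i by (rule S.sd_maps_hom[where d = "\<lambda>i. d (Suc i)", OF dh Eh])
   show "d\<^sub>0 \<in> mod_hom S (?G 0) R\<^sub>S"
    using mod_hom_comp[OF S.coord_hom[of m n 0] resolutionD(2)[OF res]] by (simp add: S.coord_def)
   show "d\<^sub>0 (\<kappa> 0 y) = d\<^sub>0 (projl y)" if "y \<in> carrier (?N 0)" for y
   proof -
    have "Inl (\<kappa> 0 y) = y" using \<kappa>2[OF that] by (simp add: S.coord_def)
    then show ?thesis by (metis sum.sel(1))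
   qed
  qed
  have Es: "S.dot (n m) x (E y) = S.sg m \<otimes>\<^bsub>S\<^esub> S.dot (n m) y (E x)" if "x \<in> carrier (?F m)" "y \<in> carrier (?F m)" for x y
  proof -
   have "e (S.covector (n m) u) \<in> carrier (?F m)" if "u \<in> carrier (?F m)" for u
    using mod_hom_closed[OF Eh that] by (simp add: E_def)
   from S.symmetric_coord[where e = e and n = "n m", OF this, THEN iffD1, OF _ sym] show ?thesis using that unfolding E_def by blast
  qed
  have sd: "S.self_dual_complex (2 * m) (S.sd_ranks m n) ?H"
   by (rule S.self_dual_complex_maps[where d = "\<lambda>i. d (Suc i)", OF dh Eh Es])
  have "gorenstein_algebra S R \<phi> (Suc (2 * m))"
  proof (rule gorenstein_of_self_dual[OF assms(4,5,7) _ _ _ res'[unfolded RS] sd])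
   show "fin_gen S (restrict_scalars \<phi> R)" using assms(8) by (simp only: RS)
   show "codimension S (restrict_scalars \<phi> R) = ereal (real (Suc (2 * m)))" using assms(10,11) by (simp add: RS)
  qed (use assms(9)[unfolded assms(1-3)] in blast)
  then show "gorenstein_algebra S R \<phi> c" using assms(11) by simp
 }
qed

end
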